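(* Let $S$ be a set and let $r\in F(S)'\setminus\{e\}$. Then $$\|G_r\|=\inf_{(n,\varepsilon)\in E}4\cdot\frac{\operatorname{cl}_S(r^{\varepsilon_1}+\dots+r^{\varepsilon_n})-1}{|\varepsilon_1+\dots+\varepsilon_n|},$$ where $E:=\{(n,\varepsilon)\mid n\in\mathbb N_{>0},\ \varepsilon\in\{-1,1\}^n,\ \varepsilon_1+\dots+\varepsilon_n\ne0\}$.
   Context: For a set $S$, $F(S)$ is the free group on $S$, $F(S)'$ its commutator subgroup and $e$ the neutral element. For $r\in F(S)'\setminus\{e\}$ let $G_r:=\langle S\mid r\rangle$. Let $P_r$ be the presentation complex (one vertex, one $1$-cell for each element of $S$, one $2$-cell attached along $r$) and let $X_r$ be a classifying space of $G_r$ obtained from $P_r$ by attaching cells of dimension $\ge 3$, with inclusion $c_r\colon P_r\to X_r$. Since $r\in F(S)'$, the $2$-cell of $P_r$ defines a class $\widetilde\alpha_r\in H_2(P_r;\mathbb Z)$; the fundamental class is $\alpha_r:=H_2(c_r;\mathbb Z)(\widetilde\alpha_r)\in H_2(X_r;\mathbb Z)=H_2(G_r;\mathbb Z)$ (this group is infinite cyclic, generated by $\alpha_r$), and $\alpha_{r,\mathbb R}\in H_2(G_r;\mathbb R)$ is its image under change of coefficients. The simplicial volume of $G_r$ is $\|G_r\|:=\|\alpha_{r,\mathbb R}\|_1$, where $\|\alpha\|_1$ is the infimum of the $\ell^1$-norms (with respect to the basis of singular simplices) of all real singular cycles representing $\alpha$. For $w\in F(S)'$, $\operatorname{cl}_S(w)$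 is the minimal $n\in\mathbb N$ such that $w$ is a product of $n$ commutators in $F(S)$. For $g_1,\dots,g_m\in F(S)$ with $g_1\cdots g_m\in F(S)'$, $$\operatorname{cl}_S(g_1+\dots+g_m):=\min_{t_1,\dots,t_m\in F(S)}\operatorname{cl}_S(t_1g_1t_1^{-1}\cdots t_mg_mt_m^{-1}).$$ *)

theory Defs
  imports "HOL-Homology.Homology" "HOL-Algebra.Generated_Groups"
begin

section \<open>Free groups and one-relator groups\<close>

text \<open>The letter \<open>(s, True)\<close> stands for \<open>s\<close> and \<open>(s, False)\<close> for its inverse.
  The elements of the free group are the reduced words.\<close>

type_synonym 's word = "('s \<times> bool) list"

fun inv_letter :: "'s \<times> bool \<Rightarrow> 's \<times> bool" where
  "inv_letter (s, b) = (s, \<not> b)"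

definition reduced :: "'s word \<Rightarrow> bool" where
  "reduced w \<longleftrightarrow> successively (\<lambda>x y. y \<noteq> inv_letter x) w"

fun cancel_cons :: "'s \<times> bool \<Rightarrow> 's word \<Rightarrow> 's word" where
  "cancel_cons x [] = [x]"
| "cancel_cons x (y # w) = (if y = inv_letter x then w else x # y # w)"

definition free_group :: "'s set \<Rightarrow> 's word monoid" where
  "free_group S = \<lparr>carrier = {w. reduced w \<and> fst ` set w \<subseteq> S},
                   monoid.mult = \<lambda>u v. foldr cancel_cons u v, one = []\<rparr>"

lemma inv_letter_inv_letter [simp]: "inv_letter (inv_letter x) = x"
  by (cases x) simp

lemma fst_inv_letter [simp]: "fst (inv_letter x) = fst x"
  by (cases x) simp

lemma reduced_Cons: "reduced (x # w) \<longleftrightarrow> (w = [] \<or> hd w \<noteq> inv_letter x) \<and> reduced w"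
  by (auto simp: reduced_def successively_Cons)

lemma reduced_cancel_cons: "reduced w \<Longrightarrow> reduced (cancel_cons x w)"
  by (cases w) (auto simp: reduced_Cons reduced_def[of "[]"])

lemma reduced_foldr: "reduced w \<Longrightarrow> reduced (foldr cancel_cons u w)"
  by (induction u) (auto simp: reduced_cancel_cons)

lemma letters_cancel_cons: "fst ` set (cancel_cons x w) \<subseteq> insert (fst x) (fst ` set w)"
  by (cases w) auto

lemma letters_foldr: "fst ` set (foldr cancel_cons u w) \<subseteq> fst ` set u \<union> fst ` set w"
proof (induction u)
  case (Cons x u)
  then show ?case
    using letters_cancel_cons[of x "foldr cancel_cons u w"] unfolding foldr.simps o_apply by force
qed simp

lemma cancel_cons_inv: "reduced w \<Longrightarrow> cancel_cons x (cancel_cons (inv_letter x) w) = w"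
proof (cases w)
  case (Cons y u)
  then show "reduced w \<Longrightarrow> ?thesis" by (cases u) (auto simp: reduced_Cons)
qed simp

lemma foldr_cancel_cons:
  assumes "reduced w"
  shows "foldr cancel_cons (cancel_cons x u) w = cancel_cons x (foldr cancel_cons u w)"
proof (cases u)
  case (Cons y v)
  then show ?thesis
    using cancel_cons_inv[of "foldr cancel_cons v w" x] reduced_foldr[OF assms] by auto
qed simp

lemma foldr_cancel_cons_assoc:
  assumes "reduced w"
  shows "foldr cancel_cons (foldr cancel_cons u v) w = foldr cancel_cons u (foldr cancel_cons v w)"
  by (induction u) (auto simp: foldr_cancel_cons[OF assms])

lemma foldr_cancel_cons_Nil: "reduced w \<Longrightarrow> foldr cancel_cons w [] = w"
proof (induction w)
  case (Cons x w)
  then show ?case by (cases w) (auto simp: reduced_Cons)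
qed simp

lemma foldr_cancel_cons_inverse: "foldr cancel_cons (rev (map inv_letter w)) w = []"
  by (induction w) auto

lemma group_free_group: "group (free_group S)"
proof (rule groupI)
  fix x assume x: "x \<in> carrier (free_group S)"
  define y where "y = foldr cancel_cons (rev (map inv_letter x)) []"
  have "fst ` set y \<subseteq> fst ` set x"
    using letters_foldr[of "rev (map inv_letter x)" "[]"] by (simp add: y_def image_image)
  moreover have "reduced y"
    unfolding y_def by (rule reduced_foldr) (simp add: reduced_def)
  moreover have "foldr cancel_cons y x = []"
    using x foldr_cancel_cons_assoc[of x "rev (map inv_letter x)" "[]"]
    by (simp add: y_def free_group_def foldr_cancel_cons_inverse)
  ultimately show "\<exists>y\<in>carrier (free_group S). y \<otimes>\<^bsub>free_group S\<^esub> x = \<one>\<^bsub>free_group S\<^esub>"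
    using x by (intro bexI[of _ y]) (auto simp: free_group_def)
next
  fix x y assume "x \<in> carrier (free_group S)" "y \<in> carrier (free_group S)"
  then show "x \<otimes>\<^bsub>free_group S\<^esub> y \<in> carrier (free_group S)"
    using order_trans[OF letters_foldr[of x y], of S] by (simp add: free_group_def reduced_foldr)
qed (auto simp: free_group_def reduced_def[of "[]"] foldr_cancel_cons_assoc)

definition normal_closure :: "('a, 'b) monoid_scheme \<Rightarrow> 'a set \<Rightarrow> 'a set" where
  "normal_closure G R = generate G {g \<otimes>\<^bsub>G\<^esub> r \<otimes>\<^bsub>G\<^esub> inv\<^bsub>G\<^esub> g | g r. g \<in> carrier G \<and> r \<in> R}"

definition one_relator_group :: "'s set \<Rightarrow> 's word \<Rightarrow> 's word set monoid" where
  "one_relator_group S r = free_group S Mod normal_closure (free_group S) {r}"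


section \<open>Commutator length\<close>

abbreviation list_mult :: "('a, 'b) monoid_scheme \<Rightarrow> 'a list \<Rightarrow> 'a" where
  "list_mult G xs \<equiv> foldr (\<otimes>\<^bsub>G\<^esub>) xs \<one>\<^bsub>G\<^esub>"

text \<open>\<^const>\<open>derived_set\<close> \<open>G (carrier G)\<close> is the set of commutators of \<open>G\<close>. As \<open>LEAST\<close> is
  unspecified on the empty set, the next two definitions are meaningful only if \<open>w\<close>, respectively
  the product of the list \<open>gs\<close>, lies in the commutator subgroup.\<close>

definition commutator_length :: "('a, 'b) monoid_scheme \<Rightarrow> 'a \<Rightarrow> nat" where
  "commutator_length G w =
     (LEAST n. \<exists>cs. length cs = n \<and> set cs \<subseteq> derived_set G (carrier G) \<and> w = list_mult G cs)"

text \<open>The commutator length of the formal sum of the entries of the list \<open>gs\<close>.\<close>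

definition sum_commutator_length :: "('a, 'b) monoid_scheme \<Rightarrow> 'a list \<Rightarrow> nat" where
  "sum_commutator_length G gs =
     (LEAST n. \<exists>ts. length ts = length gs \<and> set ts \<subseteq> carrier G \<and>
        n = commutator_length G
              (list_mult G (map2 (\<lambda>t g. t \<otimes>\<^bsub>G\<^esub> g \<otimes>\<^bsub>G\<^esub> inv\<^bsub>G\<^esub> t) ts gs)))"


section \<open>Attaching cells and presentation complexes\<close>

definition disc :: "nat \<Rightarrow> (nat \<Rightarrow> real) topology" where
  "disc n = subtopology (Euclidean_space n) {x. (\<Sum>i<n. (x i)\<^sup>2) \<le> 1}"

definition open_disc :: "nat \<Rightarrow> (nat \<Rightarrow> real) set" where
  "open_disc n = {x \<in> topspace (Euclidean_space n). (\<Sum>i<n. (x i)\<^sup>2) < 1}"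

text \<open>The space \<open>X\<close> is the pushout of \<open>A\<close> and the discs \<open>I \<times> D\<^sup>n\<close> along the maps \<open>\<Phi> i\<close>
  restricted to the boundary spheres; here \<open>n > 0\<close>, and \<open>\<Phi> i\<close> is the characteristic map of the
  cell with index \<open>i\<close>. The last conjunct is the quotient topology.\<close>

definition attaches_cells ::
  "nat \<Rightarrow> 'x topology \<Rightarrow> 'i set \<Rightarrow> ('i \<Rightarrow> (nat \<Rightarrow> real) \<Rightarrow> 'x) \<Rightarrow> 'x topology \<Rightarrow> bool" where
  "attaches_cells n A I \<Phi> X \<longleftrightarrow>
     topspace A \<subseteq> topspace X \<and>
     (\<forall>i\<in>I. continuous_map (nsphere (n - 1)) A (\<Phi> i)) \<and>
     bij_betw (\<lambda>(i, x). \<Phi> i x) (I \<times> open_disc n) (topspace X - topspace A) \<and>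
     (\<forall>U. openin X U \<longleftrightarrow>
        U \<subseteq> topspace X \<and> openin A (topspace A \<inter> U) \<and>
        (\<forall>i\<in>I. openin (disc n) {x \<in> topspace (disc n). \<Phi> i x \<in> U}))"

text \<open>\<open>X\<close> is obtained from \<open>A\<close> by successively attaching cells of dimension \<open>m, m + 1, \<dots>\<close>,
  and carries the weak topology. Distinct cells have distinct characteristic maps, so that it is
  no loss of generality to index the cells by their characteristic maps.\<close>

definition attaches_cells_from :: "nat \<Rightarrow> 'x topology \<Rightarrow> 'x topology \<Rightarrow> bool" where
  "attaches_cells_from m A X \<longleftrightarrow>
     (\<exists>F. F 0 = A \<and>
        (\<forall>k. \<exists>C. attaches_cells (m + k) (F k) C id (F (Suc k))) \<and>
        topspace X = (\<Union>k. topspace (F k)) \<and>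
        (\<forall>U. openin X U \<longleftrightarrow>
           U \<subseteq> topspace X \<and> (\<forall>k. openin (F k) (topspace (F k) \<inter> U))))"

definition circle_point :: "real \<Rightarrow> nat \<Rightarrow> real" where
  "circle_point t = (\<lambda>i. if i = 0 then cos (2 * pi * t) else if i = 1 then sin (2 * pi * t) else 0)"

text \<open>A \<open>1\<close>-cell is parametrised by the interval \<open>D\<^sup>1 = [-1, 1]\<close>; it is rescaled to \<open>[0, 1]\<close>.\<close>

fun letter_path :: "('s \<Rightarrow> (nat \<Rightarrow> real) \<Rightarrow> 'x) \<Rightarrow> 's \<times> bool \<Rightarrow> real \<Rightarrow> 'x" where
  "letter_path e (s, b) t = e s (\<lambda>i. if i = 0 then (if b then 2 * t - 1 else 1 - 2 * t) else 0)"

text \<open>The edge loop of a nonempty word: the \<open>j\<close>-th letter is traversed at constant speed on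
  \<open>[j/k, (j+1)/k]\<close>, where \<open>k\<close> is the length of the word.\<close>

definition word_loop :: "('s \<Rightarrow> (nat \<Rightarrow> real) \<Rightarrow> 'x) \<Rightarrow> 's word \<Rightarrow> real \<Rightarrow> 'x" where
  "word_loop e w t =
     (let k = length w; j = min (k - 1) (nat \<lfloor>real k * t\<rfloor>)
      in letter_path e (w ! j) (real k * t - real j))"

text \<open>\<open>P\<close> is the presentation complex of \<open>\<langle>S | r\<rangle>\<close>, with vertex \<open>v\<close>, characteristic maps
  \<open>e s\<close> of the \<open>1\<close>-cells, \<open>1\<close>-skeleton \<open>K\<close>, and characteristic map \<open>d\<close> of the \<open>2\<close>-cell.\<close>

definition presentation_complex ::
  "'s set \<Rightarrow> 's word \<Rightarrow> 'x \<Rightarrow> ('s \<Rightarrow> (nat \<Rightarrow> real) \<Rightarrow> 'x) \<Rightarrow> ((nat \<Rightarrow> real) \<Rightarrow> 'x) \<Rightarrow>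
    'x topology \<Rightarrow> 'x topology \<Rightarrow> bool" where
  "presentation_complex S r v e d K P \<longleftrightarrow>
     attaches_cells 1 (discrete_topology {v}) S e K \<and>
     attaches_cells 2 K {()} (\<lambda>_. d) P \<and>
     (\<forall>t\<in>{0..1}. d (circle_point t) = word_loop e r t)"


section \<open>Classifying spaces\<close>

definition loops :: "'x topology \<Rightarrow> 'x \<Rightarrow> (real \<Rightarrow> 'x) set" where
  "loops X v = {p. continuous_map (top_of_set {0..1}) X p \<and> p 0 = v \<and> p 1 = v}"

definition loop_class :: "'x topology \<Rightarrow> 'x \<Rightarrow> (real \<Rightarrow> 'x) \<Rightarrow> (real \<Rightarrow> 'x) set" where
  "loop_class X v p =
     {q \<in> loops X v. homotopic_with (\<lambda>h. h 0 = v \<and> h 1 = v) (top_of_set {0..1}) X p q}"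

text \<open>The library's operation \<open>+++\<close> requires the points to form a topological space type.\<close>

definition concat_paths :: "(real \<Rightarrow> 'x) \<Rightarrow> (real \<Rightarrow> 'x) \<Rightarrow> real \<Rightarrow> 'x" where
  "concat_paths p q t = (if t \<le> 1/2 then p (2 * t) else q (2 * t - 1))"

definition fundamental_group :: "'x topology \<Rightarrow> 'x \<Rightarrow> (real \<Rightarrow> 'x) set monoid" where
  "fundamental_group X v =
     \<lparr>carrier = loop_class X v ` loops X v,
      monoid.mult = \<lambda>A B. \<Union>p\<in>A. \<Union>q\<in>B. loop_class X v (concat_paths p q),
      one = loop_class X v (\<lambda>_. v)\<rparr>"

text \<open>Every map \<open>(S\<^sup>n, *) \<rightarrow> (X, v)\<close> is homotopic to the constant map relative to the base point.\<close>

definition trivial_homotopy_group :: "nat \<Rightarrow> 'x topology \<Rightarrow> 'x \<Rightarrow> bool" where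
  "trivial_homotopy_group n X v \<longleftrightarrow>
     (let b = (\<lambda>i. if i = 0 then 1 else 0) in
      \<forall>f. continuous_map (nsphere n) X f \<and> f b = v \<longrightarrow>
          homotopic_with (\<lambda>h. h b = v) (nsphere n) X f (\<lambda>_. v))"

text \<open>Being a CW complex is not part of this definition; it is used together with
  \<^const>\<open>presentation_complex\<close> and \<^const>\<open>attaches_cells_from\<close>.\<close>

definition classifying_space :: "('a, 'b) monoid_scheme \<Rightarrow> 'x topology \<Rightarrow> 'x \<Rightarrow> bool" where
  "classifying_space G X v \<longleftrightarrow>
     v \<in> topspace X \<and> path_connected_space X \<and> fundamental_group X v \<cong> G \<and>
     (\<forall>n\<ge>2. trivial_homotopy_group n X v)"


section \<open>Real singular homology and the l1-seminorm\<close>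

text \<open>The library provides singular homology with integral coefficients only.\<close>

type_synonym 'x real_chain = "((nat \<Rightarrow> real) \<Rightarrow> 'x) \<Rightarrow>\<^sub>0 real"

definition real_singular_chain :: "nat \<Rightarrow> 'x topology \<Rightarrow> 'x real_chain \<Rightarrow> bool" where
  "real_singular_chain p X c \<longleftrightarrow> Poly_Mapping.keys c \<subseteq> singular_simplex_set p X"

definition real_chain_boundary :: "nat \<Rightarrow> 'x real_chain \<Rightarrow> 'x real_chain" where
  "real_chain_boundary p c =
     (if p = 0 then 0 else
      \<Sum>f\<in>Poly_Mapping.keys c. \<Sum>k\<le>p.
        Poly_Mapping.single (singular_face p k f) ((-1) ^ k * Poly_Mapping.lookup c f))"

definition real_singular_cycle :: "nat \<Rightarrow> 'x topology \<Rightarrow> 'x real_chain \<Rightarrow> bool" where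
  "real_singular_cycle p X c \<longleftrightarrow> real_singular_chain p X c \<and> real_chain_boundary p c = 0"

definition real_singular_boundary :: "nat \<Rightarrow> 'x topology \<Rightarrow> 'x real_chain \<Rightarrow> bool" where
  "real_singular_boundary p X c \<longleftrightarrow>
     (\<exists>b. real_singular_chain (Suc p) X b \<and> real_chain_boundary (Suc p) b = c)"

definition real_homology_class :: "nat \<Rightarrow> 'x topology \<Rightarrow> 'x real_chain \<Rightarrow> 'x real_chain set" where
  "real_homology_class p X z =
     {c. real_singular_cycle p X c \<and> real_singular_boundary p X (c - z)}"

text \<open>The map \<open>H\<^sub>p(X; \<int>) \<rightarrow> H\<^sub>p(X; \<real>)\<close>. As in the library, a class is the set of its
  representing cycles. All members of the union agree.\<close>

definition change_of_coefficients ::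
  "nat \<Rightarrow> 'x topology \<Rightarrow> 'x chain set \<Rightarrow> 'x real_chain set" where
  "change_of_coefficients p X \<alpha> =
     (\<Union>z\<in>\<alpha>. real_homology_class p X (Poly_Mapping.map real_of_int z))"

definition l1_norm :: "'x real_chain \<Rightarrow> real" where
  "l1_norm c = (\<Sum>f\<in>Poly_Mapping.keys c. \<bar>Poly_Mapping.lookup c f\<bar>)"

definition l1_seminorm :: "'x real_chain set \<Rightarrow> real" where
  "l1_seminorm \<alpha> = (INF c\<in>\<alpha>. l1_norm c)"


section \<open>The fundamental class and simplicial volume\<close>

text \<open>The singular \<open>1\<close>-simplex that runs once around the unit circle.\<close>

definition circle_simplex :: "(nat \<Rightarrow> real) \<Rightarrow> nat \<Rightarrow> real" where
  "circle_simplex = (\<lambda>x\<in>standard_simplex 1. circle_point (x 1))"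

text \<open>The generator of \<open>H\<^sub>2(D\<^sup>2, S\<^sup>1; \<int>)\<close> that corresponds to the positive orientation.\<close>

definition disc_class :: "(nat \<Rightarrow> real) chain set" where
  "disc_class =
     (THE \<tau>. \<tau> \<in> carrier (relative_homology_group 2 (disc 2) (topspace (nsphere 1))) \<and>
        hom_boundary 2 (disc 2) (topspace (nsphere 1)) \<tau> =
          homologous_rel_set 1 (subtopology (disc 2) (topspace (nsphere 1))) {}
            (frag_of circle_simplex))"

text \<open>The class in \<open>H\<^sub>2(P; \<int>)\<close> defined by the \<open>2\<close>-cell with characteristic map \<open>d\<close>: the class
  that maps to the image of \<^const>\<open>disc_class\<close> under \<open>H\<^sub>2(D\<^sup>2, S\<^sup>1) \<rightarrow> H\<^sub>2(P, K)\<close>. It is unique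
  because \<open>H\<^sub>2(K) = 0\<close> for the \<open>1\<close>-skeleton \<open>K\<close>, and it exists because the relator has vanishing
  exponent sums.\<close>

definition two_cell_class ::
  "'x topology \<Rightarrow> 'x topology \<Rightarrow> ((nat \<Rightarrow> real) \<Rightarrow> 'x) \<Rightarrow> 'x chain set" where
  "two_cell_class K P d =
     (THE \<alpha>. \<alpha> \<in> carrier (homology_group 2 P) \<and>
        hom_induced 2 P {} P (topspace K) id \<alpha> =
          hom_induced 2 (disc 2) (topspace (nsphere 1)) P (topspace K) d disc_class)"

definition fundamental_class ::
  "'x topology \<Rightarrow> 'x topology \<Rightarrow> ((nat \<Rightarrow> real) \<Rightarrow> 'x) \<Rightarrow> 'x topology \<Rightarrow> 'x chain set" where
  "fundamental_class K P d X = hom_induced 2 P {} X {} id (two_cell_class K P d)"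

text \<open>The simplicial volume of \<open>\<langle>S | r\<rangle>\<close>, computed in a classifying space \<open>X\<close> that contains
  the presentation complex \<open>P\<close> as its \<open>2\<close>-skeleton.\<close>

definition simplicial_volume ::
  "'x topology \<Rightarrow> 'x topology \<Rightarrow> ((nat \<Rightarrow> real) \<Rightarrow> 'x) \<Rightarrow> 'x topology \<Rightarrow> real" where
  "simplicial_volume K P d X =
     l1_seminorm (change_of_coefficients 2 X (fundamental_class K P d X))"

end

theory Submission
  imports Defs "HOL-Library.Multiset" "HOL-Analysis.Kronecker_Approximation_Theorem"
    "HOL-Analysis.Abstract_Topological_Spaces"
begin

text \<open>If a product of \<open>m\<close> commutators is also a product of conjugates of \<open>r\<close> and its inverse with
  exponent sum \<open>k\<close>, then a closed surface of genus \<open>m\<close>, triangulated by \<open>4 m + 2\<close> singular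
  simplices, represents \<open>k\<close> times the fundamental class. Cyclic coverings of the surface improve
  \<open>4 m + 2\<close> to \<open>4 (m - 1)\<close>, whence the simplicial volume is at most the infimum.

  For the converse, choose a section of the projection of the free group onto the one-relator group.
  A singular \<open>2\<close>-simplex then determines a word in its three edges whose value lies in the normal
  closure of \<open>r\<close>. By the Magnus expansion every element of the normal closure has a well-defined
  exponent sum with respect to \<open>r\<close>, and this defines a cocycle with value \<open>1\<close> on the fundamental
  class. The triangles of an integral cycle can be glued along their edges to closed surfaces, which
  exhibits the value of the cocycle as the exponent sum of a product of few commutators; real cycles
  are approximated by rational ones. The elements of the one-relator group that belong to singular
  edges are obtained without universal coverings: a functor from the fundamental groupoid to a group
  extends over a cell as soon as it is trivial on the attaching sphere, which is automatic in
  dimension at least three.\<close>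

section \<open>Products of commutators and of conjugates\<close>

text \<open>The constant 4 arises from a count that survives gluing. Gluing two polygons along a
  side loses one polygon and two sides, so the sum of \<open>length - 2\<close> over all polygons is
  invariant. At the start it is the number of triangles, and at the end a polygon of a surface of
  genus m has at least 4 m sides. In the other direction the number of conjugates must not enter the
  count. Horn filling in the singular complex achieves this: a triangle is recorded only with its
  multiplicity over the 2-cell, modulo chains in \<open>K\<close> and boundaries, and filling
  tetrahedra merges the fillings of all conjugates into one triangle. A commutator costs three
  triangles, a multiplication one, and two more are spent once. The multiplicity determines the
  homology class because H_2 of the graph \<open>K\<close> vanishes. The delicate point of the lower
  bound is that a triangle has to determine an integer. By Hopf's formula H_2 is
  \<open>N / [F, N]\<close> for the normal closure \<open>N\<close>, so the integer has to be the
  exponent sum; it is unique because a lowest nonzero coefficient of the Magnus expansion of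
  \<open>r\<close> is additive on products of conjugates.\<close>

definition (in group) commutator_product :: "nat \<Rightarrow> 'a \<Rightarrow> bool" where
  "commutator_product n w \<longleftrightarrow>
     (\<exists>cs. length cs = n \<and> set cs \<subseteq> derived_set G (carrier G) \<and> w = list_mult G cs)"

text \<open>A relation and not a function of \<open>w\<close>: that \<open>w\<close> determines
  \<open>k\<close> is proved only later, for free groups. The product has the literal shape of the
  one in \<open>sum_commutator_length\<close>, so that the two can be exchanged without
  rewriting.\<close>

definition (in group) conjugate_product :: "'a \<Rightarrow> int \<Rightarrow> 'a \<Rightarrow> bool" where
  "conjugate_product r k w \<longleftrightarrow>
     (\<exists>\<epsilon> ts. set \<epsilon> \<subseteq> {-1, 1} \<and> sum_list \<epsilon> = k \<and> length ts = length \<epsilon> \<and> set ts \<subseteq> carrier G \<and>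
        w = list_mult G (map2 (\<lambda>t g. t \<otimes> g \<otimes> inv t) ts (map (\<lambda>j. r [^] j) \<epsilon>)))"

context group
begin

lemma list_mult_closed: "set xs \<subseteq> carrier G \<Longrightarrow> list_mult G xs \<in> carrier G"
  by (induction xs) auto

lemma list_mult_append:
  "set xs \<subseteq> carrier G \<Longrightarrow> set ys \<subseteq> carrier G \<Longrightarrow> list_mult G (xs @ ys) = list_mult G xs \<otimes> list_mult G ys"
  by (induction xs) (auto simp: list_mult_closed m_assoc)

lemma derived_set_closed: "derived_set G (carrier G) \<subseteq> carrier G"
  by (rule derived_set_in_carrier) simp

lemma inv_cancel_left: "x \<in> carrier G \<Longrightarrow> y \<in> carrier G \<Longrightarrow> inv x \<otimes> (x \<otimes> y) = y"
  by (metis inv_closed l_inv l_one m_assoc)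

lemma inv_cancel_left': "x \<in> carrier G \<Longrightarrow> y \<in> carrier G \<Longrightarrow> x \<otimes> (inv x \<otimes> y) = y"
  by (metis inv_closed r_inv l_one m_assoc)

lemma conjugate_mult:
  "\<lbrakk>t \<in> carrier G; x \<in> carrier G; y \<in> carrier G\<rbrakk> \<Longrightarrow>
     t \<otimes> (x \<otimes> y) \<otimes> inv t = (t \<otimes> x \<otimes> inv t) \<otimes> (t \<otimes> y \<otimes> inv t)"
  by (simp add: m_assoc inv_cancel_left)

lemma conjugate_inv:
  "\<lbrakk>t \<in> carrier G; x \<in> carrier G\<rbrakk> \<Longrightarrow> t \<otimes> inv x \<otimes> inv t = inv (t \<otimes> x \<otimes> inv t)"
  by (metis inv_mult_group m_assoc inv_inv inv_closed m_closed)

lemma commutator_product_closed: "commutator_product n w \<Longrightarrow> w \<in> carrier G"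
  unfolding commutator_product_def
  by (elim exE conjE) (simp only: list_mult_closed[OF subset_trans[OF _ derived_set_closed]])

lemma commutator_product_one: "commutator_product 0 \<one>"
  by (simp add: commutator_product_def)

lemma commutator_product_mult:
  "commutator_product m x \<Longrightarrow> commutator_product n y \<Longrightarrow> commutator_product (m + n) (x \<otimes> y)"
  unfolding commutator_product_def
proof (elim exE conjE)
  fix cs ds
  assume "length cs = m" "set cs \<subseteq> derived_set G (carrier G)" "x = list_mult G cs"
    "length ds = n" "set ds \<subseteq> derived_set G (carrier G)" "y = list_mult G ds"
  then show "\<exists>es. length es = m + n \<and> set es \<subseteq> derived_set G (carrier G) \<and> x \<otimes> y = list_mult G es"
    using derived_set_closed
    by (intro exI[of _ "cs @ ds"]) (simp add: list_mult_append[symmetric] subset_trans[OF _ derived_set_closed])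
qed

lemma commutator_product_commutator:
  "a \<in> carrier G \<Longrightarrow> b \<in> carrier G \<Longrightarrow> commutator_product 1 (a \<otimes> b \<otimes> inv a \<otimes> inv b)"
  unfolding commutator_product_def by (intro exI[of _ "[a \<otimes> b \<otimes> inv a \<otimes> inv b]"]) auto

lemma commutator_product_conjugate:
  assumes "commutator_product n x" "t \<in> carrier G"
  shows "commutator_product n (t \<otimes> x \<otimes> inv t)"
proof -
  obtain cs where cs: "length cs = n" "set cs \<subseteq> derived_set G (carrier G)" "x = list_mult G cs"
    using assms by (auto simp: commutator_product_def)
  have "commutator_product (length cs) (t \<otimes> list_mult G cs \<otimes> inv t)"
    using cs(2)
  proof (induction cs)
    case Nil
    then show ?case using assms by (simp add: commutator_product_one)
  next
    case (Cons c cs)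
    then obtain a b where ab: "a \<in> carrier G" "b \<in> carrier G" "c = a \<otimes> b \<otimes> inv a \<otimes> inv b" by auto
    have "t \<otimes> c \<otimes> inv t = (t \<otimes> a \<otimes> inv t) \<otimes> (t \<otimes> b \<otimes> inv t) \<otimes> inv (t \<otimes> a \<otimes> inv t) \<otimes> inv (t \<otimes> b \<otimes> inv t)"
      using ab assms by (simp add: conjugate_inv[symmetric] conjugate_mult)
    then have "commutator_product 1 (t \<otimes> c \<otimes> inv t)"
      using commutator_product_commutator ab assms by simp
    from commutator_product_mult[OF this Cons.IH] Cons.prems ab assms show ?case
      by (simp add: conjugate_mult list_mult_closed subset_trans[OF _ derived_set_closed])
  qed
  with cs show ?thesis by simp
qed

lemma derived_imp_commutator_product:
  assumes "x \<in> derived G (carrier G)" shows "\<exists>n. commutator_product n x"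
  using assms unfolding derived_def
proof (induction rule: generate.induct)
  case one
  then show ?case using commutator_product_one by blast
next
  case (incl h)
  then show ?case using commutator_product_commutator by fastforce
next
  case (inv h)
  then obtain a b where "a \<in> carrier G" "b \<in> carrier G" "h = a \<otimes> b \<otimes> inv a \<otimes> inv b" by auto
  then have "inv h = b \<otimes> a \<otimes> inv b \<otimes> inv a" by (simp add: inv_mult_group m_assoc)
  then show ?case using commutator_product_commutator \<open>a \<in> _\<close> \<open>b \<in> _\<close> by auto
next
  case (eng h1 h2)
  then show ?case using commutator_product_mult by blast
qed

lemma commutator_length_le: "commutator_product n x \<Longrightarrow> commutator_length G x \<le> n"
  unfolding commutator_length_def commutator_product_def by (rule Least_le) blast

lemma commutator_product_commutator_length:
  "commutator_product n x \<Longrightarrow> commutator_product (commutator_length G x) x"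
  unfolding commutator_length_def commutator_product_def
  by (rule LeastI_ex) blast

lemma conjugate_productE:
  assumes "conjugate_product r k w"
  obtains \<epsilon> ts where "set \<epsilon> \<subseteq> {-1, 1}" "sum_list \<epsilon> = k" "length ts = length \<epsilon>" "set ts \<subseteq> carrier G"
     "w = list_mult G (map2 (\<lambda>t g. t \<otimes> g \<otimes> inv t) ts (map (\<lambda>j. r [^] j) \<epsilon>))"
  using assms unfolding conjugate_product_def by blast

lemma conjugates_closed:
  "set ts \<subseteq> carrier G \<Longrightarrow> set gs \<subseteq> carrier G \<Longrightarrow>
     set (map2 (\<lambda>t g. t \<otimes> g \<otimes> inv t) ts gs) \<subseteq> carrier G"
  by (fastforce dest: set_zip_leftD set_zip_rightD)

lemma conjugate_product_one: "conjugate_product r 0 \<one>"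
  unfolding conjugate_product_def by (intro exI[of _ "[]"]) auto

lemma conjugate_product_closed:
  assumes "conjugate_product r k w" "r \<in> carrier G" shows "w \<in> carrier G"
proof -
  obtain \<epsilon> ts where "set \<epsilon> \<subseteq> {-1, 1}" "sum_list \<epsilon> = k" "length ts = length \<epsilon>" and *: "set ts \<subseteq> carrier G"
     "w = list_mult G (map2 (\<lambda>t g. t \<otimes> g \<otimes> inv t) ts (map (\<lambda>j. r [^] j) \<epsilon>))"
    using assms(1) by (rule conjugate_productE)
  have "set (map (\<lambda>j. r [^] j) \<epsilon>) \<subseteq> carrier G" for \<epsilon> :: "int list" using assms by auto
  from list_mult_closed[OF conjugates_closed[OF *(1) this]] show ?thesis unfolding *(2) .
qed

lemma conjugate_product_mult:
  assumes "conjugate_product r k x" "conjugate_product r l y" "r \<in> carrier G"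
  shows "conjugate_product r (k + l) (x \<otimes> y)"
proof -
  have sub: "set (map (\<lambda>j. r [^] j) \<epsilon>) \<subseteq> carrier G" for \<epsilon> :: "int list" using assms by auto
  obtain \<epsilon> ts where *: "set \<epsilon> \<subseteq> {-1, 1}" "sum_list \<epsilon> = k" "length ts = length \<epsilon>" "set ts \<subseteq> carrier G"
     "x = list_mult G (map2 (\<lambda>t g. t \<otimes> g \<otimes> inv t) ts (map (\<lambda>j. r [^] j) \<epsilon>))"
    using assms(1) by (rule conjugate_productE)
  obtain \<delta> us where **: "set \<delta> \<subseteq> {-1, 1}" "sum_list \<delta> = l" "length us = length \<delta>" "set us \<subseteq> carrier G"
     "y = list_mult G (map2 (\<lambda>t g. t \<otimes> g \<otimes> inv t) us (map (\<lambda>j. r [^] j) \<delta>))"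
    using assms(2) by (rule conjugate_productE)
  have "x \<otimes> y = list_mult G (map2 (\<lambda>t g. t \<otimes> g \<otimes> inv t) (ts @ us) (map (\<lambda>j. r [^] j) (\<epsilon> @ \<delta>)))"
    unfolding *(5) **(5) using conjugates_closed[OF *(4) sub[of \<epsilon>]] conjugates_closed[OF **(4) sub[of \<delta>]] *(3) **(3)
    by (simp add: list_mult_append[symmetric])
  then show ?thesis
    unfolding conjugate_product_def using * ** by (intro exI[of _ "\<epsilon> @ \<delta>"] exI[of _ "ts @ us"]) auto
qed

lemma conjugate_product_power:
  assumes "r \<in> carrier G" "j \<in> {-1, 1}" "t \<in> carrier G"
  shows "conjugate_product r j (t \<otimes> r [^] (j :: int) \<otimes> inv t)"
  unfolding conjugate_product_def using assms
  by (intro exI[of _ "[j]"] exI[of _ "[t]"]) auto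

lemma conjugate_product_self: "r \<in> carrier G \<Longrightarrow> conjugate_product r 1 r"
  using conjugate_product_power[of r 1 \<one>] by simp

lemma conjugate_product_induct [consumes 2, case_names one mult]:
  assumes "conjugate_product r k w" "r \<in> carrier G"
    and one: "P 0 \<one>"
    and mult: "\<And>j t k w. \<lbrakk>j \<in> {-1, 1}; t \<in> carrier G; conjugate_product r k w; P k w\<rbrakk> \<Longrightarrow>
       P (j + k) ((t \<otimes> r [^] j \<otimes> inv t) \<otimes> w)"
  shows "P k w"
proof -
  obtain \<epsilon> ts where *: "set \<epsilon> \<subseteq> {-1, 1}" "sum_list \<epsilon> = k" "length ts = length \<epsilon>" "set ts \<subseteq> carrier G"
     "w = list_mult G (map2 (\<lambda>t g. t \<otimes> g \<otimes> inv t) ts (map (\<lambda>j. r [^] j) \<epsilon>))"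
    using assms(1) by (rule conjugate_productE)
  have "P (sum_list \<epsilon>) (list_mult G (map2 (\<lambda>t g. t \<otimes> g \<otimes> inv t) ts (map (\<lambda>j. r [^] j) \<epsilon>)))"
    using *(3,1,4)
  proof (induction ts \<epsilon> rule: list_induct2)
    case (Cons t ts j \<epsilon>)
    have "conjugate_product r (sum_list \<epsilon>)
       (list_mult G (map2 (\<lambda>t g. t \<otimes> g \<otimes> inv t) ts (map (\<lambda>j. r [^] j) \<epsilon>)))"
      unfolding conjugate_product_def using Cons by (intro exI[of _ \<epsilon>] exI[of _ ts]) auto
    from mult[OF _ _ this Cons.IH, of j t] Cons.prems show ?case by auto
  qed (simp add: one)
  with * show ?thesis by simp
qed

lemma conjugate_product_conjugate:
  assumes "conjugate_product r k w" "r \<in> carrier G" "s \<in> carrier G"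
  shows "conjugate_product r k (s \<otimes> w \<otimes> inv s)"
  using assms(1,2)
proof (induction rule: conjugate_product_induct)
  case one
  then show ?case using assms by (simp add: conjugate_product_one)
next
  case (mult j t k w)
  have "conjugate_product r j ((s \<otimes> t) \<otimes> r [^] j \<otimes> inv (s \<otimes> t))"
    using conjugate_product_power[of r j "s \<otimes> t"] mult assms by auto
  moreover have "(s \<otimes> t) \<otimes> r [^] j \<otimes> inv (s \<otimes> t) = s \<otimes> (t \<otimes> r [^] j \<otimes> inv t) \<otimes> inv s"
    using assms mult by (simp add: m_assoc inv_mult_group)
  ultimately have "conjugate_product r (j + k) (s \<otimes> (t \<otimes> r [^] j \<otimes> inv t) \<otimes> inv s \<otimes> (s \<otimes> w \<otimes> inv s))"
    using conjugate_product_mult[OF _ mult(4) assms(2)] by auto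
  then show ?case
    using conjugate_product_closed[OF mult(3) assms(2)] assms mult by (simp add: conjugate_mult)
qed

lemma conjugate_product_inv:
  assumes "conjugate_product r k w" "r \<in> carrier G"
  shows "conjugate_product r (- k) (inv w)"
  using assms
proof (induction rule: conjugate_product_induct)
  case one
  then show ?case by (simp add: conjugate_product_one)
next
  case (mult j t k w)
  have w: "w \<in> carrier G" using mult assms conjugate_product_closed by blast
  have "inv ((t \<otimes> r [^] j \<otimes> inv t) \<otimes> w) = inv w \<otimes> (t \<otimes> r [^] (- j) \<otimes> inv t)"
    using w assms mult by (simp add: inv_mult_group m_assoc int_pow_neg)
  moreover have "conjugate_product r (- j) (t \<otimes> r [^] (- j) \<otimes> inv t)"
    using mult by (intro conjugate_product_power assms) auto
  ultimately show ?case
    using conjugate_product_mult[OF mult(4)] assms by (metis minus_add_distrib add.commute)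
qed

lemma normal_closure_imp_conjugate_product:
  assumes "w \<in> normal_closure G {r}" "r \<in> carrier G"
  shows "\<exists>k. conjugate_product r k w"
  using assms(1) unfolding normal_closure_def
proof (induction rule: generate.induct)
  case one
  then show ?case using conjugate_product_one by blast
next
  case (incl h)
  then show ?case using conjugate_product_power[of r 1] assms by auto
next
  case (inv h)
  then show ?case using conjugate_product_power[of r 1] assms conjugate_product_inv by fastforce
next
  case (eng h1 h2)
  then show ?case using conjugate_product_mult assms by blast
qed

lemma sum_commutator_length_le:
  assumes "conjugate_product r k w" "commutator_product n w"
  obtains \<epsilon> where "set \<epsilon> \<subseteq> {-1, 1}" "sum_list \<epsilon> = k"
    "sum_commutator_length G (map (\<lambda>j. r [^] j) \<epsilon>) \<le> n"
proof -
  obtain \<epsilon> ts where *: "set \<epsilon> \<subseteq> {-1, 1}" "sum_list \<epsilon> = k" "length ts = length \<epsilon>" "set ts \<subseteq> carrier G"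
     "w = list_mult G (map2 (\<lambda>t g. t \<otimes> g \<otimes> inv t) ts (map (\<lambda>j. r [^] j) \<epsilon>))"
    using assms(1) by (rule conjugate_productE)
  have "sum_commutator_length G (map (\<lambda>j. r [^] j) \<epsilon>) \<le> commutator_length G w"
    unfolding sum_commutator_length_def using * by (intro Least_le exI[of _ ts]) simp
  also have "\<dots> \<le> n" using commutator_length_le assms by blast
  finally show ?thesis using that * by blast
qed

text \<open>Both minima have to be attained: the outer one because some choice of conjugators
  exists, the inner one because \<open>r\<close>, and hence every product of conjugates of its
  powers, is a product of commutators.\<close>

lemma commutator_product_sum_commutator_length:
  assumes "r \<in> derived G (carrier G)" "set \<epsilon> \<subseteq> {-1, 1}"
  obtains w where "conjugate_product r (sum_list \<epsilon>) w"
    "commutator_product (sum_commutator_length G (map (\<lambda>j. r [^] j) \<epsilon>)) w"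
proof -
  obtain n where n: "commutator_product n r" using assms derived_imp_commutator_product by blast
  have r: "r \<in> carrier G" using n commutator_product_closed by blast
  have sg: "subgroup (derived G (carrier G)) G"
    unfolding derived_def by (intro generate_is_subgroup derived_set_closed)
  have pw: "r [^] (j :: int) \<in> derived G (carrier G)" for j
    by (rule subgroup_int_pow_closed[OF sg assms(1)])
  let ?P = "\<lambda>n ts. length ts = length (map (\<lambda>j. r [^] j) \<epsilon>) \<and> set ts \<subseteq> carrier G \<and>
        n = commutator_length G
              (list_mult G (map2 (\<lambda>t g. t \<otimes> g \<otimes> inv t) ts (map (\<lambda>j. r [^] j) \<epsilon>)))"
  have "?P (commutator_length G (list_mult G (map2 (\<lambda>t g. t \<otimes> g \<otimes> inv t) (map (\<lambda>_. \<one>) \<epsilon>)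
     (map (\<lambda>j. r [^] j) \<epsilon>)))) (map (\<lambda>_. \<one>) \<epsilon>)" by auto
  then have "\<exists>n ts. ?P n ts" by blast
  from LeastI_ex[OF this] obtain ts where ts: "?P (sum_commutator_length G (map (\<lambda>j. r [^] j) \<epsilon>)) ts"
    unfolding sum_commutator_length_def by blast
  define w where "w = list_mult G (map2 (\<lambda>t g. t \<otimes> g \<otimes> inv t) ts (map (\<lambda>j. r [^] j) \<epsilon>))"
  have cp: "conjugate_product r (sum_list \<epsilon>) w"
    unfolding conjugate_product_def w_def using ts assms by auto
  have "\<exists>m. commutator_product m w"
    using cp r
  proof (induction rule: conjugate_product_induct)
    case one
    then show ?case using commutator_product_one by blast
  next
    case (mult j t k w)
    obtain m n where "commutator_product m (r [^] j)" "commutator_product n w"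
      using derived_imp_commutator_product[OF pw[of j]] mult by blast
    then have "commutator_product (m + n) (t \<otimes> r [^] j \<otimes> inv t \<otimes> w)"
      by (intro commutator_product_mult commutator_product_conjugate mult)
    then show ?case ..
  qed
  then have "commutator_product (commutator_length G w) w"
    using commutator_product_commutator_length by blast
  moreover have "commutator_length G w = sum_commutator_length G (map (\<lambda>j. r [^] j) \<epsilon>)"
    unfolding w_def using ts by simp
  ultimately show ?thesis using that[OF cp] by simp
qed

end

section \<open>Polygons with paired edges\<close>

text \<open>The boundary word of a polygon whose sides can be paired with opposite orientations, so
  that a closed oriented surface results.\<close>

definition balanced :: "'e word \<Rightarrow> bool" where
  "balanced w \<longleftrightarrow> (\<forall>x. count_list w x = count_list w (inv_letter x))"

lemma inv_letter_neq [simp]: "inv_letter x \<noteq> x" "x \<noteq> inv_letter x"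
  by (cases x; simp)+

definition (in group) eval_letter :: "('e \<Rightarrow> 'a) \<Rightarrow> 'e \<times> bool \<Rightarrow> 'a" where
  "eval_letter f x = (if snd x then f (fst x) else inv (f (fst x)))"

definition (in group) eval_word :: "('e \<Rightarrow> 'a) \<Rightarrow> 'e word \<Rightarrow> 'a" where
  "eval_word f w = list_mult G (map (eval_letter f) w)"

context group
begin

context
  fixes f :: "'e \<Rightarrow> 'a"
  assumes f [simp]: "\<And>a. f a \<in> carrier G"
begin

lemma eval_letter_closed: "eval_letter f x \<in> carrier G"
  by (auto simp: eval_letter_def)

lemma eval_word_closed: "eval_word f w \<in> carrier G"
  unfolding eval_word_def by (rule list_mult_closed) (auto simp: eval_letter_closed)

lemma eval_letter_inv: "eval_letter f (inv_letter x) = inv (eval_letter f x)"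
  by (cases x) (auto simp: eval_letter_def)

lemma eval_word_Nil: "eval_word f [] = \<one>" by (simp add: eval_word_def)

lemma eval_word_Cons: "eval_word f (x # w) = eval_letter f x \<otimes> eval_word f w"
  by (simp add: eval_word_def)

lemma eval_word_append: "eval_word f (u @ v) = eval_word f u \<otimes> eval_word f v"
  unfolding eval_word_def map_append by (rule list_mult_append) (auto simp: eval_letter_closed)

lemma eval_word_inverse: "eval_word f (rev (map inv_letter w)) = inv (eval_word f w)"
  by (induction w) (simp_all add: eval_word_append eval_word_Cons eval_word_Nil eval_letter_inv
      eval_letter_closed eval_word_closed inv_mult_group)

text \<open>A closed surface with polygonal fundamental domain \<open>w\<close>, cut open along a pair of interleaved
  edges, loses a handle.\<close>

lemma handle_identity:
  assumes [simp]: "x \<in> carrier G" "y \<in> carrier G" "a \<in> carrier G" "b \<in> carrier G" "c \<in> carrier G" "d \<in> carrier G"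
  shows "\<exists>u\<in>carrier G. \<exists>v\<in>carrier G.
    x \<otimes> a \<otimes> y \<otimes> b \<otimes> inv x \<otimes> c \<otimes> inv y \<otimes> d =
    (c \<otimes> b \<otimes> a \<otimes> d) \<otimes> (inv d \<otimes> (u \<otimes> v \<otimes> inv u \<otimes> inv v) \<otimes> d)"
  \<comment> \<open>The witnesses are solved from the left-hand side: \<open>c b a u = x a\<close>
    and \<open>v = y b a\<close> make \<open>c b a u v u^-1 v^-1\<close> telescope to
    \<open>x a y b x^-1 c y^-1\<close>.\<close>
  by (intro bexI[of _ "inv (c \<otimes> b \<otimes> a) \<otimes> x \<otimes> a"] bexI[of _ "y \<otimes> b \<otimes> a"])
    (simp_all add: m_assoc inv_mult_group inv_cancel_left inv_cancel_left')

text \<open>The classification of closed oriented surfaces in algebraic form: each handle split off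
  uses up four sides. If the sides between a letter and its partner are unbalanced, some letter
  among them has its partner outside, and the two pairs interleave; otherwise the polygon falls
  apart into two balanced ones.\<close>

lemma balanced_word_commutator_product:
  "balanced w \<Longrightarrow> \<exists>m. 4 * m \<le> length w \<and> commutator_product m (eval_word f w)"
proof (induction "length w" arbitrary: w rule: less_induct)
  case less
  show ?case
  proof (cases w)
    case Nil
    then show ?thesis using commutator_product_one by (auto simp: eval_word_Nil)
  next
    case (Cons x u)
    have bal: "count_list w y = count_list w (inv_letter y)" for y
      using less.prems unfolding balanced_def by blast
    then have "count_list u (inv_letter x) > 0" using Cons bal[of x] by simp
    then have "inv_letter x \<in> set u" by (metis count_list_0_iff gr_implies_not0)
    then obtain A B where u: "u = A @ inv_letter x # B" by (meson split_list)
    have balAB: "count_list A y + count_list B y = count_list A (inv_letter y) + count_list B (inv_letter y)" for y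
      using bal[of y] unfolding Cons u by (cases x; cases y) (auto split: if_splits)
    show ?thesis
    proof (cases "balanced A")
      case True
      then have "balanced B" using balAB by (auto simp: balanced_def)
      from less.hyps[OF _ True] less.hyps[OF _ this]
      obtain m n where mn: "4 * m \<le> length A" "commutator_product m (eval_word f A)"
         "4 * n \<le> length B" "commutator_product n (eval_word f B)" unfolding Cons u by auto
      have "eval_word f w = (eval_letter f x \<otimes> eval_word f A \<otimes> inv (eval_letter f x)) \<otimes> eval_word f B"
        by (simp add: Cons u eval_word_append eval_word_Cons eval_word_Nil eval_letter_inv
            eval_letter_closed eval_word_closed m_assoc)
      moreover have "commutator_product (m + n) \<dots>"
        by (intro commutator_product_mult commutator_product_conjugate mn eval_letter_closed)
      ultimately show ?thesis using mn unfolding Cons u by (intro exI[of _ "m + n"]) auto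
    next
      case False
      then obtain y0 where "count_list A y0 \<noteq> count_list A (inv_letter y0)" by (auto simp: balanced_def)
      then obtain y where y: "count_list A y > count_list A (inv_letter y)"
        by (metis inv_letter_inv_letter linorder_neqE_nat)
      then have "count_list B (inv_letter y) > 0" using balAB[of y] by simp
      then have "inv_letter y \<in> set B" by (metis count_list_0_iff gr_implies_not0)
      then obtain C D where B: "B = C @ inv_letter y # D" by (meson split_list)
      from y have "y \<in> set A" by (metis count_list_0_iff gr_implies_not0)
      then obtain A1 A2 where A: "A = A1 @ y # A2" by (meson split_list)
      have "balanced (C @ A2 @ A1 @ D)"
        unfolding balanced_def
      proof
        fix z
        show "count_list (C @ A2 @ A1 @ D) z = count_list (C @ A2 @ A1 @ D) (inv_letter z)"
          using balAB[of z] unfolding A B by (cases y; cases z) (auto split: if_splits)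
      qed
      from less.hyps[OF _ this] obtain m where m: "4 * m \<le> length (C @ A2 @ A1 @ D)"
        "commutator_product m (eval_word f (C @ A2 @ A1 @ D))" unfolding Cons u A B by auto
      let ?e = "eval_word f" and ?l = "eval_letter f"
      obtain g h where gh: "g \<in> carrier G" "h \<in> carrier G" and *:
         "?l x \<otimes> ?e A1 \<otimes> ?l y \<otimes> ?e A2 \<otimes> inv ?l x \<otimes> ?e C \<otimes> inv ?l y \<otimes> ?e D =
         (?e C \<otimes> ?e A2 \<otimes> ?e A1 \<otimes> ?e D) \<otimes> (inv ?e D \<otimes> (g \<otimes> h \<otimes> inv g \<otimes> inv h) \<otimes> ?e D)"
        using handle_identity[of "?l x" "?l y" "?e A1" "?e A2" "?e C" "?e D"]
        by (auto simp: eval_letter_closed eval_word_closed)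
      have "commutator_product (m + 1) (?e (C @ A2 @ A1 @ D) \<otimes>
        (inv ?e D \<otimes> (g \<otimes> h \<otimes> inv g \<otimes> inv h) \<otimes> inv (inv ?e D)))"
        by (intro commutator_product_mult commutator_product_conjugate commutator_product_commutator
            m gh inv_closed eval_word_closed)
      also have "?e (C @ A2 @ A1 @ D) \<otimes> (inv ?e D \<otimes> (g \<otimes> h \<otimes> inv g \<otimes> inv h) \<otimes> inv (inv ?e D)) = ?e w"
        using * by (simp add: Cons u A B eval_word_append eval_word_Cons eval_word_Nil eval_letter_inv
            eval_letter_closed eval_word_closed m_assoc)
      finally show ?thesis using m unfolding Cons u A B by (intro exI[of _ "m + 1"]) auto
    qed
  qed
qed

text \<open>Each polygon is rotated until the common side stands at the end, or at the beginning.
  Rotation conjugates the value, which keeps the exponent sum, and then the common side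
  cancels.\<close>

lemma merge_words:
  assumes "conjugate_product r k (eval_word f (u @ x # v))" "r \<in> carrier G"
    "conjugate_product r l (eval_word f (u' @ inv_letter x # v'))"
  shows "conjugate_product r (k + l) (eval_word f (v' @ u' @ v @ u))"
proof -
  let ?e = "eval_word f" and ?l = "eval_letter f"
  note c = eval_letter_closed eval_word_closed
  have "conjugate_product r l (?e v' \<otimes> ?e (u' @ inv_letter x # v') \<otimes> inv ?e v')"
    by (rule conjugate_product_conjugate[OF assms(3,2) eval_word_closed])
  also have "?e v' \<otimes> ?e (u' @ inv_letter x # v') \<otimes> inv ?e v' = ?e v' \<otimes> ?e u' \<otimes> inv ?l x"
    by (simp add: eval_word_append eval_word_Cons eval_letter_inv c m_assoc)
  finally have 1: "conjugate_product r l (?e v' \<otimes> ?e u' \<otimes> inv ?l x)" .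
  have "conjugate_product r k (inv ?e u \<otimes> ?e (u @ x # v) \<otimes> inv (inv ?e u))"
    by (rule conjugate_product_conjugate[OF assms(1,2) inv_closed[OF eval_word_closed]])
  also have "inv ?e u \<otimes> ?e (u @ x # v) \<otimes> inv (inv ?e u) = ?l x \<otimes> ?e v \<otimes> ?e u"
    by (simp add: eval_word_append eval_word_Cons eval_letter_inv c m_assoc inv_cancel_left)
  finally have "conjugate_product r (l + k) ((?e v' \<otimes> ?e u' \<otimes> inv ?l x) \<otimes> (?l x \<otimes> ?e v \<otimes> ?e u))"
    using conjugate_product_mult[OF 1 _ assms(2)] by blast
  also have "(?e v' \<otimes> ?e u' \<otimes> inv ?l x) \<otimes> (?l x \<otimes> ?e v \<otimes> ?e u) = ?e (v' @ u' @ v @ u)"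
    by (simp add: eval_word_append c m_assoc inv_cancel_left)
  finally show ?thesis by (simp add: add.commute)
qed

text \<open>Gluing two polygons removes one of them and two sides, so the right-hand side does not
  change. When every polygon is balanced by itself, each is a closed surface to which
  \<open>bound\<close> applies.\<close>

lemma balanced_polygons:
  fixes I :: real
  assumes r: "r \<in> carrier G" and I: "I \<ge> 0"
    and bound: "\<And>m k w. \<lbrakk>commutator_product m w; conjugate_product r k w; k \<noteq> 0\<rbrakk> \<Longrightarrow> I * \<bar>k\<bar> \<le> 4 * (real m - 1)"
  assumes "\<And>W k. (W, k) \<in># M \<Longrightarrow> conjugate_product r k (eval_word f W) \<and> length W \<ge> 3"
    "\<And>x. (\<Sum>(W, k)\<in>#M. count_list W x) = (\<Sum>(W, k)\<in>#M. count_list W (inv_letter x))"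
  shows "I * \<bar>real_of_int (\<Sum>(W, k)\<in>#M. k)\<bar> \<le> (\<Sum>(W, k)\<in>#M. real (length W) - 2)"
  using assms(4,5)
proof (induction "size M" arbitrary: M rule: less_induct)
  case less
  show ?case
  proof (cases "\<forall>(W, k)\<in>#M. balanced W")
    case all_bal: True
    have *: "I * \<bar>real_of_int k\<bar> \<le> real (length W) - 2" if WM: "(W, k) \<in># M" for W k
    proof (cases "k = 0")
      \<comment> \<open>No bound is available for \<open>k = 0\<close>; the right-hand side is
        nonnegative because every polygon has at least three sides.\<close>
      case True
      then show ?thesis using less.prems(1)[OF WM] by simp
    next
      case False
      obtain m where m: "4 * m \<le> length W" "commutator_product m (eval_word f W)"
        using balanced_word_commutator_product[of W] bspec[OF all_bal WM] by auto
      have "I * \<bar>k\<bar> \<le> 4 * (real m - 1)" using bound m less.prems(1)[OF WM] False by blast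
      then show ?thesis using m(1) by (simp add: of_nat_diff)
    qed
    have "I * \<bar>real_of_int (\<Sum>(W, k)\<in>#N. k)\<bar> \<le> (\<Sum>(W, k)\<in>#N. real (length W) - 2)" if "N \<subseteq># M" for N
      using that
    proof (induction N)
      case (add p N)
      obtain W k where p: "p = (W, k)" by (cases p)
      have "(W, k) \<in># M" using add.prems p by (simp add: insert_subset_eq_iff)
      moreover have "N \<subseteq># M" using add.prems by (metis mset_subset_eq_insertD subset_mset.less_imp_le)
      moreover have "I * \<bar>real_of_int k + real_of_int (\<Sum>(W, k)\<in>#N. k)\<bar>
          \<le> I * (\<bar>real_of_int k\<bar> + \<bar>real_of_int (\<Sum>(W, k)\<in>#N. k)\<bar>)"
        by (intro mult_left_mono I abs_triangle_ineq)
      ultimately show ?case using add.IH *[of W k] by (simp add: p distrib_left)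
    qed simp
    then show ?thesis by blast
  next
    case False
    then obtain W k where Wk: "(W, k) \<in># M" "\<not> balanced W" by auto
    then obtain M1 where M1: "M = add_mset (W, k) M1" by (meson mset_add)
    obtain x0 where "count_list W x0 \<noteq> count_list W (inv_letter x0)" using Wk by (auto simp: balanced_def)
    then obtain x where x: "count_list W x > count_list W (inv_letter x)"
      by (metis inv_letter_inv_letter linorder_neqE_nat)
    then have "x \<in> set W" by (metis count_list_0_iff gr_implies_not0)
    then obtain u v where W: "W = u @ x # v" by (meson split_list)
    \<comment> \<open>The balance holds in total, so the excess of \<open>x\<close> in
      \<open>W\<close> must be made up for by \<open>inv_letter x\<close> in another
      polygon.\<close>
    have "(\<Sum>(W, k)\<in>#M1. count_list W (inv_letter x)) \<noteq> 0"
      using less.prems(2)[of x] x unfolding M1 image_mset_add_mset sum_mset.add_mset prod.case by linarith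
    then obtain W' l where W'l: "(W', l) \<in># M1" "count_list W' (inv_letter x) \<noteq> 0"
      by (auto simp: sum_mset_0_iff)
    then obtain M2 where M2: "M1 = add_mset (W', l) M2" by (meson mset_add)
    from W'l have "inv_letter x \<in> set W'" by (metis count_list_0_iff)
    then obtain u' v' where W': "W' = u' @ inv_letter x # v'" by (meson split_list)
    define N where "N = add_mset (v' @ u' @ v @ u, k + l) M2"
    have "I * \<bar>real_of_int (\<Sum>(W, k)\<in>#N. k)\<bar> \<le> (\<Sum>(W, k)\<in>#N. real (length W) - 2)"
    proof (rule less.hyps)
      show "size N < size M" by (simp add: N_def M1 M2)
      fix V j assume "(V, j) \<in># N"
      then consider "V = v' @ u' @ v @ u" "j = k + l" | "(V, j) \<in># M2" by (auto simp: N_def)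
      then show "conjugate_product r j (eval_word f V) \<and> 3 \<le> length V"
      proof cases
        case 1
        have "conjugate_product r k (eval_word f W) \<and> length W \<ge> 3"
           "conjugate_product r l (eval_word f W') \<and> length W' \<ge> 3"
          using less.prems(1)[of W k] less.prems(1)[of W' l] by (simp_all add: M1 M2)
        then show ?thesis using merge_words[OF _ r, of k u x v l u' v'] unfolding W W' 1 by simp
      next
        case 2
        then show ?thesis using less.prems(1)[of V j] by (simp add: M1 M2)
      qed
    next
      fix z
      show "(\<Sum>(W, k)\<in>#N. count_list W z) = (\<Sum>(W, k)\<in>#N. count_list W (inv_letter z))"
        using less.prems(2)[of z] unfolding N_def M1 M2 W W'
        by (cases x; cases z) (auto split: if_splits)
    qed
    then show ?thesis by (simp add: N_def M1 M2 W W' algebra_simps)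
  qed
qed

end

section \<open>Cyclic coverings of surfaces\<close>

text \<open>Moving the factors \<open>c\<close> to the left across powers of \<open>u\<close> turns
  them into conjugates, which need as many commutators as \<open>c\<close> itself.\<close>

lemma power_conjugate_expand:
  assumes [simp]: "u \<in> carrier G" "c \<in> carrier G" and "commutator_product m c"
  shows "\<exists>q. commutator_product (d * m) q \<and> (u \<otimes> c) [^] (d :: nat) = q \<otimes> u [^] d"
proof (induction d)
  case 0
  then show ?case using commutator_product_one by auto
next
  case (Suc d)
  then obtain q where q: "commutator_product (d * m) q" "(u \<otimes> c) [^] d = q \<otimes> u [^] d" by blast
  have [simp]: "q \<in> carrier G" using q commutator_product_closed by blast
  define p where "p = u [^] Suc d \<otimes> c \<otimes> inv (u [^] Suc d)"
  have [simp]: "p \<in> carrier G" by (simp add: p_def)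
  have "commutator_product m p" unfolding p_def by (intro commutator_product_conjugate assms) simp
  then have "commutator_product (d * m + m) (q \<otimes> p)" using commutator_product_mult q by blast
  moreover have "(u \<otimes> c) [^] Suc d = (q \<otimes> p) \<otimes> u [^] Suc d"
    by (simp add: q p_def m_assoc)
  ultimately show ?case by (intro exI[of _ "q \<otimes> p"]) (simp add: add.commute)
qed

text \<open>The element is the product of \<open>a^-i w a^i\<close> over \<open>i < d\<close>, the
  lifts of the boundary to the \<open>d\<close> sheets of the covering.\<close>

lemma conjugate_product_telescope:
  assumes "conjugate_product r k w" and [simp]: "r \<in> carrier G" "a \<in> carrier G"
  shows "conjugate_product r (int d * k) ((w \<otimes> inv a) [^] d \<otimes> a [^] d)"
proof (induction d)
  case 0
  then show ?case by (simp add: conjugate_product_one)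
next
  case (Suc d)
  have [simp]: "w \<in> carrier G" using assms conjugate_product_closed by blast
  have "conjugate_product r (int d * k + k) (((w \<otimes> inv a) [^] d \<otimes> a [^] d) \<otimes> (inv (a [^] d) \<otimes> w \<otimes> inv (inv (a [^] d))))"
    by (intro conjugate_product_mult Suc conjugate_product_conjugate assms) simp_all
  also have "((w \<otimes> inv a) [^] d \<otimes> a [^] d) \<otimes> (inv (a [^] d) \<otimes> w \<otimes> inv (inv (a [^] d))) = (w \<otimes> inv a) [^] d \<otimes> (w \<otimes> a [^] d)"
    by (simp add: m_assoc inv_cancel_left')
  also have "w \<otimes> a [^] d = (w \<otimes> inv a) \<otimes> a [^] Suc d"
    using nat_pow_Suc2[of a d] by (simp add: m_assoc inv_cancel_left del: nat_pow_Suc)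
  finally show ?case by (simp add: m_assoc algebra_simps)
qed

text \<open>The \<open>d\<close>-fold cyclic covering of a surface of genus \<open>g\<close> that unwinds one handle has genus
  \<open>d (g - 1) + 1\<close>, and each of its boundary components maps homeomorphically.\<close>

lemma cyclic_covering:
  assumes "commutator_product g w" "g \<ge> 1" "conjugate_product r k w" "r \<in> carrier G"
  shows "\<exists>w'. commutator_product (d * (g - 1) + 1) w' \<and> conjugate_product r (int d * k) w'"
proof -
  obtain cs where cs: "length cs = g" "set cs \<subseteq> derived_set G (carrier G)" "w = list_mult G cs"
    using assms by (auto simp: commutator_product_def)
  then obtain h ds where hds: "cs = h # ds" using assms(2) by (cases cs) auto
  define c where "c = list_mult G ds"
  have c: "commutator_product (g - 1) c"
    unfolding commutator_product_def c_def using cs hds by (intro exI[of _ ds]) auto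
  obtain a b where [simp]: "a \<in> carrier G" "b \<in> carrier G" and h: "h = a \<otimes> b \<otimes> inv a \<otimes> inv b"
    using cs hds by auto
  have [simp]: "c \<in> carrier G" using c commutator_product_closed by blast
  have w: "w = a \<otimes> b \<otimes> inv a \<otimes> inv b \<otimes> c" using cs hds h c_def by simp
  \<comment> \<open>With this \<open>u\<close> one has \<open>w a^-1 = a (u c) a^-1\<close>. The
    \<open>d\<close>-th power of \<open>u c\<close> ends in \<open>u^d = b a^-d b^-1\<close>, which
    together with \<open>a^d\<close> is a single commutator; this is the \<open>+ 1\<close> in the
    genus.\<close>
  define u where "u = b \<otimes> inv a \<otimes> inv b"
  have [simp]: "u \<in> carrier G" by (simp add: u_def)
  obtain q where q: "commutator_product (d * (g - 1)) q" "(u \<otimes> c) [^] d = q \<otimes> u [^] d"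
    using power_conjugate_expand[OF _ _ c, of u d] by auto
  have [simp]: "q \<in> carrier G" using q commutator_product_closed by blast
  have cp: "(t \<otimes> x \<otimes> inv t) [^] d = t \<otimes> x [^] d \<otimes> inv t" if [simp]: "t \<in> carrier G" "x \<in> carrier G" for t x and d :: nat
    by (induction d) (simp_all add: m_assoc inv_cancel_left)
  have "w \<otimes> inv a = a \<otimes> (u \<otimes> c) \<otimes> inv a" by (simp add: w u_def m_assoc)
  then have "(w \<otimes> inv a) [^] d \<otimes> a [^] d = a \<otimes> (q \<otimes> (b \<otimes> inv a [^] d \<otimes> inv b)) \<otimes> inv a \<otimes> a [^] d"
    by (simp add: cp q(2)) (simp add: u_def cp)
  also have "\<dots> = a \<otimes> (q \<otimes> (b \<otimes> inv (a [^] d) \<otimes> inv b \<otimes> inv (inv (a [^] d)))) \<otimes> inv a"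
  proof -
    have "inv a \<otimes> a [^] d = a [^] d \<otimes> inv a"
    proof (induction d)
      case (Suc d)
      have "inv a \<otimes> a [^] Suc d = (inv a \<otimes> a [^] d) \<otimes> a" by (simp add: m_assoc)
      also have "\<dots> = a [^] Suc d \<otimes> inv a" by (simp add: Suc m_assoc)
      finally show ?case .
    qed simp
    then show ?thesis by (simp add: nat_pow_inv[symmetric] m_assoc)
  qed
  finally have "commutator_product (d * (g - 1) + 1) ((w \<otimes> inv a) [^] d \<otimes> a [^] d)"
    using commutator_product_conjugate[OF commutator_product_mult[OF q(1)
        commutator_product_commutator[of b "inv (a [^] d)"]], of a] by simp
  then show ?thesis using conjugate_product_telescope[OF assms(3,4), of a d] by auto
qed

end

section \<open>The Magnus expansion\<close>

text \<open>The Cauchy product of power series in non-commuting variables. A monomial is the list of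
  its variables, and the recursion runs through its factorisations into a prefix and a
  suffix.\<close>

fun convolution :: "('s list \<Rightarrow> int) \<Rightarrow> ('s list \<Rightarrow> int) \<Rightarrow> 's list \<Rightarrow> int" where
  "convolution f g [] = f [] * g []"
| "convolution f g (a # l) = f [] * g (a # l) + convolution (\<lambda>l. f (a # l)) g l"

definition unit_series :: "'s list \<Rightarrow> int" where
  "unit_series l = (if l = [] then 1 else 0)"

lemma convolution_zero_left: "convolution (\<lambda>_. 0) g l = 0"
  by (induction l) auto

lemma convolution_linear_left:
  "convolution (\<lambda>l. c * f l + h l) g l = c * convolution f g l + convolution h g l"
  by (induction l arbitrary: f h) (auto simp: algebra_simps)

lemma convolution_assoc:
  "convolution f (convolution g h) l = convolution (convolution f g) h l"
proof (induction l arbitrary: f)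
  case (Cons a l)
  then show ?case by (simp add: convolution_linear_left algebra_simps)
qed simp

lemma convolution_unit_left: "convolution unit_series g = g"
proof
  show "convolution unit_series g l = g l" for l
    by (cases l) (auto simp: unit_series_def convolution_zero_left)
qed

lemma convolution_support:
  assumes "\<And>l. f l \<noteq> 0 \<Longrightarrow> set l \<subseteq> A" "\<And>l. g l \<noteq> 0 \<Longrightarrow> set l \<subseteq> A"
  shows "convolution f g l \<noteq> 0 \<Longrightarrow> set l \<subseteq> A"
  using assms(1)
proof (induction l arbitrary: f)
  case (Cons a l)
  show ?case
  proof (cases "convolution (\<lambda>l. f (a # l)) g l = 0")
    case True
    then show ?thesis using Cons.prems assms(2)[of "a # l"] by auto
  next
    case False
    have "set l \<subseteq> A"
      using Cons.IH[of "\<lambda>l. f (a # l)"] False Cons.prems(2) by fastforce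
    moreover have "a \<in> A"
    proof (rule ccontr)
      assume "a \<notin> A"
      then have "(\<lambda>l. f (a # l)) = (\<lambda>_. 0)" using Cons.prems(2) by fastforce
      then show False using False convolution_zero_left by metis
    qed
    ultimately show ?thesis by simp
  qed
qed simp

text \<open>The coefficients of \<open>1 + X\<close> and of its inverse, the alternating geometric
  series.\<close>

fun magnus_letter :: "'s \<times> bool \<Rightarrow> 's list \<Rightarrow> int" where
  "magnus_letter (s, b) l =
     (if b then (if l = [] \<or> l = [s] then 1 else 0) else if set l \<subseteq> {s} then (-1) ^ length l else 0)"

text \<open>The coefficients of the Magnus expansion, that is, of the image of a word under
  \<open>s \<mapsto> 1 + X\<^sub>s\<close> in the ring of formal power series in non-commuting variables \<open>X\<^sub>s\<close>.\<close>

definition magnus :: "'s word \<Rightarrow> 's list \<Rightarrow> int" where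
  "magnus w = foldr (\<lambda>x. convolution (magnus_letter x)) w unit_series"

lemma magnus_Nil: "magnus [] = unit_series" by (simp add: magnus_def)

lemma magnus_Cons: "magnus (x # w) = convolution (magnus_letter x) (magnus w)"
  by (simp add: magnus_def)

lemma magnus_letter_inverse:
  "convolution (magnus_letter x) (magnus_letter (inv_letter x)) = unit_series"
proof
  fix l :: "'a list"
  obtain s b where x: "x = (s, b)" by (cases x)
  \<comment> \<open>The factor \<open>c\<close> makes the induction close: removing a leading
    \<open>s\<close> from the alternating series reproduces the series with the opposite
    sign.\<close>
  have inv_letter_mult: "convolution (\<lambda>l. c * (if set l \<subseteq> {s} then (-1) ^ length l else 0)) (magnus_letter (s, True)) l
     = c * unit_series l" for c l
  proof (induction l arbitrary: c)
    case (Cons a l)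
    show ?case
    proof (cases "a = s")
      case True
      have "(\<lambda>l. c * (if set (a # l) \<subseteq> {s} then (-1) ^ length (a # l) else 0))
         = (\<lambda>l. (- c) * (if set l \<subseteq> {s} then (-1) ^ length l else 0))" using True by auto
      then show ?thesis using Cons[of "- c"] True by (auto simp: unit_series_def)
    next
      case False
      then have "(\<lambda>l. c * (if set (a # l) \<subseteq> {s} then (-1) ^ length (a # l) else 0)) = (\<lambda>_. 0)" by auto
      then show ?thesis using False by (simp add: unit_series_def convolution_zero_left)
    qed
  qed (simp add: unit_series_def)
  have letter_mult: "convolution (magnus_letter (s, True)) (magnus_letter (s, False)) l = unit_series l"
  proof (cases l)
    case (Cons a m)
    have "(\<lambda>l. magnus_letter (s, True) (a # l)) = (if a = s then unit_series else (\<lambda>_. 0))"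
      by (auto simp: unit_series_def fun_eq_iff)
    then show ?thesis unfolding Cons convolution.simps
      by (auto simp: convolution_unit_left convolution_zero_left unit_series_def)
  qed (simp add: unit_series_def)
  show "convolution (magnus_letter x) (magnus_letter (inv_letter x)) l = unit_series l"
  proof (cases b)
    case False
    have "magnus_letter (s, False) = (\<lambda>l. 1 * (if set l \<subseteq> {s} then (-1) ^ length l else 0))" by auto
    then show ?thesis using inv_letter_mult[of 1 l] False unfolding x by simp
  next
    case True
    then show ?thesis using letter_mult unfolding x by simp
  qed
qed

lemma magnus_cancel_cons: "magnus (cancel_cons x w) = convolution (magnus_letter x) (magnus w)"
proof (cases w)
  case (Cons y v)
  show ?thesis
  proof (cases "y = inv_letter x")
    case True
    have "convolution (magnus_letter x) (magnus w)
        = convolution (convolution (magnus_letter x) (magnus_letter (inv_letter x))) (magnus v)"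
      unfolding Cons True magnus_Cons by (rule ext) (rule convolution_assoc)
    then show ?thesis using Cons True by (simp add: magnus_letter_inverse convolution_unit_left)
  qed (simp add: Cons magnus_Cons)
qed (simp add: magnus_Nil magnus_Cons)

lemma magnus_mult: "magnus (foldr cancel_cons u v) = convolution (magnus u) (magnus v)"
proof (induction u)
  case (Cons x u)
  show ?case
    by (simp add: magnus_cancel_cons Cons magnus_Cons) (rule ext, rule convolution_assoc)
qed (simp add: magnus_Nil convolution_unit_left)

lemma magnus_at_Nil: "magnus w [] = 1"
  by (induction w) (auto simp: magnus_Nil unit_series_def magnus_Cons split: prod.splits)

lemma magnus_replicate:
  "magnus (replicate n (s, b)) [s] = (if b then int n else - int n)"
  "magnus (replicate n (s, b)) l \<noteq> 0 \<Longrightarrow> set l \<subseteq> {s}"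
proof -
  show "magnus (replicate n (s, b)) [s] = (if b then int n else - int n)"
    by (induction n) (auto simp: magnus_Nil unit_series_def magnus_Cons magnus_at_Nil)
  show "set l \<subseteq> {s}" if "magnus (replicate n (s, b)) l \<noteq> 0" for l
    using that
  proof (induction n arbitrary: l)
    case (Suc n)
    show ?case
      by (rule convolution_support[where f = "magnus_letter (s, b)" and g = "magnus (replicate n (s, b))"])
        (use Suc in \<open>auto simp: magnus_Cons split: if_splits\<close>)
  qed (simp add: magnus_Nil unit_series_def split: if_splits)
qed

text \<open>A nonempty prefix of \<open>l\<close> begins outside \<open>A\<close>, where
  \<open>f\<close> vanishes, so only the empty prefix contributes.\<close>

lemma convolution_eq_right:
  assumes "l \<noteq> [] \<Longrightarrow> hd l \<notin> A" "\<And>l. f l \<noteq> 0 \<Longrightarrow> set l \<subseteq> A"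
  shows "convolution f g l = f [] * g l"
proof (cases l)
  case (Cons a m)
  then have "(\<lambda>l. f (a # l)) = (\<lambda>_. 0)" using assms by fastforce
  then show ?thesis using Cons convolution_zero_left by simp
qed simp

lemma replicate_prefix:
  assumes "reduced (x # w)"
  obtains n u where "x # w = replicate (Suc n) x @ u" "u \<noteq> [] \<Longrightarrow> fst (hd u) \<noteq> fst x" "reduced u"
  using assms
proof (induction w arbitrary: thesis)
  case Nil
  show ?case by (rule Nil(1)[of 0 "[]"]) (auto simp: reduced_def)
next
  case (Cons y w)
  show ?case
  proof (cases "y = x")
    case True
    then obtain n u where "x # w = replicate (Suc n) x @ u" "u \<noteq> [] \<Longrightarrow> fst (hd u) \<noteq> fst x" "reduced u"
      using Cons.IH Cons.prems(2) by (auto simp: reduced_Cons)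
    then show ?thesis using Cons.prems(1)[of "Suc n" u] True by simp
  next
    case False
    then have "fst y \<noteq> fst x" using Cons.prems(2) by (cases x; cases y) (auto simp: reduced_Cons)
    then show ?thesis using Cons.prems(1)[of 0 "y # w"] Cons.prems(2) by (auto simp: reduced_Cons)
  qed
qed

text \<open>The witness is the product of the variables of the syllables; its coefficient is the product of
  the exponents.\<close>

lemma magnus_leading:
  "reduced w \<Longrightarrow> \<exists>l. distinct_adj l \<and> (l = [] \<longleftrightarrow> w = []) \<and> (w \<noteq> [] \<longrightarrow> hd l = fst (hd w)) \<and>
     magnus w l \<noteq> 0 \<and> (\<forall>m. distinct_adj m \<and> length m > length l \<longrightarrow> magnus w m = 0)"
proof (induction "length w" arbitrary: w rule: less_induct)
  case less
  show ?case
  proof (cases w)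
    case Nil
    then show ?thesis by (intro exI[of _ "[]"]) (auto simp: magnus_Nil unit_series_def)
  next
    case (Cons x v)
    obtain n u where nu: "x # v = replicate (Suc n) x @ u" "u \<noteq> [] \<Longrightarrow> fst (hd u) \<noteq> fst x" "reduced u"
      using replicate_prefix less.prems unfolding Cons by blast
    obtain s b where x: "x = (s, b)" by (cases x)
    have "length u < length w" using Cons arg_cong[OF nu(1), of length] by simp
    from less.hyps[OF this nu(3)] obtain l where l: "distinct_adj l" "l = [] \<longleftrightarrow> u = []"
      "u \<noteq> [] \<longrightarrow> hd l = fst (hd u)" "magnus u l \<noteq> 0"
      "\<And>m. distinct_adj m \<Longrightarrow> length m > length l \<Longrightarrow> magnus u m = 0" by blast
    define f where "f = magnus (replicate (Suc n) x)"
    have f0: "f [] = 1" by (simp add: f_def magnus_at_Nil)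
    have fs: "f [s] \<noteq> 0" and fsupp: "f l \<noteq> 0 \<Longrightarrow> set l \<subseteq> {s}" for l
      using magnus_replicate[of "Suc n" s b] unfolding f_def x by (simp_all split: if_splits)
    have app: "magnus (p @ q) m = convolution (magnus p) (magnus q) m" for p q :: "'a word" and m
    proof (induction p arbitrary: m)
      case (Cons y p)
      then have "magnus (p @ q) = convolution (magnus p) (magnus q)" by blast
      then show ?case by (simp add: magnus_Cons convolution_assoc)
    qed (simp add: magnus_Nil convolution_unit_left)
    have w: "magnus w m = convolution f (magnus u) m" for m
      unfolding Cons nu(1) f_def by (rule app)
    \<comment> \<open>A monomial without adjacent repetitions can take at most one variable from the
      first syllable, that is, nothing or a single \<open>s\<close>.\<close>
    have step: "magnus w (a # m) = magnus u (a # m) + (if a = s then f [s] * magnus u m else 0)"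
      if "distinct_adj (a # m)" for a m
    proof (cases "a = s")
      case True
      have "convolution (\<lambda>l. f (s # l)) (magnus u) m = f [s] * magnus u m"
        by (rule convolution_eq_right[where A = "{s}"])
          (use that True fsupp[of "s # _"] in \<open>auto simp: distinct_adj_Cons\<close>)
      then show ?thesis by (simp add: w f0 True)
    next
      case False
      have "convolution f (magnus u) (a # m) = f [] * magnus u (a # m)"
        by (rule convolution_eq_right[where A = "{s}"]) (use False fsupp in auto)
      then show ?thesis using False by (simp add: w f0)
    qed
    have adj: "distinct_adj (s # l)"
      using l nu(2) x by (cases l) (auto simp: distinct_adj_Cons)
    show ?thesis
    proof (intro exI[of _ "s # l"] conjI allI impI)
      \<comment> \<open>The first summand of \<open>step\<close> vanishes since \<open>s # l\<close>
        is longer than \<open>l\<close>; the second is the exponent of the first syllable times the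
        leading coefficient of the rest.\<close>
      show "magnus w (s # l) \<noteq> 0"
        using step[OF adj] l(5)[OF adj] fs l(4) by simp
      fix m :: "'a list" assume m: "distinct_adj m \<and> length (s # l) < length m"
      then obtain a m' where am: "m = a # m'" by (cases m) auto
      show "magnus w m = 0"
        using step[of a m'] m l(5)[of m] l(5)[of m'] unfolding am by (auto simp: distinct_adj_Cons)
    qed (use adj Cons x in auto)
  qed
qed

text \<open>In a mixed term both the prefix and the suffix are nonempty and shorter than
  \<open>l\<close>, so it is enough that one of the two factors has no such terms.\<close>

lemma convolution_low_degree:
  assumes "(\<forall>m. m \<noteq> [] \<longrightarrow> length m < length l \<longrightarrow> f m = 0) \<or> (\<forall>m. m \<noteq> [] \<longrightarrow> length m < length l \<longrightarrow> g m = 0)"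
    and "l \<noteq> []"
  shows "convolution f g l = f [] * g l + f l * g []"
proof -
  have *: "convolution h g m = h m * g []"
    if "(\<forall>p. length p < length m \<longrightarrow> h p = 0) \<or> (\<forall>p. p \<noteq> [] \<longrightarrow> length p \<le> length m \<longrightarrow> g p = 0)" for h m
    using that
  proof (induction m arbitrary: h)
    case (Cons a m)
    show ?case using Cons.IH[of "\<lambda>l. h (a # l)"] Cons.prems by auto
  qed simp
  obtain a m where l: "l = a # m" using assms(2) by (cases l) auto
  show ?thesis using *[of m "\<lambda>l. f (a # l)"] assms(1) unfolding l by (auto simp: less_Suc_eq_le)
qed

text \<open>Conjugates of \<open>r\<close> have the same leading term in the Magnus expansion, and leading terms add
  up under multiplication.\<close>

lemma conjugate_product_trivial:
  fixes S :: "'s set" and r :: "'s word"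
  assumes "group.conjugate_product (free_group S) r k []" "r \<in> carrier (free_group S)" "r \<noteq> []"
  shows "k = 0"
proof -
  interpret F: group "free_group S" by (rule group_free_group)
  have mult: "x \<otimes>\<^bsub>free_group S\<^esub> y = foldr cancel_cons x y" and one_eq: "\<one>\<^bsub>free_group S\<^esub> = []" for x y
    by (simp_all add: free_group_def)
  have "reduced r" using assms by (simp add: free_group_def)
  with magnus_leading[OF this] assms have "\<exists>l. l \<noteq> [] \<and> magnus r l \<noteq> 0" by auto
  then obtain l where l: "l \<noteq> []" "magnus r l \<noteq> 0"
    and min: "\<And>m. m \<noteq> [] \<Longrightarrow> length m < length l \<Longrightarrow> magnus r m = 0"
    using ex_has_least_nat[of "\<lambda>l. l \<noteq> [] \<and> magnus r l \<noteq> 0" _ length] by (metis linorder_not_le)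
  \<comment> \<open>The words that satisfy \<open>low\<close> agree with 1 in all degrees below that
    of \<open>l\<close>; on them the coefficient at \<open>l\<close> is additive.\<close>
  define low where "low w \<longleftrightarrow> (\<forall>m. m \<noteq> [] \<and> length m < length l \<longrightarrow> magnus w m = 0)" for w :: "'s word"
  have mult_low: "low (x \<otimes>\<^bsub>free_group S\<^esub> y)" "magnus (x \<otimes>\<^bsub>free_group S\<^esub> y) l = magnus x l + magnus y l"
    if "low x" "low y" for x y
  proof -
    have *: "magnus (x \<otimes>\<^bsub>free_group S\<^esub> y) m = magnus x m + magnus y m" if "m \<noteq> []" "length m \<le> length l" for m
      unfolding mult magnus_mult using convolution_low_degree[of m "magnus x" "magnus y"] \<open>low x\<close> \<open>low y\<close> that
      by (auto simp: low_def magnus_at_Nil)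
    show "low (x \<otimes>\<^bsub>free_group S\<^esub> y)" using * that by (simp add: low_def)
    show "magnus (x \<otimes>\<^bsub>free_group S\<^esub> y) l = magnus x l + magnus y l" using * l by simp
  qed
  have inv_low: "low (inv\<^bsub>free_group S\<^esub> x) \<and> magnus (inv\<^bsub>free_group S\<^esub> x) l = - magnus x l"
    if "low x" "x \<in> carrier (free_group S)" for x
  proof -
    have c: "convolution (magnus x) (magnus (inv\<^bsub>free_group S\<^esub> x)) m = 0" if "m \<noteq> []" for m
      using F.r_inv[OF \<open>x \<in> _\<close>] that by (metis magnus_mult mult one_eq magnus_Nil unit_series_def)
    have *: "magnus (inv\<^bsub>free_group S\<^esub> x) m = - magnus x m" if "m \<noteq> []" "length m \<le> length l" for m
      using that
    proof (induction "length m" arbitrary: m rule: less_induct)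
      case less
      have "convolution (magnus x) (magnus (inv\<^bsub>free_group S\<^esub> x)) m
          = magnus x [] * magnus (inv\<^bsub>free_group S\<^esub> x) m + magnus x m * magnus (inv\<^bsub>free_group S\<^esub> x) []"
        by (rule convolution_low_degree) (use less.prems \<open>low x\<close> in \<open>auto simp: low_def\<close>)
      then show ?case using c[of m] less.prems by (simp add: magnus_at_Nil)
    qed
    then show ?thesis using l \<open>low x\<close> by (simp add: low_def)
  qed
  let ?c = "magnus r l"
  have r: "low r" using min by (simp add: low_def)
  have power: "low (r [^]\<^bsub>free_group S\<^esub> j) \<and> magnus (r [^]\<^bsub>free_group S\<^esub> j) l = j * ?c" if "j \<in> {-1, 1}" for j :: int
    using that r inv_low[OF r] assms by (auto simp: F.int_pow_neg)
  have conj: "low (t \<otimes>\<^bsub>free_group S\<^esub> x \<otimes>\<^bsub>free_group S\<^esub> inv\<^bsub>free_group S\<^esub> t) \<and>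
      magnus (t \<otimes>\<^bsub>free_group S\<^esub> x \<otimes>\<^bsub>free_group S\<^esub> inv\<^bsub>free_group S\<^esub> t) l = magnus x l"
      if t: "t \<in> carrier (free_group S)" and x: "x \<in> carrier (free_group S)" "low x" for t x
    proof -
      let ?y = "t \<otimes>\<^bsub>free_group S\<^esub> x \<otimes>\<^bsub>free_group S\<^esub> inv\<^bsub>free_group S\<^esub> t"
      \<comment> \<open>Comparing coefficients in \<open>y t = t x\<close> avoids the expansion of
        the inverse of \<open>t\<close>: the terms of \<open>t\<close> itself occur on both sides
        and cancel.\<close>
      have yt: "?y \<otimes>\<^bsub>free_group S\<^esub> t = t \<otimes>\<^bsub>free_group S\<^esub> x"
        using t x by (simp add: F.m_assoc F.m_closed)
      have *: "magnus ?y m = magnus x m" if "m \<noteq> []" "length m \<le> length l" for m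
        using that
      proof (induction "length m" arbitrary: m rule: less_induct)
        case less
        have "magnus ?y p = 0" if "p \<noteq> []" "length p < length m" for p
          using less.hyps[OF that(2,1)] that less.prems x by (simp add: low_def)
        then have "convolution (magnus ?y) (magnus t) m = magnus ?y [] * magnus t m + magnus ?y m * magnus t []"
          using less.prems by (intro convolution_low_degree) auto
        moreover have "convolution (magnus t) (magnus x) m = magnus t [] * magnus x m + magnus t m * magnus x []"
          using less.prems x by (intro convolution_low_degree) (auto simp: low_def)
        moreover have "convolution (magnus ?y) (magnus t) = convolution (magnus t) (magnus x)"
          using arg_cong[OF yt, of magnus] unfolding mult magnus_mult .
        ultimately show ?case by (simp add: magnus_at_Nil)
      qed
      then show ?thesis using x l by (simp add: low_def)
    qed
  have "low w \<and> magnus w l = j * ?c" if "F.conjugate_product r j w" for j w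
    using that assms(2)
  proof (induction rule: F.conjugate_product_induct)
    case one
    then show ?case using l by (simp add: one_eq low_def magnus_Nil unit_series_def)
  next
    case (mult j t k w)
    then show ?case
      using mult_low conj[of t "r [^]\<^bsub>free_group S\<^esub> j"] power[of j] assms by (simp add: algebra_simps)
  qed
  from this[OF assms(1)] have "k * ?c = 0" using l by (simp add: magnus_Nil unit_series_def)
  then show ?thesis using l by simp
qed

section \<open>Gluing polygons to closed surfaces\<close>

context group
begin

text \<open>Each triangle is taken \<open>|p t|\<close> times, and reversed where the coefficient is
  negative. The cycle condition then says that the resulting family is balanced in total.\<close>

lemma integral_polygon_bound:
  fixes I :: real and f :: "'e \<Rightarrow> 'a" and p :: "'t \<Rightarrow> int"
  assumes f: "\<And>a. f a \<in> carrier G" and r: "r \<in> carrier G" and I: "I \<ge> 0"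
    and bound: "\<And>m k w. \<lbrakk>commutator_product m w; conjugate_product r k w; k \<noteq> 0\<rbrakk> \<Longrightarrow> I * \<bar>k\<bar> \<le> 4 * (real m - 1)"
    and T: "finite T" "\<And>t. t \<in> T \<Longrightarrow> length (W t) = 3"
      "\<And>t. t \<in> T \<Longrightarrow> conjugate_product r (k t) (eval_word f (W t))"
    and cycle: "\<And>x. (\<Sum>t\<in>T. p t * (int (count_list (W t) x) - int (count_list (W t) (inv_letter x)))) = 0"
  shows "I * \<bar>real_of_int (\<Sum>t\<in>T. p t * k t)\<bar> \<le> real_of_int (\<Sum>t\<in>T. \<bar>p t\<bar>)"
proof -
  define e where "e t = (if p t > 0 then (W t, k t) else (rev (map inv_letter (W t)), - k t))" for t
  define M where "M = (\<Sum>t\<in>T. replicate_mset (nat \<bar>p t\<bar>) (e t))"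
  have count_inverse: "count_list (map inv_letter w) x = count_list w (inv_letter x)" for w :: "'e word" and x
  proof (induction w)
    case (Cons y w)
    have "inv_letter y = x \<longleftrightarrow> y = inv_letter x" by (metis inv_letter_inv_letter)
    then show ?case using Cons by simp
  qed simp
  have sum_M: "(\<Sum>q\<in>#M. h q) = (\<Sum>t\<in>T. of_nat (nat \<bar>p t\<bar>) * h (e t))" for h :: "_ \<Rightarrow> 'c::comm_semiring_1"
    unfolding M_def using T(1) by (induction T rule: finite_induct) auto
  have set_M: "q \<in># M \<Longrightarrow> \<exists>t\<in>T. q = e t" for q
    unfolding M_def using T(1) by (induction T rule: finite_induct) (auto split: if_splits)
  have "I * \<bar>real_of_int (\<Sum>(W, k)\<in>#M. k)\<bar> \<le> (\<Sum>(W, k)\<in>#M. real (length W) - 2)"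
  proof (rule balanced_polygons[OF f r I bound])
    fix V j assume "(V, j) \<in># M"
    then obtain t where t: "t \<in> T" "(V, j) = e t" using set_M by blast
    then show "conjugate_product r j (eval_word f V) \<and> 3 \<le> length V"
      using T(2)[OF t(1)] T(3)[OF t(1)] conjugate_product_inv[OF T(3)[OF t(1)] r]
      by (auto simp: e_def eval_word_inverse[OF f] split: if_splits)
  next
    fix x
    have "int (\<Sum>(V, k)\<in>#M. count_list V x) - int (\<Sum>(V, k)\<in>#M. count_list V (inv_letter x)) =
      (\<Sum>t\<in>T. \<bar>p t\<bar> * (int (count_list (fst (e t)) x) - int (count_list (fst (e t)) (inv_letter x))))"
      by (simp add: sum_M split_beta sum_subtractf algebra_simps)
    also have "\<dots> = (\<Sum>t\<in>T. p t * (int (count_list (W t) x) - int (count_list (W t) (inv_letter x))))"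
      by (intro sum.cong) (auto simp: e_def count_inverse algebra_simps)
    also have "\<dots> = 0" by (rule cycle)
    finally show "(\<Sum>(V, k)\<in>#M. count_list V x) = (\<Sum>(V, k)\<in>#M. count_list V (inv_letter x))" by linarith
  qed
  also have "(\<Sum>(W, k)\<in>#M. k) = (\<Sum>t\<in>T. p t * k t)"
    unfolding sum_M by (intro sum.cong) (auto simp: e_def)
  also have "(\<Sum>(W, k)\<in>#M. real (length W) - 2) = real_of_int (\<Sum>t\<in>T. \<bar>p t\<bar>)"
    unfolding sum_M of_int_sum using T(2) by (intro sum.cong) (auto simp: e_def)
  finally show ?thesis .
qed

text \<open>A sufficiently good simultaneous rational approximation of a real cycle is an integral cycle
  up to a common denominator, because its boundary is an integer of absolute value less than one.\<close>

lemma real_polygon_bound: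
  fixes I :: real and f :: "'e \<Rightarrow> 'a" and c :: "'t \<Rightarrow> real"
  assumes f: "\<And>a. f a \<in> carrier G" and r: "r \<in> carrier G" and I: "I \<ge> 0"
    and bound: "\<And>m k w. \<lbrakk>commutator_product m w; conjugate_product r k w; k \<noteq> 0\<rbrakk> \<Longrightarrow> I * \<bar>k\<bar> \<le> 4 * (real m - 1)"
    and T: "finite T" "\<And>t. t \<in> T \<Longrightarrow> length (W t) = 3"
      "\<And>t. t \<in> T \<Longrightarrow> conjugate_product r (k t) (eval_word f (W t))"
    and cycle: "\<And>x. (\<Sum>t\<in>T. c t * real_of_int (int (count_list (W t) x) - int (count_list (W t) (inv_letter x)))) = 0"
  shows "I * \<bar>\<Sum>t\<in>T. c t * k t\<bar> \<le> (\<Sum>t\<in>T. \<bar>c t\<bar>)"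
proof (rule ccontr)
  define D where "D = I * \<bar>\<Sum>t\<in>T. c t * k t\<bar> - (\<Sum>t\<in>T. \<bar>c t\<bar>)"
  define B where "B = real (card T) + I * (\<Sum>t\<in>T. \<bar>real_of_int (k t)\<bar>)"
  assume "\<not> ?thesis"
  then have "D > 0" by (simp add: D_def)
  \<comment> \<open>The bound \<open>3 card T\<close> makes the rounded boundary smaller than one,
    since a letter occurs at most three times in a triangle. The bound \<open>B / D\<close> makes
    the accumulated rounding errors smaller than the supposed gap \<open>D\<close>.\<close>
  obtain N where N: "real N > max (B / D) (3 * real (card T))" using reals_Archimedean2 by blast
  then have "N > 0" by (cases N) auto
  obtain h where h: "bij_betw h {..<card T} T" using T(1) bij_betw_from_nat_into_finite
    by (metis ex_bij_betw_nat_finite lessThan_atLeast0)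
  obtain q p' where q: "q > 0" "\<And>i. i < card T \<Longrightarrow> \<bar>of_int q * c (h i) - of_int (p' i)\<bar> < 1 / N"
    using Dirichlet_approx_simult[OF \<open>N > 0\<close>, of "card T" "\<lambda>i. c (h i)"] by blast
  define p where "p t = p' (inv_into {..<card T} h t)" for t
  have p: "\<bar>of_int q * c t - of_int (p t)\<bar> < 1 / N" if "t \<in> T" for t
  proof -
    have "t \<in> h ` {..<card T}" using that h by (simp add: bij_betw_def)
    from inv_into_into[OF this] f_inv_into_f[OF this] q(2) show ?thesis by (force simp: p_def)
  qed
  have "I * \<bar>real_of_int (\<Sum>t\<in>T. p t * k t)\<bar> \<le> real_of_int (\<Sum>t\<in>T. \<bar>p t\<bar>)"
  proof (rule integral_polygon_bound[OF f r I bound T])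
    fix x
    define a where "a t = int (count_list (W t) x) - int (count_list (W t) (inv_letter x))" for t
    have a: "\<bar>a t\<bar> \<le> 3" if "t \<in> T" for t
      using count_le_length[of "W t" x] count_le_length[of "W t" "inv_letter x"] T(2)[OF that] by (simp add: a_def)
    have "\<bar>real_of_int (\<Sum>t\<in>T. p t * a t)\<bar> = \<bar>(\<Sum>t\<in>T. (of_int (p t) - of_int q * c t) * a t) + of_int q * (\<Sum>t\<in>T. c t * a t)\<bar>"
      by (simp add: sum_distrib_left sum.distrib[symmetric] algebra_simps)
    also have "(\<Sum>t\<in>T. c t * real_of_int (a t)) = 0" using cycle[of x] by (simp add: a_def)
    also have "\<bar>(\<Sum>t\<in>T. (of_int (p t) - of_int q * c t) * a t) + of_int q * 0\<bar> \<le> (\<Sum>t\<in>T. (1 / N) * 3)"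
      unfolding mult_zero_right add_0_right
    proof (rule order_trans[OF sum_abs sum_mono])
      fix t assume "t \<in> T"
      then have "\<bar>real_of_int (p t) - of_int q * c t\<bar> \<le> 1 / N" "\<bar>real_of_int (a t)\<bar> \<le> 3"
        using p[of t] a[of t] by (simp_all add: abs_minus_commute less_imp_le)
      then show "\<bar>(real_of_int (p t) - of_int q * c t) * a t\<bar> \<le> (1 / N) * 3"
        unfolding abs_mult by (intro mult_mono) auto
    qed
    also have "\<dots> < 1" using N \<open>N > 0\<close> by (simp add: field_simps)
    finally have "\<bar>\<Sum>t\<in>T. p t * a t\<bar> < 1" by linarith
    then show "(\<Sum>t\<in>T. p t * (int (count_list (W t) x) - int (count_list (W t) (inv_letter x)))) = 0"
      by (simp add: a_def)
  qed
  also have "real_of_int (\<Sum>t\<in>T. \<bar>p t\<bar>) \<le> (\<Sum>t\<in>T. of_int q * \<bar>c t\<bar> + 1 / N)"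
    unfolding of_int_sum
  proof (rule sum_mono)
    fix t assume "t \<in> T"
    have "\<bar>real_of_int (p t)\<bar> \<le> \<bar>of_int q * c t\<bar> + \<bar>of_int q * c t - of_int (p t)\<bar>" by linarith
    then show "real_of_int \<bar>p t\<bar> \<le> of_int q * \<bar>c t\<bar> + 1 / N"
      using p[OF \<open>t \<in> T\<close>] q(1) by (simp add: abs_mult)
  qed
  finally have 1: "I * \<bar>real_of_int (\<Sum>t\<in>T. p t * k t)\<bar> \<le> of_int q * (\<Sum>t\<in>T. \<bar>c t\<bar>) + card T / N"
    by (simp add: sum.distrib sum_distrib_left)
  have "of_int q * \<bar>\<Sum>t\<in>T. c t * k t\<bar> = \<bar>real_of_int (\<Sum>t\<in>T. p t * k t) + (\<Sum>t\<in>T. (of_int q * c t - of_int (p t)) * k t)\<bar>"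
    using q(1) by (simp add: abs_mult_pos' sum_distrib_left sum.distrib[symmetric] algebra_simps)
  also have "\<dots> \<le> \<bar>real_of_int (\<Sum>t\<in>T. p t * k t)\<bar> + \<bar>\<Sum>t\<in>T. (of_int q * c t - of_int (p t)) * k t\<bar>"
    by (rule abs_triangle_ineq)
  also have "\<bar>\<Sum>t\<in>T. (of_int q * c t - of_int (p t)) * k t\<bar> \<le> (\<Sum>t\<in>T. (1 / N) * \<bar>real_of_int (k t)\<bar>)"
  proof (rule order_trans[OF sum_abs sum_mono])
    fix t assume "t \<in> T"
    then show "\<bar>(of_int q * c t - of_int (p t)) * k t\<bar> \<le> (1 / N) * \<bar>real_of_int (k t)\<bar>"
      unfolding abs_mult using p[of t] by (intro mult_right_mono) (auto simp: less_imp_le)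
  qed
  finally have "I * (of_int q * \<bar>\<Sum>t\<in>T. c t * k t\<bar>) \<le> I * (\<bar>real_of_int (\<Sum>t\<in>T. p t * k t)\<bar> + (\<Sum>t\<in>T. (1 / N) * \<bar>real_of_int (k t)\<bar>))"
    using I by (intro mult_left_mono) auto
  then have "I * (of_int q * \<bar>\<Sum>t\<in>T. c t * k t\<bar>) \<le> of_int q * (\<Sum>t\<in>T. \<bar>c t\<bar>) + B / N"
    using 1 by (simp add: B_def sum_distrib_left[symmetric] algebra_simps add_divide_distrib sum_divide_distrib[symmetric])
  then have "of_int q * D \<le> B / N" by (simp add: D_def algebra_simps)
  moreover have "of_int q * D \<ge> 1 * D" using q(1) \<open>D > 0\<close> by (intro mult_right_mono) auto
  moreover have "B / N < D" using N \<open>N > 0\<close> \<open>D > 0\<close> by (simp add: field_simps)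
  ultimately show False by linarith
qed

end

section \<open>Uniqueness of exponent sums and the infimum\<close>

locale one_relator =
  fixes S :: "'s set" and r :: "'s word"
  assumes relator: "r \<in> derived (free_group S) (carrier (free_group S)) - {\<one>\<^bsub>free_group S\<^esub>}"
begin

abbreviation F where "F \<equiv> free_group S"

sublocale F: group F by (rule group_free_group)

lemma relator_derived: "r \<in> derived F (carrier F)" and relator_nontrivial: "r \<noteq> []"
  using relator by (auto simp: free_group_def)

lemma relator_closed: "r \<in> carrier F"
  using F.derived_imp_commutator_product[OF relator_derived] F.commutator_product_closed by blast

lemma conjugate_product_unique:
  assumes "F.conjugate_product r k w" "F.conjugate_product r l w" shows "k = l"
proof -
  have "F.conjugate_product r (k + - l) (w \<otimes>\<^bsub>F\<^esub> inv\<^bsub>F\<^esub> w)"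
    by (intro F.conjugate_product_mult F.conjugate_product_inv assms relator_closed)
  also have "w \<otimes>\<^bsub>F\<^esub> inv\<^bsub>F\<^esub> w = []"
    using F.conjugate_product_closed[OF assms(1) relator_closed] by (subst F.r_inv) (simp_all add: free_group_def)
  finally show ?thesis using conjugate_product_trivial[OF _ relator_closed relator_nontrivial] by fastforce
qed

text \<open>Excludes genus zero, which would contribute the negative value \<open>- 4 / |k|\<close>
  to the infimum.\<close>

lemma commutator_product_pos:
  assumes "F.commutator_product m w" "F.conjugate_product r k w" "k \<noteq> 0" shows "m \<ge> 1"
proof (rule ccontr)
  assume "\<not> m \<ge> 1"
  then have "m = 0" by simp
  then have "w = \<one>\<^bsub>F\<^esub>" using assms(1) by (auto simp: F.commutator_product_def)
  then show False using conjugate_product_unique[OF assms(2)] F.conjugate_product_one assms(3) by blast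
qed

definition exponents :: "(nat \<times> int list) set" where
  "exponents = {(n, \<epsilon>). n > 0 \<and> length \<epsilon> = n \<and> set \<epsilon> \<subseteq> {-1, 1} \<and> (\<Sum>i<n. \<epsilon> ! i) \<noteq> 0}"

definition complexity :: "nat \<times> int list \<Rightarrow> real" where
  "complexity = (\<lambda>(n, \<epsilon>). 4 * ((real (sum_commutator_length F (map (\<lambda>k. r [^]\<^bsub>F\<^esub> k) \<epsilon>)) - 1)
            / \<bar>real_of_int (\<Sum>i<n. \<epsilon> ! i)\<bar>))"

lemma exponents_sum: "(n, \<epsilon>) \<in> exponents \<Longrightarrow> (\<Sum>i<n. \<epsilon> ! i) = sum_list \<epsilon>"
  by (auto simp: exponents_def sum_list_sum_nth lessThan_atLeast0)

lemma exponentsE: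
  assumes "(n, \<epsilon>) \<in> exponents"
  obtains m k w where "F.commutator_product m w" "F.conjugate_product r k w" "k \<noteq> 0" "m \<ge> 1"
    "complexity (n, \<epsilon>) = 4 * ((real m - 1) / \<bar>k\<bar>)"
proof -
  from assms have "set \<epsilon> \<subseteq> {-1, 1}" by (auto simp: exponents_def)
  then obtain w where w: "F.conjugate_product r (sum_list \<epsilon>) w"
    "F.commutator_product (sum_commutator_length F (map (\<lambda>j. r [^]\<^bsub>F\<^esub> j) \<epsilon>)) w"
    using F.commutator_product_sum_commutator_length[OF relator_derived] by blast
  have "sum_list \<epsilon> \<noteq> 0" using assms exponents_sum[OF assms] by (auto simp: exponents_def)
  then show ?thesis using that[OF w(2,1)] commutator_product_pos[OF w(2,1)] exponents_sum[OF assms]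
    by (simp add: complexity_def del: of_int_sum)
qed

lemma complexity_nonneg: "x \<in> exponents \<Longrightarrow> 0 \<le> complexity x"
  by (cases x) (auto elim!: exponentsE)

lemma exponents_nonempty: "exponents \<noteq> {}"
  by (auto simp: exponents_def intro!: exI[of _ "[1]"])

lemma Inf_complexity_nonneg: "0 \<le> (INF x\<in>exponents. complexity x)"
  using exponents_nonempty complexity_nonneg by (intro cINF_greatest)

lemma Inf_complexity_le:
  assumes "F.commutator_product m w" "F.conjugate_product r k w" "k \<noteq> 0"
  shows "(INF x\<in>exponents. complexity x) * \<bar>k\<bar> \<le> 4 * (real m - 1)"
proof -
  obtain \<epsilon> where \<epsilon>: "set \<epsilon> \<subseteq> {-1, 1}" "sum_list \<epsilon> = k"
    "sum_commutator_length F (map (\<lambda>j. r [^]\<^bsub>F\<^esub> j) \<epsilon>) \<le> m"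
    using F.sum_commutator_length_le[OF assms(2,1)] .
  have "\<epsilon> \<noteq> []" using \<epsilon>(2) assms(3) by auto
  moreover have "(\<Sum>i<length \<epsilon>. \<epsilon> ! i) = k" using \<epsilon>(2) by (simp add: sum_list_sum_nth lessThan_atLeast0)
  ultimately have "(length \<epsilon>, \<epsilon>) \<in> exponents" using \<epsilon> assms(3) by (auto simp: exponents_def)
  then have "(INF x\<in>exponents. complexity x) \<le> complexity (length \<epsilon>, \<epsilon>)"
    by (intro cINF_lower bdd_belowI2[where m = 0] complexity_nonneg)
  also have "\<dots> \<le> 4 * ((real m - 1) / \<bar>k\<bar>)"
    using \<epsilon>(3) assms(3) \<open>(\<Sum>i<length \<epsilon>. \<epsilon> ! i) = k\<close> by (simp add: complexity_def divide_right_mono del: of_int_sum)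
  finally show ?thesis using assms(3) by (simp add: field_simps)
qed

text \<open>Passing to cyclic coverings of large degree makes the constant \<open>C\<close> negligible.\<close>

lemma le_Inf_complexity:
  fixes N C :: real
  assumes "\<And>m k w. \<lbrakk>F.commutator_product m w; F.conjugate_product r k w; k \<noteq> 0\<rbrakk> \<Longrightarrow> N * \<bar>k\<bar> \<le> 4 * real m + C"
  shows "N \<le> (INF x\<in>exponents. complexity x)"
proof (rule cINF_greatest[OF exponents_nonempty])
  fix x assume "x \<in> exponents"
  then obtain m k w where *: "F.commutator_product m w" "F.conjugate_product r k w" "k \<noteq> 0" "m \<ge> 1"
    and x: "complexity x = 4 * ((real m - 1) / \<bar>k\<bar>)" by (cases x) (auto elim!: exponentsE)
  have bound: "N * \<bar>k\<bar> \<le> 4 * (real m - 1) + (4 + C) / real d" if "d > 0" for d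
  proof -
    obtain w' where "F.commutator_product (d * (m - 1) + 1) w'" "F.conjugate_product r (int d * k) w'"
      using F.cyclic_covering[OF *(1,4,2) relator_closed] by blast
    from assms[OF this] have "N * \<bar>int d * k\<bar> \<le> 4 * real (d * (m - 1) + 1) + C" using * that by simp
    then show ?thesis using that *(4) by (simp add: abs_mult of_nat_diff field_simps)
  qed
  have "(\<lambda>d. 4 * (real m - 1) + (4 + C) / real d) \<longlonglongrightarrow> 4 * (real m - 1) + 0"
    by (intro tendsto_intros lim_const_over_n)
  then have "N * \<bar>k\<bar> \<le> 4 * (real m - 1)"
    using bound by (intro LIMSEQ_le_const[of _ _ "N * \<bar>k\<bar>"]) (auto intro!: exI[of _ 1])
  then show "N \<le> complexity x" unfolding x using *(3) by (simp add: field_simps)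
qed

end

section \<open>Filling horns of singular simplices\<close>

lemma singular_simplex_euclidean:
  "singular_simplex p X f \<longleftrightarrow>
     continuous_map (top_of_set (standard_simplex p)) X f \<and> f \<in> extensional (standard_simplex p)"
  by (simp add: singular_simplex_def euclidean_product_topology)

lemma continuous_on_vector:
  fixes f :: "'a::topological_space \<Rightarrow> nat \<Rightarrow> real"
  assumes "\<And>i. continuous_on A (\<lambda>x. f x i)"
  shows "continuous_on A f"
  using assms by (rule continuous_on_coordinatewise_then_product)

lemma continuous_on_coordinate:
  fixes f :: "'a::topological_space \<Rightarrow> nat \<Rightarrow> real"
  assumes "continuous_on A f"
  shows "continuous_on A (\<lambda>x. f x i)"
  using continuous_on_product_then_coordinatewise[OF assms] .

lemma continuous_on_if_constant:
  "(P \<Longrightarrow> continuous_on A f) \<Longrightarrow> (\<not> P \<Longrightarrow> continuous_on A g) \<Longrightarrow> continuous_on A (\<lambda>x. if P then f x else g x)"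
  by (cases P) auto

definition delete_coordinate :: "nat \<Rightarrow> (nat \<Rightarrow> 'a) \<Rightarrow> nat \<Rightarrow> 'a" where
  "delete_coordinate i y = (\<lambda>j. if j < i then y j else y (Suc j))"

lemma simplical_face_delete_coordinate:
  fixes y :: "nat \<Rightarrow> 'a::comm_monoid_add"
  shows "y i = 0 \<Longrightarrow> simplical_face i (delete_coordinate i y) = y"
  by (auto simp: simplical_face_def delete_coordinate_def fun_eq_iff)

lemma delete_coordinate_simplical_face: "delete_coordinate i (simplical_face i y) = y"
  by (auto simp: simplical_face_def delete_coordinate_def fun_eq_iff)

lemma delete_coordinate_commute:
  assumes "i < j"
  shows "delete_coordinate i (delete_coordinate j y) = delete_coordinate (j - 1) (delete_coordinate i y)"
  using assms by (auto simp: delete_coordinate_def fun_eq_iff)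

lemma delete_coordinate_in_standard_simplex:
  assumes "y \<in> standard_simplex n" "y i = 0" "i \<le> n" "n \<ge> 1"
  shows "delete_coordinate i y \<in> standard_simplex (n - 1)"
proof -
  have y: "\<And>j. 0 \<le> y j \<and> y j \<le> 1" "\<And>j. j > n \<Longrightarrow> y j = 0" "(\<Sum>j\<le>n. y j) = 1"
    using assms by (auto simp: standard_simplex_def)
  have "{..n} = insert i ((\<lambda>j. if j < i then j else Suc j) ` {..n - 1})"
  proof (rule Set.set_eqI)
    fix x show "x \<in> {..n} \<longleftrightarrow> x \<in> insert i ((\<lambda>j. if j < i then j else Suc j) ` {..n - 1})"
    proof
      assume "x \<in> {..n}"
      then consider "x = i" | "x < i" | "i < x" "x \<le> n" by fastforce
      then show "x \<in> insert i ((\<lambda>j. if j < i then j else Suc j) ` {..n - 1})"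
        using assms(3) by cases (auto intro!: image_eqI[of _ _ x] image_eqI[of _ _ "x - 1"])
    qed (use assms in auto)
  qed
  then have "(\<Sum>j\<le>n. y j) = sum y (insert i ((\<lambda>j. if j < i then j else Suc j) ` {..n - 1}))"
    by (rule arg_cong)
  also have "\<dots> = y i + sum y ((\<lambda>j. if j < i then j else Suc j) ` {..n - 1})"
    by (rule sum.insert) auto
  also have "sum y ((\<lambda>j. if j < i then j else Suc j) ` {..n - 1}) = (\<Sum>j\<le>n - 1. y (if j < i then j else Suc j))"
    by (subst sum.reindex) (auto simp: inj_on_def o_def)
  also have "y i + \<dots> = (\<Sum>j\<le>n - 1. delete_coordinate i y j)"
    using assms(2) by (simp add: delete_coordinate_def if_distrib cong: if_cong)
  finally show ?thesis using y assms(3,4) by (auto simp: standard_simplex_def delete_coordinate_def)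
qed

lemma singular_face_singular_face:
  assumes "i < j" "j \<le> n" "n \<ge> 2"
  shows "singular_face (n - 1) i (singular_face n j f) = singular_face (n - 1) (j - 1) (singular_face n i f)"
proof
  fix t
  show "singular_face (n - 1) i (singular_face n j f) t = singular_face (n - 1) (j - 1) (singular_face n i f) t"
  proof (cases "t \<in> standard_simplex (n - 1 - 1)")
    case True
    have "simplical_face i t \<in> standard_simplex (n - 1)" "simplical_face (j - 1) t \<in> standard_simplex (n - 1)"
      using simplical_face_in_standard_simplex[of "n - 1" i t] simplical_face_in_standard_simplex[of "n - 1" "j - 1" t]
        True assms by auto
    moreover have "simplical_face j (simplical_face i t) = simplical_face i (simplical_face (j - 1) t)"
      using assms by (auto simp: simplical_face_def fun_eq_iff)
    ultimately show ?thesis using True by (simp add: singular_face_def)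
  qed (simp add: singular_face_def)
qed

lemma closed_pasting:
  assumes "finite I" "topspace X \<subseteq> \<Union> (T ` I)"
    "\<forall>i\<in>I. closedin X (T i) \<and> continuous_map (subtopology X (T i)) Y (f i)"
    "\<forall>i\<in>I. \<forall>j\<in>I. \<forall>x\<in>topspace X \<inter> T i \<inter> T j. f i x = f j x"
  shows "\<exists>g. continuous_map X Y g \<and> (\<forall>i\<in>I. \<forall>x\<in>topspace X \<inter> T i. g x = f i x)"
proof (rule pasting_lemma_exists_closed[of I X T Y f])
  show "finite I" "topspace X \<subseteq> \<Union> (T ` I)" by fact+
  show "\<And>i. i \<in> I \<Longrightarrow> closedin X (T i)" "\<And>i. i \<in> I \<Longrightarrow> continuous_map (subtopology X (T i)) Y (f i)"
    "\<And>i j x. \<lbrakk>i \<in> I; j \<in> I; x \<in> topspace X \<inter> T i \<inter> T j\<rbrakk> \<Longrightarrow> f i x = f j x"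
    using assms by blast+
  show ?thesis if "continuous_map X Y g" "\<And>x i. \<lbrakk>i \<in> I; x \<in> topspace X \<inter> T i\<rbrakk> \<Longrightarrow> g x = f i x" for g
    using that by blast
qed

text \<open>The singular complex of a space is a Kan complex: subtracting from all barycentric coordinates
  but the \<open>k\<close>-th their minimum retracts the simplex onto its \<open>k\<close>-th horn.\<close>

lemma horn_filler:
  fixes X :: "'x topology"
  assumes "n \<ge> 2" "k \<le> n"
    and f: "\<And>i. i \<le> n \<Longrightarrow> i \<noteq> k \<Longrightarrow> singular_simplex (n - 1) X (f i)"
    and compat: "\<And>i j. i < j \<Longrightarrow> j \<le> n \<Longrightarrow> i \<noteq> k \<Longrightarrow> j \<noteq> k \<Longrightarrow>
       singular_face (n - 1) i (f j) = singular_face (n - 1) (j - 1) (f i)"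
  obtains g where "singular_simplex n X g" "\<And>i. i \<le> n \<Longrightarrow> i \<noteq> k \<Longrightarrow> singular_face n i g = f i"
proof -
  let ?D = "standard_simplex n"
  define J where "J = {..n} - {k}"
  have J: "finite J" "J \<noteq> {}" "card J = n"
  proof -
    have "(if k = 0 then 1 else 0) \<in> J" using assms by (auto simp: J_def)
    then show "J \<noteq> {}" by blast
  qed (use assms in \<open>auto simp: J_def\<close>)
  define m where "m x = Min (x ` J)" for x :: "nat \<Rightarrow> real"
  \<comment> \<open>What is subtracted from the other \<open>n\<close> coordinates is added to the
    \<open>k\<close>-th, so that the sum remains one.\<close>
  define \<rho> where "\<rho> x = (\<lambda>j. if j = k then x k + real n * m x else if j \<le> n then x j - m x else 0)" for x
  \<comment> \<open>The retraction is affine on each of these pieces: on \<open>T i\<close> the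
    minimum is \<open>x i\<close>, and the image lies in the \<open>i\<close>-th face.\<close>
  define T where "T i = {x \<in> ?D. \<forall>j\<in>J. x i \<le> x j}" for i
  have m_T: "m x = x i" if "x \<in> T i" "i \<in> J" for x i
    unfolding m_def using that J by (intro Min_eqI) (auto simp: T_def)
  have rho: "\<rho> x \<in> ?D" "\<rho> x i = 0" if "x \<in> T i" "i \<in> J" for x i
  proof -
    have x: "\<And>j. 0 \<le> x j \<and> x j \<le> 1" "(\<Sum>j\<le>n. x j) = 1" using that by (auto simp: T_def standard_simplex_def)
    have mx: "m x = x i" "\<And>j. j \<in> J \<Longrightarrow> m x \<le> x j" using m_T[OF that] that by (auto simp: T_def)
    show "\<rho> x i = 0" using that mx by (auto simp: \<rho>_def J_def)
    have "(\<Sum>j\<le>n. \<rho> x j) = \<rho> x k + (\<Sum>j\<in>J. \<rho> x j)"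
      unfolding J_def using assms by (subst sum.remove[of "{..n}" k]) auto
    also have "(\<Sum>j\<in>J. \<rho> x j) = (\<Sum>j\<in>J. x j - m x)" by (intro sum.cong) (auto simp: \<rho>_def J_def)
    also have "\<rho> x k + (\<Sum>j\<in>J. x j - m x) = x k + (\<Sum>j\<in>J. x j)"
      by (simp add: sum_subtractf J \<rho>_def)
    also have "\<dots> = (\<Sum>j\<le>n. x j)" unfolding J_def using assms(2) by (intro sum.remove[symmetric]) auto
    finally have sum: "(\<Sum>j\<le>n. \<rho> x j) = 1" using x by simp
    have nonneg: "0 \<le> \<rho> x j" for j using x mx assms(2) by (auto simp: \<rho>_def J_def)
    have "\<rho> x j \<le> 1" for j
    proof (cases "j \<le> n")
      case True
      have "\<rho> x j \<le> (\<Sum>j\<le>n. \<rho> x j)" by (rule member_le_sum) (use True nonneg in auto)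
      then show ?thesis using sum by simp
    qed (use assms in \<open>auto simp: \<rho>_def\<close>)
    then show "\<rho> x \<in> ?D" using sum nonneg assms by (auto simp: standard_simplex_def \<rho>_def)
  qed
  have rho_id: "\<rho> x = x" if "x \<in> ?D" "i \<in> J" "x i = 0" for x i
  proof -
    have "x \<in> T i" using that by (auto simp: T_def standard_simplex_def)
    then show ?thesis using m_T[of x i] that by (auto simp: \<rho>_def fun_eq_iff standard_simplex_def)
  qed
  have cover: "\<exists>i\<in>J. x \<in> T i" if "x \<in> ?D" for x
  proof -
    have "Min (x ` J) \<in> x ` J" using J by (intro Min_in) auto
    then obtain i where "i \<in> J" "x i = Min (x ` J)" by auto
    then show ?thesis using that J by (intro bexI[of _ i]) (auto simp: T_def)
  qed
  have cont_\<rho>: "continuous_on (T i) (\<lambda>x. delete_coordinate i (\<rho> x))" if "i \<in> J" for i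
  proof -
    have "continuous_on (T i) (\<lambda>x. \<rho> x j)" for j
    proof -
      have "continuous_on (T i) (\<lambda>x. if j = k then x k + real n * x i else if j \<le> n then x j - x i else 0)"
        by (cases "j = k"; cases "j \<le> n"; simp; intro continuous_on_add continuous_on_diff
            continuous_on_mult continuous_on_const continuous_on_product_coordinates continuous_on_subset[OF _ subset_UNIV])
      then show ?thesis by (rule continuous_on_eq) (simp add: \<rho>_def m_T[OF _ that])
    qed
    then show ?thesis unfolding delete_coordinate_def
      by (intro continuous_on_vector continuous_on_if_constant)
  qed
  define h where "h i x = f i (delete_coordinate i (\<rho> x))" for i x
  have del: "delete_coordinate i (\<rho> x) \<in> standard_simplex (n - 1)" if "x \<in> T i" "i \<in> J" for i x
    using rho[OF that] that(2) assms(1) by (intro delete_coordinate_in_standard_simplex) (auto simp: J_def)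
  have TT: "closedin (top_of_set ?D) (T i) \<and> continuous_map (subtopology (top_of_set ?D) (T i)) X (h i)"
    if i: "i \<in> J" for i
  proof -
    have "closedin (top_of_set ?D) (?D \<inter> (\<lambda>x. x i - x j) -` {..0})" for j
      by (intro continuous_closedin_preimage continuous_on_diff continuous_on_product_coordinates
          continuous_on_subset[OF _ subset_UNIV]) auto
    then have "closedin (top_of_set ?D) (\<Inter>j\<in>J. ?D \<inter> (\<lambda>x. x i - x j) -` {..0})"
      using J by (intro closedin_INT) auto
    also have "(\<Inter>j\<in>J. ?D \<inter> (\<lambda>x. x i - x j) -` {..0}) = T i" using J by (auto simp: T_def)
    finally have clo: "closedin (top_of_set ?D) (T i)" .
    have "T i \<subseteq> ?D" by (auto simp: T_def)
    have "continuous_map (top_of_set (T i)) (top_of_set (standard_simplex (n - 1))) (\<lambda>x. delete_coordinate i (\<rho> x))"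
      using cont_\<rho>[OF i] del[OF _ i] by (auto simp: continuous_map_in_subtopology)
    moreover have "continuous_map (top_of_set (standard_simplex (n - 1))) X (f i)"
      using f[of i] i by (auto simp: J_def singular_simplex_euclidean)
    ultimately have "continuous_map (top_of_set (T i)) X (f i \<circ> (\<lambda>x. delete_coordinate i (\<rho> x)))"
      by (rule continuous_map_compose)
    then have "continuous_map (subtopology (top_of_set ?D) (T i)) X (h i)"
      using \<open>T i \<subseteq> ?D\<close> by (simp add: h_def[abs_def] o_def subtopology_subtopology Int_absorb1)
    with clo show ?thesis ..
  qed
  \<comment> \<open>Where two pieces meet, the retracted point lies in both faces, and the
    compatibility of the given simplices applies.\<close>
  have *: "h i x = h j x" if ij: "i \<in> J" "j \<in> J" "i < j" "x \<in> T i" "x \<in> T j" for i j x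
  proof -
    let ?y = "\<rho> x"
    have z: "?y i = 0" "?y j = 0" using rho ij by auto
    have dj: "delete_coordinate j ?y \<in> standard_simplex (n - 1)" and di: "delete_coordinate i ?y \<in> standard_simplex (n - 1)"
      using del ij by auto
    let ?t = "delete_coordinate i (delete_coordinate j ?y)"
    have t: "?t = delete_coordinate (j - 1) (delete_coordinate i ?y)" using delete_coordinate_commute ij(3) .
    have dji: "delete_coordinate j ?y i = 0" and dij: "delete_coordinate i ?y (j - 1) = 0"
      using z ij(3) by (auto simp: delete_coordinate_def)
    have tin: "?t \<in> standard_simplex (n - 1 - 1)"
      using delete_coordinate_in_standard_simplex[OF dj dji] assms(1) ij by (auto simp: J_def)
    have "h j x = singular_face (n - 1) i (f j) ?t"
      using tin by (simp add: singular_face_def h_def simplical_face_delete_coordinate[of "delete_coordinate j ?y" i, OF dji])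
    also have "\<dots> = singular_face (n - 1) (j - 1) (f i) ?t" using compat ij by (auto simp: J_def)
    also have "\<dots> = h i x"
      using tin simplical_face_delete_coordinate[of "delete_coordinate i ?y" "j - 1", OF dij]
      unfolding singular_face_def h_def t by simp
    finally show ?thesis by simp
  qed
  have agree: "h i x = h j x" if "i \<in> J" "j \<in> J" "x \<in> topspace (top_of_set ?D) \<inter> T i \<inter> T j" for i j x
  proof (rule linorder_cases[of i j])
    show "i < j \<Longrightarrow> h i x = h j x" using *[of i j x] that by blast
    show "j < i \<Longrightarrow> h i x = h j x" using *[of j i x] that by fastforce
  qed simp
  have cov: "topspace (top_of_set ?D) \<subseteq> \<Union> (T ` J)" using cover by auto
  obtain g where g: "continuous_map (top_of_set ?D) X g"
    "\<And>x i. i \<in> J \<Longrightarrow> x \<in> topspace (top_of_set ?D) \<inter> T i \<Longrightarrow> g x = h i x"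
    using closed_pasting[of J "top_of_set ?D" T X h] J(1) cov TT agree by metis
  show thesis
  proof
    show "singular_simplex n X (restrict g ?D)"
      using continuous_map_eq[OF g(1), of "restrict g ?D"] by (simp add: singular_simplex_euclidean)
    fix i assume i: "i \<le> n" "i \<noteq> k"
    then have iJ: "i \<in> J" by (auto simp: J_def)
    show "singular_face n i (restrict g ?D) = f i"
    proof
      fix t
      show "singular_face n i (restrict g ?D) t = f i t"
      proof (cases "t \<in> standard_simplex (n - 1)")
        case True
        have 1: "simplical_face i t \<in> ?D" using simplical_face_in_standard_simplex[of n i t] True i assms by auto
        have 2: "simplical_face i t i = 0" by (simp add: simplical_face_def)
        have "simplical_face i t \<in> T i" using 1 2 by (auto simp: T_def standard_simplex_def)
        then have "g (simplical_face i t) = h i (simplical_face i t)" using g(2)[OF iJ] 1 by simp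
        also have "\<dots> = f i t" unfolding h_def rho_id[OF 1 iJ 2] delete_coordinate_simplical_face ..
        finally show ?thesis using True 1 by (simp add: singular_face_def)
      next
        case False
        then show ?thesis using f[OF i] by (auto simp: singular_face_def singular_simplex_def extensional_def)
      qed
    qed
  qed
qed

text \<open>The edges are listed in the order 01, 12, 02, so that a triangle exhibits
  \<open>c\<close> as the composite of \<open>a\<close> followed by \<open>b\<close>.\<close>

definition triangle :: "'x topology \<Rightarrow> ((nat \<Rightarrow> real) \<Rightarrow> 'x) \<Rightarrow> ((nat \<Rightarrow> real) \<Rightarrow> 'x) \<Rightarrow>
    ((nat \<Rightarrow> real) \<Rightarrow> 'x) \<Rightarrow> ((nat \<Rightarrow> real) \<Rightarrow> 'x) \<Rightarrow> bool" where
  "triangle X a b c \<tau> \<longleftrightarrow> singular_simplex 2 X \<tau> \<and>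
     singular_face 2 2 \<tau> = a \<and> singular_face 2 0 \<tau> = b \<and> singular_face 2 1 \<tau> = c"

lemma chain_boundary_triangle:
  "triangle X a b c \<tau> \<Longrightarrow> chain_boundary 2 (frag_of \<tau>) = frag_of a + frag_of b - frag_of c"
  by (auto simp: chain_boundary_of triangle_def numeral_2_eq_2)

lemma triangle_edges:
  assumes "triangle X a b c \<tau>"
  shows "singular_simplex 1 X a" "singular_simplex 1 X b" "singular_simplex 1 X c"
  using assms singular_simplex_singular_face[of 2 X \<tau>] by (auto simp: triangle_def)

text \<open>The three vertices of the \<open>k\<close>-th face of a tetrahedron.\<close>

definition vertex_a :: "nat \<Rightarrow> nat" where "vertex_a k = (if k = 0 then 1 else 0)"
definition vertex_b :: "nat \<Rightarrow> nat" where "vertex_b k = (if k \<le> 1 then 2 else 1)"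
definition vertex_c :: "nat \<Rightarrow> nat" where "vertex_c k = (if k \<le> 2 then 3 else 2)"

lemmas vertex_defs = vertex_a_def vertex_b_def vertex_c_def

lemma less_4_cases: "(i :: nat) \<le> 3 \<Longrightarrow> i = 0 \<or> i = 1 \<or> i = 2 \<or> i = 3"
  by arith

text \<open>Horn filling in dimension three, expressed by the six edges. It takes the place of
  explicit homotopies between products of loops.\<close>

lemma tetrahedron:
  assumes "k \<le> 3"
    and tri: "\<And>i. i \<le> 3 \<Longrightarrow> i \<noteq> k \<Longrightarrow>
      triangle X (e (vertex_a i) (vertex_b i)) (e (vertex_b i) (vertex_c i)) (e (vertex_a i) (vertex_c i)) (\<tau> i)"
  obtains g where "singular_simplex 3 X g" "\<And>i. i \<le> 3 \<Longrightarrow> i \<noteq> k \<Longrightarrow> singular_face 3 i g = \<tau> i"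
    "triangle X (e (vertex_a k) (vertex_b k)) (e (vertex_b k) (vertex_c k)) (e (vertex_a k) (vertex_c k))
       (singular_face 3 k g)"
proof -
  have compat: "singular_face 2 i (\<tau> j) = singular_face 2 (j - 1) (\<tau> i)"
    if "i < j" "j \<le> 3" "i \<noteq> k" "j \<noteq> k" for i j
  proof -
    have "(i = 0 \<and> j = 1) \<or> (i = 0 \<and> j = 2) \<or> (i = 0 \<and> j = 3) \<or> (i = 1 \<and> j = 2) \<or> (i = 1 \<and> j = 3) \<or> (i = 2 \<and> j = 3)"
      using that by arith
    then show ?thesis
      using tri[of i] tri[of j] that by (elim disjE) (simp_all add: triangle_def vertex_defs)
  qed
  obtain g where g: "singular_simplex 3 X g" "\<And>i. i \<le> 3 \<Longrightarrow> i \<noteq> k \<Longrightarrow> singular_face 3 i g = \<tau> i"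
  proof (rule horn_filler[of 3 k X \<tau>])
    show "singular_simplex (3 - 1) X (\<tau> i)" if "i \<le> 3" "i \<noteq> k" for i
      using tri[OF that] by (simp add: triangle_def)
    show "singular_face (3 - 1) i (\<tau> j) = singular_face (3 - 1) (j - 1) (\<tau> i)"
      if "i < j" "j \<le> 3" "i \<noteq> k" "j \<noteq> k" for i j
      using compat[OF that] by simp
  qed (use assms in auto)
  have faces: "singular_face 2 i (singular_face 3 j g) = singular_face 2 (j - 1) (singular_face 3 i g)"
    if "i < j" "j \<le> 3" for i j
    using singular_face_singular_face[of i j 3 g] that by simp
  note ff = faces[of 0 1] faces[of 0 2] faces[of 0 3] faces[of 1 2] faces[of 1 3] faces[of 2 3]
  have "singular_simplex 2 X (singular_face 3 k g)"
    using singular_simplex_singular_face[OF g(1)] \<open>k \<le> 3\<close> by simp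
  then have "triangle X (e (vertex_a k) (vertex_b k)) (e (vertex_b k) (vertex_c k)) (e (vertex_a k) (vertex_c k))
       (singular_face 3 k g)"
    using less_4_cases[OF \<open>k \<le> 3\<close>] ff g(2)[of 0] g(2)[of 1] g(2)[of 2] g(2)[of 3]
      tri[of 0] tri[of 1] tri[of 2] tri[of 3]
    by (elim disjE) (simp_all add: triangle_def vertex_defs)
  with g that show thesis by blast
qed

lemma chain_boundary_3:
  "chain_boundary 3 (frag_of g) = frag_of (singular_face 3 0 g) - frag_of (singular_face 3 1 g)
     + frag_of (singular_face 3 2 g) - frag_of (singular_face 3 3 g)"
  by (simp add: chain_boundary_of numeral_3_eq_3 numeral_2_eq_2)

section \<open>Segments of paths and loops given by singular edges\<close>

definition segment :: "(real \<Rightarrow> 'x) \<Rightarrow> real \<Rightarrow> real \<Rightarrow> (nat \<Rightarrow> real) \<Rightarrow> 'x" where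
  "segment p s t = restrict (\<lambda>x. p (s * x 0 + t * x 1)) (standard_simplex 1)"

text \<open>The simplex is the path composed with the affine function that takes the values
  \<open>s\<close>, \<open>t\<close>, \<open>u\<close> at the vertices. Subdivision, reversal and
  degenerate triangles are special cases, as the three parameters need not be ordered or
  distinct.\<close>

lemma triangle_segment:
  assumes p: "continuous_map (top_of_set {0..1}) X p" and stu: "s \<in> {0..1}" "t \<in> {0..1}" "u \<in> {0..1}"
  shows "\<exists>\<tau>. triangle X (segment p s t) (segment p t u) (segment p s u) \<tau>"
proof -
  define f where "f x = s * x 0 + t * x 1 + u * x 2" for x :: "nat \<Rightarrow> real"
  have f01: "f x \<in> {0..1}" if "x \<in> standard_simplex 2" for x
  proof -
    have x: "0 \<le> x 0" "0 \<le> x 1" "0 \<le> x 2" "x 0 + x 1 + x 2 = 1"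
      using that by (auto simp: standard_simplex_def numeral_2_eq_2)
    have "f x \<le> x 0 + x 1 + x 2"
      unfolding f_def using stu x mult_right_mono[of s 1 "x 0"] mult_right_mono[of t 1 "x 1"] mult_right_mono[of u 1 "x 2"]
      by simp
    moreover have "0 \<le> f x" unfolding f_def using stu x by simp
    ultimately show ?thesis using x by simp
  qed
  have "continuous_on (standard_simplex 2) f"
    unfolding f_def by (intro continuous_on_add continuous_on_mult continuous_on_const
        continuous_on_subset[OF continuous_on_product_coordinates subset_UNIV])
  then have "continuous_map (top_of_set (standard_simplex 2)) (top_of_set {0..1}) f"
    using f01 by (auto simp: continuous_map_in_subtopology)
  from continuous_map_compose[OF this p]
  have cont: "continuous_map (top_of_set (standard_simplex 2)) X (restrict (p \<circ> f) (standard_simplex 2))"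
    by (rule continuous_map_eq) auto
  have face: "simplical_face i x \<in> standard_simplex 2" if "x \<in> standard_simplex 1" "i \<le> 2" for i and x :: "nat \<Rightarrow> real"
    using simplical_face_in_standard_simplex[of 2 i x] that by simp
  have "singular_face 2 2 (restrict (p \<circ> f) (standard_simplex 2)) = segment p s t"
     "singular_face 2 0 (restrict (p \<circ> f) (standard_simplex 2)) = segment p t u"
     "singular_face 2 1 (restrict (p \<circ> f) (standard_simplex 2)) = segment p s u"
    using face by (auto simp: singular_face_def segment_def fun_eq_iff restrict_def)
      (auto simp: f_def simplical_face_def numeral_2_eq_2)
  then show ?thesis
    using cont by (intro exI[of _ "restrict (p \<circ> f) (standard_simplex 2)"])
      (simp add: triangle_def singular_simplex_euclidean)
qed

definition edge_point :: "real \<Rightarrow> nat \<Rightarrow> real" where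
  "edge_point t = (\<lambda>i. if i = 0 then 1 - t else if i = 1 then t else 0)"

lemma edge_point_in_standard_simplex: "t \<in> {0..1} \<Longrightarrow> edge_point t \<in> standard_simplex 1"
  by (auto simp: standard_simplex_def edge_point_def)

lemma standard_simplex_1_edge_point: "x \<in> standard_simplex 1 \<Longrightarrow> x = edge_point (x 1) \<and> x 1 \<in> {0..1}"
  by (auto simp: standard_simplex_def edge_point_def fun_eq_iff)

lemma continuous_on_edge_point: "continuous_on A edge_point"
  unfolding edge_point_def
  by (intro continuous_on_vector continuous_on_if_constant continuous_intros)

lemma edge_path_continuous:
  assumes "singular_simplex 1 X a"
  shows "continuous_map (top_of_set {0..1}) X (\<lambda>t. a (edge_point t))"
proof -
  have "continuous_map (top_of_set {0..1}) (top_of_set (standard_simplex 1)) edge_point"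
    using continuous_on_edge_point[of "{0..1}"] edge_point_in_standard_simplex
    by (auto simp: continuous_map_in_subtopology)
  moreover have "continuous_map (top_of_set (standard_simplex 1)) X a"
    using assms by (simp add: singular_simplex_euclidean)
  ultimately have "continuous_map (top_of_set {0..1}) X (a \<circ> edge_point)"
    by (rule continuous_map_compose)
  then show ?thesis by (simp add: o_def)
qed

lemma segment_edge:
  assumes "singular_simplex 1 X a" shows "segment (\<lambda>t. a (edge_point t)) 0 1 = a"
proof
  fix x
  show "segment (\<lambda>t. a (edge_point t)) 0 1 x = a x"
  proof (cases "x \<in> standard_simplex 1")
    case True
    then show ?thesis using standard_simplex_1_edge_point[of x] by (simp add: segment_def)
  next
    case False
    then show ?thesis using assms by (auto simp: segment_def singular_simplex_def extensional_def)
  qed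
qed

lemma segment_edge_point: "t \<in> {0..1} \<Longrightarrow> segment p u w (edge_point t) = p (u * (1 - t) + w * t)"
  using edge_point_in_standard_simplex by (simp add: segment_def) (simp add: edge_point_def)

definition constant_edge :: "'x \<Rightarrow> (nat \<Rightarrow> real) \<Rightarrow> 'x" where
  "constant_edge v = restrict (\<lambda>_. v) (standard_simplex 1)"

lemma segment_constant: "segment p s s = constant_edge (p s)"
proof
  fix x
  have "x 0 + x 1 = 1" if "x \<in> standard_simplex 1" using that by (auto simp: standard_simplex_def)
  then have "s * x 0 + s * x 1 = s" if "x \<in> standard_simplex 1"
    using that by (metis distrib_left mult.right_neutral)
  then show "segment p s s x = constant_edge (p s) x"
    by (auto simp: segment_def constant_edge_def)
qed

definition edge_loop :: "'x topology \<Rightarrow> 'x \<Rightarrow> ((nat \<Rightarrow> real) \<Rightarrow> 'x) \<Rightarrow> bool" where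
  "edge_loop X v a \<longleftrightarrow> singular_simplex 1 X a \<and> a (edge_point 0) = v \<and> a (edge_point 1) = v"

lemma triangle_degenerate:
  assumes "edge_loop X v a"
  shows "\<exists>\<tau>. triangle X (constant_edge v) a a \<tau>" "\<exists>\<tau>. triangle X a (constant_edge v) a \<tau>"
proof -
  have ss: "singular_simplex 1 X a" using assms by (simp add: edge_loop_def)
  from triangle_segment[OF edge_path_continuous[OF ss], of 0 0 1] triangle_segment[OF edge_path_continuous[OF ss], of 0 1 1]
  show "\<exists>\<tau>. triangle X (constant_edge v) a a \<tau>" "\<exists>\<tau>. triangle X a (constant_edge v) a \<tau>"
    using assms by (simp_all add: segment_edge[OF ss] segment_constant edge_loop_def)
qed

lemma edge_loop_constant: "v \<in> topspace X \<Longrightarrow> edge_loop X v (constant_edge v)"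
  using edge_point_in_standard_simplex[of 0] edge_point_in_standard_simplex[of 1]
  by (simp add: edge_loop_def constant_edge_def singular_simplex_euclidean)

lemma segment_continuous:
  assumes "continuous_map (top_of_set {0..1}) X p" "s \<in> {0..1}" "t \<in> {0..1}"
  shows "singular_simplex 1 X (segment p s t)"
  using triangle_segment[OF assms assms(3)] triangle_edges(1) by blast

lemma standard_simplex_0_iff: "x \<in> standard_simplex 0 \<longleftrightarrow> x = edge_point 0"
  by (simp add: standard_simplex_0) (auto simp: edge_point_def fun_eq_iff)

lemma simplical_face_edge_point:
  "simplical_face 0 (edge_point 0) = edge_point 1" "simplical_face 1 (edge_point 0) = edge_point 0"
  by (auto simp: simplical_face_def edge_point_def fun_eq_iff)

lemma singular_face_1:
  "singular_face 1 0 a = (\<lambda>x\<in>standard_simplex 0. a (edge_point 1))"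
  "singular_face 1 1 a = (\<lambda>x\<in>standard_simplex 0. a (edge_point 0))"
  unfolding singular_face_def diff_self_eq_0 One_nat_def[symmetric]
  by (rule restrict_ext; simp only: standard_simplex_0_iff o_apply simplical_face_edge_point)+

lemma triangle_vertices:
  assumes "triangle X a b c \<tau>"
  shows "a (edge_point 1) = b (edge_point 0)" "c (edge_point 0) = a (edge_point 0)" "c (edge_point 1) = b (edge_point 1)"
proof -
  have f: "singular_face 1 i (singular_face 2 j \<tau>) = singular_face 1 (j - 1) (singular_face 2 i \<tau>)"
    if "i < j" "j \<le> 2" for i j
    using singular_face_singular_face[of i j 2 \<tau>] that by simp
  have "edge_point 0 \<in> standard_simplex 0" by (simp add: standard_simplex_0_iff)
  then have *: "u = w" if "(\<lambda>x\<in>standard_simplex 0. u) = (\<lambda>x\<in>standard_simplex 0. w)" for u w :: 'a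
    using that by (metis restrict_apply')
  show "a (edge_point 1) = b (edge_point 0)" "c (edge_point 0) = a (edge_point 0)" "c (edge_point 1) = b (edge_point 1)"
    using f[of 0 2] f[of 1 2] f[of 0 1] assms
    unfolding triangle_def by (auto simp: singular_face_1 singular_face_1[unfolded One_nat_def] intro!: *)
qed

lemma triangle_fill:
  assumes "edge_loop X v a" "edge_loop X v b"
  shows "\<exists>c \<tau>. triangle X a b c \<tau> \<and> edge_loop X v c"
proof -
  define f where "f i = (if i = 2 then a else b)" for i :: nat
  obtain g where g: "singular_simplex 2 X g" "\<And>i. i \<le> 2 \<Longrightarrow> i \<noteq> 1 \<Longrightarrow> singular_face 2 i g = f i"
  proof (rule horn_filler[of 2 1 X f])
    show "singular_simplex (2 - 1) X (f i)" if "i \<le> 2" "i \<noteq> 1" for i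
      using assms by (simp add: f_def edge_loop_def)
    fix i j :: nat assume "i < j" "j \<le> 2" "i \<noteq> 1" "j \<noteq> 1"
    then have "i = 0 \<and> j = 2" by arith
    then show "singular_face (2 - 1) i (f j) = singular_face (2 - 1) (j - 1) (f i)"
      using assms by (simp add: f_def singular_face_1 singular_face_1[unfolded One_nat_def] edge_loop_def)
  qed auto
  have "triangle X a b (singular_face 2 1 g) g"
    using g(1) g(2)[of 0] g(2)[of 2] by (simp add: triangle_def f_def)
  moreover from triangle_vertices[OF this] triangle_edges[OF this] have "edge_loop X v (singular_face 2 1 g)"
    using assms by (simp add: edge_loop_def)
  ultimately show ?thesis by blast
qed

section \<open>Size of chains and relations between edges\<close>

definition chain_size :: "'x chain \<Rightarrow> int" where
  "chain_size c = (\<Sum>f\<in>Poly_Mapping.keys c. \<bar>Poly_Mapping.lookup c f\<bar>)"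

lemma chain_size_superset:
  assumes "finite A" "Poly_Mapping.keys c \<subseteq> A"
  shows "chain_size c = (\<Sum>f\<in>A. \<bar>Poly_Mapping.lookup c f\<bar>)"
  unfolding chain_size_def using assms by (intro sum.mono_neutral_left) (auto simp: in_keys_iff)

lemma chain_size_add: "chain_size (a + b) \<le> chain_size a + chain_size b"
proof -
  let ?A = "Poly_Mapping.keys a \<union> Poly_Mapping.keys b"
  have "chain_size (a + b) = (\<Sum>f\<in>?A. \<bar>Poly_Mapping.lookup (a + b) f\<bar>)"
    using keys_add[of a b] by (intro chain_size_superset) auto
  also have "\<dots> \<le> (\<Sum>f\<in>?A. \<bar>Poly_Mapping.lookup a f\<bar> + \<bar>Poly_Mapping.lookup b f\<bar>)"
    by (intro sum_mono) (simp add: lookup_add)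
  also have "\<dots> = chain_size a + chain_size b"
    by (simp add: sum.distrib chain_size_superset[of ?A])
  finally show ?thesis .
qed

lemma chain_size_minus: "chain_size (- a) = chain_size a"
  by (simp add: chain_size_def)

lemma chain_size_diff: "chain_size (a - b) \<le> chain_size a + chain_size b"
  using chain_size_add[of a "- b"] by (simp add: chain_size_minus)

lemma chain_size_frag_of: "chain_size (frag_of f) = 1"
  by (simp add: chain_size_def)

definition bounds :: "'x topology \<Rightarrow> ((nat \<Rightarrow> real) \<Rightarrow> 'x) \<Rightarrow> ((nat \<Rightarrow> real) \<Rightarrow> 'x) \<Rightarrow>
    ((nat \<Rightarrow> real) \<Rightarrow> 'x) \<Rightarrow> bool" where
  "bounds X a b c \<longleftrightarrow> (\<exists>\<tau>. triangle X a b c \<tau>)"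

text \<open>Six edges as a function of two vertices, the form required by
  \<open>tetrahedron\<close>.\<close>

definition tetrahedron_edge where
  "tetrahedron_edge x01 x12 x23 x02 x13 x03 i j =
     (if i = (0::nat) then (if j = (1::nat) then x01 else if j = 2 then x02 else x03)
      else if i = 1 then (if j = 2 then x12 else x13) else x23)"

text \<open>Associativity, by filling the horn that lacks the face opposite vertex 1: a composite
  bracketed as \<open>x01 (x12 x23)\<close> is also one bracketed as
  \<open>(x01 x12) x23\<close>.\<close>

lemma bounds_assoc1:
  assumes "bounds X x12 x23 x13" "bounds X x01 x13 x03" "bounds X x01 x12 x02"
  shows "bounds X x02 x23 x03"
proof -
  obtain \<tau>0 \<tau>2 \<tau>3 where \<tau>: "triangle X x12 x23 x13 \<tau>0" "triangle X x01 x13 x03 \<tau>2" "triangle X x01 x12 x02 \<tau>3"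
    using assms by (auto simp: bounds_def)
  let ?e = "tetrahedron_edge x01 x12 x23 x02 x13 x03"
  obtain g where "triangle X (?e (vertex_a 1) (vertex_b 1)) (?e (vertex_b 1) (vertex_c 1)) (?e (vertex_a 1) (vertex_c 1))
       (singular_face 3 1 g)"
    by (rule tetrahedron[of 1 X ?e "\<lambda>i. if i = 0 then \<tau>0 else if i = 2 then \<tau>2 else \<tau>3"])
      (use \<tau> in \<open>auto dest!: less_4_cases simp: vertex_defs tetrahedron_edge_def\<close>)
  then show ?thesis by (auto simp: bounds_def vertex_defs tetrahedron_edge_def)
qed

text \<open>The change of brackets in the other direction, from the horn that lacks the face
  opposite vertex 2.\<close>

lemma bounds_assoc2:
  assumes "bounds X x12 x23 x13" "bounds X x02 x23 x03" "bounds X x01 x12 x02"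
  shows "bounds X x01 x13 x03"
proof -
  obtain \<tau>0 \<tau>1 \<tau>3 where \<tau>: "triangle X x12 x23 x13 \<tau>0" "triangle X x02 x23 x03 \<tau>1" "triangle X x01 x12 x02 \<tau>3"
    using assms by (auto simp: bounds_def)
  let ?e = "tetrahedron_edge x01 x12 x23 x02 x13 x03"
  obtain g where "triangle X (?e (vertex_a 2) (vertex_b 2)) (?e (vertex_b 2) (vertex_c 2)) (?e (vertex_a 2) (vertex_c 2))
       (singular_face 3 2 g)"
    by (rule tetrahedron[of 2 X ?e "\<lambda>i. if i = 0 then \<tau>0 else if i = 1 then \<tau>1 else \<tau>3"])
      (use \<tau> in \<open>auto dest!: less_4_cases simp: vertex_defs tetrahedron_edge_def\<close>)
  then show ?thesis by (auto simp: bounds_def vertex_defs tetrahedron_edge_def)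
qed

text \<open>Chains in \<open>P\<close> that are, modulo \<open>K\<close>, homologous to \<open>k\<close> times \<open>\<delta>\<close>.\<close>

definition cell_chain :: "'x topology \<Rightarrow> 'x topology \<Rightarrow> 'x chain \<Rightarrow> int \<Rightarrow> 'x chain \<Rightarrow> bool" where
  "cell_chain K P \<delta> k c \<longleftrightarrow>
     (\<exists>y z. singular_chain 2 K y \<and> singular_chain 3 P z \<and> c = frag_cmul k \<delta> + y + chain_boundary 3 z)"

lemma cell_chain_add:
  assumes "cell_chain K P \<delta> k c" "cell_chain K P \<delta> l d" shows "cell_chain K P \<delta> (k + l) (c + d)"
proof -
  obtain y z y' z' where "singular_chain 2 K y" "singular_chain 3 P z" "c = frag_cmul k \<delta> + y + chain_boundary 3 z"
    "singular_chain 2 K y'" "singular_chain 3 P z'" "d = frag_cmul l \<delta> + y' + chain_boundary 3 z'"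
    using assms by (auto simp: cell_chain_def)
  then show ?thesis unfolding cell_chain_def
    by (intro exI[of _ "y + y'"] exI[of _ "z + z'"])
      (simp add: singular_chain_add chain_boundary_add frag_cmul_distrib)
qed

lemma cell_chain_minus:
  assumes "cell_chain K P \<delta> k c" shows "cell_chain K P \<delta> (- k) (- c)"
proof -
  obtain y z where "singular_chain 2 K y" "singular_chain 3 P z" "c = frag_cmul k \<delta> + y + chain_boundary 3 z"
    using assms by (auto simp: cell_chain_def)
  then show ?thesis unfolding cell_chain_def
    by (intro exI[of _ "- y"] exI[of _ "- z"])
      (simp add: singular_chain_minus chain_boundary_minus)
qed

lemma cell_chain_diff:
  "cell_chain K P \<delta> k c \<Longrightarrow> cell_chain K P \<delta> l d \<Longrightarrow> cell_chain K P \<delta> (k - l) (c - d)"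
  using cell_chain_add[OF _ cell_chain_minus] by fastforce

lemma cell_chain_subspace: "singular_chain 2 K y \<Longrightarrow> cell_chain K P \<delta> 0 y"
  unfolding cell_chain_def by (intro exI[of _ y] exI[of _ 0]) simp

lemma cell_chain_boundary: "singular_chain 3 P z \<Longrightarrow> cell_chain K P \<delta> 0 (chain_boundary 3 z)"
  unfolding cell_chain_def by (intro exI[of _ 0] exI[of _ z]) simp

lemma cell_chain_cell: "cell_chain K P \<delta> 1 \<delta>"
  unfolding cell_chain_def by (intro exI[of _ 0] exI[of _ 0]) simp

text \<open>A relation between edges in \<open>P\<close> together with the multiplicity with which
  its triangle covers the 2-cell.\<close>

definition cell_bounds where
  "cell_bounds K P \<delta> a b c k \<longleftrightarrow> (\<exists>\<tau>. triangle P a b c \<tau> \<and> cell_chain K P \<delta> k (frag_of \<tau>))"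

lemma cell_bounds_subspace:
  assumes "bounds (subtopology P A) a b c"
  shows "cell_bounds (subtopology P A) P \<delta> a b c 0"
proof -
  obtain \<tau> where \<tau>: "triangle (subtopology P A) a b c \<tau>" using assms by (auto simp: bounds_def)
  then have "triangle P a b c \<tau>" "singular_chain 2 (subtopology P A) (frag_of \<tau>)"
    by (auto simp: triangle_def singular_simplex_subtopology singular_chain_of)
  then show ?thesis unfolding cell_bounds_def using cell_chain_subspace by blast
qed

text \<open>The boundary of the filling tetrahedron relates the multiplicities of its four faces. In
  this way a single triangle can carry the total multiplicity of arbitrarily many relators.\<close>

lemma cell_bounds_assoc1:
  assumes "cell_bounds K P \<delta> x12 x23 x13 k0" "cell_bounds K P \<delta> x01 x13 x03 k2" "cell_bounds K P \<delta> x01 x12 x02 k3"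
  shows "cell_bounds K P \<delta> x02 x23 x03 (k0 + k2 - k3)"
proof -
  obtain \<tau>0 \<tau>2 \<tau>3 where \<tau>: "triangle P x12 x23 x13 \<tau>0" "triangle P x01 x13 x03 \<tau>2" "triangle P x01 x12 x02 \<tau>3"
    and cc: "cell_chain K P \<delta> k0 (frag_of \<tau>0)" "cell_chain K P \<delta> k2 (frag_of \<tau>2)" "cell_chain K P \<delta> k3 (frag_of \<tau>3)"
    using assms by (auto simp: cell_bounds_def)
  let ?e = "tetrahedron_edge x01 x12 x23 x02 x13 x03" and ?t = "\<lambda>i. if i = 0 then \<tau>0 else if i = 2 then \<tau>2 else \<tau>3"
  obtain g where g: "singular_simplex 3 P g" "\<And>i. i \<le> 3 \<Longrightarrow> i \<noteq> 1 \<Longrightarrow> singular_face 3 i g = ?t i"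
    "triangle P (?e (vertex_a 1) (vertex_b 1)) (?e (vertex_b 1) (vertex_c 1)) (?e (vertex_a 1) (vertex_c 1)) (singular_face 3 1 g)"
    by (rule tetrahedron[of 1 P ?e ?t])
      (use \<tau> in \<open>auto dest!: less_4_cases simp: vertex_defs tetrahedron_edge_def\<close>)
  have "frag_of (singular_face 3 1 g) = frag_of \<tau>0 + frag_of \<tau>2 - frag_of \<tau>3 - chain_boundary 3 (frag_of g)"
    using g(2)[of 0] g(2)[of 2] g(2)[of 3] by (simp add: chain_boundary_3)
  moreover have "cell_chain K P \<delta> (k0 + k2 - k3 - 0) \<dots>"
    by (intro cell_chain_diff cell_chain_add cc cell_chain_boundary) (simp add: singular_chain_of g)
  ultimately show ?thesis using g(3) by (auto simp: cell_bounds_def vertex_defs tetrahedron_edge_def)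
qed

lemma cell_bounds_assoc2:
  assumes "cell_bounds K P \<delta> x12 x23 x13 k0" "cell_bounds K P \<delta> x02 x23 x03 k1" "cell_bounds K P \<delta> x01 x12 x02 k3"
  shows "cell_bounds K P \<delta> x01 x13 x03 (k1 + k3 - k0)"
proof -
  obtain \<tau>0 \<tau>1 \<tau>3 where \<tau>: "triangle P x12 x23 x13 \<tau>0" "triangle P x02 x23 x03 \<tau>1" "triangle P x01 x12 x02 \<tau>3"
    and cc: "cell_chain K P \<delta> k0 (frag_of \<tau>0)" "cell_chain K P \<delta> k1 (frag_of \<tau>1)" "cell_chain K P \<delta> k3 (frag_of \<tau>3)"
    using assms by (auto simp: cell_bounds_def)
  let ?e = "tetrahedron_edge x01 x12 x23 x02 x13 x03" and ?t = "\<lambda>i. if i = 0 then \<tau>0 else if i = 1 then \<tau>1 else \<tau>3"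
  obtain g where g: "singular_simplex 3 P g" "\<And>i. i \<le> 3 \<Longrightarrow> i \<noteq> 2 \<Longrightarrow> singular_face 3 i g = ?t i"
    "triangle P (?e (vertex_a 2) (vertex_b 2)) (?e (vertex_b 2) (vertex_c 2)) (?e (vertex_a 2) (vertex_c 2)) (singular_face 3 2 g)"
    by (rule tetrahedron[of 2 P ?e ?t])
      (use \<tau> in \<open>auto dest!: less_4_cases simp: vertex_defs tetrahedron_edge_def\<close>)
  have "frag_of (singular_face 3 2 g) = frag_of \<tau>1 + frag_of \<tau>3 - frag_of \<tau>0 + chain_boundary 3 (frag_of g)"
    using g(2)[of 0] g(2)[of 1] g(2)[of 3] by (simp add: chain_boundary_3)
  moreover have "cell_chain K P \<delta> (k1 + k3 - k0 + 0) \<dots>"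
    by (intro cell_chain_diff cell_chain_add cc cell_chain_boundary) (simp add: singular_chain_of g)
  ultimately show ?thesis using g(3) by (auto simp: cell_bounds_def vertex_defs tetrahedron_edge_def)
qed

section \<open>Surface cycles\<close>

locale word_edges = one_relator S r for S :: "'s set" and r :: "'s word" +
  fixes K P :: "'x topology" and v :: 'x and A :: "'x set" and edge :: "'s \<times> bool \<Rightarrow> (nat \<Rightarrow> real) \<Rightarrow> 'x"
  assumes K_sub: "K = subtopology P A" and v: "v \<in> topspace K"
    and edge: "edge_loop K v (edge x)" "bounds K (edge x) (edge (inv_letter x)) (constant_edge v)"
begin

abbreviation one_edge where "one_edge \<equiv> constant_edge v"

text \<open>One loop for each word, multiplicative up to a triangle in \<open>K\<close>. Fixing the
  loop once and for all makes the edges of equal words cancel exactly in boundaries.\<close>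

primrec word_edge :: "'s word \<Rightarrow> (nat \<Rightarrow> real) \<Rightarrow> 'x" where
  "word_edge [] = one_edge"
| "word_edge (x # w) = (SOME c. edge_loop K v c \<and> bounds K (edge x) (word_edge w) c)"

lemma word_edge_loop: "edge_loop K v (word_edge w)"
  and word_edge_Cons: "bounds K (edge x) (word_edge w) (word_edge (x # w))"
proof -
  have ex: "\<exists>c. edge_loop K v c \<and> bounds K (edge x) b c" if "edge_loop K v b" for b x
    using triangle_fill[OF edge(1) that, of x] unfolding bounds_def by blast
  have *: "edge_loop K v (word_edge w)"
  proof (induction w)
    case Nil
    then show ?case by (simp add: edge_loop_constant[OF v])
  next
    case (Cons y w)
    then show ?case using someI_ex[OF ex[OF Cons, of y]] by simp
  qed
  then show "edge_loop K v (word_edge w)" .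
  show "bounds K (edge x) (word_edge w) (word_edge (x # w))"
    using someI_ex[OF ex[OF *, of x]] by simp
qed

lemma bounds_one: "edge_loop K v a \<Longrightarrow> bounds K one_edge a a" "edge_loop K v a \<Longrightarrow> bounds K a one_edge a"
  using triangle_degenerate by (auto simp: bounds_def)

lemma one_edge_loop: "edge_loop K v one_edge"
  using edge_loop_constant[OF v] .

lemma word_edge_cancel_cons: "bounds K (edge x) (word_edge w) (word_edge (cancel_cons x w))"
proof (cases w)
  case Nil
  then show ?thesis using word_edge_Cons[of x "[]"] by simp
next
  case (Cons y u)
  show ?thesis
  proof (cases "y = inv_letter x")
    case True
    have "bounds K (edge x) (word_edge (inv_letter x # u)) (word_edge u)"
      by (rule bounds_assoc2[OF word_edge_Cons bounds_one(1)[OF word_edge_loop] edge(2)])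
    then show ?thesis using True Cons by simp
  next
    case False
    then show ?thesis using word_edge_Cons[of x w] Cons by simp
  qed
qed

lemma word_edge_mult: "bounds K (word_edge x) (word_edge y) (word_edge (x \<otimes>\<^bsub>F\<^esub> y))"
proof -
  have "bounds K (word_edge x) (word_edge y) (word_edge (foldr cancel_cons x y))"
  proof (induction x)
    case Nil
    then show ?case using bounds_one(1)[OF word_edge_loop] by simp
  next
    case (Cons a x)
    show ?case
      using bounds_assoc1[OF Cons word_edge_cancel_cons word_edge_Cons] by simp
  qed
  then show ?thesis by (simp add: free_group_def)
qed

lemma word_edge_one: "word_edge \<one>\<^bsub>F\<^esub> = one_edge"
  by (simp add: free_group_def)

lemma word_edge_mult': "x \<otimes>\<^bsub>F\<^esub> y = z \<Longrightarrow> bounds K (word_edge x) (word_edge y) (word_edge z)"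
  using word_edge_mult by blast

text \<open>Downward induction on \<open>j\<close>: the part of the path from
  \<open>j / length w\<close> to 1 represents the suffix of the word from position
  \<open>j\<close>.\<close>

lemma loop_word_edge:
  assumes p: "continuous_map (top_of_set {0..1}) K p" "p 1 = v" and w: "w \<noteq> []"
    and seg: "\<And>j. j < length w \<Longrightarrow> segment p (j / length w) ((j + 1) / length w) = edge (w ! j)"
  shows "bounds K (segment p 0 1) one_edge (word_edge w)"
proof -
  let ?n = "length w"
  have "bounds K (segment p (j / ?n) 1) one_edge (word_edge (drop j w))" if "j \<le> ?n" for j
    using that
  proof (induction j rule: inc_induct)
    case base
    have "bounds K one_edge one_edge one_edge" using bounds_one(1)[OF one_edge_loop] .
    moreover have "segment p (?n / ?n) 1 = one_edge" using segment_constant[of p 1] w p by simp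
    ultimately show ?case by simp
  next
    case (step j)
    have le: "real j / ?n \<in> {0..1}" "real (Suc j) / ?n \<in> {0..1}" using step(1,2) w by (auto simp: field_simps)
    have "bounds K (edge (w ! j)) (segment p (real (Suc j) / ?n) 1) (segment p (real j / ?n) 1)"
      using triangle_segment[OF p(1) le(1) le(2), of 1] seg[of j] step by (simp add: bounds_def add.commute)
    moreover have "drop j w = w ! j # drop (Suc j) w" using step by (simp add: Cons_nth_drop_Suc)
    ultimately show ?case
      using bounds_assoc1[OF step.IH] word_edge_Cons[of "w ! j" "drop (Suc j) w"] by simp
  qed
  from this[of 0] show ?thesis by simp
qed

text \<open>A torus with one hole from three triangles. Reading \<open>x2 = x1 a^-1\<close> as
  \<open>x2 a = x1\<close>, and likewise for \<open>b\<close>, uses each of the edges of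
  \<open>a\<close> and \<open>b\<close> twice with opposite signs, so only the boundary loop
  remains.\<close>

lemma commutator_chain:
  assumes "a \<in> carrier F" "b \<in> carrier F"
  shows "\<exists>y. singular_chain 2 K y \<and> chain_size y \<le> 3 \<and>
    chain_boundary 2 y = - frag_of (word_edge (a \<otimes>\<^bsub>F\<^esub> b \<otimes>\<^bsub>F\<^esub> inv\<^bsub>F\<^esub> a \<otimes>\<^bsub>F\<^esub> inv\<^bsub>F\<^esub> b))"
proof -
  let ?x1 = "a \<otimes>\<^bsub>F\<^esub> b" let ?x2 = "?x1 \<otimes>\<^bsub>F\<^esub> inv\<^bsub>F\<^esub> a" let ?x3 = "?x2 \<otimes>\<^bsub>F\<^esub> inv\<^bsub>F\<^esub> b"
  have "?x2 \<otimes>\<^bsub>F\<^esub> a = ?x1" "?x3 \<otimes>\<^bsub>F\<^esub> b = ?x2" using assms by (simp_all add: F.m_assoc)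
  then obtain t1 t2 t3 where t: "triangle K (word_edge a) (word_edge b) (word_edge ?x1) t1"
    "triangle K (word_edge ?x2) (word_edge a) (word_edge ?x1) t2"
    "triangle K (word_edge ?x3) (word_edge b) (word_edge ?x2) t3"
    using word_edge_mult' unfolding bounds_def by metis
  show ?thesis
  proof (intro exI[of _ "frag_of t1 - frag_of t2 - frag_of t3"] conjI)
    show "singular_chain 2 K (frag_of t1 - frag_of t2 - frag_of t3)"
      using t by (intro singular_chain_diff) (auto simp: singular_chain_of triangle_def)
    show "chain_size (frag_of t1 - frag_of t2 - frag_of t3) \<le> 3"
      using chain_size_diff[of "frag_of t1 - frag_of t2" "frag_of t3"] chain_size_diff[of "frag_of t1" "frag_of t2"]
      by (simp add: chain_size_frag_of)
    show "chain_boundary 2 (frag_of t1 - frag_of t2 - frag_of t3) = - frag_of (word_edge ?x3)"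
      by (simp add: chain_boundary_diff chain_boundary_triangle[OF t(1)] chain_boundary_triangle[OF t(2)] chain_boundary_triangle[OF t(3)])
  qed
qed

text \<open>Three triangles for each commutator and one for each multiplication; the
  \<open>+ 1\<close> is the degenerate triangle that bounds the constant edge of the empty
  product.\<close>

lemma commutator_product_chain:
  assumes "F.commutator_product m w"
  shows "\<exists>y. singular_chain 2 K y \<and> chain_size y \<le> 4 * int m + 1 \<and> chain_boundary 2 y = - frag_of (word_edge w)"
proof -
  obtain cs where cs: "length cs = m" "set cs \<subseteq> derived_set F (carrier F)" "w = list_mult F cs"
    using assms by (auto simp: F.commutator_product_def)
  have "\<exists>y. singular_chain 2 K y \<and> chain_size y \<le> 4 * int (length cs) + 1 \<and>
    chain_boundary 2 y = - frag_of (word_edge (list_mult F cs))"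
    using cs(2)
  proof (induction cs)
    case Nil
    obtain t where t: "triangle K one_edge one_edge one_edge t"
      using bounds_one(1)[OF one_edge_loop] by (auto simp: bounds_def)
    show ?case
      using t by (intro exI[of _ "- frag_of t"])
        (auto simp: chain_boundary_minus chain_boundary_triangle[OF t] chain_size_minus chain_size_frag_of
          singular_chain_minus singular_chain_of triangle_def word_edge_one)
  next
    case (Cons c cs)
    then obtain y where y: "singular_chain 2 K y" "chain_size y \<le> 4 * int (length cs) + 1"
      "chain_boundary 2 y = - frag_of (word_edge (list_mult F cs))" by auto
    obtain a b where ab: "a \<in> carrier F" "b \<in> carrier F" "c = a \<otimes>\<^bsub>F\<^esub> b \<otimes>\<^bsub>F\<^esub> inv\<^bsub>F\<^esub> a \<otimes>\<^bsub>F\<^esub> inv\<^bsub>F\<^esub> b"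
      using Cons.prems by auto
    then obtain z where z: "singular_chain 2 K z" "chain_size z \<le> 3" "chain_boundary 2 z = - frag_of (word_edge c)"
      using commutator_chain by blast
    obtain t where t: "triangle K (word_edge c) (word_edge (list_mult F cs)) (word_edge (list_mult F (c # cs))) t"
      using word_edge_mult[of c "list_mult F cs"] by (auto simp: bounds_def)
    show ?case
    proof (intro exI[of _ "y + z + frag_of t"] conjI)
      show "singular_chain 2 K (y + z + frag_of t)"
        using y z t by (intro singular_chain_add) (auto simp: singular_chain_of triangle_def)
      show "chain_size (y + z + frag_of t) \<le> 4 * int (length (c # cs)) + 1"
        using chain_size_add[of "y + z" "frag_of t"] chain_size_add[of y z] y z by (simp add: chain_size_frag_of)
      show "chain_boundary 2 (y + z + frag_of t) = - frag_of (word_edge (list_mult F (c # cs)))"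
        by (simp add: chain_boundary_add y z chain_boundary_triangle[OF t])
    qed
  qed
  then show ?thesis using cs by simp
qed

section \<open>Filling products of conjugates of the relator\<close>

context
  fixes \<delta>
  assumes relator_cell: "cell_bounds K P \<delta> (word_edge r) one_edge one_edge 1"
begin

abbreviation fills :: "'s word \<Rightarrow> int \<Rightarrow> bool" where
  "fills w k \<equiv> cell_bounds K P \<delta> (word_edge w) one_edge one_edge k"

lemma cell_bounds_K: "bounds K a b c \<Longrightarrow> cell_bounds K P \<delta> a b c 0"
  unfolding K_sub by (rule cell_bounds_subspace)

lemma fills_one: "fills \<one>\<^bsub>F\<^esub> 0"
  unfolding word_edge_one using bounds_one(1)[OF one_edge_loop] by (rule cell_bounds_K)

lemma fills_mult:
  assumes "fills x k" "fills y l" shows "fills (x \<otimes>\<^bsub>F\<^esub> y) (k + l)"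
  using cell_bounds_assoc1[OF assms(2,1) cell_bounds_K[OF word_edge_mult]] by (simp add: add.commute)

lemma fills_inv:
  assumes "fills x k" "x \<in> carrier F" shows "fills (inv\<^bsub>F\<^esub> x) (- k)"
proof -
  have "bounds K (word_edge (inv\<^bsub>F\<^esub> x)) (word_edge x) one_edge"
    using word_edge_mult[of "inv\<^bsub>F\<^esub> x" x] assms(2) by (simp add: word_edge_one)
  from cell_bounds_assoc2[OF assms(1) fills_one[unfolded word_edge_one] cell_bounds_K[OF this]]
  show ?thesis by simp
qed

text \<open>Three tetrahedra carry \<open>t\<close> across \<open>x\<close> and cancel it against
  its inverse; the filling then has the loop as its third edge and the opposite sign. A fourth
  tetrahedron moves the loop back to the first edge and restores the sign.\<close>

lemma fills_conjugate:
  assumes "fills x k" "x \<in> carrier F" "t \<in> carrier F"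
  shows "fills (t \<otimes>\<^bsub>F\<^esub> x \<otimes>\<^bsub>F\<^esub> inv\<^bsub>F\<^esub> t) k"
proof -
  let ?E = word_edge and ?T = "cell_bounds K P \<delta>"
  note one = cell_bounds_K[OF bounds_one(1)[OF word_edge_loop]] cell_bounds_K[OF bounds_one(2)[OF word_edge_loop]]
  note oo = fills_one[unfolded word_edge_one]
  have 1: "?T (?E (t \<otimes>\<^bsub>F\<^esub> x)) one_edge (?E t) k"
    using cell_bounds_assoc1[OF assms(1) one(2)[of t] cell_bounds_K[OF word_edge_mult[of t x]]] by simp
  have 2: "?T (?E t) (?E (inv\<^bsub>F\<^esub> t)) (?E (t \<otimes>\<^bsub>F\<^esub> x \<otimes>\<^bsub>F\<^esub> inv\<^bsub>F\<^esub> t)) (- k)"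
    using cell_bounds_assoc1[OF one(1)[of "inv\<^bsub>F\<^esub> t"] cell_bounds_K[OF word_edge_mult] 1] by simp
  have "?T (?E t) (?E (inv\<^bsub>F\<^esub> t)) one_edge 0"
    using cell_bounds_K[OF word_edge_mult[of t "inv\<^bsub>F\<^esub> t"]] assms by (simp add: word_edge_one)
  from cell_bounds_assoc1[OF one(2)[of "inv\<^bsub>F\<^esub> t"] 2 this]
  have 3: "?T one_edge one_edge (?E (t \<otimes>\<^bsub>F\<^esub> x \<otimes>\<^bsub>F\<^esub> inv\<^bsub>F\<^esub> t)) (- k)" by simp
  show ?thesis using cell_bounds_assoc1[OF oo oo 3] by simp
qed

lemma conjugate_product_fills:
  assumes "F.conjugate_product r k w" shows "fills w k"
  using assms relator_closed
proof (induction rule: F.conjugate_product_induct)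
  case one
  show ?case by (rule fills_one)
next
  case (mult j t k w)
  have "fills (r [^]\<^bsub>F\<^esub> j) j"
    using mult(1) relator_cell fills_inv[OF relator_cell relator_closed] relator_closed
    by (auto simp: F.int_pow_neg)
  then show ?case
    using fills_mult[OF fills_conjugate mult.IH] mult(2) relator_closed by simp
qed

text \<open>The boundary of the surface is capped by one triangle, whatever the number of conjugates
  in \<open>w\<close>. This is the second extra triangle in \<open>4 m + 2\<close>.\<close>

lemma closed_surface_cycle:
  assumes "F.commutator_product m w" "F.conjugate_product r k w"
  shows "\<exists>Z. singular_relcycle 2 P {} Z \<and> chain_size Z \<le> 4 * int m + 2 \<and> cell_chain K P \<delta> k Z"
proof -
  obtain y where y: "singular_chain 2 K y" "chain_size y \<le> 4 * int m + 1"
    "chain_boundary 2 y = - frag_of (word_edge w)"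
    using commutator_product_chain assms by blast
  obtain t where t: "triangle P (word_edge w) one_edge one_edge t" "cell_chain K P \<delta> k (frag_of t)"
    using conjugate_product_fills[OF assms(2)] by (auto simp: cell_bounds_def)
  show ?thesis
  proof (intro exI[of _ "frag_of t + y"] conjI)
    have "singular_chain 2 P (frag_of t + y)"
      using y(1) t(1) unfolding K_sub
      by (intro singular_chain_add) (auto simp: singular_chain_subtopology singular_chain_of triangle_def)
    then show "singular_relcycle 2 P {} (frag_of t + y)"
      by (simp add: singular_cycle chain_boundary_add chain_boundary_triangle[OF t(1)] y)
    show "chain_size (frag_of t + y) \<le> 4 * int m + 2"
      using chain_size_add[of "frag_of t" y] y by (simp add: chain_size_frag_of)
    show "cell_chain K P \<delta> k (frag_of t + y)"
      using cell_chain_add[OF t(2) cell_chain_subspace[OF y(1)]] by simp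
  qed
qed

end

end

section \<open>Attaching cells\<close>

definition radius :: "nat \<Rightarrow> (nat \<Rightarrow> real) \<Rightarrow> real" where
  "radius n x = sqrt (\<Sum>i<n. (x i)\<^sup>2)"

definition radial :: "nat \<Rightarrow> (nat \<Rightarrow> real) \<Rightarrow> nat \<Rightarrow> real" where
  "radial n x = (\<lambda>i. x i / radius n x)"

lemma topspace_disc: "topspace (disc n) = {x. (\<forall>i\<ge>n. x i = 0) \<and> radius n x \<le> 1}"
  by (auto simp: disc_def topspace_Euclidean_space radius_def)

lemma open_disc_radius: "open_disc n = {x. (\<forall>i\<ge>n. x i = 0) \<and> radius n x < 1}"
  by (auto simp: open_disc_def topspace_Euclidean_space radius_def)

lemma topspace_nsphere_radius:
  assumes "n \<ge> 1" shows "topspace (nsphere (n - 1)) = {x. (\<forall>i\<ge>n. x i = 0) \<and> radius n x = 1}"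
proof -
  have "{..n - 1} = {..<n}" "\<And>i. i > n - 1 \<longleftrightarrow> i \<ge> n" using assms by auto
  then show ?thesis by (auto simp: nsphere radius_def)
qed

lemma disc_euclidean: "disc n = top_of_set (topspace (disc n))"
  by (simp add: disc_def Euclidean_space_def subtopology_subtopology euclidean_product_topology)

lemma nsphere_euclidean: "nsphere n = top_of_set (topspace (nsphere n))"
  by (simp add: nsphere euclidean_product_topology)

lemma radius_zero_iff: "(\<forall>i\<ge>n. x i = 0) \<Longrightarrow> radius n x = 0 \<longleftrightarrow> x = (\<lambda>_. 0)"
  by (auto simp: radius_def sum_nonneg_eq_0_iff fun_eq_iff) (metis lessThan_iff not_le)

lemma radius_nonneg: "0 \<le> radius n x"
  by (simp add: radius_def sum_nonneg)

lemma radius_radial: "radius n x \<noteq> 0 \<Longrightarrow> radius n (radial n x) = 1"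
proof -
  assume nz: "radius n x \<noteq> 0"
  have "(\<Sum>i<n. (radial n x i)\<^sup>2) = (\<Sum>i<n. (x i)\<^sup>2) / (radius n x)\<^sup>2"
    by (simp add: radial_def power_divide sum_divide_distrib)
  also have "(\<Sum>i<n. (x i)\<^sup>2) = (radius n x)\<^sup>2" by (simp add: radius_def sum_nonneg)
  finally show ?thesis using nz by (simp add: radius_def)
qed

lemma radial_unit: "radius n x = 1 \<Longrightarrow> radial n x = x"
  by (simp add: radial_def)

lemma radial_in_nsphere:
  assumes "n \<ge> 1" "x \<in> topspace (disc n)" "x \<noteq> (\<lambda>_. 0)"
  shows "radial n x \<in> topspace (nsphere (n - 1))"
  using assms radius_radial[of n x] radius_zero_iff[of n x]
  unfolding topspace_nsphere_radius[OF assms(1)] by (simp add: topspace_disc) (simp add: radial_def)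

lemma continuous_on_radius: "continuous_on A (radius n)"
  unfolding radius_def
  by (intro continuous_intros continuous_on_subset[OF continuous_on_product_coordinates subset_UNIV])

lemma continuous_on_radial:
  "(\<And>x. x \<in> A \<Longrightarrow> radius n x \<noteq> 0) \<Longrightarrow> continuous_on A (radial n)"
  unfolding radial_def
  by (intro continuous_on_vector continuous_on_divide continuous_on_radius
     continuous_on_subset[OF continuous_on_product_coordinates subset_UNIV]) auto

lemma disc_eq: "n \<ge> 1 \<Longrightarrow> topspace (disc n) = open_disc n \<union> topspace (nsphere (n - 1))"
  by (subst topspace_nsphere_radius) (auto simp: topspace_disc open_disc_radius)

lemma nsphere_subset_disc: "n \<ge> 1 \<Longrightarrow> topspace (nsphere (n - 1)) \<subseteq> topspace (disc n)"
  using disc_eq by blast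

lemma subtopology_disc: "B \<subseteq> topspace (disc n) \<Longrightarrow> subtopology (disc n) B = top_of_set B"
  by (subst disc_euclidean) (simp only: subtopology_subtopology Int_absorb1)

lemma nsphere_subtopology_disc: "n \<ge> 1 \<Longrightarrow> nsphere (n - 1) = subtopology (disc n) (topspace (nsphere (n - 1)))"
  using subtopology_disc[OF nsphere_subset_disc] nsphere_euclidean[of "n - 1"] by simp

lemma closedin_disc_nsphere: "n \<ge> 1 \<Longrightarrow> closedin (disc n) (topspace (nsphere (n - 1)))"
proof -
  assume n: "n \<ge> 1"
  have "closedin (top_of_set (topspace (disc n))) (topspace (disc n) \<inter> radius n -` {1})"
    by (intro continuous_closedin_preimage continuous_on_radius) auto
  also have "topspace (disc n) \<inter> radius n -` {1} = topspace (nsphere (n - 1))"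
    unfolding topspace_nsphere_radius[OF n] by (auto simp: topspace_disc)
  finally show ?thesis using disc_euclidean[of n] by simp
qed

lemma openin_disc_open_disc: "openin (disc n) (open_disc n)"
proof -
  have "openin (top_of_set (topspace (disc n))) (topspace (disc n) \<inter> radius n -` {..<1})"
    by (intro continuous_openin_preimage_gen continuous_on_radius) auto
  also have "topspace (disc n) \<inter> radius n -` {..<1} = open_disc n"
    by (auto simp: topspace_disc open_disc_radius)
  finally show ?thesis using disc_euclidean[of n] by simp
qed

lemma openin_disc_punctured: "openin (disc n) (topspace (disc n) - {\<lambda>_. 0})"
proof -
  have "openin (top_of_set (topspace (disc n))) (topspace (disc n) \<inter> radius n -` (- {0}))"
    by (intro continuous_openin_preimage_gen continuous_on_radius) auto
  also have "topspace (disc n) \<inter> radius n -` (- {0}) = topspace (disc n) - {\<lambda>_. 0}"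
    using radius_zero_iff by (fastforce simp: topspace_disc)
  finally show ?thesis using disc_euclidean[of n] by simp
qed

lemma continuous_map_radial:
  assumes "n \<ge> 1"
  shows "continuous_map (subtopology (disc n) (topspace (disc n) - {\<lambda>_. 0})) (nsphere (n - 1)) (radial n)"
proof -
  let ?D = "topspace (disc n) - {\<lambda>_. 0}"
  have "continuous_on ?D (radial n)"
    using radius_zero_iff by (intro continuous_on_radial) (auto simp: topspace_disc)
  then have "continuous_map (top_of_set ?D) (top_of_set (topspace (nsphere (n - 1)))) (radial n)"
    using radial_in_nsphere[OF assms] by (auto simp: continuous_map_in_subtopology)
  then have "continuous_map (top_of_set ?D) (nsphere (n - 1)) (radial n)"
    by (simp only: nsphere_euclidean[symmetric])
  moreover have "subtopology (disc n) ?D = top_of_set ?D"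
    by (rule subtopology_disc) auto
  ultimately show ?thesis by (simp only:)
qed

lemma zero_in_open_disc: "(\<lambda>_. 0) \<in> open_disc n"
  by (simp add: open_disc_radius radius_def)

locale cell_attachment =
  fixes n :: nat and A :: "'x topology" and I :: "'i set" and \<Phi> :: "'i \<Rightarrow> (nat \<Rightarrow> real) \<Rightarrow> 'x" and X :: "'x topology"
  assumes attaches: "attaches_cells n A I \<Phi> X" and n_pos: "n \<ge> 1"
begin

lemma A_subset: "topspace A \<subseteq> topspace X"
  and attaching_map: "i \<in> I \<Longrightarrow> continuous_map (nsphere (n - 1)) A (\<Phi> i)"
  and cells: "bij_betw (\<lambda>(i, x). \<Phi> i x) (I \<times> open_disc n) (topspace X - topspace A)"
  and openin_iff: "openin X U \<longleftrightarrow> U \<subseteq> topspace X \<and> openin A (topspace A \<inter> U) \<and>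
        (\<forall>i\<in>I. openin (disc n) {x \<in> topspace (disc n). \<Phi> i x \<in> U})"
  using attaches unfolding attaches_cells_def by blast+

lemma cell_open_disc: "i \<in> I \<Longrightarrow> x \<in> open_disc n \<Longrightarrow> \<Phi> i x \<in> topspace X - topspace A"
  using bij_betwE[OF cells] by fastforce

lemma cell_inj:
  assumes "i \<in> I" "x \<in> open_disc n" "j \<in> I" "y \<in> open_disc n" "\<Phi> i x = \<Phi> j y"
  shows "i = j \<and> x = y"
  using bij_betw_imp_inj_on[OF cells] assms unfolding inj_on_def by fastforce

lemma cell_nsphere: "i \<in> I \<Longrightarrow> x \<in> topspace (nsphere (n - 1)) \<Longrightarrow> \<Phi> i x \<in> topspace A"
  using attaching_map[of i] by (auto simp: continuous_map_def)

lemma cell_disc: "i \<in> I \<Longrightarrow> x \<in> topspace (disc n) \<Longrightarrow> \<Phi> i x \<in> topspace X"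
  using cell_open_disc cell_nsphere A_subset disc_eq[OF n_pos] by blast

lemma cell_disc_A_iff:
  "i \<in> I \<Longrightarrow> x \<in> topspace (disc n) \<Longrightarrow> \<Phi> i x \<in> topspace A \<longleftrightarrow> x \<in> topspace (nsphere (n - 1))"
  using cell_open_disc cell_nsphere disc_eq[OF n_pos] by blast

lemma cell_exists:
  assumes "x \<in> topspace X" "x \<notin> topspace A" obtains i y where "i \<in> I" "y \<in> open_disc n" "x = \<Phi> i y"
proof -
  have "x \<in> (\<lambda>(i, x). \<Phi> i x) ` (I \<times> open_disc n)" using assms cells by (simp add: bij_betw_def)
  then show thesis using that by auto
qed

lemma closedin_iff:
  "closedin X C \<longleftrightarrow> C \<subseteq> topspace X \<and> closedin A (topspace A \<inter> C) \<and>
        (\<forall>i\<in>I. closedin (disc n) {x \<in> topspace (disc n). \<Phi> i x \<in> C})"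
proof (cases "C \<subseteq> topspace X")
  case True
  have A: "topspace A \<inter> (topspace X - C) = topspace A - (topspace A \<inter> C)" using A_subset by auto
  have "openin (disc n) {x \<in> topspace (disc n). \<Phi> i x \<in> topspace X - C} \<longleftrightarrow>
      closedin (disc n) {x \<in> topspace (disc n). \<Phi> i x \<in> C}" if "i \<in> I" for i
  proof -
    have "{x \<in> topspace (disc n). \<Phi> i x \<in> topspace X - C} = topspace (disc n) - {x \<in> topspace (disc n). \<Phi> i x \<in> C}"
      using cell_disc[OF that] by auto
    then show ?thesis by (simp add: closedin_def)
  qed
  then show ?thesis
    using True unfolding closedin_def[of X] openin_iff A by (auto simp: closedin_def[of A])
qed (auto simp: closedin_def)

lemma closedin_A:
  assumes "closedin A C" shows "closedin X C"
  unfolding closedin_iff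
proof (intro conjI ballI)
  have C: "C \<subseteq> topspace A" using assms closedin_subset by blast
  then show "C \<subseteq> topspace X" using A_subset by blast
  show "closedin A (topspace A \<inter> C)" using assms C by (simp add: Int_absorb1)
  fix i assume i: "i \<in> I"
  have "closedin (nsphere (n - 1)) {x \<in> topspace (nsphere (n - 1)). \<Phi> i x \<in> C}"
    using closedin_continuous_map_preimage[OF attaching_map[OF i] assms] .
  also have "{x \<in> topspace (nsphere (n - 1)). \<Phi> i x \<in> C} = {x \<in> topspace (disc n). \<Phi> i x \<in> C}"
    using cell_disc_A_iff[OF i] C nsphere_subset_disc[OF n_pos] by blast
  finally show "closedin (disc n) {x \<in> topspace (disc n). \<Phi> i x \<in> C}"
    using closedin_trans_full[OF _ closedin_disc_nsphere[OF n_pos]] nsphere_subtopology_disc[OF n_pos] by simp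
qed

lemma closedin_X_A: "closedin X (topspace A)"
  using closedin_A closedin_topspace by blast

lemma subtopology_A: "subtopology X (topspace A) = A"
proof -
  have "closedin (subtopology X (topspace A)) C \<longleftrightarrow> closedin A C" for C
  proof
    assume "closedin (subtopology X (topspace A)) C"
    then have "closedin X C" "C \<subseteq> topspace A"
      using closedin_closed_subtopology[OF closedin_X_A] by blast+
    then show "closedin A C" using closedin_iff[of C] by (simp add: Int_absorb1)
  next
    assume "closedin A C"
    then show "closedin (subtopology X (topspace A)) C"
      using closedin_closed_subtopology[OF closedin_X_A] closedin_A closedin_subset by blast
  qed
  moreover have "topspace (subtopology X (topspace A)) = topspace A" using A_subset by auto
  ultimately show ?thesis unfolding topology_eq openin_closedin_eq by simp
qed

lemma characteristic_map: "i \<in> I \<Longrightarrow> continuous_map (disc n) X (\<Phi> i)"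
  using openin_iff cell_disc by (auto simp: continuous_map_def)

lemma openin_cell:
  assumes i: "i \<in> I" and V: "openin (disc n) V" "V \<subseteq> open_disc n"
  shows "openin X (\<Phi> i ` V)"
  unfolding openin_iff
proof (intro conjI ballI)
  show "\<Phi> i ` V \<subseteq> topspace X" using V cell_open_disc[OF i] by blast
  have "topspace A \<inter> \<Phi> i ` V = {}" using V cell_open_disc[OF i] by blast
  then show "openin A (topspace A \<inter> \<Phi> i ` V)" by simp
  fix j assume j: "j \<in> I"
  have "{x \<in> topspace (disc n). \<Phi> j x \<in> \<Phi> i ` V} = (if j = i then V else {})"
  proof -
    have *: "j = i \<and> x \<in> V" if x: "x \<in> topspace (disc n)" "\<Phi> j x \<in> \<Phi> i ` V" for x
    proof -
      obtain y where y: "y \<in> V" "\<Phi> j x = \<Phi> i y" using x(2) by (rule imageE)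
      then have yo: "y \<in> open_disc n" using V(2) by (rule_tac subsetD)
      then have "\<Phi> j x \<notin> topspace A" using cell_open_disc[OF i yo] y(2) by simp
      then have "x \<in> open_disc n" using cell_disc_A_iff[OF j x(1)] disc_eq[OF n_pos] x(1) by auto
      from cell_inj[OF j this i yo y(2)] y(1) show ?thesis by simp
    qed
    have "V \<subseteq> topspace (disc n)" using V(1) openin_subset by (rule_tac openin_subset)
    then show ?thesis using * by auto
  qed
  then show "openin (disc n) {x \<in> topspace (disc n). \<Phi> j x \<in> \<Phi> i ` V}" using V by simp
qed

definition cell_of :: "'x \<Rightarrow> 'i \<times> (nat \<Rightarrow> real)" where
  "cell_of = inv_into (I \<times> open_disc n) (\<lambda>(i, x). \<Phi> i x)"

lemma cell_of: "i \<in> I \<Longrightarrow> y \<in> open_disc n \<Longrightarrow> cell_of (\<Phi> i y) = (i, y)"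
  unfolding cell_of_def using inv_into_f_f[OF bij_betw_imp_inj_on[OF cells], of "(i, y)"] by simp

definition cell :: "'i \<Rightarrow> 'x set" where "cell i = \<Phi> i ` open_disc n"

lemma openin_open_cell: "i \<in> I \<Longrightarrow> openin X (cell i)"
  unfolding cell_def by (intro openin_cell openin_disc_open_disc) auto

lemma continuous_map_cell_coordinate:
  assumes i: "i \<in> I"
  shows "continuous_map (subtopology X (cell i)) (subtopology (disc n) (open_disc n)) (snd \<circ> cell_of)"
  unfolding continuous_map_def
proof (intro conjI allI impI)
  have od: "topspace (disc n) \<inter> open_disc n = open_disc n" using disc_eq[OF n_pos] by blast
  show "snd \<circ> cell_of \<in> topspace (subtopology X (cell i)) \<rightarrow> topspace (subtopology (disc n) (open_disc n))"
    using i by (auto simp: cell_def cell_of od)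
  fix U assume "openin (subtopology (disc n) (open_disc n)) U"
  then have U: "openin (disc n) U" "U \<subseteq> open_disc n"
    using openin_open_subtopology[OF openin_disc_open_disc] by blast+
  have "{x \<in> topspace (subtopology X (cell i)). (snd \<circ> cell_of) x \<in> U} = \<Phi> i ` U"
    using U(2) cell_open_disc[OF i] by (auto simp: cell_def cell_of[OF i])
  then show "openin (subtopology X (cell i)) {x \<in> topspace (subtopology X (cell i)). (snd \<circ> cell_of) x \<in> U}"
    using openin_cell[OF i U] U(2) openin_open_subtopology[OF openin_open_cell[OF i]] by (auto simp: cell_def)
qed

text \<open>Removing the centres of the cells leaves an open set that retracts onto
  \<open>A\<close>. Together with the open cells it forms the cover along which transports are
  glued.\<close>

definition collar :: "'x set" where
  "collar = topspace X - (\<lambda>i. \<Phi> i (\<lambda>_. 0)) ` I"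

definition retraction :: "'x \<Rightarrow> 'x" where
  "retraction x = (if x \<in> topspace A then x else \<Phi> (fst (cell_of x)) (radial n (snd (cell_of x))))"

lemma A_subset_collar: "topspace A \<subseteq> collar"
  using A_subset cell_open_disc zero_in_open_disc by (fastforce simp: collar_def)

lemma cell_collar_iff:
  assumes "i \<in> I" "y \<in> topspace (disc n)" shows "\<Phi> i y \<in> collar \<longleftrightarrow> y \<noteq> (\<lambda>_. 0)"
proof (cases "y \<in> open_disc n")
  case True
  then show ?thesis
    using cell_inj[OF assms(1) True _ zero_in_open_disc] cell_disc[OF assms] assms
    unfolding collar_def by blast
next
  case False
  then have "\<Phi> i y \<in> topspace A" using disc_eq[OF n_pos] assms cell_nsphere by blast
  then show ?thesis using A_subset_collar False zero_in_open_disc by blast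
qed

lemma openin_collar: "openin X collar"
  unfolding openin_iff
proof (intro conjI ballI)
  show "collar \<subseteq> topspace X" by (auto simp: collar_def)
  show "openin A (topspace A \<inter> collar)" using A_subset_collar by (simp add: Int_absorb2)
  fix i assume "i \<in> I"
  then have "{x \<in> topspace (disc n). \<Phi> i x \<in> collar} = topspace (disc n) - {\<lambda>_. 0}"
    using cell_collar_iff by blast
  then show "openin (disc n) {x \<in> topspace (disc n). \<Phi> i x \<in> collar}" using openin_disc_punctured by simp
qed

lemma retraction_cell:
  assumes "i \<in> I" "y \<in> topspace (disc n)" "y \<noteq> (\<lambda>_. 0)"
  shows "retraction (\<Phi> i y) = \<Phi> i (radial n y)"
proof (cases "y \<in> open_disc n")
  case True
  then show ?thesis using cell_open_disc[OF assms(1) True] cell_of[OF assms(1) True] by (simp add: retraction_def)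
next
  case False
  then have y: "y \<in> topspace (nsphere (n - 1))" using disc_eq[OF n_pos] assms by blast
  then have "radial n y = y" using radial_unit topspace_nsphere_radius[OF n_pos] by blast
  then show ?thesis using cell_nsphere[OF assms(1) y] by (simp add: retraction_def)
qed

lemma retraction_A: "x \<in> topspace A \<Longrightarrow> retraction x = x"
  by (simp add: retraction_def)

lemma retraction_in_A:
  assumes "x \<in> collar" shows "retraction x \<in> topspace A"
proof (cases "x \<in> topspace A")
  case False
  moreover have "x \<in> topspace X" using assms by (simp add: collar_def)
  ultimately obtain i y where x: "i \<in> I" "y \<in> open_disc n" "x = \<Phi> i y" using cell_exists by blast
  then have y: "y \<in> topspace (disc n)" using disc_eq[OF n_pos] by blast
  then have "y \<noteq> (\<lambda>_. 0)" using cell_collar_iff assms x by blast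
  then show ?thesis using retraction_cell[OF x(1) y] cell_nsphere[OF x(1)] radial_in_nsphere[OF n_pos y] x by simp
qed (simp add: retraction_A)

lemma continuous_map_retraction: "continuous_map (subtopology X collar) A retraction"
  unfolding continuous_map_def
proof (intro conjI allI impI)
  show "retraction \<in> topspace (subtopology X collar) \<rightarrow> topspace A" using retraction_in_A by auto
  fix U assume U: "openin A U"
  have UA: "U \<subseteq> topspace A" using U openin_subset by blast
  let ?W = "{x \<in> collar. retraction x \<in> U}"
  have "openin X ?W"
    unfolding openin_iff
  proof (intro conjI ballI)
    show "?W \<subseteq> topspace X" by (auto simp: collar_def)
    have "topspace A \<inter> ?W = U" using UA A_subset_collar retraction_A by force
    then show "openin A (topspace A \<inter> ?W)" using U by simp
    fix i assume i: "i \<in> I"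
    let ?D = "topspace (disc n) - {\<lambda>_. 0}"
    have "continuous_map (subtopology (disc n) ?D) A (\<Phi> i \<circ> radial n)"
      by (rule continuous_map_compose[OF continuous_map_radial[OF n_pos] attaching_map[OF i]])
    from openin_continuous_map_preimage[OF this U]
    have "openin (disc n) {x \<in> ?D. \<Phi> i (radial n x) \<in> U}"
      using openin_trans_full[OF _ openin_disc_punctured] by (simp add: Int_absorb1)
    also have "{x \<in> ?D. \<Phi> i (radial n x) \<in> U} = {x \<in> topspace (disc n). \<Phi> i x \<in> ?W}"
      using cell_collar_iff[OF i] retraction_cell[OF i] by auto
    finally show "openin (disc n) {x \<in> topspace (disc n). \<Phi> i x \<in> ?W}" .
  qed
  moreover have "{x \<in> topspace (subtopology X collar). retraction x \<in> U} = ?W"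
    by (auto simp: collar_def)
  ultimately show "openin (subtopology X collar) {x \<in> topspace (subtopology X collar). retraction x \<in> U}"
    using openin_open_subtopology[OF openin_collar] by auto
qed

lemma cover: "topspace X \<subseteq> collar \<union> \<Union> (cell ` I)"
  using zero_in_open_disc by (auto simp: collar_def cell_def)

text \<open>Points must be closed at every stage for a compact subset of an increasing union to lie
  in a single stage.\<close>

lemma t1_space_X:
  assumes "t1_space A" shows "t1_space X"
  unfolding t1_space_closedin_singleton
proof
  fix x assume x: "x \<in> topspace X"
  show "closedin X {x}"
  proof (cases "x \<in> topspace A")
    case True
    then show ?thesis using assms closedin_A by (simp add: t1_space_closedin_singleton)
  next
    case False
    then obtain i y where iy: "i \<in> I" "y \<in> open_disc n" "x = \<Phi> i y" using x cell_exists by blast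
    have t1: "t1_space (disc n)"
      unfolding disc_def Euclidean_space_def euclidean_product_topology
      by (intro t1_space_subtopology) (simp add: t1_space_closedin_singleton)
    show ?thesis
      unfolding closedin_iff
    proof (intro conjI ballI)
      have "topspace A \<inter> {x} = {}" using False by auto
      then show "closedin A (topspace A \<inter> {x})" by simp
      fix j assume j: "j \<in> I"
      have "z \<in> open_disc n" if "z \<in> topspace (disc n)" "\<Phi> j z = x" for z
        using that False cell_nsphere[OF j] disc_eq[OF n_pos] by blast
      then have "{z \<in> topspace (disc n). \<Phi> j z \<in> {x}} \<subseteq> {y}"
        using cell_inj[OF j _ iy(1,2)] iy(3) by blast
      moreover have "closedin (disc n) {y}"
        using t1 iy(2) disc_eq[OF n_pos] by (auto simp: t1_space_closedin_singleton)
      ultimately show "closedin (disc n) {z \<in> topspace (disc n). \<Phi> j z \<in> {x}}"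
        by (elim subset_singletonD[elim_format] disjE) (simp_all only: closedin_empty)
    qed (use x in auto)
  qed
qed

end

section \<open>Functors on the fundamental groupoid\<close>

abbreviation path_in :: "'x topology \<Rightarrow> (real \<Rightarrow> 'x) \<Rightarrow> bool" where
  "path_in X p \<equiv> continuous_map (top_of_set {0..1}) X p"

abbreviation square_in :: "'x topology \<Rightarrow> (real \<times> real \<Rightarrow> 'x) \<Rightarrow> bool" where
  "square_in X H \<equiv> continuous_map (top_of_set ({0..1} \<times> {0..1})) X H"

text \<open>Functoriality is stated by halving a path and not by joining two paths, so that repeated
  halving can serve as subdivision.\<close>

definition lower :: "(real \<Rightarrow> 'x) \<Rightarrow> real \<Rightarrow> 'x" where "lower p t = p (t / 2)"
definition upper :: "(real \<Rightarrow> 'x) \<Rightarrow> real \<Rightarrow> 'x" where "upper p t = p ((t + 1) / 2)"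

text \<open>A transport is a functor from the fundamental groupoid of \<open>X\<close> to the group \<open>G\<close>.\<close>

definition transport :: "('g, 'm) monoid_scheme \<Rightarrow> 'x topology \<Rightarrow> ((real \<Rightarrow> 'x) \<Rightarrow> 'g) \<Rightarrow> bool" where
  "transport G X \<theta> \<longleftrightarrow>
     (\<forall>p. path_in X p \<longrightarrow> \<theta> p \<in> carrier G) \<and>
     (\<forall>p q. path_in X p \<longrightarrow> (\<forall>t\<in>{0..1}. p t = q t) \<longrightarrow> \<theta> p = \<theta> q) \<and>
     (\<forall>p. path_in X p \<longrightarrow> \<theta> p = \<theta> (lower p) \<otimes>\<^bsub>G\<^esub> \<theta> (upper p)) \<and>
     (\<forall>H. square_in X H \<longrightarrow>
        \<theta> (\<lambda>s. H (s, 0)) \<otimes>\<^bsub>G\<^esub> \<theta> (\<lambda>t. H (1, t)) = \<theta> (\<lambda>t. H (0, t)) \<otimes>\<^bsub>G\<^esub> \<theta> (\<lambda>s. H (s, 1)))"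

lemma transportD:
  assumes "transport G X \<theta>"
  shows "path_in X p \<Longrightarrow> \<theta> p \<in> carrier G"
    "path_in X p \<Longrightarrow> (\<And>t. t \<in> {0..1} \<Longrightarrow> p t = q t) \<Longrightarrow> \<theta> p = \<theta> q"
    "path_in X p \<Longrightarrow> \<theta> p = \<theta> (lower p) \<otimes>\<^bsub>G\<^esub> \<theta> (upper p)"
    "square_in X H \<Longrightarrow>
        \<theta> (\<lambda>s. H (s, 0)) \<otimes>\<^bsub>G\<^esub> \<theta> (\<lambda>t. H (1, t)) = \<theta> (\<lambda>t. H (0, t)) \<otimes>\<^bsub>G\<^esub> \<theta> (\<lambda>s. H (s, 1))"
  using assms unfolding transport_def by blast+

lemma path_in_compose:
  assumes "path_in X p" "continuous_on {0..1} f" "f ` {0..1} \<subseteq> {0..1}"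
  shows "path_in X (\<lambda>t. p (f t))"
proof -
  have "continuous_map (top_of_set {0..1}) (top_of_set {0..1}) f"
    using assms by (auto simp: continuous_map_in_subtopology)
  from continuous_map_compose[OF this assms(1)] show ?thesis by (simp add: o_def)
qed

lemma path_in_lower: "path_in X p \<Longrightarrow> path_in X (lower p)"
  and path_in_upper: "path_in X p \<Longrightarrow> path_in X (upper p)"
  unfolding lower_def[abs_def] upper_def[abs_def]
  by (rule path_in_compose; auto intro!: continuous_intros)+

lemma square_in_compose:
  assumes "square_in X H" "continuous_on ({0..1} \<times> {0..1}) f" "f ` ({0..1} \<times> {0..1}) \<subseteq> {0..1} \<times> {0..1}"
  shows "square_in X (\<lambda>z. H (f z))"
proof -
  have "continuous_map (top_of_set ({0..1} \<times> {0..1})) (top_of_set ({0..1} \<times> {0..1})) f"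
    using assms by (auto simp: continuous_map_in_subtopology)
  from continuous_map_compose[OF this assms(1)] show ?thesis by (simp add: o_def)
qed

lemma square_side:
  assumes "square_in X H" "continuous_on {0..1} f" "f ` {0..1} \<subseteq> {0..1} \<times> {0..1}"
  shows "path_in X (\<lambda>t. H (f t))"
proof -
  have "continuous_map (top_of_set {0..1}) (top_of_set ({0..1} \<times> {0..1})) f"
    using assms by (auto simp: continuous_map_in_subtopology)
  from continuous_map_compose[OF this assms(1)] show ?thesis by (simp add: o_def)
qed

lemma square_sides:
  assumes "square_in X H"
  shows "path_in X (\<lambda>s. H (s, 0))" "path_in X (\<lambda>t. H (1, t))" "path_in X (\<lambda>t. H (0, t))" "path_in X (\<lambda>s. H (s, 1))"
  by (rule square_side[OF assms]; auto intro!: continuous_intros)+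

text \<open>A constant path equals both of its halves, so its value is idempotent.\<close>

lemma transport_constant:
  assumes "group G" "transport G X \<theta>" "x \<in> topspace X" "\<And>t. t \<in> {0..1} \<Longrightarrow> p t = x"
  shows "\<theta> p = \<one>\<^bsub>G\<^esub>"
proof -
  interpret group G by fact
  have path: "path_in X (\<lambda>_. x)" using assms by simp
  have "lower (\<lambda>_. x) = (\<lambda>_. x)" "upper (\<lambda>_. x) = (\<lambda>_. x)" by (auto simp: lower_def upper_def)
  then have "\<theta> (\<lambda>_. x) = \<theta> (\<lambda>_. x) \<otimes>\<^bsub>G\<^esub> \<theta> (\<lambda>_. x)" using transportD(3)[OF assms(2) path] by simp
  then have "\<theta> (\<lambda>_. x) = \<one>\<^bsub>G\<^esub>" using transportD(1)[OF assms(2) path] by (simp add: r_cancel_one)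
  moreover have "\<theta> (\<lambda>_. x) = \<theta> p" using assms(4) by (intro transportD(2)[OF assms(2) path]) simp
  ultimately show ?thesis by simp
qed

lemma path_in_eq: "path_in X p \<Longrightarrow> (\<And>t. t \<in> {0..1} \<Longrightarrow> p t = q t) \<Longrightarrow> path_in X q"
  by (erule continuous_map_eq) simp

lemma transport_cong:
  assumes "transport G X \<theta>" "\<And>p. path_in X p \<Longrightarrow> \<theta>' p = \<theta> p"
  shows "transport G X \<theta>'"
  unfolding transport_def
proof (intro conjI allI impI)
  fix p q assume p: "path_in X p"
  show "\<theta>' p \<in> carrier G" using transportD(1)[OF assms(1) p] assms(2)[OF p] by simp
  show "\<theta>' p = \<theta>' (lower p) \<otimes>\<^bsub>G\<^esub> \<theta>' (upper p)"
    using transportD(3)[OF assms(1) p] assms(2)[OF p] assms(2)[OF path_in_lower[OF p]] assms(2)[OF path_in_upper[OF p]]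
    by simp
  assume eq: "\<forall>t\<in>{0..1}. p t = q t"
  then have q: "path_in X q" using path_in_eq[OF p] by simp
  show "\<theta>' p = \<theta>' q" using transportD(2)[OF assms(1) p] eq assms(2)[OF p] assms(2)[OF q] by simp
next
  fix H assume H: "square_in X H"
  show "\<theta>' (\<lambda>s. H (s, 0)) \<otimes>\<^bsub>G\<^esub> \<theta>' (\<lambda>t. H (1, t)) = \<theta>' (\<lambda>t. H (0, t)) \<otimes>\<^bsub>G\<^esub> \<theta>' (\<lambda>s. H (s, 1))"
    using transportD(4)[OF assms(1) H] square_sides[OF H, THEN assms(2)] by simp
qed

lemma transport_pullback:
  assumes "transport G Y \<theta>" "continuous_map X Y f"
  shows "transport G X (\<lambda>p. \<theta> (f \<circ> p))"
  unfolding transport_def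
proof (intro conjI allI impI)
  fix p q assume p: "path_in X p"
  then have fp: "path_in Y (f \<circ> p)" using assms(2) by (rule continuous_map_compose)
  show "\<theta> (f \<circ> p) \<in> carrier G" using transportD(1)[OF assms(1) fp] .
  have "lower (f \<circ> p) = f \<circ> lower p" "upper (f \<circ> p) = f \<circ> upper p"
    by (auto simp: lower_def upper_def)
  then show "\<theta> (f \<circ> p) = \<theta> (f \<circ> lower p) \<otimes>\<^bsub>G\<^esub> \<theta> (f \<circ> upper p)"
    using transportD(3)[OF assms(1) fp] by simp
  assume "\<forall>t\<in>{0..1}. p t = q t"
  then show "\<theta> (f \<circ> p) = \<theta> (f \<circ> q)" by (intro transportD(2)[OF assms(1) fp]) simp
next
  fix H assume H: "square_in X H"
  from transportD(4)[OF assms(1) continuous_map_compose[OF H assms(2)]]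
  show "\<theta> (f \<circ> (\<lambda>s. H (s, 0))) \<otimes>\<^bsub>G\<^esub> \<theta> (f \<circ> (\<lambda>t. H (1, t))) = \<theta> (f \<circ> (\<lambda>t. H (0, t))) \<otimes>\<^bsub>G\<^esub> \<theta> (f \<circ> (\<lambda>s. H (s, 1)))"
    by (simp add: o_def)
qed

text \<open>These are the functors that are trivial on loops. On a simply connected piece every
  transport has this form, which is how transports are prescribed on open cells.\<close>

lemma transport_gauge:
  assumes "group G" "\<And>x. x \<in> topspace X \<Longrightarrow> g x \<in> carrier G"
  shows "transport G X (\<lambda>p. inv\<^bsub>G\<^esub> g (p 0) \<otimes>\<^bsub>G\<^esub> g (p 1))"
proof -
  interpret group G by fact
  have pt: "p t \<in> topspace X" if "path_in X p" "t \<in> {0..1}" for p t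
    using that by (auto simp: continuous_map_def)
  have Ht: "H z \<in> topspace X" if "square_in X H" "z \<in> {0..1} \<times> {0..1}" for H z
    using that by (auto simp: continuous_map_def)
  have cancel: "inv\<^bsub>G\<^esub> x \<otimes>\<^bsub>G\<^esub> y \<otimes>\<^bsub>G\<^esub> (inv\<^bsub>G\<^esub> y \<otimes>\<^bsub>G\<^esub> z) = inv\<^bsub>G\<^esub> x \<otimes>\<^bsub>G\<^esub> z"
    if "x \<in> carrier G" "y \<in> carrier G" "z \<in> carrier G" for x y z
    using that by (simp add: m_assoc inv_cancel_left')
  show ?thesis
    unfolding transport_def
  proof (intro conjI allI impI)
    fix p assume p: "path_in X p"
    note c = assms(2)[OF pt[OF p]]
    show "inv\<^bsub>G\<^esub> g (p 0) \<otimes>\<^bsub>G\<^esub> g (p 1) \<in> carrier G" using c by simp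
    show "inv\<^bsub>G\<^esub> g (p 0) \<otimes>\<^bsub>G\<^esub> g (p 1) =
      inv\<^bsub>G\<^esub> g (lower p 0) \<otimes>\<^bsub>G\<^esub> g (lower p 1) \<otimes>\<^bsub>G\<^esub> (inv\<^bsub>G\<^esub> g (upper p 0) \<otimes>\<^bsub>G\<^esub> g (upper p 1))"
      using c by (simp add: lower_def upper_def cancel)
  next
    fix H assume H: "square_in X H"
    note c = assms(2)[OF Ht[OF H]]
    show "inv\<^bsub>G\<^esub> g (H (0, 0)) \<otimes>\<^bsub>G\<^esub> g (H (1, 0)) \<otimes>\<^bsub>G\<^esub> (inv\<^bsub>G\<^esub> g (H (1, 0)) \<otimes>\<^bsub>G\<^esub> g (H (1, 1))) =
      inv\<^bsub>G\<^esub> g (H (0, 0)) \<otimes>\<^bsub>G\<^esub> g (H (0, 1)) \<otimes>\<^bsub>G\<^esub> (inv\<^bsub>G\<^esub> g (H (0, 1)) \<otimes>\<^bsub>G\<^esub> g (H (1, 1)))"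
      using c by (simp add: cancel)
  qed auto
qed

lemma transport_hom:
  assumes "transport G X \<theta>" "h \<in> hom G G'"
  shows "transport G' X (\<lambda>p. h (\<theta> p))"
  unfolding transport_def
proof (intro conjI allI impI)
  fix p q assume p: "path_in X p"
  show "h (\<theta> p) \<in> carrier G'" using transportD(1)[OF assms(1) p] assms(2) by (auto simp: hom_def)
  show "h (\<theta> p) = h (\<theta> (lower p)) \<otimes>\<^bsub>G'\<^esub> h (\<theta> (upper p))"
    unfolding transportD(3)[OF assms(1) p]
    using transportD(1)[OF assms(1)] path_in_lower[OF p] path_in_upper[OF p] hom_mult[OF assms(2)] by blast
  assume "\<forall>t\<in>{0..1}. p t = q t"
  then show "h (\<theta> p) = h (\<theta> q)" using transportD(2)[OF assms(1) p, of q] by simp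
next
  fix H assume H: "square_in X H"
  note c = square_sides[OF H, THEN transportD(1)[OF assms(1)]]
  show "h (\<theta> (\<lambda>s. H (s, 0))) \<otimes>\<^bsub>G'\<^esub> h (\<theta> (\<lambda>t. H (1, t))) = h (\<theta> (\<lambda>t. H (0, t))) \<otimes>\<^bsub>G'\<^esub> h (\<theta> (\<lambda>s. H (s, 1)))"
    using arg_cong[OF transportD(4)[OF assms(1) H], of h] hom_mult[OF assms(2)] c by simp
qed

section \<open>Gluing transports along an open cover\<close>

text \<open>The setting of the van Kampen theorem for groupoids. Agreement on overlaps is built in,
  because one and the same function \<open>\<omega>\<close> is a transport on every member of the
  cover.\<close>

locale local_transport = group G for G :: "('g, 'm) monoid_scheme" (structure) +
  fixes X :: "'x topology" and \<U> :: "'x set set" and \<omega> :: "(real \<Rightarrow> 'x) \<Rightarrow> 'g"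
  assumes open_cover: "\<And>U. U \<in> \<U> \<Longrightarrow> openin X U" "topspace X \<subseteq> \<Union> \<U>"
    and local: "\<And>U. U \<in> \<U> \<Longrightarrow> transport G (subtopology X U) \<omega>"
begin

text \<open>Only dyadic subdivisions occur: they match the law of halves in
  \<open>transport\<close>, and of two of them one always refines the other.\<close>

primrec small_path :: "nat \<Rightarrow> (real \<Rightarrow> 'x) \<Rightarrow> bool" where
  "small_path 0 p \<longleftrightarrow> (\<exists>U\<in>\<U>. path_in (subtopology X U) p)"
| "small_path (Suc n) p \<longleftrightarrow> small_path n (lower p) \<and> small_path n (upper p)"

primrec dyadic :: "nat \<Rightarrow> (real \<Rightarrow> 'x) \<Rightarrow> 'g" where
  "dyadic 0 p = \<omega> p"
| "dyadic (Suc n) p = dyadic n (lower p) \<otimes> dyadic n (upper p)"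

lemma dyadic_closed: "small_path n p \<Longrightarrow> dyadic n p \<in> carrier G"
  by (induction n arbitrary: p) (auto simp: transportD(1)[OF local])

lemma dyadic_refine: "small_path n p \<Longrightarrow> small_path (Suc n) p \<and> dyadic (Suc n) p = dyadic n p"
proof (induction n arbitrary: p)
  case 0
  then obtain U where U: "U \<in> \<U>" "path_in (subtopology X U) p" by auto
  then show ?case
    using path_in_lower[OF U(2)] path_in_upper[OF U(2)] transportD(3)[OF local[OF U(1)] U(2)] by auto
next
  case (Suc n)
  then have "small_path (Suc n) (lower p) \<and> dyadic (Suc n) (lower p) = dyadic n (lower p)"
    "small_path (Suc n) (upper p) \<and> dyadic (Suc n) (upper p) = dyadic n (upper p)" by simp_all
  then show ?case by (simp del: small_path.simps(2) dyadic.simps(2) add: small_path.simps(2)[of "Suc n"]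
        dyadic.simps(2)[of "Suc n"] dyadic.simps(2)[of n p])
qed

lemma dyadic_refine_le: "small_path m p \<Longrightarrow> m \<le> n \<Longrightarrow> small_path n p \<and> dyadic n p = dyadic m p"
proof (induction n)
  case (Suc n)
  then show ?case using dyadic_refine by (cases "m = Suc n") (auto simp del: small_path.simps dyadic.simps)
qed simp

definition subsquare :: "real \<Rightarrow> real \<Rightarrow> (real \<times> real \<Rightarrow> 'x) \<Rightarrow> real \<times> real \<Rightarrow> 'x" where
  "subsquare a b H = (\<lambda>z. H ((fst z + a) / 2, (snd z + b) / 2))"

primrec small_square :: "nat \<Rightarrow> (real \<times> real \<Rightarrow> 'x) \<Rightarrow> bool" where
  "small_square 0 H \<longleftrightarrow> (\<exists>U\<in>\<U>. square_in (subtopology X U) H)"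
| "small_square (Suc n) H \<longleftrightarrow> (\<forall>a\<in>{0, 1}. \<forall>b\<in>{0, 1}. small_square n (subsquare a b H))"

lemma small_square_sides:
  "small_square n H \<Longrightarrow> small_path n (\<lambda>s. H (s, 0)) \<and> small_path n (\<lambda>t. H (1, t)) \<and> small_path n (\<lambda>t. H (0, t)) \<and> small_path n (\<lambda>s. H (s, 1))"
proof (induction n arbitrary: H)
  case 0
  then obtain U where U: "U \<in> \<U>" "square_in (subtopology X U) H" by auto
  from square_sides[OF U(2)] U(1) show ?case by auto
next
  case (Suc n)
  have "lower (\<lambda>s. H (s, 0)) = (\<lambda>s. subsquare 0 0 H (s, 0))" "upper (\<lambda>s. H (s, 0)) = (\<lambda>s. subsquare 1 0 H (s, 0))"
    "lower (\<lambda>s. H (s, 1)) = (\<lambda>s. subsquare 0 1 H (s, 1))" "upper (\<lambda>s. H (s, 1)) = (\<lambda>s. subsquare 1 1 H (s, 1))"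
    "lower (\<lambda>t. H (0, t)) = (\<lambda>t. subsquare 0 0 H (0, t))" "upper (\<lambda>t. H (0, t)) = (\<lambda>t. subsquare 0 1 H (0, t))"
    "lower (\<lambda>t. H (1, t)) = (\<lambda>t. subsquare 1 0 H (1, t))" "upper (\<lambda>t. H (1, t)) = (\<lambda>t. subsquare 1 1 H (1, t))"
    by (auto simp: lower_def upper_def subsquare_def)
  then show ?case using Suc.prems Suc.IH by simp
qed

text \<open>The quarters of a square are passed one after the other; their common inner sides
  cancel.\<close>

lemma dyadic_square:
  "small_square n H \<Longrightarrow>
     dyadic n (\<lambda>s. H (s, 0)) \<otimes> dyadic n (\<lambda>t. H (1, t)) = dyadic n (\<lambda>t. H (0, t)) \<otimes> dyadic n (\<lambda>s. H (s, 1))"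
proof (induction n arbitrary: H)
  case 0
  then show ?case using transportD(4)[OF local] by auto
next
  case (Suc n)
  let ?B = "\<lambda>a b. dyadic n (\<lambda>s. subsquare a b H (s, 0))" and ?T = "\<lambda>a b. dyadic n (\<lambda>s. subsquare a b H (s, 1))"
  let ?L = "\<lambda>a b. dyadic n (\<lambda>t. subsquare a b H (0, t))" and ?R = "\<lambda>a b. dyadic n (\<lambda>t. subsquare a b H (1, t))"
  have sides: "lower (\<lambda>s. H (s, 0)) = (\<lambda>s. subsquare 0 0 H (s, 0))" "upper (\<lambda>s. H (s, 0)) = (\<lambda>s. subsquare 1 0 H (s, 0))"
    "lower (\<lambda>s. H (s, 1)) = (\<lambda>s. subsquare 0 1 H (s, 1))" "upper (\<lambda>s. H (s, 1)) = (\<lambda>s. subsquare 1 1 H (s, 1))"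
    "lower (\<lambda>t. H (0, t)) = (\<lambda>t. subsquare 0 0 H (0, t))" "upper (\<lambda>t. H (0, t)) = (\<lambda>t. subsquare 0 1 H (0, t))"
    "lower (\<lambda>t. H (1, t)) = (\<lambda>t. subsquare 1 0 H (1, t))" "upper (\<lambda>t. H (1, t)) = (\<lambda>t. subsquare 1 1 H (1, t))"
    by (auto simp: lower_def upper_def subsquare_def)
  have common: "?L 1 0 = ?R 0 0" "?B 0 1 = ?T 0 0" "?B 1 1 = ?T 1 0" "?L 1 1 = ?R 0 1"
    by (simp_all add: subsquare_def)
  have fs: "small_square n (subsquare a b H)" if "a \<in> {0, 1}" "b \<in> {0, 1}" for a b using Suc.prems that by auto
  have c: "?B a b \<in> carrier G" "?T a b \<in> carrier G" "?L a b \<in> carrier G" "?R a b \<in> carrier G"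
    if "a \<in> {0, 1}" "b \<in> {0, 1}" for a b
    using small_square_sides[OF fs[OF that]] dyadic_closed by blast+
  note [simp] = c[of 0 0, simplified] c[of 0 1, simplified] c[of 1 0, simplified] c[of 1 1, simplified]
  have law: "?B a b \<otimes> ?R a b = ?L a b \<otimes> ?T a b" if "a \<in> {0, 1}" "b \<in> {0, 1}" for a b
    using Suc.IH[OF fs[OF that]] .
  have "?B 0 0 \<otimes> ?B 1 0 \<otimes> (?R 1 0 \<otimes> ?R 1 1) = ?B 0 0 \<otimes> (?B 1 0 \<otimes> ?R 1 0) \<otimes> ?R 1 1" by (simp add: m_assoc)
  also have "\<dots> = ?B 0 0 \<otimes> (?R 0 0 \<otimes> ?T 1 0) \<otimes> ?R 1 1" using law[of 1 0] common by simp
  also have "\<dots> = (?B 0 0 \<otimes> ?R 0 0) \<otimes> (?T 1 0 \<otimes> ?R 1 1)" by (simp add: m_assoc)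
  also have "\<dots> = (?L 0 0 \<otimes> ?T 0 0) \<otimes> (?R 0 1 \<otimes> ?T 1 1)" using law[of 0 0] law[of 1 1] common by simp
  also have "\<dots> = ?L 0 0 \<otimes> (?T 0 0 \<otimes> ?R 0 1) \<otimes> ?T 1 1" by (simp add: m_assoc)
  also have "\<dots> = ?L 0 0 \<otimes> (?L 0 1 \<otimes> ?T 0 1) \<otimes> ?T 1 1" using law[of 0 1] common by simp
  also have "\<dots> = ?L 0 0 \<otimes> ?L 0 1 \<otimes> (?T 0 1 \<otimes> ?T 1 1)" by (simp add: m_assoc)
  finally show ?case by (simp add: sides)
qed

text \<open>A Lebesgue number of the cover pulled back to the compact square bounds the depth of the
  subdivision.\<close>

lemma small_square_exists:
  assumes H: "square_in X H" shows "\<exists>n. small_square n H"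
proof -
  let ?Q = "{0..1} \<times> {0..1} :: (real \<times> real) set"
  have "\<exists>T. open T \<and> {z \<in> ?Q. H z \<in> U} = ?Q \<inter> T" if "U \<in> \<U>" for U
    using openin_continuous_map_preimage[OF H open_cover(1)[OF that]] by (auto simp: openin_open)
  then have "\<forall>U\<in>\<U>. \<exists>T. open T \<and> {z \<in> ?Q. H z \<in> U} = ?Q \<inter> T" by (rule ballI)
  from bchoice[OF this] obtain T where "\<forall>U\<in>\<U>. open (T U) \<and> {z \<in> ?Q. H z \<in> U} = ?Q \<inter> T U" ..
  then have T: "\<And>U. U \<in> \<U> \<Longrightarrow> open (T U)" "\<And>U. U \<in> \<U> \<Longrightarrow> {z \<in> ?Q. H z \<in> U} = ?Q \<inter> T U"
    by simp_all
  have HQ: "H z \<in> topspace X" if "z \<in> ?Q" for z using H that by (auto simp: continuous_map_def)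
  have cov: "?Q \<subseteq> \<Union> (T ` \<U>)"
  proof
    fix z assume z: "z \<in> ?Q"
    then obtain U where "U \<in> \<U>" "H z \<in> U" using HQ open_cover(2) by blast
    then show "z \<in> \<Union> (T ` \<U>)" using T(2) z by blast
  qed
  have Q: "compact ?Q" by (intro compact_Times compact_Icc)
  obtain e where e: "e > 0" "\<And>z. z \<in> ?Q \<Longrightarrow> \<exists>G\<in>T ` \<U>. ball z e \<subseteq> G"
  proof (rule Heine_Borel_lemma[OF Q cov])
    show "open G" if "G \<in> T ` \<U>" for G using that T(1) by blast
  qed (rule that)
  \<comment> \<open>Here \<open>m\<close> is the depth already reached and \<open>(a, b)\<close> the
    position of the subsquare; after \<open>n\<close> further halvings its diameter is below the
    Lebesgue number \<open>e\<close>.\<close>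
  have main: "small_square n (\<lambda>z. H ((fst z + a) / 2 ^ m, (snd z + b) / 2 ^ m))"
    if "2 / 2 ^ (m + n) < e" "0 \<le> a" "a \<le> 2 ^ m - 1" "0 \<le> b" "b \<le> 2 ^ m - 1" for n m a b
    using that
  proof (induction n arbitrary: m a b)
    case 0
    let ?f = "\<lambda>z :: real \<times> real. ((fst z + a) / 2 ^ m, (snd z + b) / 2 ^ m)"
    have fQ: "?f z \<in> ?Q" if "z \<in> ?Q" for z
      using that 0 by (auto simp: field_simps)
    have "?f (0, 0) \<in> ?Q" by (rule fQ) simp
    then obtain U where U: "U \<in> \<U>" "ball (?f (0, 0)) e \<subseteq> T U" using e(2)[of "?f (0, 0)"] by auto
    have near: "?f z \<in> ball (?f (0, 0)) e" if "z \<in> ?Q" for z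
    proof -
      have "dist (?f (0, 0)) (?f z) \<le> dist (a / 2 ^ m) ((fst z + a) / 2 ^ m) + dist (b / 2 ^ m) ((snd z + b) / 2 ^ m)"
        unfolding dist_Pair_Pair by (simp add: sqrt_sum_squares_le_sum)
      also have "\<dots> = fst z / 2 ^ m + snd z / 2 ^ m"
        using that by (auto simp: dist_real_def diff_divide_distrib[symmetric] add_divide_distrib)
      also have "\<dots> \<le> 2 / 2 ^ m" using that by (auto simp: add_divide_distrib[symmetric] divide_right_mono)
      also have "\<dots> < e" using 0 by simp
      finally show ?thesis by simp
    qed
    have "H (?f z) \<in> U" if "z \<in> ?Q" for z
    proof -
      have "?f z \<in> T U" using near[OF that] U(2) by (rule_tac subsetD)
      then have "?f z \<in> {z \<in> ?Q. H z \<in> U}" unfolding T(2)[OF U(1)] using fQ[OF that] by simp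
      then show ?thesis by simp
    qed
    moreover have "square_in X (\<lambda>z. H (?f z))"
      by (rule square_in_compose[OF H]) (use fQ in \<open>auto intro!: continuous_intros\<close>)
    ultimately show ?case using U(1) by (auto simp: continuous_map_in_subtopology)
  next
    case (Suc n)
    have "small_square n (subsquare c d (\<lambda>z. H ((fst z + a) / 2 ^ m, (snd z + b) / 2 ^ m)))"
      if cd: "c \<in> {0, 1}" "d \<in> {0, 1}" for c d
    proof -
      have "small_square n (\<lambda>z. H ((fst z + (c + 2 * a)) / 2 ^ Suc m, (snd z + (d + 2 * b)) / 2 ^ Suc m))"
        using Suc.prems cd by (intro Suc.IH) auto
      also have "(\<lambda>z. H ((fst z + (c + 2 * a)) / 2 ^ Suc m, (snd z + (d + 2 * b)) / 2 ^ Suc m))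
         = subsquare c d (\<lambda>z. H ((fst z + a) / 2 ^ m, (snd z + b) / 2 ^ m))"
        by (simp add: subsquare_def field_simps)
      finally show ?thesis .
    qed
    then show ?case by simp
  qed
  obtain n where "2 / e < 2 ^ n" using real_arch_pow[of 2 "2 / e"] by auto
  then have "2 / 2 ^ n < e" using e(1) by (simp add: field_simps)
  from main[of 0 n 0 0] this show ?thesis by auto
qed

lemma small_path_exists:
  assumes "path_in X p" shows "\<exists>n. small_path n p"
proof -
  have "continuous_map (top_of_set ({0..1} \<times> {0..1})) (top_of_set {0..1}) (fst :: real \<times> real \<Rightarrow> real)"
    by (auto simp: continuous_map_in_subtopology intro!: continuous_intros)
  from small_square_exists[OF continuous_map_compose[OF this assms]]
  obtain n where n: "small_square n (p \<circ> fst)" ..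
  from small_square_sides[OF n] have "small_path n (\<lambda>s. (p \<circ> fst) (s, 0))" by simp
  then show ?thesis by auto
qed

definition glued :: "(real \<Rightarrow> 'x) \<Rightarrow> 'g" where
  "glued p = dyadic (LEAST n. small_path n p) p"

lemma glued_eq: "small_path n p \<Longrightarrow> glued p = dyadic n p"
  unfolding glued_def using dyadic_refine_le[of "LEAST n. small_path n p" p n] by (metis LeastI Least_le)

lemma dyadic_cong:
  "small_path n p \<Longrightarrow> (\<And>t. t \<in> {0..1} \<Longrightarrow> p t = q t) \<Longrightarrow> small_path n q \<and> dyadic n p = dyadic n q"
proof (induction n arbitrary: p q)
  case 0
  then obtain U where U: "U \<in> \<U>" "path_in (subtopology X U) p" by auto
  have "path_in (subtopology X U) q" by (rule path_in_eq[OF U(2) 0(2)])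
  then show ?case using transportD(2)[OF local[OF U(1)] U(2) 0(2)] U(1) by auto
next
  case (Suc n)
  have "small_path n (lower q) \<and> dyadic n (lower p) = dyadic n (lower q)"
    "small_path n (upper q) \<and> dyadic n (upper p) = dyadic n (upper q)"
    using Suc.prems by (auto intro!: Suc.IH simp: lower_def upper_def)
  then show ?case by simp
qed

theorem transport_glued: "transport G X glued"
  unfolding transport_def
proof (intro conjI allI impI)
  fix p q assume p: "path_in X p"
  obtain n where n: "small_path n p" using small_path_exists[OF p] by blast
  then have n1: "small_path (Suc n) p" using dyadic_refine by blast
  show "glued p \<in> carrier G" using glued_eq[OF n] dyadic_closed[OF n] by simp
  show "glued p = glued (lower p) \<otimes> glued (upper p)"
    using glued_eq[OF n1] n1 glued_eq[of n "lower p"] glued_eq[of n "upper p"] by simp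
  assume "\<forall>t\<in>{0..1}. p t = q t"
  then show "glued p = glued q" using dyadic_cong[OF n, of q] glued_eq[of n] n by metis
next
  fix H assume "square_in X H"
  then obtain n where n: "small_square n H" using small_square_exists by blast
  show "glued (\<lambda>s. H (s, 0)) \<otimes> glued (\<lambda>t. H (1, t)) = glued (\<lambda>t. H (0, t)) \<otimes> glued (\<lambda>s. H (s, 1))"
    using dyadic_square[OF n] small_square_sides[OF n] by (simp add: glued_eq[of n])
qed

lemma glued_local: "U \<in> \<U> \<Longrightarrow> path_in (subtopology X U) p \<Longrightarrow> glued p = \<omega> p"
  using glued_eq[of 0 p] by auto

text \<open>Serves to compare a given transport with one prescribed by a gauge, once they agree on
  the members of a cover.\<close>

lemma transport_unique:
  assumes "transport G X \<theta>" "\<And>U p. U \<in> \<U> \<Longrightarrow> path_in (subtopology X U) p \<Longrightarrow> \<theta> p = \<omega> p" "path_in X p"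
  shows "\<theta> p = glued p"
proof -
  have "small_path n p \<Longrightarrow> path_in X p \<Longrightarrow> \<theta> p = dyadic n p" for n p
  proof (induction n arbitrary: p)
    case 0
    then show ?case using assms(2) by auto
  next
    case (Suc n)
    then show ?case using transportD(3)[OF assms(1) Suc.prems(2)] path_in_lower[OF Suc.prems(2)]
        path_in_upper[OF Suc.prems(2)] by simp
  qed
  then show ?thesis using small_path_exists[OF assms(3)] glued_eq assms(3) by metis
qed

end

section \<open>Extending a transport over cells\<close>

context cell_attachment
begin

text \<open>On the collar the transport is pulled back along the retraction, on an open cell it is
  given by the gauge \<open>g\<close> extended radially. The assumption \<open>gauge\<close> is the
  agreement of the two on their overlap.\<close>

lemma extend_transport:
  fixes G :: "('g, 'm) monoid_scheme" and g :: "'i \<Rightarrow> (nat \<Rightarrow> real) \<Rightarrow> 'g"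
  assumes G: "group G" and \<theta>: "transport G A \<theta>"
    and g: "\<And>i y. i \<in> I \<Longrightarrow> y \<in> topspace (nsphere (n - 1)) \<Longrightarrow> g i y \<in> carrier G"
    and gauge: "\<And>i q. i \<in> I \<Longrightarrow> path_in (nsphere (n - 1)) q \<Longrightarrow> \<theta> (\<Phi> i \<circ> q) = inv\<^bsub>G\<^esub> g i (q 0) \<otimes>\<^bsub>G\<^esub> g i (q 1)"
  obtains \<theta>' \<gamma> where "transport G X \<theta>'" "\<And>p. path_in A p \<Longrightarrow> \<theta>' p = \<theta> p"
    "\<And>p. path_in (subtopology X collar) p \<Longrightarrow> \<theta>' p = \<theta> (retraction \<circ> p)"
    "\<And>i x. i \<in> I \<Longrightarrow> x \<in> cell i \<Longrightarrow> \<gamma> x \<in> carrier G"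
    "\<And>i y. i \<in> I \<Longrightarrow> y \<in> open_disc n - {\<lambda>_. 0} \<Longrightarrow> \<gamma> (\<Phi> i y) = g i (radial n y)"
    "\<And>i p. i \<in> I \<Longrightarrow> path_in (subtopology X (cell i)) p \<Longrightarrow> \<theta>' p = inv\<^bsub>G\<^esub> \<gamma> (p 0) \<otimes>\<^bsub>G\<^esub> \<gamma> (p 1)"
proof -
  \<comment> \<open>The centre of a cell lies outside the collar, so the value of
    \<open>\<gamma>\<close> there is a free choice.\<close>
  define \<gamma> where "\<gamma> x = (if snd (cell_of x) = (\<lambda>_. 0) then \<one>\<^bsub>G\<^esub> else g (fst (cell_of x)) (radial n (snd (cell_of x))))" for x
  define \<omega> where "\<omega> p = (if path_in (subtopology X collar) p then \<theta> (retraction \<circ> p)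
     else inv\<^bsub>G\<^esub> \<gamma> (p 0) \<otimes>\<^bsub>G\<^esub> \<gamma> (p 1))" for p
  interpret G: group G by fact
  have od: "y \<in> topspace (disc n)" if "y \<in> open_disc n" for y using that disc_eq[OF n_pos] by blast
  have \<gamma>_cell: "\<gamma> (\<Phi> i y) = g i (radial n y)" if "i \<in> I" "y \<in> open_disc n - {\<lambda>_. 0}" for i y
    using that cell_of by (simp add: \<gamma>_def)
  have \<gamma>_carrier: "\<gamma> x \<in> carrier G" if ix: "i \<in> I" "x \<in> cell i" for i x
  proof -
    obtain y where y: "y \<in> open_disc n" "x = \<Phi> i y" using ix(2) unfolding cell_def by (rule imageE)
    then show ?thesis using g[OF ix(1) radial_in_nsphere[OF n_pos od[OF y(1)]]] cell_of[OF ix(1) y(1)]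
      by (simp add: \<gamma>_def)
  qed
  have \<omega>_cell: "\<omega> p = inv\<^bsub>G\<^esub> \<gamma> (p 0) \<otimes>\<^bsub>G\<^esub> \<gamma> (p 1)" if i: "i \<in> I" and p: "path_in (subtopology X (cell i)) p" for i p
  proof (cases "path_in (subtopology X collar) p")
    case True
    define y where "y = snd \<circ> cell_of \<circ> p"
    have y: "path_in (subtopology (disc n) (open_disc n)) y"
      unfolding y_def by (rule continuous_map_compose[OF p continuous_map_cell_coordinate[OF i]])
    have py: "y t \<in> open_disc n - {\<lambda>_. 0} \<and> p t = \<Phi> i (y t)" if t: "t \<in> {0..1}" for t
    proof -
      have "p t \<in> cell i" "p t \<in> collar" using p True t by (auto simp: continuous_map_def)
      then obtain z where z: "z \<in> open_disc n" "p t = \<Phi> i z" by (auto simp: cell_def)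
      moreover have "z \<noteq> (\<lambda>_. 0)" using cell_collar_iff[OF i od[OF z(1)]] \<open>p t \<in> collar\<close> z by simp
      moreover have "y t = z" using cell_of[OF i z(1)] z(2) by (simp add: y_def)
      ultimately show ?thesis by simp
    qed
    have "path_in (subtopology (disc n) (topspace (disc n) - {\<lambda>_. 0})) y"
      using y py od by (auto simp: continuous_map_in_subtopology)
    then have q: "path_in (nsphere (n - 1)) (radial n \<circ> y)"
      using continuous_map_radial[OF n_pos] by (rule continuous_map_compose)
    have r: "retraction (p t) = (\<Phi> i \<circ> (radial n \<circ> y)) t" if "t \<in> {0..1}" for t
      using py[OF that] retraction_cell[OF i od] by simp
    have "path_in A (retraction \<circ> p)" using True continuous_map_retraction by (rule continuous_map_compose)
    then have "\<theta> (retraction \<circ> p) = \<theta> (\<Phi> i \<circ> (radial n \<circ> y))"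
      using r by (intro transportD(2)[OF \<theta>]) simp_all
    also have "\<dots> = inv\<^bsub>G\<^esub> g i (radial n (y 0)) \<otimes>\<^bsub>G\<^esub> g i (radial n (y 1))"
      using gauge[OF i q] by simp
    finally show ?thesis using True py[of 0] py[of 1] \<gamma>_cell[OF i] by (simp add: \<omega>_def)
  qed (simp add: \<omega>_def)
  have loc: "transport G (subtopology X collar) \<omega>"
    by (rule transport_cong[OF transport_pullback[OF \<theta> continuous_map_retraction]]) (simp add: \<omega>_def)
  have loc': "transport G (subtopology X (cell i)) \<omega>" if "i \<in> I" for i
    by (rule transport_cong[OF transport_gauge[OF G, of _ \<gamma>]])
      (use \<gamma>_carrier[OF that] \<omega>_cell[OF that] in auto)
  interpret local_transport G X "insert collar (cell ` I)" \<omega>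
  proof unfold_locales
    show "openin X U" if "U \<in> insert collar (cell ` I)" for U using that openin_collar openin_open_cell by blast
    show "topspace X \<subseteq> \<Union> (insert collar (cell ` I))" using cover by blast
    show "transport G (subtopology X U) \<omega>" if "U \<in> insert collar (cell ` I)" for U using that loc loc' by blast
  qed
  show thesis
  proof (rule that)
    show "transport G X glued" by (rule transport_glued)
    have c: "glued p = \<theta> (retraction \<circ> p)" if "path_in (subtopology X collar) p" for p
      using glued_local[OF _ that] that by (simp add: \<omega>_def)
    then show "glued p = \<theta> (retraction \<circ> p)" if "path_in (subtopology X collar) p" for p using that .
    show "glued p = \<theta> p" if p: "path_in A p" for p
    proof -
      have "path_in X p" using p subtopology_A by (metis continuous_map_in_subtopology)
      moreover have pA: "p t \<in> topspace A" if "t \<in> {0..1}" for t using p that by (auto simp: continuous_map_def)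
      ultimately have "path_in (subtopology X collar) p"
        using A_subset_collar by (auto simp: continuous_map_in_subtopology)
      then have "glued p = \<theta> (retraction \<circ> p)" by (rule c)
      also have "\<dots> = \<theta> p"
        using pA retraction_A by (intro transportD(2)[OF \<theta> p, symmetric]) simp
      finally show ?thesis .
    qed
    show "glued p = inv\<^bsub>G\<^esub> \<gamma> (p 0) \<otimes>\<^bsub>G\<^esub> \<gamma> (p 1)" if "i \<in> I" "path_in (subtopology X (cell i)) p" for i p
      using glued_local[OF _ that(2)] that(1) \<omega>_cell[OF that(1,2)] by simp
    show "\<gamma> x \<in> carrier G" if "i \<in> I" "x \<in> cell i" for i x using \<gamma>_carrier[OF that] .
    show "\<gamma> (\<Phi> i y) = g i (radial n y)" if "i \<in> I" "y \<in> open_disc n - {\<lambda>_. 0}" for i y using \<gamma>_cell[OF that] .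
  qed
qed

end

section \<open>Transports on spheres\<close>

text \<open>The arc of a great circle from \<open>y\<close> to \<open>z\<close>, obtained by
  normalising the chord. It is meant for points that are not antipodal, where the chord misses the
  origin.\<close>

definition sphere_arc :: "nat \<Rightarrow> (nat \<Rightarrow> real) \<Rightarrow> (nat \<Rightarrow> real) \<Rightarrow> real \<Rightarrow> nat \<Rightarrow> real" where
  "sphere_arc n y z t = radial n (\<lambda>i. (1 - t) * y i + t * z i)"

lemma radius_scale: "radius n (\<lambda>i. c * x i) = \<bar>c\<bar> * radius n x"
proof -
  have "(\<Sum>i<n. (c * x i)\<^sup>2) = c\<^sup>2 * (\<Sum>i<n. (x i)\<^sup>2)" by (simp add: power_mult_distrib sum_distrib_left)
  then show ?thesis by (simp add: radius_def real_sqrt_mult)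
qed

context
  fixes m n :: nat and Sp :: "(nat \<Rightarrow> real) set"
  defines "n \<equiv> Suc m" and "Sp \<equiv> topspace (nsphere m)"
begin

lemma Sp_iff: "x \<in> Sp \<longleftrightarrow> (\<forall>i\<ge>n. x i = 0) \<and> radius n x = 1"
  using topspace_nsphere_radius[of n] by (auto simp: n_def Sp_def)

lemma path_in_nsphere: "path_in (nsphere m) p \<longleftrightarrow> continuous_on {0..1} p \<and> p ` {0..1} \<subseteq> Sp"
proof -
  have "nsphere m = top_of_set Sp" unfolding Sp_def by (rule nsphere_euclidean)
  then show ?thesis by (auto simp: continuous_map_in_subtopology)
qed

lemma square_in_nsphere:
  "square_in (nsphere m) H \<longleftrightarrow> continuous_on ({0..1} \<times> {0..1}) H \<and> H ` ({0..1} \<times> {0..1}) \<subseteq> Sp"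
proof -
  have "nsphere m = top_of_set Sp" unfolding Sp_def by (rule nsphere_euclidean)
  then show ?thesis by (auto simp: continuous_map_in_subtopology)
qed

lemma radial_Sp: "(\<forall>i\<ge>n. x i = 0) \<Longrightarrow> radius n x \<noteq> 0 \<Longrightarrow> radial n x \<in> Sp"
  using radius_radial by (auto simp: Sp_iff radial_def)

lemma not_antipodal:
  assumes "y \<in> Sp" "z \<in> Sp" "z \<noteq> (\<lambda>i. - y i)" "t \<in> {0..1}"
  shows "radius n (\<lambda>i. (1 - t) * y i + t * z i) \<noteq> 0"
proof
  assume "radius n (\<lambda>i. (1 - t) * y i + t * z i) = 0"
  then have vanish: "(\<lambda>i. (1 - t) * y i + t * z i) = (\<lambda>_. 0)"
    using radius_zero_iff[of n "\<lambda>i. (1 - t) * y i + t * z i"] assms by (simp add: Sp_iff)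
  have 0: "(1 - t) * y i = (- t) * z i" for i using fun_cong[OF vanish, of i] by (simp add: eq_neg_iff_add_eq_0)
  then have "radius n (\<lambda>i. (1 - t) * y i) = radius n (\<lambda>i. (- t) * z i)" by simp
  then have "1 - t = t" using assms unfolding radius_scale by (simp add: Sp_iff)
  then have t: "t = 1 / 2" by simp
  have "z i = - y i" for i using 0[of i] unfolding t by simp
  then show False using assms(3) by blast
qed

lemma arc_in_Sp:
  assumes "y \<in> Sp" "z \<in> Sp" "z \<noteq> (\<lambda>i. - y i)" "t \<in> {0..1}" shows "sphere_arc n y z t \<in> Sp"
  unfolding sphere_arc_def using assms not_antipodal[OF assms] by (intro radial_Sp) (auto simp: Sp_iff)

lemma arc_ends: "y \<in> Sp \<Longrightarrow> sphere_arc n y z 0 = y" "z \<in> Sp \<Longrightarrow> sphere_arc n y z 1 = z"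
  by (auto simp: sphere_arc_def Sp_iff radial_unit)

lemma arc_constant: "y \<in> Sp \<Longrightarrow> sphere_arc n y y t = y"
  by (simp add: sphere_arc_def Sp_iff radial_unit algebra_simps)

lemma arc_square:
  assumes "y \<in> Sp" "continuous_on {0..1} p" "p ` {0..1} \<subseteq> Sp - {\<lambda>i. - y i}"
  shows "square_in (nsphere m) (\<lambda>(s, t). sphere_arc n y (p s) t)"
  unfolding square_in_nsphere
proof
  let ?Q = "{0..1} \<times> {0..1} :: (real \<times> real) set"
  have ne: "p s \<in> Sp \<and> p s \<noteq> (\<lambda>i. - y i)" if "s \<in> {0..1}" for s using assms(3) that by blast
  define h where "h z = (\<lambda>i. (1 - snd z) * y i + snd z * p (fst z) i)" for z :: "real \<times> real"
  have "continuous_on ?Q (\<lambda>z. p (fst z) i)" for i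
    by (rule continuous_on_compose2[OF continuous_on_coordinate[OF assms(2)] continuous_on_fst]) (auto intro: continuous_intros)
  then have h: "continuous_on ?Q h"
    unfolding h_def by (intro continuous_on_vector continuous_intros)
  have "continuous_on (h ` ?Q) (radial n)"
    by (intro continuous_on_radial) (use not_antipodal[OF assms(1)] ne in \<open>fastforce simp: h_def\<close>)
  from continuous_on_compose[OF h this]
  show "continuous_on ?Q (\<lambda>(s, t). sphere_arc n y (p s) t)" by (simp add: o_def h_def sphere_arc_def split_def)
  show "(\<lambda>(s, t). sphere_arc n y (p s) t) ` ?Q \<subseteq> Sp" using arc_in_Sp[OF assms(1)] ne by auto
qed

lemma path_in_arc:
  assumes "y \<in> Sp" "z \<in> Sp" "z \<noteq> (\<lambda>i. - y i)" shows "path_in (nsphere m) (sphere_arc n y z)"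
proof -
  have "(\<lambda>_. z) ` {0..1 :: real} \<subseteq> Sp - {\<lambda>i. - y i}" using assms by auto
  from square_sides(2)[OF arc_square[OF assms(1) continuous_on_const this]] show ?thesis by simp
qed

context
  fixes G :: "('g, 'm) monoid_scheme" and \<theta> :: "(real \<Rightarrow> nat \<Rightarrow> real) \<Rightarrow> 'g"
  assumes G: "group G" and \<theta>: "transport G (nsphere m) \<theta>"
begin

interpretation group G by (rule G)

text \<open>The arcs from \<open>c\<close> to the points of \<open>p\<close> sweep out a square
  whose sides are a constant path, the path \<open>p\<close> and the two outer arcs. Off the
  antipode of \<open>c\<close> the transport is therefore a gauge transport.\<close>

lemma hemisphere_gauge:
  assumes c: "c \<in> Sp" and p: "continuous_on {0..1} p" "p ` {0..1} \<subseteq> Sp - {\<lambda>i. - c i}"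
  shows "\<theta> p = inv\<^bsub>G\<^esub> \<theta> (sphere_arc n c (p 0)) \<otimes>\<^bsub>G\<^esub> \<theta> (sphere_arc n c (p 1))"
proof -
  have pt: "p t \<in> Sp \<and> p t \<noteq> (\<lambda>i. - c i)" if "t \<in> {0..1}" for t using p(2) that by blast
  have pp: "path_in (nsphere m) p" using p by (auto simp: path_in_nsphere)
  have cl: "\<theta> (sphere_arc n c (p t)) \<in> carrier G" if "t \<in> {0..1}" for t
    using transportD(1)[OF \<theta> path_in_arc[OF c]] pt[OF that] by blast
  have "\<theta> (\<lambda>s. sphere_arc n c (p s) 0) \<otimes>\<^bsub>G\<^esub> \<theta> (sphere_arc n c (p 1)) = \<theta> (sphere_arc n c (p 0)) \<otimes>\<^bsub>G\<^esub> \<theta> (\<lambda>s. sphere_arc n c (p s) 1)"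
    using transportD(4)[OF \<theta> arc_square[OF c p]] by simp
  moreover have "\<theta> (\<lambda>s. sphere_arc n c (p s) 0) = \<one>\<^bsub>G\<^esub>"
    using c by (intro transport_constant[OF G \<theta>, of c]) (auto simp: arc_ends Sp_def)
  moreover have "\<theta> (\<lambda>s. sphere_arc n c (p s) 1) = \<theta> p"
    using pt by (intro transportD(2)[OF \<theta> pp, symmetric]) (auto simp: arc_ends)
  ultimately show ?thesis using cl[of 0] cl[of 1] transportD(1)[OF \<theta> pp] by (simp add: inv_cancel_left)
qed

definition pole :: "real \<Rightarrow> nat \<Rightarrow> real" where
  "pole c = (\<lambda>i. if i = 0 then c else 0)"

lemma pole_Sp: "pole 1 \<in> Sp" "pole (- 1) \<in> Sp" "(\<lambda>i. - pole 1 i) = pole (- 1)" "(\<lambda>i. - pole (- 1) i) = pole 1"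
  by (auto simp: Sp_iff pole_def radius_def n_def fun_eq_iff sum.If_cases if_distrib[of "\<lambda>x. x\<^sup>2"] lessThan_Suc_eq_insert_0 image_iff cong: if_cong)

text \<open>The value of the transport along the meridian from one pole to the other through
  \<open>y\<close>. The gauges based at the two poles fit together precisely if this value does not
  depend on \<open>y\<close>.\<close>

definition polar :: "(nat \<Rightarrow> real) \<Rightarrow> 'g" where
  "polar y = \<theta> (sphere_arc n (pole 1) y) \<otimes>\<^bsub>G\<^esub> inv\<^bsub>G\<^esub> \<theta> (sphere_arc n (pole (- 1)) y)"

lemma gauge_closed:
  assumes "y \<in> Sp"
  shows "y \<noteq> pole (- 1) \<Longrightarrow> \<theta> (sphere_arc n (pole 1) y) \<in> carrier G" "y \<noteq> pole 1 \<Longrightarrow> \<theta> (sphere_arc n (pole (- 1)) y) \<in> carrier G"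
  using transportD(1)[OF \<theta> path_in_arc[of "pole 1" y]] transportD(1)[OF \<theta> path_in_arc[of "pole (- 1)" y]]
    pole_Sp assms by auto

lemma polar_path:
  fixes p :: "real \<Rightarrow> nat \<Rightarrow> real"
  assumes p: "continuous_on {0..1} p" "p ` {0..1} \<subseteq> Sp - {pole 1, pole (- 1)}"
  shows "polar (p 0) = polar (p 1)"
proof -
  have 1: "\<theta> p = inv\<^bsub>G\<^esub> \<theta> (sphere_arc n (pole 1) (p 0)) \<otimes>\<^bsub>G\<^esub> \<theta> (sphere_arc n (pole 1) (p 1))"
    by (rule hemisphere_gauge) (use p pole_Sp in auto)
  have 2: "\<theta> p = inv\<^bsub>G\<^esub> \<theta> (sphere_arc n (pole (- 1)) (p 0)) \<otimes>\<^bsub>G\<^esub> \<theta> (sphere_arc n (pole (- 1)) (p 1))"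
    by (rule hemisphere_gauge) (use p pole_Sp in auto)
  have pt: "p t \<in> Sp" "p t \<noteq> pole 1" "p t \<noteq> pole (- 1)" if "t \<in> {0..1}" for t
    using p(2) imageI[OF that, of p] by blast+
  note c = gauge_closed[OF pt(1)] pt
  have a: "inv\<^bsub>G\<^esub> x0 \<otimes>\<^bsub>G\<^esub> x1 = inv\<^bsub>G\<^esub> y0 \<otimes>\<^bsub>G\<^esub> y1 \<Longrightarrow> x0 \<otimes>\<^bsub>G\<^esub> inv\<^bsub>G\<^esub> y0 = x1 \<otimes>\<^bsub>G\<^esub> inv\<^bsub>G\<^esub> y1"
    if [simp]: "x0 \<in> carrier G" "x1 \<in> carrier G" "y0 \<in> carrier G" "y1 \<in> carrier G" for x0 x1 y0 y1
  proof -
    assume eq: "inv\<^bsub>G\<^esub> x0 \<otimes>\<^bsub>G\<^esub> x1 = inv\<^bsub>G\<^esub> y0 \<otimes>\<^bsub>G\<^esub> y1"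
    have "x1 = x0 \<otimes>\<^bsub>G\<^esub> (inv\<^bsub>G\<^esub> x0 \<otimes>\<^bsub>G\<^esub> x1)" by (simp add: inv_cancel_left')
    then have "x1 \<otimes>\<^bsub>G\<^esub> inv\<^bsub>G\<^esub> y1 = x0 \<otimes>\<^bsub>G\<^esub> (inv\<^bsub>G\<^esub> y0 \<otimes>\<^bsub>G\<^esub> y1) \<otimes>\<^bsub>G\<^esub> inv\<^bsub>G\<^esub> y1" using eq by simp
    then show ?thesis by (simp add: m_assoc)
  qed
  show ?thesis unfolding polar_def
    using 1 2 c[of 0] c[of 1] by (intro a) auto
qed

definition unit_vector :: "nat \<Rightarrow> real \<Rightarrow> nat \<Rightarrow> real" where
  "unit_vector j c = (\<lambda>i. if i = j then c else 0)"

lemma unit_vector_Sp: "j \<le> m \<Longrightarrow> \<bar>c\<bar> = 1 \<Longrightarrow> unit_vector j c \<in> Sp"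
  using power2_abs[of c]
  by (auto simp: Sp_iff unit_vector_def radius_def n_def sum.If_cases if_distrib[of "\<lambda>x. x\<^sup>2"] cong: if_cong)

text \<open>The condition keeps the chord off the axis through the poles, so the arc avoids both of
  them.\<close>

lemma polar_segment:
  assumes "y \<in> Sp" "z \<in> Sp" "\<And>t. t \<in> {0..1} \<Longrightarrow> \<exists>j\<ge>1. (1 - t) * y j + t * z j \<noteq> 0"
  shows "polar y = polar z"
proof -
  have "z \<noteq> (\<lambda>i. - y i)" using assms(3)[of "1 / 2"] by auto
  then have "path_in (nsphere m) (sphere_arc n y z)" and at: "\<And>t. t \<in> {0..1} \<Longrightarrow> sphere_arc n y z t \<in> Sp"
    using path_in_arc arc_in_Sp assms by blast+
  moreover have "sphere_arc n y z t \<noteq> pole c" if t: "t \<in> {0..1}" for t c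
  proof -
    obtain j where j: "j \<ge> 1" "(1 - t) * y j + t * z j \<noteq> 0" using assms(3)[OF t] by blast
    have "radius n (\<lambda>i. (1 - t) * y i + t * z i) \<noteq> 0"
      using not_antipodal[OF assms(1,2) \<open>z \<noteq> _\<close> t] .
    then have "sphere_arc n y z t j \<noteq> 0" using j by (simp add: sphere_arc_def radial_def)
    then show ?thesis using j(1) by (auto simp: pole_def)
  qed
  ultimately have "polar (sphere_arc n y z 0) = polar (sphere_arc n y z 1)"
    by (intro polar_path) (auto simp: path_in_nsphere)
  then show ?thesis using arc_ends assms(1,2) by simp
qed

lemma not_pole:
  assumes "y \<in> Sp" "y \<noteq> pole 1" "y \<noteq> pole (- 1)" shows "\<exists>j\<in>{1..m}. y j \<noteq> 0"
proof (rule ccontr)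
  assume "\<not> ?thesis"
  then have 0: "y j = 0" if "j \<ge> 1" for j using that assms(1) by (cases "j \<le> m") (auto simp: Sp_iff n_def)
  then have "y = pole (y 0)" by (auto simp: pole_def fun_eq_iff)
  moreover have "(\<Sum>i<n. (y i)\<^sup>2) = (y 0)\<^sup>2" unfolding n_def sum.lessThan_Suc_shift using 0 by simp
  then have "\<bar>y 0\<bar> = 1" using assms(1) by (simp add: Sp_iff radius_def)
  ultimately show False using assms by (metis abs_if minus_minus)
qed

lemma polar_unit_vector:
  assumes y: "y \<in> Sp" "y \<noteq> pole 1" "y \<noteq> pole (- 1)" and j: "1 \<le> j" "j \<le> m" and c: "\<bar>c\<bar> = 1" "c * y j \<ge> 0"
  shows "polar y = polar (unit_vector j c)"
proof (rule polar_segment[OF y(1) unit_vector_Sp[OF j(2) c(1)]])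
  fix t :: real assume t: "t \<in> {0..1}"
  show "\<exists>k\<ge>1. (1 - t) * y k + t * unit_vector j c k \<noteq> 0"
  proof (cases "t = 0")
    case True
    then show ?thesis using not_pole[OF y] by auto
  next
    case False
    have "c * ((1 - t) * y j + t * c) = (1 - t) * (c * y j) + t * (c * c)" by (simp add: algebra_simps)
    moreover have "c * c = 1" using c(1) by (auto simp: abs_if split: if_splits)
    moreover have "(1 - t) * (c * y j) \<ge> 0" using t c by simp
    ultimately have "c * ((1 - t) * y j + t * c) > 0" using False t by simp
    then have "(1 - t) * y j + t * unit_vector j c j \<noteq> 0" by (auto simp: unit_vector_def)
    then show ?thesis using j by blast
  qed
qed

lemma unit_vector_not_pole: "1 \<le> j \<Longrightarrow> \<bar>c\<bar> = 1 \<Longrightarrow> unit_vector j c \<noteq> pole b"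
  by (auto simp: unit_vector_def pole_def fun_eq_iff)

text \<open>For \<open>m \<ge> 2\<close> the sphere without its poles is connected. For
  \<open>m = 1\<close> it has two components, the two half circles, and the value of the full circle
  compares their meridians.\<close>

lemma polar_constant:
  assumes "m \<ge> 2 \<or> (m = 1 \<and> \<theta> circle_point = \<one>\<^bsub>G\<^esub>)"
    and y: "y \<in> Sp" "y \<noteq> pole 1" "y \<noteq> pole (- 1)"
  shows "polar y = polar (unit_vector 1 1)"
proof (cases "m \<ge> 2")
  case True
  define c where "c = (if y 2 \<ge> 0 then 1 else - 1 :: real)"
  have c: "\<bar>c\<bar> = 1" "c * y 2 \<ge> 0" by (auto simp: c_def)
  have "polar y = polar (unit_vector 2 c)" using True c by (intro polar_unit_vector y) auto
  \<comment> \<open>The first coordinate of \<open>unit_vector 2 c\<close> is zero, so the sign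
    condition for moving on to \<open>unit_vector 1 1\<close> holds trivially.\<close>
  also have "\<dots> = polar (unit_vector 1 1)"
    using True c unit_vector_Sp[of 2 c] unit_vector_not_pole[of 2 c]
    by (intro polar_unit_vector) (auto simp: unit_vector_def)
  finally show ?thesis .
next
  case False
  then have m: "m = 1" and circle: "\<theta> circle_point = \<one>\<^bsub>G\<^esub>" using assms(1) by auto
  have cS: "circle_point t \<in> Sp" for t
    by (simp add: Sp_iff n_def m circle_point_def radius_def numeral_2_eq_2)
  have "continuous_on A circle_point" for A
    unfolding circle_point_def by (intro continuous_on_vector continuous_on_if_constant continuous_intros)
  note cc = this
  have cp: "path_in (nsphere m) circle_point" using cS cc by (auto simp: path_in_nsphere)
  have quarter: "continuous_on {0..1} (\<lambda>t. circle_point ((t + a) / 4))" for a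
    by (rule continuous_on_compose2[OF cc[of UNIV]]) (auto intro!: continuous_intros)
  have coords: "circle_point ((t + 0) / 4) 0 = cos (pi * t / 2)" "circle_point ((t + 1) / 4) 0 = - sin (pi * t / 2)"
    "circle_point ((t + 2) / 4) 0 = - cos (pi * t / 2)" "circle_point ((t + 3) / 4) 0 = sin (pi * t / 2)" for t
  proof -
    have e: "2 * pi * ((t + 1) / 4) = pi * t / 2 + pi / 2" "2 * pi * ((t + 2) / 4) = pi * t / 2 + pi"
      "2 * pi * ((t + 3) / 4) = pi * t / 2 + pi / 2 + pi" by (simp_all add: field_simps)
    note trig_simps = refl if_True cos_add sin_add cos_pi sin_pi cos_pi_half sin_pi_half
    show "circle_point ((t + 0) / 4) 0 = cos (pi * t / 2)" by (simp add: circle_point_def)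
    show "circle_point ((t + 1) / 4) 0 = - sin (pi * t / 2)"
      unfolding circle_point_def e by (simp only: trig_simps; simp)
    show "circle_point ((t + 2) / 4) 0 = - cos (pi * t / 2)"
      unfolding circle_point_def e by (simp only: trig_simps; simp)
    show "circle_point ((t + 3) / 4) 0 = sin (pi * t / 2)"
      unfolding circle_point_def e by (simp only: trig_simps; simp)
  qed
  have trig: "cos (pi * t / 2) \<ge> 0" "sin (pi * t / 2) \<ge> 0" if "t \<in> {0..1}" for t
  proof -
    have "0 \<le> pi * t / 2" "pi * t / 2 \<le> pi / 2" using that mult_left_le[of t pi] by auto
    then show "cos (pi * t / 2) \<ge> 0" "sin (pi * t / 2) \<ge> 0"
      by (intro cos_ge_zero sin_ge_zero; linarith)+
  qed
  \<comment> \<open>The first and the last quarter of the circle avoid the pole at -1, the middle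
    two avoid the pole at 1. Each quarter is thus governed by the gauge of a single pole.\<close>
  have neq: "circle_point ((t + 0) / 4) \<noteq> pole (- 1)" "circle_point ((t + 1) / 4) \<noteq> pole 1"
    "circle_point ((t + 2) / 4) \<noteq> pole 1" "circle_point ((t + 3) / 4) \<noteq> pole (- 1)" if "t \<in> {0..1}" for t
  proof -
    have p: "pole 1 0 = 1" "pole (- 1) 0 = - 1" by (simp_all add: pole_def)
    show "circle_point ((t + 0) / 4) \<noteq> pole (- 1)" using coords(1)[of t] trig[OF that] p by auto
    show "circle_point ((t + 1) / 4) \<noteq> pole 1" using coords(2)[of t] trig[OF that] p by auto
    show "circle_point ((t + 2) / 4) \<noteq> pole 1" using coords(3)[of t] trig[OF that] p by auto
    show "circle_point ((t + 3) / 4) \<noteq> pole (- 1)" using coords(4)[of t] trig[OF that] p by auto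
  qed
  let ?c = "\<lambda>a t. circle_point ((t + a) / 4)"
  let ?u = "\<lambda>y. \<theta> (sphere_arc n (pole 1) y)" and ?w = "\<lambda>y. \<theta> (sphere_arc n (pole (- 1)) y)"
  let ?e = "unit_vector 1 1" and ?f = "unit_vector 1 (- 1)"
  have c0: "\<theta> (?c 0) = inv\<^bsub>G\<^esub> ?u (?c 0 0) \<otimes>\<^bsub>G\<^esub> ?u (?c 0 1)"
    by (rule hemisphere_gauge) (use quarter[of 0] pole_Sp neq cS in auto)
  have c1: "\<theta> (?c 1) = inv\<^bsub>G\<^esub> ?w (?c 1 0) \<otimes>\<^bsub>G\<^esub> ?w (?c 1 1)"
    by (rule hemisphere_gauge) (use quarter[of 1] pole_Sp neq cS in auto)
  have c2: "\<theta> (?c 2) = inv\<^bsub>G\<^esub> ?w (?c 2 0) \<otimes>\<^bsub>G\<^esub> ?w (?c 2 1)"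
    by (rule hemisphere_gauge) (use quarter[of 2] pole_Sp neq cS in auto)
  have c3: "\<theta> (?c 3) = inv\<^bsub>G\<^esub> ?u (?c 3 0) \<otimes>\<^bsub>G\<^esub> ?u (?c 3 1)"
    by (rule hemisphere_gauge) (use quarter[of 3] pole_Sp neq cS in auto)
  have three: "3 * pi / 2 = pi / 2 + pi" by simp
  have e: "cos (3 * pi / 2) = 0" "sin (3 * pi / 2) = - 1"
    unfolding three by (simp_all only: cos_add sin_add cos_pi sin_pi cos_pi_half sin_pi_half)
  have pts: "?c 0 0 = pole 1" "?c 0 1 = ?e" "?c 1 0 = ?e" "?c 1 1 = pole (- 1)" "?c 2 0 = pole (- 1)"
    "?c 2 1 = ?f" "?c 3 0 = ?f" "?c 3 1 = pole 1"
    unfolding circle_point_def by (simp_all add: e pole_def unit_vector_def fun_eq_iff)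
  have one: "?u (pole 1) = \<one>\<^bsub>G\<^esub>" "?w (pole (- 1)) = \<one>\<^bsub>G\<^esub>"
    using transport_constant[OF G \<theta>, of "pole 1"] transport_constant[OF G \<theta>, of "pole (- 1)"] pole_Sp
      arc_constant by (simp_all add: Sp_def)
  have eS: "?e \<in> Sp" "?f \<in> Sp" using unit_vector_Sp[of 1] m by auto
  define a1 a2 a3 a4 where a: "a1 = ?u ?e" "a2 = ?w ?e" "a3 = ?u ?f" "a4 = ?w ?f"
  have [simp]: "a1 \<in> carrier G" "a2 \<in> carrier G" "a3 \<in> carrier G" "a4 \<in> carrier G"
    unfolding a using gauge_closed[OF eS(1)] gauge_closed[OF eS(2)] unit_vector_not_pole[of 1 1]
      unit_vector_not_pole[of 1 "- 1"] by simp_all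
  have polar_a: "polar ?e = a1 \<otimes>\<^bsub>G\<^esub> inv\<^bsub>G\<^esub> a2" "polar ?f = a3 \<otimes>\<^bsub>G\<^esub> inv\<^bsub>G\<^esub> a4"
    by (simp_all only: polar_def a)
  have "\<theta> circle_point = \<theta> (lower (lower circle_point)) \<otimes>\<^bsub>G\<^esub> \<theta> (upper (lower circle_point)) \<otimes>\<^bsub>G\<^esub>
      (\<theta> (lower (upper circle_point)) \<otimes>\<^bsub>G\<^esub> \<theta> (upper (upper circle_point)))"
    using transportD(3)[OF \<theta> cp] transportD(3)[OF \<theta> path_in_lower[OF cp]] transportD(3)[OF \<theta> path_in_upper[OF cp]]
    by simp
  also have "lower (lower circle_point) = ?c 0" by (auto simp: lower_def)
  also have "upper (lower circle_point) = ?c 1" by (auto simp: lower_def upper_def)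
  also have "lower (upper circle_point) = ?c 2"
    by (auto simp: lower_def upper_def fun_eq_iff intro!: arg_cong2[of _ _ _ _ circle_point])
  also have "upper (upper circle_point) = ?c 3"
    by (auto simp: lower_def upper_def fun_eq_iff intro!: arg_cong2[of _ _ _ _ circle_point])
  finally have "inv\<^bsub>G\<^esub> \<one>\<^bsub>G\<^esub> \<otimes>\<^bsub>G\<^esub> a1 \<otimes>\<^bsub>G\<^esub> (inv\<^bsub>G\<^esub> a2 \<otimes>\<^bsub>G\<^esub> \<one>\<^bsub>G\<^esub>) \<otimes>\<^bsub>G\<^esub>
      (inv\<^bsub>G\<^esub> \<one>\<^bsub>G\<^esub> \<otimes>\<^bsub>G\<^esub> a4 \<otimes>\<^bsub>G\<^esub> (inv\<^bsub>G\<^esub> a3 \<otimes>\<^bsub>G\<^esub> \<one>\<^bsub>G\<^esub>)) = \<theta> circle_point"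
    unfolding c0 c1 c2 c3 pts one a[symmetric] by (rule sym)
  \<comment> \<open>The product of the four quarters is \<open>polar ?e\<close> times the inverse of
    \<open>polar ?f\<close>.\<close>
  then have "(a1 \<otimes>\<^bsub>G\<^esub> inv\<^bsub>G\<^esub> a2) \<otimes>\<^bsub>G\<^esub> inv\<^bsub>G\<^esub> (a3 \<otimes>\<^bsub>G\<^esub> inv\<^bsub>G\<^esub> a4) = \<one>\<^bsub>G\<^esub>"
    by (simp add: inv_mult_group circle)
  then have "inv\<^bsub>G\<^esub> (inv\<^bsub>G\<^esub> (a3 \<otimes>\<^bsub>G\<^esub> inv\<^bsub>G\<^esub> a4)) = a1 \<otimes>\<^bsub>G\<^esub> inv\<^bsub>G\<^esub> a2"
    by (intro inv_equality) simp_all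
  then have ef: "polar ?f = polar ?e" unfolding polar_a by simp
  show ?thesis
  proof (cases "y 1 \<ge> 0")
    case True
    then show ?thesis using m by (intro polar_unit_vector y) auto
  next
    case False
    then have "polar y = polar ?f" using m by (intro polar_unit_vector y) auto
    then show ?thesis using ef by simp
  qed
qed

lemma sphere_gauge:
  assumes "m \<ge> 2 \<or> (m = 1 \<and> \<theta> circle_point = \<one>\<^bsub>G\<^esub>)"
  obtains g where "\<And>y. y \<in> Sp \<Longrightarrow> g y \<in> carrier G"
    "\<And>p. path_in (nsphere m) p \<Longrightarrow> \<theta> p = inv\<^bsub>G\<^esub> g (p 0) \<otimes>\<^bsub>G\<^esub> g (p 1)"
proof -
  define \<kappa> where "\<kappa> = polar (unit_vector 1 1)"
  \<comment> \<open>The gauge based at \<open>pole 1\<close> fails only at the opposite pole. The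
    constant \<open>\<kappa>\<close> shifts the other gauge so that the two agree wherever both make
    sense.\<close>
  define g where "g y = (if y = pole (- 1) then \<kappa> \<otimes>\<^bsub>G\<^esub> \<theta> (sphere_arc n (pole (- 1)) y) else \<theta> (sphere_arc n (pole 1) y))" for y
  have "m \<ge> 1" using assms by auto
  have polar_closed: "polar y \<in> carrier G" if "y \<in> Sp" "y \<noteq> pole 1" "y \<noteq> pole (- 1)" for y
    using gauge_closed[OF that(1)] that by (simp add: polar_def)
  have \<kappa>: "\<kappa> \<in> carrier G"
    unfolding \<kappa>_def using unit_vector_Sp[of 1 1] \<open>m \<ge> 1\<close> unit_vector_not_pole[of 1 1] by (intro polar_closed) auto
  have gV: "g y = \<kappa> \<otimes>\<^bsub>G\<^esub> \<theta> (sphere_arc n (pole (- 1)) y)" if y: "y \<in> Sp" "y \<noteq> pole 1" for y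
  proof (cases "y = pole (- 1)")
    case False
    have "\<kappa> = polar y" unfolding \<kappa>_def using polar_constant[OF assms y False] by simp
    then show ?thesis using False gauge_closed[OF y(1)] y by (simp add: g_def polar_def m_assoc)
  qed (simp add: g_def)
  have pm: "pole 1 \<noteq> pole (- 1)" by (auto simp: pole_def fun_eq_iff)
  have g: "g y \<in> carrier G" if "y \<in> Sp" for y
    using gauge_closed[OF that] \<kappa> pm by (auto simp: g_def)
  let ?N = "nsphere m" and ?U = "{Sp - {pole (- 1)}, Sp - {pole 1}}"
  have op: "openin ?N (Sp - {x})" for x
  proof -
    have "?N = top_of_set Sp" unfolding Sp_def by (rule nsphere_euclidean)
    then show ?thesis by (simp add: openin_delete)
  qed
  interpret local_transport G ?N ?U \<theta>
  proof unfold_locales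
    show "openin ?N U" if "U \<in> ?U" for U using that op by blast
    show "topspace ?N \<subseteq> \<Union> ?U" using pm by (auto simp: Sp_def)
    show "transport G (subtopology ?N U) \<theta>" if "U \<in> ?U" for U
      using transport_pullback[OF \<theta>, of "subtopology ?N U" id] by (simp add: continuous_map_from_subtopology)
  qed
  have "\<theta> p = inv\<^bsub>G\<^esub> g (p 0) \<otimes>\<^bsub>G\<^esub> g (p 1)" if p: "path_in ?N p" for p
  proof -
    have "inv\<^bsub>G\<^esub> g (p 0) \<otimes>\<^bsub>G\<^esub> g (p 1) = glued p"
    proof (rule transport_unique[OF transport_gauge[OF G] _ p])
      show "x \<in> topspace ?N \<Longrightarrow> g x \<in> carrier G" for x using g by (simp add: Sp_def)
      fix U p assume U: "U \<in> ?U" and "path_in (subtopology ?N U) p"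
      then have p: "continuous_on {0..1} p" "p ` {0..1} \<subseteq> Sp" "p ` {0..1} \<subseteq> U"
        by (auto simp: continuous_map_in_subtopology path_in_nsphere)
      have pt: "p 0 \<in> Sp" "p 1 \<in> Sp" using p(2) by auto
      consider "U = Sp - {pole (- 1)}" | "U = Sp - {pole 1}" using U by blast
      then show "inv\<^bsub>G\<^esub> g (p 0) \<otimes>\<^bsub>G\<^esub> g (p 1) = \<theta> p"
      proof cases
        case 1
        have "p 0 \<in> p ` {0..1}" "p 1 \<in> p ` {0..1}" by auto
        then have "p 0 \<noteq> pole (- 1)" "p 1 \<noteq> pole (- 1)" using p(3) 1 by blast+
        then show ?thesis using hemisphere_gauge[OF pole_Sp(1) p(1)] p(3) 1 pole_Sp(3) by (simp add: g_def)
      next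
        case 2
        have "p 0 \<in> p ` {0..1}" "p 1 \<in> p ` {0..1}" by auto
        then have ne: "p 0 \<noteq> pole 1" "p 1 \<noteq> pole 1" using p(3) 2 by blast+
        have "\<theta> p = inv\<^bsub>G\<^esub> \<theta> (sphere_arc n (pole (- 1)) (p 0)) \<otimes>\<^bsub>G\<^esub> \<theta> (sphere_arc n (pole (- 1)) (p 1))"
          using hemisphere_gauge[OF pole_Sp(2) p(1)] p(3) 2 pole_Sp(4) by simp
        then show ?thesis
          using gV[OF pt(1) ne(1)] gV[OF pt(2) ne(2)] gauge_closed[OF pt(1)] gauge_closed[OF pt(2)] ne \<kappa>
          by (simp add: inv_mult_group m_assoc inv_cancel_left)
      qed
    qed
    moreover have "\<theta> p = glued p" by (rule transport_unique[OF \<theta> _ p]) simp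
    ultimately show ?thesis by simp
  qed
  with g that show thesis by blast
qed

end

end

section \<open>The second homology of a graph\<close>

context cell_attachment
begin

lemma cell_part_contractible:
  assumes i: "i \<in> I" and B: "B \<subseteq> open_disc n" and c: "c \<in> B"
    and star: "\<And>t y. t \<in> {0..1} \<Longrightarrow> y \<in> B \<Longrightarrow> (\<lambda>j. (1 - t) * y j + t * c j) \<in> B"
  shows "contractible_space (subtopology X (\<Phi> i ` B))"
proof -
  let ?Y = "subtopology X (\<Phi> i ` B)" and ?I = "top_of_set {0..1 :: real}"
  define coord where "coord = snd \<circ> cell_of"
  have coord: "coord (\<Phi> i y) = y" if "y \<in> B" for y using that B cell_of[OF i] by (auto simp: coord_def)
  have BD: "B \<subseteq> topspace (disc n)" using B disc_eq[OF n_pos] by blast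
  have cont_coord: "continuous_map ?Y (top_of_set B) coord"
  proof -
    have "?Y = subtopology (subtopology X (cell i)) (\<Phi> i ` B)"
      using B by (simp add: subtopology_subtopology cell_def Int_absorb1 image_mono)
    then have "continuous_map ?Y (subtopology (disc n) (open_disc n)) coord"
      unfolding coord_def using continuous_map_cell_coordinate[OF i] by (simp add: continuous_map_from_subtopology)
    then have "continuous_map ?Y (subtopology (disc n) B) coord"
      using coord by (auto simp: continuous_map_in_subtopology)
    then show ?thesis unfolding subtopology_disc[OF BD] .
  qed
  have cont_\<Phi>: "continuous_map (top_of_set B) ?Y (\<Phi> i)"
    using continuous_map_from_subtopology[OF characteristic_map[OF i], of B] unfolding subtopology_disc[OF BD]
    by (auto simp: continuous_map_in_subtopology)
  have cont_star: "continuous_map (prod_topology ?I (top_of_set B)) (top_of_set B) (\<lambda>(t, y) j. (1 - t) * y j + t * c j)"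
  proof -
    have "continuous_on ({0..1} \<times> B) (\<lambda>z. snd z j)" for j
      by (rule continuous_on_coordinate[OF continuous_on_snd[OF continuous_on_id]])
    then have "continuous_on ({0..1} \<times> B) (\<lambda>z. (\<lambda>j. (1 - fst z) * snd z j + fst z * c j))"
      by (intro continuous_on_vector continuous_on_add continuous_on_mult continuous_on_diff
          continuous_on_const continuous_on_fst continuous_on_id)
    then show ?thesis
      using star by (auto simp: prod_topology_subtopology_eu split_def)
  qed
  have pair: "continuous_map (prod_topology ?I ?Y) (prod_topology ?I (top_of_set B)) (\<lambda>(t, x). (t, coord x))"
    by (intro continuous_map_prod_top[THEN iffD2]) (use cont_coord in auto)
  define h where "h = \<Phi> i \<circ> (\<lambda>(t, y) j. (1 - t) * y j + t * c j) \<circ> (\<lambda>(t, x). (t, coord x))"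
  have "continuous_map (prod_topology ?I ?Y) ?Y h"
    unfolding h_def by (rule continuous_map_compose[OF pair continuous_map_compose[OF cont_star cont_\<Phi>]])
  moreover have "h (0, x) = x" if "x \<in> topspace ?Y" for x
    using that coord by (auto simp: h_def)
  moreover have "h (1, x) = \<Phi> i c" for x by (simp add: h_def)
  ultimately have "homotopic_with (\<lambda>_. True) ?Y ?Y id (\<lambda>_. \<Phi> i c)"
    by (subst homotopic_with) (auto intro!: exI[of _ h])
  then show ?thesis unfolding contractible_space_def by blast
qed

text \<open>The straight-line homotopy from the identity to the radial projection of the punctured
  disc.\<close>

definition push :: "real \<Rightarrow> (nat \<Rightarrow> real) \<Rightarrow> nat \<Rightarrow> real" where
  "push t y = (\<lambda>j. (1 - t) * y j + t * radial n y j)"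

lemma push_disc:
  assumes "t \<in> {0..1}" "y \<in> topspace (disc n) - {\<lambda>_. 0}"
  shows "push t y \<in> topspace (disc n) - {\<lambda>_. 0}"
proof -
  have y: "\<forall>i\<ge>n. y i = 0" "radius n y \<le> 1" "radius n y \<noteq> 0"
    using assms radius_zero_iff[of n y] by (auto simp: topspace_disc)
  have r: "radius n y > 0" using y(3) radius_nonneg[of n y] by simp
  have "push t y = (\<lambda>i. ((1 - t) + t / radius n y) * y i)"
    by (auto simp: push_def radial_def fun_eq_iff field_simps)
  then have "radius n (push t y) = \<bar>(1 - t) + t / radius n y\<bar> * radius n y" by (simp add: radius_scale)
  also have "\<bar>(1 - t) + t / radius n y\<bar> = (1 - t) + t / radius n y"
    using r assms by (intro abs_of_nonneg add_nonneg_nonneg) auto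
  also have "((1 - t) + t / radius n y) * radius n y = (1 - t) * radius n y + t"
    using r by (simp add: field_simps)
  finally have R: "radius n (push t y) = (1 - t) * radius n y + t" .
  have "(1 - t) * radius n y \<le> 1 - t" using assms y mult_left_mono[of "radius n y" 1 "1 - t"] by simp
  moreover have "(1 - t) * radius n y + t > 0"
    using assms r by (cases "t = 0") (auto intro: add_nonneg_pos)
  ultimately have "radius n (push t y) \<le> 1" "radius n (push t y) \<noteq> 0" using R by auto
  moreover have "\<forall>i\<ge>n. push t y i = 0" using y by (simp add: push_def radial_def)
  ultimately show ?thesis using radius_zero_iff[of n "push t y"] by (auto simp: topspace_disc)
qed

lemma continuous_map_push:
  defines "D \<equiv> topspace (disc n) - {\<lambda>_. 0}"
  shows "continuous_map (prod_topology (top_of_set {0..1}) (top_of_set D)) (top_of_set D) (\<lambda>(t, y). push t y)"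
proof -
  have "continuous_on D (radial n)"
    using radius_zero_iff by (intro continuous_on_radial) (auto simp: D_def topspace_disc)
  then have "continuous_on ({0..1} \<times> D) (\<lambda>z. radial n (snd z))"
    by (rule continuous_on_compose2[OF _ continuous_on_snd]) (auto intro: continuous_intros)
  then have "continuous_on ({0..1} \<times> D) (\<lambda>z. radial n (snd z) j)" for j
    by (rule continuous_on_coordinate)
  moreover have "continuous_on ({0..1} \<times> D) (\<lambda>z. snd z j)" for j
    by (rule continuous_on_coordinate[OF continuous_on_snd[OF continuous_on_id]])
  ultimately have "continuous_on ({0..1} \<times> D) (\<lambda>z. push (fst z) (snd z))"
    unfolding push_def by (intro continuous_on_vector continuous_on_add continuous_on_mult continuous_on_diff
          continuous_on_const continuous_on_fst continuous_on_id)
  then show ?thesis using push_disc by (auto simp: D_def prod_topology_subtopology_eu split_def)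
qed

definition collar_push :: "real \<Rightarrow> 'x \<Rightarrow> 'x" where
  "collar_push t x = (if x \<in> topspace A then x else \<Phi> (fst (cell_of x)) (push t (snd (cell_of x))))"

lemma collar_push_cell:
  assumes "i \<in> I" "y \<in> topspace (disc n) - {\<lambda>_. 0}"
  shows "collar_push t (\<Phi> i y) = \<Phi> i (push t y)"
proof (cases "y \<in> open_disc n")
  case True
  then show ?thesis using cell_open_disc[OF assms(1) True] cell_of[OF assms(1) True] by (simp add: collar_push_def)
next
  case False
  then have y: "y \<in> topspace (nsphere (n - 1))" using disc_eq[OF n_pos] assms by blast
  then have "radial n y = y" using radial_unit topspace_nsphere_radius[OF n_pos] by blast
  then have "push t y = y" by (auto simp: push_def fun_eq_iff algebra_simps)
  then show ?thesis using cell_nsphere[OF assms(1) y] by (simp add: collar_push_def)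
qed

lemma collarE:
  assumes "x \<in> collar" "x \<notin> topspace A"
  obtains i y where "i \<in> I" "y \<in> open_disc n" "y \<in> topspace (disc n) - {\<lambda>_. 0}" "x = \<Phi> i y"
proof -
  have "x \<in> topspace X" using assms by (simp add: collar_def)
  then obtain i y where x: "i \<in> I" "y \<in> open_disc n" "x = \<Phi> i y" using cell_exists assms(2) by blast
  then have "y \<in> topspace (disc n)" using disc_eq[OF n_pos] by blast
  then show thesis using that x cell_collar_iff[OF x(1)] assms(1) by blast
qed

lemma collar_push_collar:
  assumes "t \<in> {0..1}" "x \<in> collar" shows "collar_push t x \<in> collar"
proof (cases "x \<in> topspace A")
  case True
  then show ?thesis using assms by (simp add: collar_push_def)
next
  case False
  obtain i y where x: "i \<in> I" "y \<in> open_disc n" "y \<in> topspace (disc n) - {\<lambda>_. 0}" "x = \<Phi> i y"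
    by (rule collarE[OF assms(2) False])
  then show ?thesis using collar_push_cell[OF x(1,3)] push_disc[OF assms(1) x(3)] cell_collar_iff[OF x(1)] by auto
qed

text \<open>The topology of \<open>X\<close> is a quotient, and taking the product with an interval
  need not respect it visibly. At a point of \<open>A\<close> a neighbourhood is needed whose whole
  tracks stay in \<open>U\<close>; in each disc it is open because projection along the compact
  interval is a closed map.\<close>

lemma openin_push_invariant:
  assumes U: "openin X U"
  shows "openin X {x \<in> collar. \<forall>t\<in>{0..1}. collar_push t x \<in> U}"
  unfolding openin_iff
proof (intro conjI ballI)
  let ?W = "{x \<in> collar. \<forall>t\<in>{0..1}. collar_push t x \<in> U}"
  show "?W \<subseteq> topspace X" by (auto simp: collar_def)
  have "topspace A \<inter> ?W = topspace A \<inter> U"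
  proof (rule Set.set_eqI)
    fix x
    have "(\<forall>t\<in>{0..1}. collar_push t x \<in> U) \<longleftrightarrow> x \<in> U" if "x \<in> topspace A"
      using that by (simp add: collar_push_def) (use zero_le_one in blast)
    then show "x \<in> topspace A \<inter> ?W \<longleftrightarrow> x \<in> topspace A \<inter> U" using A_subset_collar by auto
  qed
  then show "openin A (topspace A \<inter> ?W)" using U openin_iff[of U] by simp
  fix i assume i: "i \<in> I"
  let ?D = "topspace (disc n) - {\<lambda>_. 0}" and ?I = "top_of_set {0..1 :: real}"
  have sub: "subtopology (disc n) ?D = top_of_set ?D" by (rule subtopology_disc) auto
  have "continuous_map (top_of_set ?D) X (\<Phi> i)"
    using continuous_map_from_subtopology[OF characteristic_map[OF i], of ?D] by (simp only: sub)
  then have "continuous_map (prod_topology ?I (top_of_set ?D)) X (\<Phi> i \<circ> (\<lambda>(t, y). push t y))"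
    by (rule continuous_map_compose[OF continuous_map_push])
  from openin_continuous_map_preimage[OF this U]
  have op: "openin (prod_topology ?I (top_of_set ?D)) {z \<in> {0..1} \<times> ?D. \<Phi> i (push (fst z) (snd z)) \<in> U}"
    by (simp add: split_def)
  let ?C = "{z \<in> {0..1} \<times> ?D. \<Phi> i (push (fst z) (snd z)) \<notin> U}"
  have "closedin (prod_topology ?I (top_of_set ?D)) ({0..1} \<times> ?D - {z \<in> {0..1} \<times> ?D. \<Phi> i (push (fst z) (snd z)) \<in> U})"
    using op by (intro closedin_diff) (auto simp: closedin_def)
  also have "{0..1} \<times> ?D - {z \<in> {0..1} \<times> ?D. \<Phi> i (push (fst z) (snd z)) \<in> U} = ?C" by auto
  finally have "closedin (prod_topology ?I (top_of_set ?D)) ?C" .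
  moreover have "closed_map (prod_topology ?I (top_of_set ?D)) (top_of_set ?D) snd"
    by (rule Abstract_Topological_Spaces.closed_map_snd) (simp add: compact_space_subtopology)
  ultimately have "closedin (top_of_set ?D) (snd ` ?C)" by (simp add: closed_map_def)
  then have "openin (top_of_set ?D) (?D - snd ` ?C)" by (simp add: openin_diff)
  then have "openin (subtopology (disc n) ?D) (?D - snd ` ?C)" by (simp only: sub)
  then have "openin (disc n) (?D - snd ` ?C)"
    by (rule openin_trans_full[OF _ openin_disc_punctured])
  also have "?D - snd ` ?C = {x \<in> topspace (disc n). \<Phi> i x \<in> ?W}"
  proof (rule Set.set_eqI)
    fix x
    show "x \<in> ?D - snd ` ?C \<longleftrightarrow> x \<in> {x \<in> topspace (disc n). \<Phi> i x \<in> ?W}"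
    proof (cases "x \<in> ?D")
      case True
      have "snd ` ?C = {y \<in> ?D. \<exists>t\<in>{0..1}. \<Phi> i (push t y) \<notin> U}" by (auto simp: image_iff)
      moreover have "\<Phi> i x \<in> collar" using cell_collar_iff[OF i] True by simp
      moreover have "collar_push t (\<Phi> i x) = \<Phi> i (push t x)" for t using collar_push_cell[OF i True] .
      ultimately show ?thesis using True by simp
    next
      case False
      then show ?thesis using cell_collar_iff[OF i, of x] by auto
    qed
  qed
  finally show "openin (disc n) {x \<in> topspace (disc n). \<Phi> i x \<in> ?W}" .
qed

text \<open>Continuity is checked pointwise: at points of \<open>A\<close> with the neighbourhoods
  of \<open>openin_push_invariant\<close>, at points of an open cell in the coordinates of that
  cell.\<close>

lemma collar_homotopy: "homotopic_with (\<lambda>_. True) (subtopology X collar) (subtopology X collar) id retraction"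
proof -
  let ?N = "subtopology X collar" and ?I = "top_of_set {0..1 :: real}"
  let ?h = "\<lambda>(t, x). collar_push t x"
  have cX: "collar \<subseteq> topspace X" and N: "topspace ?N = collar" by (auto simp: collar_def)
  have "continuous_map (prod_topology ?I ?N) X ?h"
    unfolding continuous_map_def
  proof (intro conjI allI impI)
    show "?h \<in> topspace (prod_topology ?I ?N) \<rightarrow> topspace X"
      using collar_push_collar by (auto simp: N collar_def)
    fix U assume U: "openin X U"
    let ?P = "{z \<in> topspace (prod_topology ?I ?N). ?h z \<in> U}"
    show "openin (prod_topology ?I ?N) ?P"
    proof (subst openin_subopen, intro ballI)
      fix z assume z: "z \<in> ?P"
      obtain t x where tx: "z = (t, x)" "t \<in> {0..1}" "x \<in> collar" "collar_push t x \<in> U"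
        using z N by (cases z) auto
      show "\<exists>T. openin (prod_topology ?I ?N) T \<and> z \<in> T \<and> T \<subseteq> ?P"
      proof (cases "x \<in> topspace A")
        case True
        let ?W = "{x \<in> collar. \<forall>t\<in>{0..1}. collar_push t x \<in> U}"
        have "openin ?N ?W"
          using openin_push_invariant[OF U] openin_open_subtopology[OF openin_collar] by auto
        then have "openin (prod_topology ?I ?N) ({0..1} \<times> ?W)" by (simp add: openin_prod_Times_iff)
        moreover have "z \<in> {0..1} \<times> ?W" using tx True by (simp add: collar_push_def)
        ultimately show ?thesis using cX by (intro exI[of _ "{0..1} \<times> ?W"]) auto
      next
        case False
        obtain i y where iy: "i \<in> I" "y \<in> open_disc n" "y \<in> topspace (disc n) - {\<lambda>_. 0}" "x = \<Phi> i y"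
          by (rule collarE[OF tx(3) False])
        let ?B = "open_disc n - {\<lambda>_. 0}" and ?D = "topspace (disc n) - {\<lambda>_. 0}"
        let ?V = "\<Phi> i ` ?B"
        have BD: "?B \<subseteq> topspace (disc n)" "?B \<subseteq> ?D" using disc_eq[OF n_pos] by auto
        have "openin (disc n) (open_disc n \<inter> ?D)"
          by (intro openin_Int openin_disc_open_disc openin_disc_punctured)
        also have "open_disc n \<inter> ?D = ?B" using disc_eq[OF n_pos] by auto
        finally have opV: "openin X ?V" by (intro openin_cell iy) auto
        have VN: "?V \<subseteq> collar" using cell_collar_iff[OF iy(1)] BD by auto
        have "subtopology X ?V = subtopology (subtopology X (cell i)) ?V"
          by (simp add: subtopology_subtopology cell_def Int_absorb1 image_mono)
        then have "continuous_map (subtopology X ?V) (subtopology (disc n) (open_disc n)) (snd \<circ> cell_of)"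
          using continuous_map_cell_coordinate[OF iy(1)] by (simp add: continuous_map_from_subtopology)
        then have "continuous_map (subtopology X ?V) (subtopology (disc n) ?D) (snd \<circ> cell_of)"
          using cell_of[OF iy(1)] BD by (auto simp: continuous_map_in_subtopology)
        then have co: "continuous_map (subtopology X ?V) (top_of_set ?D) (snd \<circ> cell_of)"
          by (subst subtopology_disc[symmetric]) auto
        have pair: "continuous_map (prod_topology ?I (subtopology X ?V)) (prod_topology ?I (top_of_set ?D))
            (\<lambda>(t, x). (t, snd (cell_of x)))"
          by (intro continuous_map_prod_top[THEN iffD2]) (use co[unfolded o_def] in auto)
        have "subtopology (disc n) ?D = top_of_set ?D" by (rule subtopology_disc) auto
        then have "continuous_map (top_of_set ?D) X (\<Phi> i)"
          using continuous_map_from_subtopology[OF characteristic_map[OF iy(1)], of ?D] by (simp only:)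
        from continuous_map_compose[OF pair continuous_map_compose[OF continuous_map_push this]]
        have c: "continuous_map (prod_topology ?I (subtopology X ?V)) X
          (\<Phi> i \<circ> (\<lambda>(t, y). push t y) \<circ> (\<lambda>(t, x). (t, snd (cell_of x))))" (is "continuous_map _ _ ?k") .
        have k: "?k (s, \<Phi> i y') = collar_push s (\<Phi> i y')" if "y' \<in> ?B" for s y'
          using that collar_push_cell[OF iy(1)] cell_of[OF iy(1)] BD by auto
        let ?T = "{w \<in> topspace (prod_topology ?I (subtopology X ?V)). ?k w \<in> U}"
        have T: "openin (prod_topology ?I (subtopology X ?V)) ?T"
          by (rule openin_continuous_map_preimage[OF c U])
        have sub: "prod_topology ?I (subtopology X ?V) = subtopology (prod_topology ?I ?N) ({0..1} \<times> ?V)"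
        proof -
          have "subtopology X ?V = subtopology ?N ?V" using VN by (simp add: subtopology_subtopology Int_absorb1)
          then show ?thesis using prod_topology_subtopology(2)[of ?I ?N ?V] by simp
        qed
        have "openin (prod_topology ?I ?N) ({0..1} \<times> ?V)"
          using opV VN openin_open_subtopology[OF openin_collar] by (simp add: openin_prod_Times_iff)
        with T have "openin (prod_topology ?I ?N) ?T"
          unfolding sub by (rule openin_trans_full)
        moreover have "z \<in> ?T" using tx iy k[of y t] opV openin_subset by (auto simp del: o_apply)
        moreover have "?T \<subseteq> ?P" using VN k by (auto simp: N simp del: o_apply)
        ultimately show ?thesis by blast
      qed
    qed
  qed
  then have "continuous_map (prod_topology ?I ?N) ?N ?h"
    using collar_push_collar by (auto simp: continuous_map_in_subtopology N)
  moreover have "?h (0, x) = x" if xc: "x \<in> collar" for x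
  proof (cases "x \<in> topspace A")
    case False
    obtain i y where "i \<in> I" "y \<in> open_disc n" "y \<in> topspace (disc n) - {\<lambda>_. 0}" "x = \<Phi> i y"
      by (rule collarE[OF xc False])
    then show ?thesis using collar_push_cell by (simp add: push_def)
  qed (simp add: collar_push_def)
  moreover have "?h (1, x) = retraction x" if xc: "x \<in> collar" for x
  proof (cases "x \<in> topspace A")
    case False
    obtain i y where "i \<in> I" "y \<in> open_disc n" "y \<in> topspace (disc n) - {\<lambda>_. 0}" "x = \<Phi> i y"
      by (rule collarE[OF xc False])
    then show ?thesis using collar_push_cell retraction_cell by (simp add: push_def)
  qed (simp add: collar_push_def retraction_def)
  ultimately show ?thesis by (subst homotopic_with) (auto intro!: exI[of _ ?h] simp: N)
qed

lemma collar_contractible: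
  assumes "topspace A = {v}" shows "contractible_space (subtopology X collar)"
proof -
  have "retraction x = v" if "x \<in> collar" for x using retraction_in_A[OF that] assms by simp
  then have "homotopic_with (\<lambda>_. True) (subtopology X collar) (subtopology X collar) id (\<lambda>_. v)"
    by (intro homotopic_with_eq[OF collar_homotopy]) auto
  then show ?thesis unfolding contractible_space_def by blast
qed

end

lemma trivial_homology_boundary:
  assumes "trivial_group (homology_group (int p) Y)" "singular_relcycle p Y {} c"
  shows "singular_relboundary p Y {} c"
proof -
  have "homologous_rel_set p Y {} c \<in> carrier (homology_group (int p) Y)"
    using assms(2) by (auto simp: carrier_relative_homology_group)
  then have "homologous_rel_set p Y {} c = singular_relboundary_set p Y {}"
    using assms(1) by (simp add: trivial_group_def)
  then show ?thesis using homologous_rel_set_eq_relboundary by blast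
qed

lemma trivial_homology_contractible:
  assumes "contractible_space Y" "p \<noteq> 0" shows "trivial_group (homology_group p Y)"
  using trivial_reduced_homology_group_contractible_space[OF assms(1), of p] un_reduced_homology_group[OF assms(2)]
  by metis

lemma trivial_homology_disjoint_union:
  assumes "pairwise disjnt \<U>" "\<Union> \<U> = topspace Y"
    and "\<And>V. V \<in> \<U> \<Longrightarrow> openin Y V \<and> contractible_space (subtopology Y V)" and "p \<noteq> 0"
  shows "trivial_group (homology_group p Y)"
proof -
  let ?SG = "sum_group \<U> (\<lambda>V. homology_group p (subtopology Y V))"
  have grp: "group (homology_group p (subtopology Y V))" for V by simp
  have triv: "carrier (homology_group p (subtopology Y V)) = {\<one>\<^bsub>homology_group p (subtopology Y V)\<^esub>}" if "V \<in> \<U>" for V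
    using trivial_homology_contractible[of "subtopology Y V" p] assms(3)[OF that] assms(4)
    by (simp add: trivial_group_def)
  have "carrier ?SG \<subseteq> {\<one>\<^bsub>?SG\<^esub>}"
  proof
    fix x assume "x \<in> carrier ?SG"
    then have "x \<in> (\<Pi>\<^sub>E V\<in>\<U>. carrier (homology_group p (subtopology Y V)))"
      by (simp add: carrier_sum_group)
    then have "x = (\<lambda>V\<in>\<U>. \<one>\<^bsub>homology_group p (subtopology Y V)\<^esub>)"
      using triv by (auto simp: PiE_iff extensional_def fun_eq_iff)
    then show "x \<in> {\<one>\<^bsub>?SG\<^esub>}" by simp
  qed
  then have SG: "trivial_group ?SG"
    using group.is_monoid[of ?SG] monoid.one_closed[of ?SG] by (auto simp: trivial_group_def)
  have "?SG \<cong> homology_group p Y"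
    using homology_additivity_axiom[OF assms(1,2), of p] assms(3) unfolding is_iso_def by blast
  then show ?thesis using SG isomorphic_group_triviality by (metis group_relative_homology_group grp sum_group)
qed

lemma open_disc_1_nonzero: "y \<in> open_disc 1 \<Longrightarrow> y 0 = 0 \<longleftrightarrow> y = (\<lambda>_. 0)"
  by (auto simp: open_disc_radius fun_eq_iff) (metis One_nat_def Suc_leI bot_nat_0.not_eq_extremum)

lemma open_disc_1_iff: "y \<in> open_disc 1 \<longleftrightarrow> (\<forall>j\<ge>1. y j = 0) \<and> \<bar>y 0\<bar> < 1"
  by (simp add: open_disc_radius radius_def)

context cell_attachment
begin

text \<open>A Mayer-Vietoris argument on chains. The collar is a contractible neighbourhood of the
  vertex, the complement \<open>W\<close> of the vertex is a disjoint union of open intervals, and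
  their intersection \<open>L\<close> is a disjoint union of half intervals.\<close>

lemma graph_second_homology:
  assumes A: "topspace A = {v}" and n: "n = 1" and z: "singular_relcycle 2 X {} z"
  shows "singular_relboundary 2 X {} z"
proof -
  let ?N = "subtopology X collar"
  define W where "W = topspace X - {v}"
  define L where "L = collar - {v}"
  have vX: "v \<in> collar" using A A_subset_collar by auto
  have cX: "collar \<subseteq> topspace X" by (auto simp: collar_def)
  have closed: "closedin X {v}" using closedin_X_A A by simp
  have star: "(\<lambda>j. (1 - t) * y j + t * c j) \<in> open_disc n"
    if "t \<in> {0..1}" "y \<in> open_disc n" "c \<in> open_disc n" for t y c
  proof -
    have "\<bar>(1 - t) * y 0 + t * c 0\<bar> \<le> (1 - t) * \<bar>y 0\<bar> + t * \<bar>c 0\<bar>"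
      using that(1) abs_triangle_ineq[of "(1 - t) * y 0" "t * c 0"] by (simp add: abs_mult)
    also have "\<dots> < 1"
      using that unfolding n open_disc_1_iff by (intro convex_bound_lt) auto
    finally show ?thesis using that(2,3) unfolding n open_disc_1_iff by auto
  qed
  have disj: "disjnt (\<Phi> i ` B) (\<Phi> j ` C)"
    if "i \<in> I" "j \<in> I" "B \<subseteq> open_disc n" "C \<subseteq> open_disc n" "i \<noteq> j \<or> B \<inter> C = {}" for i j B C
    unfolding disjnt_def
  proof (rule ccontr)
    assume "\<Phi> i ` B \<inter> \<Phi> j ` C \<noteq> {}"
    then obtain x y where "x \<in> B" "y \<in> C" "\<Phi> i x = \<Phi> j y" by auto
    then have "i = j \<and> x = y" using cell_inj that(1-4) by (metis subsetD)
    then show False using that(5) \<open>x \<in> B\<close> \<open>y \<in> C\<close> by blast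
  qed
  have H2W: "trivial_group (homology_group (int 2) (subtopology X W))"
  proof (rule trivial_homology_disjoint_union[where \<U> = "cell ` I"])
    have "topspace X - topspace A = (\<Union>i\<in>I. cell i)"
      using cell_open_disc cell_exists by (auto simp: cell_def) (metis DiffI imageI)
    then have WU: "W = \<Union> (cell ` I)" using A by (simp add: W_def)
    then show "\<Union> (cell ` I) = topspace (subtopology X W)" by (auto simp: W_def)
    show "pairwise disjnt (cell ` I)"
      unfolding pairwise_image by (auto simp: pairwise_def cell_def intro!: disj)
    show "openin (subtopology X W) V \<and> contractible_space (subtopology (subtopology X W) V)" if V: "V \<in> cell ` I" for V
    proof -
      obtain i where i: "i \<in> I" "V = cell i" using V by auto
      have "V \<subseteq> W" using WU V by auto
      then have "openin (subtopology X W) V"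
        using openin_open_cell[OF i(1)] i(2) by (simp add: openin_subset_topspace_eq openin_subtopology) (use openin_open_cell[OF i(1)] i(2) in blast)
      moreover have "contractible_space (subtopology X (\<Phi> i ` open_disc n))"
        using zero_in_open_disc star by (intro cell_part_contractible[OF i(1)]) auto
      ultimately show ?thesis using \<open>V \<subseteq> W\<close> i(2) by (simp add: subtopology_subtopology Int_absorb1 cell_def)
    qed
  qed simp
  \<comment> \<open>The sign \<open>b\<close> selects one of the two components that remain of an
    open edge without its midpoint.\<close>
  define half where "half b i = \<Phi> i ` {y \<in> open_disc n. b * y 0 > 0}" for b :: real and i
  have H1L: "trivial_group (homology_group (int 1) (subtopology X L))"
  proof (rule trivial_homology_disjoint_union[where \<U> = "half 1 ` I \<union> half (- 1) ` I"])
    have L_eq: "L = \<Union> (half 1 ` I \<union> half (- 1) ` I)"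
    proof (intro equalityI subsetI)
      fix x assume "x \<in> L"
      then have "x \<in> collar" "x \<notin> topspace A" using A by (auto simp: L_def)
      then obtain i y where iy: "i \<in> I" "y \<in> open_disc n" "y \<in> topspace (disc n) - {\<lambda>_. 0}" "x = \<Phi> i y" by (rule collarE)
      then have "y 0 \<noteq> 0" using open_disc_1_nonzero[of y] n by auto
      then show "x \<in> \<Union> (half 1 ` I \<union> half (- 1) ` I)" using iy by (force simp: half_def)
    next
      fix x assume "x \<in> \<Union> (half 1 ` I \<union> half (- 1) ` I)"
      then obtain i y where iy: "i \<in> I" "y \<in> open_disc n" "y 0 \<noteq> 0" "x = \<Phi> i y" by (auto simp: half_def)
      then have "y \<in> topspace (disc n)" "y \<noteq> (\<lambda>_. 0)" using disc_eq[OF n_pos] by auto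
      then show "x \<in> L" using iy cell_collar_iff[OF iy(1)] cell_open_disc[OF iy(1,2)] A by (simp add: L_def)
    qed
    then show "\<Union> (half 1 ` I \<union> half (- 1) ` I) = topspace (subtopology X L)" using cX by (auto simp: L_def)
    show "pairwise disjnt (half 1 ` I \<union> half (- 1) ` I)"
    proof (rule pairwiseI)
      fix V V' assume V: "V \<in> half 1 ` I \<union> half (- 1) ` I" "V' \<in> half 1 ` I \<union> half (- 1) ` I" "V \<noteq> V'"
      obtain b i where bi: "b \<in> {1, - 1}" "i \<in> I" "V = half b i" using V(1) by auto
      obtain c j where cj: "c \<in> {1, - 1}" "j \<in> I" "V' = half c j" using V(2) by auto
      have "i \<noteq> j \<or> b \<noteq> c" using bi cj V(3) by auto
      then show "disjnt V V'" unfolding bi cj half_def using bi(1,2) cj(1,2) by (intro disj) auto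
    qed
    show "openin (subtopology X L) V \<and> contractible_space (subtopology (subtopology X L) V)"
      if V: "V \<in> half 1 ` I \<union> half (- 1) ` I" for V
    proof -
      obtain b i where bi: "b \<in> {1, - 1}" "i \<in> I" "V = half b i" using V by auto
      have VL: "V \<subseteq> L" using V L_eq by auto
      have "openin (top_of_set (topspace (disc n))) (topspace (disc n) \<inter> (\<lambda>y. b * y 0) -` {0<..})"
        by (intro continuous_openin_preimage_gen continuous_on_mult continuous_on_const
            continuous_on_subset[OF continuous_on_product_coordinates subset_UNIV]) auto
      then have "openin (disc n) (topspace (disc n) \<inter> (\<lambda>y. b * y 0) -` {0<..})" using disc_euclidean[of n] by simp
      then have "openin (disc n) (open_disc n \<inter> (topspace (disc n) \<inter> (\<lambda>y. b * y 0) -` {0<..}))"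
        by (rule openin_Int[OF openin_disc_open_disc])
      also have "open_disc n \<inter> (topspace (disc n) \<inter> (\<lambda>y. b * y 0) -` {0<..}) = {y \<in> open_disc n. b * y 0 > 0}"
        using disc_eq[OF n_pos] by auto
      finally have "openin X V" unfolding bi(3) half_def by (intro openin_cell bi) auto
      then have "openin (subtopology X L) V" using VL by (auto simp: openin_subtopology)
      moreover have "contractible_space (subtopology X (\<Phi> i ` {y \<in> open_disc n. b * y 0 > 0}))"
      proof (rule cell_part_contractible[OF bi(2), where c = "\<lambda>j. if j = 0 then b / 2 else 0"])
        show c: "(\<lambda>j. if j = 0 then b / 2 else 0) \<in> {y \<in> open_disc n. b * y 0 > 0}"
          using bi(1) unfolding n open_disc_1_iff by auto
        fix t y assume t: "t \<in> {0..1 :: real}" and y: "y \<in> {y \<in> open_disc n. b * y 0 > 0}"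
        have "b * ((1 - t) * y 0 + t * (b / 2)) = (1 - t) * (b * y 0) + t * (b * (b / 2))" by (simp add: algebra_simps)
        also have "b * (b / 2) = 1 / 2" using bi(1) by auto
        also have "(1 - t) * (b * y 0) + t * (1 / 2) > 0"
        proof (cases "t = 0")
          case False
          have "(1 - t) * (b * y 0) \<ge> 0" by (rule mult_nonneg_nonneg) (use t y in auto)
          then show ?thesis using False t by (intro add_nonneg_pos) auto
        qed (use y in simp)
        finally show "(\<lambda>j. (1 - t) * y j + t * (if j = 0 then b / 2 else 0)) \<in> {y \<in> open_disc n. b * y 0 > 0}"
          using star[OF t, of y "\<lambda>j. if j = 0 then b / 2 else 0"] y c by simp
      qed auto
      ultimately show ?thesis using VL bi(3) by (simp add: subtopology_subtopology Int_absorb1 half_def)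
    qed
  qed simp
  have H2N: "trivial_group (homology_group (int 2) ?N)"
    using collar_contractible[OF A] by (intro trivial_homology_contractible) auto
  have "singular_relcycle 2 (subtopology X (topspace X)) collar z"
    using z unfolding singular_cycle by (simp add: singular_relcycle)
  moreover have "X closure_of {v} \<subseteq> X interior_of collar"
    using closed vX openin_collar by (simp add: closure_of_closedin interior_of_openin)
  ultimately obtain c' where c': "singular_relcycle 2 (subtopology X W) L c'" "homologous_rel 2 X collar z c'"
    using excised_relcycle_exists[of X "{v}" collar "topspace X" 2 z] cX by (auto simp: W_def L_def)
  have WL: "W \<inter> L = L" using cX by (auto simp: W_def L_def)
  have c'_chain: "singular_chain 2 (subtopology X W) c'" and bc': "singular_chain 1 (subtopology X L) (chain_boundary 2 c')"
    using c'(1) by (simp_all add: singular_relcycle subtopology_subtopology WL)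
  have "singular_relcycle 1 (subtopology X L) {} (chain_boundary 2 c')"
    using bc' chain_boundary_boundary[OF c'_chain] by (simp add: singular_cycle)
  \<comment> \<open>Subtracting a filling of the boundary inside \<open>L\<close> turns
    \<open>c'\<close> into a cycle of \<open>W\<close>, where cycles bound. What remains of
    \<open>z\<close> is a boundary plus a cycle of the contractible collar.\<close>
  from trivial_homology_boundary[OF H1L this] obtain b where
    b: "singular_chain 2 (subtopology X L) b" "chain_boundary 2 b = chain_boundary 2 c'"
    by (auto simp: singular_boundary numeral_2_eq_2)
  have bW: "singular_chain 2 (subtopology X W) b"
    by (rule singular_chain_mono[OF b(1)]) (use WL in auto)
  have "singular_relcycle 2 (subtopology X W) {} (c' - b)"
    using c'_chain bW b(2) by (simp add: singular_cycle singular_chain_diff chain_boundary_diff)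
  from trivial_homology_boundary[OF H2W this] have "singular_relboundary 2 (subtopology X (topspace X)) {} (c' - b)"
    by (rule singular_boundary_mono[rotated]) (auto simp: W_def)
  then have 1: "singular_relboundary 2 X {} (c' - b)" by simp
  obtain w y where wy: "singular_chain 3 X w" "singular_chain 2 ?N y" "chain_boundary 3 w + y = z - c'"
    using c'(2) by (auto simp: homologous_rel_def singular_relboundary eval_nat_numeral)
  have 2: "singular_relboundary 2 X {} (chain_boundary 3 w)"
    using wy(1) by (auto simp: singular_boundary eval_nat_numeral)
  have bN: "singular_chain 2 ?N b" by (rule singular_chain_mono[OF b(1)]) (auto simp: L_def)
  have "chain_boundary 2 (chain_boundary 3 w) = 0" using chain_boundary_boundary[OF wy(1)] by simp
  then have "chain_boundary 2 (y + b) = 0"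
    using arg_cong[OF wy(3), of "chain_boundary 2"] b(2) z by (simp add: chain_boundary_add chain_boundary_diff singular_cycle)
  then have "singular_relcycle 2 ?N {} (y + b)"
    using wy(2) bN by (simp add: singular_cycle singular_chain_add)
  from trivial_homology_boundary[OF H2N this] have "singular_relboundary 2 (subtopology X (topspace X)) {} (y + b)"
    by (rule singular_boundary_mono[OF cX])
  then have 3: "singular_relboundary 2 X {} (y + b)" by simp
  have "z = chain_boundary 3 w + (c' - b) + (y + b)" using wy(3) by (simp add: algebra_simps)
  then show ?thesis by (simp only: singular_relboundary_add 1 2 3)
qed

end

section \<open>Weak unions\<close>

locale weak_union =
  fixes F :: "nat \<Rightarrow> 'x topology" and X :: "'x topology"
  assumes closed_stage: "\<And>k C. closedin (F k) C \<Longrightarrow> closedin (F (Suc k)) C"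
    and stage_subset: "\<And>k. topspace (F k) \<subseteq> topspace (F (Suc k))"
    and stage_subtopology: "\<And>k. subtopology (F (Suc k)) (topspace (F k)) = F k"
    and t1: "\<And>k. t1_space (F k)"
    and union: "topspace X = (\<Union>k. topspace (F k))"
    and openin_union: "\<And>U. openin X U \<longleftrightarrow> U \<subseteq> topspace X \<and> (\<forall>k. openin (F k) (topspace (F k) \<inter> U))"
begin

lemma stage_mono: "k \<le> l \<Longrightarrow> topspace (F k) \<subseteq> topspace (F l)"
  by (rule lift_Suc_mono_le[of "\<lambda>k. topspace (F k)"]) (rule stage_subset)

lemma closed_mono: "k \<le> l \<Longrightarrow> closedin (F k) C \<Longrightarrow> closedin (F l) C"
  by (induction rule: dec_induct) (auto intro: closed_stage)

lemma subtopology_stage: "k \<le> l \<Longrightarrow> subtopology (F l) (topspace (F k)) = F k"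
proof (induction l rule: dec_induct)
  case base
  then show ?case by simp
next
  case (step l)
  have "subtopology (F (Suc l)) (topspace (F k)) = subtopology (subtopology (F (Suc l)) (topspace (F l))) (topspace (F k))"
    using stage_mono[OF step(1)] by (simp only: subtopology_subtopology Int_absorb1)
  also have "\<dots> = F k" using step.IH by (simp only: stage_subtopology)
  finally show ?case .
qed

lemma closedin_union: "closedin X C \<longleftrightarrow> C \<subseteq> topspace X \<and> (\<forall>k. closedin (F k) (topspace (F k) \<inter> C))"
proof (cases "C \<subseteq> topspace X")
  case True
  have "topspace (F k) \<inter> (topspace X - C) = topspace (F k) - (topspace (F k) \<inter> C)" for k using union by auto
  then show ?thesis using True unfolding closedin_def[of X] openin_union by (auto simp: closedin_def[of "F _"])
qed (auto simp: closedin_def)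

lemma closedin_stage:
  assumes "closedin (F k) C" shows "closedin X C"
  unfolding closedin_union
proof (intro conjI allI)
  have C: "C \<subseteq> topspace (F k)" using assms closedin_subset by blast
  then show "C \<subseteq> topspace X" using union by blast
  fix l
  show "closedin (F l) (topspace (F l) \<inter> C)"
  proof (cases "k \<le> l")
    case True
    then have "topspace (F l) \<inter> C = C" using C stage_mono by blast
    then show ?thesis using closed_mono[OF True assms] by simp
  next
    case False
    then have lk: "l \<le> k" by simp
    have "closedin (subtopology (F k) (topspace (F l))) (topspace (F l) \<inter> C)"
      using assms by (auto simp: closedin_subtopology)
    then show ?thesis unfolding subtopology_stage[OF lk] .
  qed
qed

lemma subtopology_X: "subtopology X (topspace (F k)) = F k"
proof -
  have clX: "closedin X (topspace (F k))" using closedin_stage closedin_topspace by blast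
  have "closedin (subtopology X (topspace (F k))) C \<longleftrightarrow> closedin (F k) C" for C
  proof
    assume "closedin (subtopology X (topspace (F k))) C"
    then have "closedin X C" "C \<subseteq> topspace (F k)" using closedin_closed_subtopology[OF clX] by blast+
    then show "closedin (F k) C" using closedin_union[of C] by (metis Int_absorb1)
  next
    assume "closedin (F k) C"
    then show "closedin (subtopology X (topspace (F k))) C"
      using closedin_closed_subtopology[OF clX] closedin_stage closedin_subset by blast
  qed
  moreover have "topspace (subtopology X (topspace (F k))) = topspace (F k)" using union by auto
  ultimately show ?thesis unfolding topology_eq openin_closedin_eq by simp
qed

text \<open>Points chosen outside the successive stages meet every stage in a finite set, so all
  sets of such points are closed. They would form an infinite closed discrete subset of a compact
  set.\<close>

lemma compact_in_stage:
  assumes "compactin X C" shows "\<exists>k. C \<subseteq> topspace (F k)"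
proof (rule ccontr)
  assume "\<not> ?thesis"
  then have "\<forall>k. \<exists>x. x \<in> C - topspace (F k)" by blast
  then obtain x where x: "\<And>k. x k \<in> C - topspace (F k)" by metis
  have CX: "C \<subseteq> topspace X" using assms compactin_subset_topspace by blast
  have closed: "closedin X B" if B: "B \<subseteq> range x" for B
    unfolding closedin_union
  proof (intro conjI allI)
    show "B \<subseteq> topspace X" using B x CX by blast
    fix k
    have "topspace (F k) \<inter> B \<subseteq> x ` {..<k}"
    proof
      fix y assume y: "y \<in> topspace (F k) \<inter> B"
      then obtain j where j: "y = x j" using B by auto
      have "\<not> k \<le> j" using y x[of j] stage_mono[of k j] j by blast
      then show "y \<in> x ` {..<k}" using j by auto
    qed
    then have "finite (topspace (F k) \<inter> B)" by (rule finite_subset) simp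
    then show "closedin (F k) (topspace (F k) \<inter> B)" using t1[of k] by (simp add: t1_space_closedin_finite)
  qed
  have "infinite (range x)"
  proof
    assume fin: "finite (range x)"
    have "\<exists>k. B \<subseteq> topspace (F k)" if "finite B" "B \<subseteq> topspace X" for B
      using that
    proof (induction B)
      case (insert b B)
      then obtain k where k: "B \<subseteq> topspace (F k)" by auto
      obtain l where l: "b \<in> topspace (F l)" using insert.prems union by auto
      have "insert b B \<subseteq> topspace (F (max k l))" using k l stage_mono[of k "max k l"] stage_mono[of l "max k l"] by auto
      then show ?case by blast
    qed simp
    then obtain k where "range x \<subseteq> topspace (F k)" using fin x CX by blast
    then show False using x[of k] by blast
  qed
  moreover have "range x \<subseteq> C" using x by blast
  ultimately obtain y where y: "y \<in> C" "y \<in> X derived_set_of (range x)"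
    using compactin_imp_Bolzano_Weierstrass[OF assms] by blast
  have "openin X (topspace X - (range x - {y}))" using closed[of "range x - {y}"] by auto
  moreover have "y \<in> topspace X - (range x - {y})" using y(1) CX by auto
  moreover have "\<forall>T. y \<in> T \<and> openin X T \<longrightarrow> (\<exists>z. z \<noteq> y \<and> z \<in> range x \<and> z \<in> T)"
    using y(2) unfolding in_derived_set_of by (rule conjunct2)
  ultimately have "\<exists>z. z \<noteq> y \<and> z \<in> range x \<and> z \<in> topspace X - (range x - {y})"
    by (metis (no_types, lifting))
  then show False by blast
qed

lemma continuous_map_in_stage:
  assumes "continuous_map (top_of_set C) X f" "compact C"
  shows "\<exists>k. continuous_map (top_of_set C) (F k) f"
proof -
  have "compactin X (f ` C)" using image_compactin[of "top_of_set C" C X f] assms by (simp add: compactin_subtopology)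
  then obtain k where "f ` C \<subseteq> topspace (F k)" using compact_in_stage by blast
  then have "continuous_map (top_of_set C) (subtopology X (topspace (F k))) f"
    using assms(1) by (auto simp: continuous_map_in_subtopology)
  then show ?thesis unfolding subtopology_X by blast
qed

lemma stage_continuous_mono:
  assumes "continuous_map Y (F k) f" "k \<le> l" shows "continuous_map Y (F l) f"
proof -
  have "continuous_map Y (subtopology (F l) (topspace (F k))) f"
    unfolding subtopology_stage[OF assms(2)] by (rule assms(1))
  then show ?thesis unfolding continuous_map_in_subtopology by blast
qed

text \<open>Paths and squares have compact images and so lie in one stage, where each law can be
  checked.\<close>

lemma transport_union:
  assumes \<Theta>: "\<And>k. transport G (F k) (\<Theta> k)" and ext: "\<And>k p. path_in (F k) p \<Longrightarrow> \<Theta> (Suc k) p = \<Theta> k p"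
  obtains \<theta> where "transport G X \<theta>" "\<And>k p. path_in (F k) p \<Longrightarrow> \<theta> p = \<Theta> k p"
proof -
  have ext_le: "\<Theta> l p = \<Theta> k p" if "path_in (F k) p" "k \<le> l" for k l p
    using that(2)
  proof (induction l rule: dec_induct)
    case (step l)
    then show ?case using ext[OF stage_continuous_mono[OF that(1) step(1)]] by simp
  qed simp
  define \<theta> where "\<theta> p = \<Theta> (LEAST k. path_in (F k) p) p" for p
  have \<theta>: "\<theta> p = \<Theta> k p" if "path_in (F k) p" for k p
    unfolding \<theta>_def by (rule ext_le[symmetric]) (use that in \<open>auto intro: LeastI Least_le\<close>)
  have "transport G X \<theta>"
    unfolding transport_def
  proof (intro conjI allI impI)
    fix p q assume "path_in X p"
    then obtain k where k: "path_in (F k) p" using continuous_map_in_stage compact_Icc by blast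
    show "\<theta> p \<in> carrier G" using \<theta>[OF k] transportD(1)[OF \<Theta> k] by simp
    show "\<theta> p = \<theta> (lower p) \<otimes>\<^bsub>G\<^esub> \<theta> (upper p)"
      using \<theta>[OF k] \<theta>[OF path_in_lower[OF k]] \<theta>[OF path_in_upper[OF k]] transportD(3)[OF \<Theta> k] by simp
    assume eq: "\<forall>t\<in>{0..1}. p t = q t"
    have q: "path_in (F k) q" by (rule path_in_eq[OF k]) (use eq in simp)
    show "\<theta> p = \<theta> q"
      unfolding \<theta>[OF k] \<theta>[OF q] by (rule transportD(2)[OF \<Theta> k]) (use eq in simp)
  next
    fix H assume H: "square_in X H"
    obtain k where k: "square_in (F k) H" using continuous_map_in_stage[OF H compact_Times[OF compact_Icc compact_Icc]] by blast
    show "\<theta> (\<lambda>s. H (s, 0)) \<otimes>\<^bsub>G\<^esub> \<theta> (\<lambda>t. H (1, t)) = \<theta> (\<lambda>t. H (0, t)) \<otimes>\<^bsub>G\<^esub> \<theta> (\<lambda>s. H (s, 1))"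
      using square_sides[OF k, THEN \<theta>] transportD(4)[OF \<Theta> k] by simp
  qed
  then show thesis by (rule that) (rule \<theta>)
qed

end

section \<open>Values of transports on singular edges\<close>

definition edge_value :: "((real \<Rightarrow> 'x) \<Rightarrow> 'g) \<Rightarrow> ((nat \<Rightarrow> real) \<Rightarrow> 'x) \<Rightarrow> 'g" where
  "edge_value \<theta> a = \<theta> (\<lambda>t. a (edge_point t))"

lemma edge_value_triangle:
  assumes G: "group G" and \<theta>: "transport G X \<theta>" and tri: "triangle X a b c \<tau>"
  shows "edge_value \<theta> c = edge_value \<theta> a \<otimes>\<^bsub>G\<^esub> edge_value \<theta> b"
proof -
  interpret group G by fact
  \<comment> \<open>The map collapses the side \<open>fst z = 0\<close> of the square to the vertex
    0; the other three sides become the edges 01, 12 and 02.\<close>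
  define q where "q z = (\<lambda>i. if i = (0::nat) then 1 - fst z else if i = 1 then fst z * (1 - snd z)
     else if i = 2 then fst z * snd z else 0)" for z :: "real \<times> real"
  have "q z \<in> standard_simplex 2" if "z \<in> {0..1} \<times> {0..1}" for z
  proof -
    have "fst z * (1 - snd z) \<le> 1" "fst z * snd z \<le> 1" "fst z * snd z \<le> fst z"
      using that by (auto intro: mult_le_one mult_left_le)
    then show ?thesis using that by (auto simp: standard_simplex_def q_def numeral_2_eq_2 algebra_simps)
  qed
  moreover have "continuous_on ({0..1} \<times> {0..1}) q"
    unfolding q_def by (intro continuous_on_vector continuous_on_if_constant continuous_intros)
  ultimately have "continuous_map (top_of_set ({0..1} \<times> {0..1})) (top_of_set (standard_simplex 2)) q"
    by (auto simp: continuous_map_in_subtopology)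
  moreover have "continuous_map (top_of_set (standard_simplex 2)) X \<tau>"
    using tri by (simp add: triangle_def singular_simplex_euclidean)
  ultimately have H: "square_in X (\<tau> \<circ> q)" by (rule continuous_map_compose)
  have faces: "a = singular_face 2 2 \<tau>" "b = singular_face 2 0 \<tau>" "c = singular_face 2 1 \<tau>"
    using tri by (auto simp: triangle_def)
  have ep: "simplical_face 2 (edge_point t) = q (t, 0)" "simplical_face 0 (edge_point t) = q (1, t)"
    "simplical_face 1 (edge_point t) = q (t, 1)" for t
    by (auto simp: simplical_face_def edge_point_def q_def fun_eq_iff)
  have val: "singular_face 2 k \<tau> (edge_point t) = \<tau> (simplical_face k (edge_point t))" if "t \<in> {0..1}" for k t
    using edge_point_in_standard_simplex[OF that] by (simp add: singular_face_def)
  note E = triangle_edges[OF tri, THEN edge_path_continuous]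
  have "edge_value \<theta> a = \<theta> (\<lambda>s. (\<tau> \<circ> q) (s, 0))" "edge_value \<theta> b = \<theta> (\<lambda>t. (\<tau> \<circ> q) (1, t))"
    "edge_value \<theta> c = \<theta> (\<lambda>s. (\<tau> \<circ> q) (s, 1))"
    unfolding edge_value_def using val ep
    by (intro transportD(2)[OF \<theta>] E; simp add: faces del: One_nat_def)+
  moreover have "\<theta> (\<lambda>t. (\<tau> \<circ> q) (0, t)) = \<one>\<^bsub>G\<^esub>"
  proof (rule transport_constant[OF G \<theta>])
    show "(\<tau> \<circ> q) (0, 0) \<in> topspace X" using H by (auto simp: continuous_map_def)
    show "(\<tau> \<circ> q) (0, t) = (\<tau> \<circ> q) (0, 0)" for t
      unfolding o_apply by (rule arg_cong[of _ _ \<tau>]) (auto simp: q_def fun_eq_iff)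
  qed
  ultimately show ?thesis
    using transportD(4)[OF \<theta> H] transportD(1)[OF \<theta> square_sides(4)[OF H]] by simp
qed

lemma edge_value_constant:
  assumes "group G" "transport G X \<theta>" "v \<in> topspace X"
  shows "edge_value \<theta> (constant_edge v) = \<one>\<^bsub>G\<^esub>"
  unfolding edge_value_def
  by (rule transport_constant[OF assms], drule edge_point_in_standard_simplex) (simp add: constant_edge_def)

lemma edge_value_segment:
  assumes "transport G X \<theta>" "path_in X p"
  shows "edge_value \<theta> (segment p 0 1) = \<theta> p"
  unfolding edge_value_def
  by (rule transportD(2)[OF assms, symmetric]) (simp add: segment_edge_point)

section \<open>The fundamental class\<close>

text \<open>At the apex \<open>x 2 = 1\<close> the quotient has no limit, but \<open>g\<close> is
  bounded and the factor \<open>1 - x 2\<close> tends to zero.\<close>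

lemma continuous_on_cone:
  fixes g :: "real \<Rightarrow> real"
  assumes "continuous_on UNIV g" "\<And>t. \<bar>g t\<bar> \<le> 1"
  shows "continuous_on A (\<lambda>x :: nat \<Rightarrow> real. (1 - x 2) * g (x 1 / (1 - x 2)))"
  unfolding continuous_on_eq_continuous_within
proof
  fix x :: "nat \<Rightarrow> real" assume "x \<in> A"
  have co: "continuous (at x within A) (\<lambda>x. x i)" for i
    using continuous_on_subset[OF continuous_on_product_coordinates subset_UNIV] \<open>x \<in> A\<close>
    by (rule continuous_on_eq_continuous_within[THEN iffD1, rule_format])
  show "continuous (at x within A) (\<lambda>x. (1 - x 2) * g (x 1 / (1 - x 2)))"
  proof (cases "x 2 = 1")
    case False
    have "continuous (at x within A) (\<lambda>x. x 1 / (1 - x 2))"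
      by (rule continuous_at_within_divide[OF co continuous_diff[OF continuous_const co]]) (use False in simp)
    moreover have "continuous (at (x 1 / (1 - x 2)) within (\<lambda>x. x 1 / (1 - x 2)) ` A) g"
      using assms(1) by (simp add: continuous_on_eq_continuous_at continuous_at_imp_continuous_within)
    ultimately have "continuous (at x within A) (g \<circ> (\<lambda>x. x 1 / (1 - x 2)))"
      by (rule continuous_within_compose)
    then show ?thesis by (intro continuous_mult continuous_diff continuous_const co) (simp add: o_def)
  next
    case True
    have "continuous (at x within A) (\<lambda>y. \<bar>1 - y 2\<bar>)"
      by (intro continuous_rabs continuous_diff continuous_const co)
    then have lim: "((\<lambda>y. \<bar>1 - y 2\<bar>) \<longlongrightarrow> 0) (at x within A)" using True by (simp add: continuous_within)
    have le: "norm ((1 - y 2) * g (y 1 / (1 - y 2))) \<le> \<bar>1 - y 2\<bar>" for y :: "nat \<Rightarrow> real"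
      using mult_left_le[OF assms(2), of "\<bar>1 - y 2\<bar>"] by (simp add: abs_mult)
    have "((\<lambda>y. (1 - y 2) * g (y 1 / (1 - y 2))) \<longlongrightarrow> 0) (at x within A)"
      by (rule Lim_null_comparison[OF always_eventually lim]) (rule allI, rule le)
    then show ?thesis unfolding continuous_within using True by simp
  qed
qed

text \<open>The cone over the circle, with apex on the circle, parametrised by the \<open>2\<close>-simplex.\<close>

definition cone_point :: "(nat \<Rightarrow> real) \<Rightarrow> nat \<Rightarrow> real" where
  "cone_point x = (\<lambda>i. (1 - x 2) * circle_point (x 1 / (1 - x 2)) i + x 2 * circle_point 0 i)"

lemma circle_point_nsphere: "circle_point t \<in> topspace (nsphere 1)"
  by (simp add: nsphere circle_point_def)

lemma continuous_on_circle_point: "continuous_on A circle_point"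
  unfolding circle_point_def by (intro continuous_on_vector continuous_on_if_constant continuous_intros)

lemma path_in_circle_point: "path_in (nsphere 1) circle_point"
  using circle_point_nsphere continuous_on_circle_point
  by (subst nsphere_euclidean) (auto simp: continuous_map_in_subtopology)

lemma cone_point_disc:
  assumes "x \<in> standard_simplex 2" shows "cone_point x \<in> topspace (disc 2)"
proof -
  define s t where "s = x 2" and "t = 2 * pi * (x 1 / (1 - x 2))"
  have s: "0 \<le> s" "s \<le> 1" using assms by (auto simp: standard_simplex_def s_def)
  have "((1 - s) * c + s)\<^sup>2 + ((1 - s) * \<sigma>)\<^sup>2 = (1 - s)\<^sup>2 * (\<sigma>\<^sup>2 + c\<^sup>2) + s\<^sup>2 + 2 * s * (1 - s) * c" for c \<sigma> :: real
    by (simp only: power2_sum power_mult_distrib distrib_left) (simp add: ac_simps)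
  then have "((1 - s) * cos t + s)\<^sup>2 + ((1 - s) * sin t)\<^sup>2 = (1 - s)\<^sup>2 + s\<^sup>2 + 2 * s * (1 - s) * cos t"
    by simp
  also have "\<dots> \<le> (1 - s)\<^sup>2 + s\<^sup>2 + 2 * s * (1 - s) * 1"
    using s by (intro add_mono mult_left_mono) auto
  also have "\<dots> = 1" by (simp add: power2_eq_square algebra_simps)
  finally have "((1 - s) * cos t + s)\<^sup>2 + ((1 - s) * sin t)\<^sup>2 \<le> 1" .
  then show ?thesis
    by (simp add: topspace_disc cone_point_def circle_point_def radius_def numeral_2_eq_2 s_def t_def)
qed

definition cone_simplex :: "(nat \<Rightarrow> real) \<Rightarrow> nat \<Rightarrow> real" where
  "cone_simplex = restrict cone_point (standard_simplex 2)"

lemma singular_simplex_cone: "singular_simplex 2 (disc 2) cone_simplex"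
proof -
  have "continuous_on (standard_simplex 2) cone_point"
    unfolding cone_point_def
  proof (intro continuous_on_vector continuous_on_add)
    fix i
    have "continuous_on UNIV (\<lambda>t. circle_point t i)" by (rule continuous_on_coordinate[OF continuous_on_circle_point])
    moreover have "\<bar>circle_point t i\<bar> \<le> 1" for t by (simp add: circle_point_def)
    ultimately show "continuous_on (standard_simplex 2) (\<lambda>x. (1 - x 2) * circle_point (x 1 / (1 - x 2)) i)"
      by (rule continuous_on_cone)
    show "continuous_on (standard_simplex 2) (\<lambda>x. x 2 * circle_point 0 i)"
      by (intro continuous_on_mult continuous_on_const continuous_on_subset[OF continuous_on_product_coordinates subset_UNIV])
  qed
  then have "continuous_on (standard_simplex 2) cone_simplex"
    by (rule continuous_on_eq) (simp add: cone_simplex_def)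
  then have "continuous_map (top_of_set (standard_simplex 2)) (top_of_set (topspace (disc 2))) cone_simplex"
    using cone_point_disc by (auto simp: continuous_map_in_subtopology cone_simplex_def)
  then show ?thesis
    using disc_euclidean[of 2] by (simp add: singular_simplex_euclidean cone_simplex_def)
qed

lemma circle_point_integer: "circle_point 0 = circle_point 1"
  by (simp add: circle_point_def fun_eq_iff)

lemma cone_faces:
  "singular_face 2 2 cone_simplex = circle_simplex"
  "singular_face 2 0 cone_simplex = constant_edge (circle_point 0)"
  "singular_face 2 1 cone_simplex = constant_edge (circle_point 0)"
proof -
  have face: "singular_face 2 k cone_simplex x = cone_point (simplical_face k x)" if "x \<in> standard_simplex 1" "k \<le> 2" for k x
    using simplical_face_in_standard_simplex[of 2 k x] that by (simp add: singular_face_def cone_simplex_def)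
  have x0: "x 0 = 1 - x 1" if "x \<in> standard_simplex 1" for x
    using that by (simp add: standard_simplex_def)
  have out: "singular_face 2 k cone_simplex x = undefined" if "x \<notin> standard_simplex 1" for k x
    using that by (simp add: singular_face_def)
  show "singular_face 2 2 cone_simplex = circle_simplex"
  proof
    fix x show "singular_face 2 2 cone_simplex x = circle_simplex x"
    proof (cases "x \<in> standard_simplex 1")
      case True
      then show ?thesis using face[OF True, of 2] by (simp add: circle_simplex_def) (simp add: cone_point_def simplical_face_def)
    qed (simp add: circle_simplex_def out)
  qed
  show "singular_face 2 0 cone_simplex = constant_edge (circle_point 0)"
  proof
    fix x show "singular_face 2 0 cone_simplex x = constant_edge (circle_point 0) x"
    proof (cases "x \<in> standard_simplex 1")
      case True
      have s: "simplical_face 0 x 1 = 1 - x 1" "simplical_face 0 x 2 = x 1"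
        using x0[OF True] by (simp_all add: simplical_face_def)
      have "cone_point (simplical_face 0 x) = circle_point 0"
      proof (cases "x 1 = 1")
        \<comment> \<open>Here the quotient is \<open>0 / 0\<close>, but the factor in front of it
          vanishes.\<close>
        case True
        then show ?thesis unfolding cone_point_def s by simp
      next
        case False
        then show ?thesis unfolding cone_point_def s by (simp add: circle_point_integer algebra_simps)
      qed
      then show ?thesis using face[OF True, of 0] True by (simp add: constant_edge_def)
    qed (simp add: constant_edge_def out)
  qed
  show "singular_face 2 1 cone_simplex = constant_edge (circle_point 0)"
  proof
    fix x show "singular_face 2 1 cone_simplex x = constant_edge (circle_point 0) x"
    proof (cases "x \<in> standard_simplex 1")
      case True
      have s: "simplical_face 1 x 1 = 0" "simplical_face 1 x 2 = x 1" by (simp_all add: simplical_face_def)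
      have "cone_point (simplical_face 1 x) = circle_point 0"
        unfolding cone_point_def s by (simp add: algebra_simps)
      then show ?thesis using face[OF True, of 1] True by (simp add: constant_edge_def)
    qed (simp add: constant_edge_def out)
  qed
qed

lemma triangle_cone:
  "triangle (disc 2) circle_simplex (constant_edge (circle_point 0)) (constant_edge (circle_point 0)) cone_simplex"
  unfolding triangle_def using singular_simplex_cone cone_faces by blast

lemma chain_boundary_cone: "chain_boundary 2 (frag_of cone_simplex) = frag_of circle_simplex"
  using chain_boundary_triangle[OF triangle_cone] by simp

lemma contractible_disc: "contractible_space (disc n)"
proof -
  let ?D = "topspace (disc n)"
  have "homotopic_with (\<lambda>_. True) (top_of_set ?D) (top_of_set ?D) id (\<lambda>_. (\<lambda>_. 0))"
    unfolding homotopic_with_def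
  proof (intro exI conjI)
    have "radius n (\<lambda>i. (1 - t) * y i) \<le> 1" if "t \<in> {0..1}" "radius n y \<le> 1" for t y
      using that by (simp add: radius_scale mult_le_one radius_nonneg)
    moreover have "continuous_on ({0..1} \<times> ?D) (\<lambda>z i. (1 - fst z) * snd z i)"
      by (intro continuous_on_vector continuous_on_mult continuous_on_diff continuous_on_const continuous_on_fst
          continuous_on_id continuous_on_coordinate[OF continuous_on_snd[OF continuous_on_id]])
    ultimately show "continuous_map (prod_topology (top_of_set {0..1}) (top_of_set ?D)) (top_of_set ?D)
       (\<lambda>(t, y) i. (1 - t) * y i)"
      by (auto simp: prod_topology_subtopology_eu split_def topspace_disc)
  qed auto
  then have "contractible_space (top_of_set ?D)" unfolding contractible_space_def by blast
  then show ?thesis using disc_euclidean[of n] by simp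
qed

lemma singular_simplex_circle: "singular_simplex 1 (nsphere 1) circle_simplex"
proof -
  have "continuous_map (top_of_set (standard_simplex 1)) (top_of_set {0..1 :: real}) (\<lambda>x. x 1)"
    using continuous_on_subset[OF continuous_on_product_coordinates subset_UNIV]
    by (auto simp: continuous_map_in_subtopology standard_simplex_def)
  from continuous_map_compose[OF this path_in_circle_point]
  have "continuous_map (top_of_set (standard_simplex 1)) (nsphere 1) circle_simplex"
    by (rule continuous_map_eq) (simp add: circle_simplex_def)
  then show ?thesis by (simp add: singular_simplex_euclidean circle_simplex_def)
qed

lemma singular_relcycle_cone: "singular_relcycle 2 (disc 2) (topspace (nsphere 1)) (frag_of cone_simplex)"
proof -
  have "subtopology (disc 2) (topspace (nsphere 1)) = nsphere 1" using nsphere_subtopology_disc[of 2] by simp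
  then show ?thesis
    by (simp add: singular_relcycle singular_chain_of singular_simplex_cone chain_boundary_cone
        singular_simplex_circle[unfolded One_nat_def])
qed

text \<open>The cone is a relative cycle whose boundary is the circle. A class with this boundary is
  unique because the disc is contractible, which makes the boundary map injective.\<close>

lemma disc_class_eq:
  "disc_class = homologous_rel_set 2 (disc 2) (topspace (nsphere 1)) (frag_of cone_simplex)"
proof -
  let ?D = "disc 2" and ?S = "topspace (nsphere 1)"
  note cyc = singular_relcycle_cone
  have bd: "hom_boundary 2 ?D ?S (homologous_rel_set 2 ?D ?S c) = homologous_rel_set 1 (subtopology ?D ?S) {} (chain_boundary 2 c)"
    if "singular_relcycle 2 ?D ?S c" for c
    using hom_boundary_chain_boundary[OF that] by simp
  show ?thesis
    unfolding disc_class_def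
  proof (rule the_equality)
    show "homologous_rel_set 2 ?D ?S (frag_of cone_simplex) \<in> carrier (relative_homology_group 2 ?D ?S) \<and>
      hom_boundary 2 ?D ?S (homologous_rel_set 2 ?D ?S (frag_of cone_simplex)) =
      homologous_rel_set 1 (subtopology ?D ?S) {} (frag_of circle_simplex)"
      using bd[OF cyc] carrier_relative_homology_group[of 2 ?D ?S] cyc by (auto simp: chain_boundary_cone)
    fix \<tau> assume \<tau>: "\<tau> \<in> carrier (relative_homology_group 2 ?D ?S) \<and>
      hom_boundary 2 ?D ?S \<tau> = homologous_rel_set 1 (subtopology ?D ?S) {} (frag_of circle_simplex)"
    then obtain c where c: "\<tau> = homologous_rel_set 2 ?D ?S c" "singular_relcycle 2 ?D ?S c"
      using carrier_relative_homology_group[of 2 ?D ?S] by auto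
    then have "homologous_rel_set 1 (subtopology ?D ?S) {} (chain_boundary 2 c) =
      homologous_rel_set 1 (subtopology ?D ?S) {} (frag_of circle_simplex)" using \<tau> bd by simp
    then have "homologous_rel 1 (subtopology ?D ?S) {} (chain_boundary 2 c) (frag_of circle_simplex)"
      using homologous_rel_set_eq by blast
    then obtain y where y: "singular_chain 2 (subtopology ?D ?S) y" "chain_boundary 2 y = chain_boundary 2 c - frag_of circle_simplex"
      by (auto simp: homologous_rel_def singular_boundary numeral_2_eq_2)
    have yD: "singular_chain 2 ?D y" using y(1) by (simp add: singular_chain_subtopology)
    have "singular_chain 2 ?D c" using c(2) by (simp add: singular_relcycle)
    then have "singular_relcycle 2 ?D {} (c - frag_of cone_simplex - y)"
      using yD singular_simplex_cone
      by (simp add: singular_cycle singular_chain_diff singular_chain_of chain_boundary_diff chain_boundary_cone y(2))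
    then have "singular_relboundary 2 ?D {} (c - frag_of cone_simplex - y)"
      by (rule trivial_homology_boundary[rotated]) (rule trivial_homology_contractible[OF contractible_disc], simp)
    then obtain w where "singular_chain 3 ?D w" "chain_boundary 3 w = c - frag_of cone_simplex - y"
      by (auto simp: singular_boundary eval_nat_numeral)
    then have "singular_relboundary 2 ?D ?S (c - frag_of cone_simplex)"
      unfolding singular_relboundary using y(1) by (intro exI[of _ w] exI[of _ y]) (simp add: eval_nat_numeral)
    then show "\<tau> = homologous_rel_set 2 ?D ?S (frag_of cone_simplex)"
      unfolding c(1) by (intro homologous_rel_set_eq[THEN iffD2]) (simp only: homologous_rel_def)
  qed
qed

lemma cell_chain_cmul:
  assumes "cell_chain K P \<delta> k c" shows "cell_chain K P \<delta> (j * k) (frag_cmul j c)"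
proof -
  obtain y z where "singular_chain 2 K y" "singular_chain 3 P z" "c = frag_cmul k \<delta> + y + chain_boundary 3 z"
    using assms by (auto simp: cell_chain_def)
  then show ?thesis unfolding cell_chain_def
    by (intro exI[of _ "frag_cmul j y"] exI[of _ "frag_cmul j z"])
      (simp add: singular_chain_cmul chain_boundary_cmul frag_cmul_distrib2)
qed

lemma triangle_simplex_map:
  assumes "triangle X a b c \<tau>" "continuous_map X Y f"
  shows "triangle Y (simplex_map 1 f a) (simplex_map 1 f b) (simplex_map 1 f c) (simplex_map 2 f \<tau>)"
proof -
  have "singular_face 2 k (simplex_map 2 f \<tau>) = simplex_map 1 f (singular_face 2 k \<tau>)" if "k \<le> 2" for k
    using singular_face_simplex_map[of 2 k f \<tau>] that by (simp add: simplex_map_def singular_face_def fun_eq_iff)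
  then show ?thesis using assms singular_simplex_simplex_map[of 2 X \<tau> Y f] by (simp add: triangle_def)
qed

definition interval_point :: "real \<Rightarrow> nat \<Rightarrow> real" where
  "interval_point u = (\<lambda>i. if i = 0 then u else 0)"

lemma letter_path_interval_point:
  "letter_path e (s, True) t = e s (interval_point (2 * t - 1))"
  "letter_path e (s, False) t = e s (interval_point (1 - 2 * t))"
  by (simp_all add: interval_point_def)

lemma letter_path_inv: "letter_path e (inv_letter x) t = letter_path e x (1 - t)"
proof (cases x)
  case (Pair s b)
  have "2 * (1 - t) - 1 = 1 - 2 * t" "1 - 2 * (1 - t) = 2 * t - 1" by simp_all
  then show ?thesis using Pair by (cases b) (simp_all only: inv_letter.simps letter_path.simps simp_thms if_True if_False)
qed

lemma interval_point_disc: "interval_point u \<in> topspace (disc 1) \<longleftrightarrow> \<bar>u\<bar> \<le> 1"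
  "interval_point u \<in> open_disc 1 \<longleftrightarrow> \<bar>u\<bar> < 1"
  "interval_point u \<in> topspace (nsphere 0) \<longleftrightarrow> \<bar>u\<bar> = 1"
  by (auto simp: topspace_disc open_disc_radius radius_def interval_point_def nsphere power2_eq_1_iff)

lemma continuous_on_interval_point: "continuous_on A f \<Longrightarrow> continuous_on A (\<lambda>t. interval_point (f t))"
  unfolding interval_point_def by (intro continuous_on_vector continuous_on_if_constant) auto

section \<open>The presentation complex\<close>

locale one_relator_complex = one_relator S r for S :: "'s set" and r :: "'s word" +
  fixes v :: 'x and e :: "'s \<Rightarrow> (nat \<Rightarrow> real) \<Rightarrow> 'x" and d :: "(nat \<Rightarrow> real) \<Rightarrow> 'x" and K P :: "'x topology"
  assumes complex: "presentation_complex S r v e d K P"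
begin

sublocale edges: cell_attachment 1 "discrete_topology {v}" S e K
  using complex by unfold_locales (auto simp: presentation_complex_def)

sublocale face: cell_attachment 2 K "{()}" "\<lambda>_. d" P
  using complex by unfold_locales (auto simp: presentation_complex_def)

lemma boundary_path: "t \<in> {0..1} \<Longrightarrow> d (circle_point t) = word_loop e r t"
  using complex by (auto simp: presentation_complex_def)

lemma K_subtopology: "K = subtopology P (topspace K)"
  by (rule face.subtopology_A[symmetric])

lemma vertex: "v \<in> topspace K"
  using edges.A_subset by simp

lemma letter_path_endpoints:
  assumes "fst x \<in> S" shows "letter_path e x 0 = v" "letter_path e x 1 = v"
proof -
  have "e (fst x) (interval_point u) = v" if "\<bar>u\<bar> = 1" for u
    using edges.cell_nsphere[OF assms, of "interval_point u"] interval_point_disc(3)[of u] that by simp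
  then show "letter_path e x 0 = v" "letter_path e x 1 = v"
    by (cases x; cases "snd x"; simp add: letter_path_interval_point del: letter_path.simps)+
qed

lemma edge_path_in_K:
  assumes "s \<in> S" "continuous_on {0..1} f" "\<And>t. t \<in> {0..1} \<Longrightarrow> \<bar>f t\<bar> \<le> 1"
  shows "path_in K (\<lambda>t. e s (interval_point (f t)))"
proof -
  have "continuous_map (top_of_set {0..1}) (top_of_set (topspace (disc 1))) (\<lambda>t. interval_point (f t))"
    using continuous_on_interval_point[OF assms(2)] assms(3) interval_point_disc(1)
    by (auto simp: continuous_map_in_subtopology)
  then have "continuous_map (top_of_set {0..1}) (disc 1) (\<lambda>t. interval_point (f t))"
    by (simp only: disc_euclidean[symmetric])
  from continuous_map_compose[OF this edges.characteristic_map[OF assms(1)]] show ?thesis by (simp add: o_def)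
qed

lemma letter_path_continuous:
  assumes "fst x \<in> S" shows "path_in K (letter_path e x)"
proof -
  note path = edge_path_in_K[OF assms]
  have "path_in K (\<lambda>t. e (fst x) (interval_point (2 * t - 1)))"
    by (rule path) (intro continuous_intros, simp add: abs_le_iff)
  moreover have "path_in K (\<lambda>t. e (fst x) (interval_point (1 - 2 * t)))"
    by (rule path) (intro continuous_intros, simp add: abs_le_iff)
  ultimately show ?thesis
    by (cases x; cases "snd x") (simp_all add: letter_path_interval_point[abs_def] del: letter_path.simps)
qed

text \<open>Constant outside \<open>S\<close>, so that the assumptions of \<open>word_edges\<close>
  hold for all letters.\<close>

definition letter_edge :: "'s \<times> bool \<Rightarrow> (nat \<Rightarrow> real) \<Rightarrow> 'x" where
  "letter_edge x = (if fst x \<in> S then segment (letter_path e x) 0 1 else constant_edge v)"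

sublocale word_edges S r K P v "topspace K" letter_edge
proof
  show "K = subtopology P (topspace K)" by (rule K_subtopology)
  show "v \<in> topspace K" by (rule vertex)
  fix x
  show "edge_loop K v (letter_edge x)"
    using letter_path_endpoints[of x] segment_continuous[OF letter_path_continuous, of x 0 1] edge_loop_constant[OF vertex]
    by (simp add: letter_edge_def edge_loop_def segment_edge_point)
  have "segment (letter_path e x) 1 0 = segment (letter_path e (inv_letter x)) 0 1"
  proof
    fix y :: "nat \<Rightarrow> real"
    have "y 0 = 1 - y 1" if "y \<in> standard_simplex 1" using that by (simp add: standard_simplex_def)
    then show "segment (letter_path e x) 1 0 y = segment (letter_path e (inv_letter x)) 0 1 y"
      by (simp add: segment_def letter_path_inv)
  qed
  then show "bounds K (letter_edge x) (letter_edge (inv_letter x)) (constant_edge v)"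
    using triangle_segment[OF letter_path_continuous, of x 0 1 0] letter_path_endpoints[of x]
      triangle_degenerate(1)[OF edge_loop_constant[OF vertex]]
    by (simp add: letter_edge_def bounds_def segment_constant)
qed

lemma word_loop_letter:
  assumes w: "fst ` set w \<subseteq> S" "j < length w" and t: "t \<in> {0..1}"
  shows "word_loop e w ((real j + t) / length w) = letter_path e (w ! j) t"
proof -
  have l: "real (length w) * ((real j + t) / length w) = real j + t" using w(2) by auto
  have S: "fst (w ! i) \<in> S" if "i < length w" for i using w(1) that by auto
  define m where "m = min (length w - 1) (nat \<lfloor>real j + t\<rfloor>)"
  have eq: "word_loop e w ((real j + t) / length w) = letter_path e (w ! m) (real j + t - real m)"
    unfolding word_loop_def Let_def l m_def ..
  \<comment> \<open>At \<open>t = 1\<close> the floor already selects the next letter, except at the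
    end of the word, where the minimum holds it back. Both letters have the vertex as their value
    there.\<close>
  have "\<lfloor>real j + t\<rfloor> = int j \<or> t = 1 \<and> \<lfloor>real j + t\<rfloor> = int j + 1" using t by (auto simp: floor_eq_iff)
  then consider "m = j" | "t = 1" "m = j + 1" "j + 1 < length w" using w(2) by (fastforce simp: m_def nat_add_distrib)
  then show ?thesis
  proof cases
    case 2
    then show ?thesis using letter_path_endpoints[OF S[OF 2(3)]] letter_path_endpoints[OF S[OF w(2)]] unfolding eq by simp
  qed (simp add: eq)
qed

abbreviation relator_loop :: "real \<Rightarrow> 'x" where "relator_loop \<equiv> d \<circ> circle_point"

lemma relator_letters: "fst ` set r \<subseteq> S"
  using relator_closed by (simp add: free_group_def)

lemma relator_loop_path: "path_in K relator_loop"
  using continuous_map_compose[OF path_in_circle_point] face.attaching_map by simp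

lemma relator_loop_letter:
  assumes "j < length r" "t \<in> {0..1}"
  shows "relator_loop ((real j + t) / length r) = letter_path e (r ! j) t"
proof -
  have "(real j + t) / length r \<in> {0..1}" using assms by (auto simp: divide_simps)
  then show ?thesis using boundary_path word_loop_letter[OF relator_letters assms] by simp
qed

lemma relator_loop_endpoints: "relator_loop 0 = v" "relator_loop 1 = v"
proof -
  have n: "length r > 0" using relator_nontrivial by simp
  have S: "fst (r ! i) \<in> S" if "i < length r" for i using relator_letters that by auto
  show "relator_loop 0 = v" using relator_loop_letter[of 0 0] letter_path_endpoints[OF S] n by simp
  have "real (length r - 1) + 1 = length r" using n by (cases r) auto
  then show "relator_loop 1 = v" using relator_loop_letter[of "length r - 1" 1] letter_path_endpoints[OF S] n by simp
qed

lemma relator_segment: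
  assumes "j < length r"
  shows "segment relator_loop (j / length r) ((j + 1) / length r) = letter_edge (r ! j)" (is "?s = _")
proof
  fix x :: "nat \<Rightarrow> real"
  have "fst (r ! j) \<in> S" using relator_letters assms by auto
  moreover have "j / length r * x 0 + (real j + 1) / length r * x 1 = (real j * (x 0 + x 1) + x 1) / length r"
    by (simp add: divide_inverse algebra_simps)
  moreover have "x 0 + x 1 = 1" "x 1 \<in> {0..1}" if "x \<in> standard_simplex 1"
    using that by (auto simp: standard_simplex_def)
  ultimately show "?s x = letter_edge (r ! j) x"
    using relator_loop_letter[OF assms, of "x 1"] by (simp add: segment_def letter_edge_def)
qed

lemma relator_edge: "bounds K (segment relator_loop 0 1) one_edge (word_edge r)"
  using loop_word_edge[OF relator_loop_path relator_loop_endpoints(2) _ relator_segment] relator_nontrivial by blast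

definition cell_simplex :: "(nat \<Rightarrow> real) \<Rightarrow> 'x" where
  "cell_simplex = simplex_map 2 d cone_simplex"

lemma triangle_cell_simplex: "triangle P (segment relator_loop 0 1) one_edge one_edge cell_simplex"
proof -
  have "simplex_map 1 d circle_simplex = segment relator_loop 0 1"
    by (auto simp: simplex_map_def circle_simplex_def segment_def fun_eq_iff)
  moreover have "simplex_map 1 d (constant_edge (circle_point 0)) = one_edge"
    using relator_loop_endpoints(1) by (auto simp: simplex_map_def constant_edge_def fun_eq_iff)
  ultimately show ?thesis
    using triangle_simplex_map[OF triangle_cone face.characteristic_map] by (simp add: cell_simplex_def)
qed

abbreviation \<delta> :: "'x chain" where "\<delta> \<equiv> frag_of cell_simplex"

text \<open>The characteristic map fills the relator loop itself; one tetrahedron transfers the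
  filling to the edge chosen for the word \<open>r\<close>.\<close>

lemma relator_cell: "cell_bounds K P \<delta> (word_edge r) one_edge one_edge 1"
proof -
  have "cell_bounds K P \<delta> (segment relator_loop 0 1) one_edge one_edge 1"
    using triangle_cell_simplex cell_chain_cell by (auto simp: cell_bounds_def)
  from cell_bounds_assoc1[OF cell_bounds_subspace[of P "topspace K", unfolded K_subtopology[symmetric], OF bounds_one(1)[OF one_edge_loop]]
      this cell_bounds_subspace[of P "topspace K", unfolded K_subtopology[symmetric], OF relator_edge]]
  show ?thesis by simp
qed

text \<open>Injectivity of the map from H_2 of \<open>P\<close> to H_2 of the pair
  \<open>(P, K)\<close>: modulo a boundary such a cycle lies in the graph, whose second homology
  vanishes.\<close>

lemma cell_chain_cycle_boundary:
  assumes c: "singular_relcycle 2 P {} c" "cell_chain K P \<delta> 0 c" shows "singular_relboundary 2 P {} c"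
proof -
  obtain y z where y: "singular_chain 2 K y" and z: "singular_chain 3 P z" and cyz: "c = y + chain_boundary 3 z"
    using c(2) by (auto simp: cell_chain_def)
  have "chain_boundary 2 (chain_boundary 3 z) = 0"
    using chain_boundary_boundary[OF z] by simp
  then have "singular_relcycle 2 K {} y"
    using c(1) y by (simp add: singular_cycle cyz chain_boundary_add)
  then have "singular_relboundary 2 K {} y"
    by (intro edges.graph_second_homology[of v]) auto
  then obtain u where u: "singular_chain 3 K u" "chain_boundary 3 u = y"
    by (auto simp: singular_boundary eval_nat_numeral)
  have "singular_chain 3 P u"
    using u(1) K_subtopology by (metis singular_chain_subtopology)
  then show ?thesis
    using u z by (auto simp: singular_boundary eval_nat_numeral cyz chain_boundary_add intro!: exI[of _ "u + z"] singular_chain_add)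
qed

text \<open>The surface of a factorisation of \<open>r\<close> into commutators, capped by the cell
  once. This is where vanishing exponent sums of the relator produce a class.\<close>

lemma exists_cell_cycle: "\<exists>z. singular_relcycle 2 P {} z \<and> cell_chain K P \<delta> 1 z"
  using closed_surface_cycle[OF relator_cell] F.derived_imp_commutator_product[OF relator_derived]
    F.conjugate_product_self[OF relator_closed] by blast

text \<open>For a cycle the defining condition of the class says precisely that it covers the cell
  once, and two such cycles differ by a boundary.\<close>

lemma two_cell_class_eq:
  assumes z: "singular_relcycle 2 P {} z" "cell_chain K P \<delta> 1 z"
  shows "two_cell_class K P d = homologous_rel_set 2 P {} z"
proof -
  have id: "hom_induced 2 P {} P (topspace K) id (homologous_rel_set 2 P {} c) = homologous_rel_set 2 P (topspace K) c"
    if "singular_relcycle 2 P {} c" for c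
    using hom_induced_chain_map[OF continuous_map_id[of P] _ that, of "topspace K"] that
    by (simp add: chain_map_ident[of 2 P] singular_cycle)
  have dd: "hom_induced 2 (disc 2) (topspace (nsphere 1)) P (topspace K) d disc_class =
      homologous_rel_set 2 P (topspace K) \<delta>"
    unfolding disc_class_eq cell_simplex_def chain_map_of[symmetric]
    using hom_induced_chain_map[OF face.characteristic_map _ singular_relcycle_cone, of "()" "topspace K"] face.cell_nsphere
    by simp
  have iff: "homologous_rel_set 2 P (topspace K) c = homologous_rel_set 2 P (topspace K) \<delta> \<longleftrightarrow> cell_chain K P \<delta> 1 c" for c
  proof -
    have "homologous_rel_set 2 P (topspace K) c = homologous_rel_set 2 P (topspace K) \<delta> \<longleftrightarrow>
      (\<exists>z y. singular_chain 3 P z \<and> singular_chain 2 K y \<and> chain_boundary 3 z + y = c - \<delta>)"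
      unfolding homologous_rel_set_eq unfolding homologous_rel_def singular_relboundary K_subtopology[symmetric] by (simp add: eval_nat_numeral)
    also have "\<dots> \<longleftrightarrow> cell_chain K P \<delta> 1 c"
    proof
      assume "\<exists>z y. singular_chain 3 P z \<and> singular_chain 2 K y \<and> chain_boundary 3 z + y = c - \<delta>"
      then obtain z y where "singular_chain 3 P z" "singular_chain 2 K y" "chain_boundary 3 z + y = c - \<delta>" by blast
      moreover from this(3) have "c = \<delta> + y + chain_boundary 3 z" by (simp add: algebra_simps)
      ultimately show "cell_chain K P \<delta> 1 c" unfolding cell_chain_def by auto
    next
      assume "cell_chain K P \<delta> 1 c"
      then obtain z y where zy: "singular_chain 3 P z" "singular_chain 2 K y" "c = frag_cmul 1 \<delta> + y + chain_boundary 3 z"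
        unfolding cell_chain_def by blast
      have "chain_boundary 3 z + y = c - \<delta>" unfolding zy(3) by simp
      with zy show "\<exists>z y. singular_chain 3 P z \<and> singular_chain 2 K y \<and> chain_boundary 3 z + y = c - \<delta>" by blast
    qed
    finally show ?thesis .
  qed
  have carrier: "carrier (homology_group 2 P) = homologous_rel_set 2 P {} ` singular_relcycle_set 2 P {}"
    using carrier_relative_homology_group[of 2 P "{}"] by simp
  show ?thesis
    unfolding two_cell_class_def
  proof (rule the_equality)
    show "homologous_rel_set 2 P {} z \<in> carrier (homology_group 2 P) \<and>
      hom_induced 2 P {} P (topspace K) id (homologous_rel_set 2 P {} z) =
      hom_induced 2 (disc 2) (topspace (nsphere 1)) P (topspace K) d disc_class"
      unfolding carrier dd id[OF z(1)] iff using z by simp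
    fix \<alpha> assume \<alpha>: "\<alpha> \<in> carrier (homology_group 2 P) \<and>
      hom_induced 2 P {} P (topspace K) id \<alpha> =
      hom_induced 2 (disc 2) (topspace (nsphere 1)) P (topspace K) d disc_class"
    then obtain c where c: "singular_relcycle 2 P {} c" "\<alpha> = homologous_rel_set 2 P {} c"
      unfolding carrier by auto
    have "cell_chain K P \<delta> 1 c" using \<alpha> unfolding c(2) dd id[OF c(1)] iff by simp
    from cell_chain_diff[OF this z(2)] have "singular_relboundary 2 P {} (c - z)"
      using c(1) z(1) by (intro cell_chain_cycle_boundary) (auto simp: singular_relcycle_diff)
    then show "\<alpha> = homologous_rel_set 2 P {} z"
      unfolding c(2) by (intro homologous_rel_set_eq[THEN iffD2]) (simp only: homologous_rel_def)
  qed
qed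

end

section \<open>Transports on one-relator complexes\<close>

text \<open>On the boundary of a 1-cell paths are constant, so every gauge is admissible there; the
  values on edges can be prescribed freely.\<close>

lemma path_in_nsphere_0:
  assumes "path_in (nsphere 0) q" shows "q 0 0 = q 1 0"
proof (rule ccontr)
  assume ne: "q 0 0 \<noteq> q 1 0"
  have q: "q t 0 = 1 \<or> q t 0 = -1" if "t \<in> {0..1}" for t
    using continuous_map_image_subset_topspace[OF assms] that by (force simp: nsphere power2_eq_1_iff image_subset_iff)
  have "continuous_on {0..1} q"
    using assms by (subst (asm) nsphere_euclidean) (simp add: continuous_map_in_subtopology)
  then have "continuous_on {0..1} (\<lambda>t. q t 0)" by (rule continuous_on_coordinate)
  then have "connected ((\<lambda>t. q t 0) ` {0..1})" by (rule connected_continuous_image) simp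
  then have "is_interval ((\<lambda>t. q t 0) ` {0..1})" by (simp add: is_interval_connected_1)
  moreover have "q 0 0 \<in> (\<lambda>t. q t 0) ` {0..1}" "q 1 0 \<in> (\<lambda>t. q t 0) ` {0..1}" by auto
  ultimately have "0 \<in> (\<lambda>t. q t 0) ` {0..1}"
    using ne q[of 0] q[of 1] unfolding is_interval_1 by fastforce
  then obtain t where "t \<in> {0..1}" "q t 0 = 0" by auto
  with q[of t] show False by simp
qed

context one_relator_complex
begin

lemma graph_transport:
  obtains \<theta> where "transport F K \<theta>" "\<And>s. s \<in> S \<Longrightarrow> \<theta> (letter_path e (s, True)) = [(s, True)]"
proof -
  \<comment> \<open>The gauge is trivial at the end -1 and equals the letter at the end 1, so that
    the whole edge receives the letter as its value.\<close>
  define g :: "'s \<Rightarrow> (nat \<Rightarrow> real) \<Rightarrow> 's word" where "g s y = (if y 0 > 0 then [(s, True)] else [])" for s y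
  have g: "g s y \<in> carrier F" if "s \<in> S" for s y
    using that by (simp add: g_def free_group_def reduced_def)
  have one: "\<one>\<^bsub>F\<^esub> = []" by (simp add: free_group_def)
  have trivial: "transport F (discrete_topology {v}) (\<lambda>_. \<one>\<^bsub>F\<^esub>)" by (simp add: transport_def)
  have gauge: "\<one>\<^bsub>F\<^esub> = inv\<^bsub>F\<^esub> g i (q 0) \<otimes>\<^bsub>F\<^esub> g i (q 1)" if "i \<in> S" "path_in (nsphere (1 - 1)) q" for i q
  proof -
    have "g i (q 0) = g i (q 1)" using path_in_nsphere_0[of q] that(2) by (simp add: g_def)
    then show ?thesis using g[OF that(1)] by simp
  qed
  obtain \<theta> \<gamma> where \<theta>: "transport F K \<theta>"
    and collar: "\<And>p. path_in (subtopology K edges.collar) p \<Longrightarrow> \<theta> p = \<one>\<^bsub>F\<^esub>"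
    and \<gamma>: "\<And>i x. i \<in> S \<Longrightarrow> x \<in> edges.cell i \<Longrightarrow> \<gamma> x \<in> carrier F"
    and \<gamma>_g: "\<And>i y. i \<in> S \<Longrightarrow> y \<in> open_disc 1 - {\<lambda>_. 0} \<Longrightarrow> \<gamma> (e i y) = g i (radial 1 y)"
    and cell: "\<And>i p. i \<in> S \<Longrightarrow> path_in (subtopology K (edges.cell i)) p \<Longrightarrow> \<theta> p = inv\<^bsub>F\<^esub> \<gamma> (p 0) \<otimes>\<^bsub>F\<^esub> \<gamma> (p 1)"
    by (rule edges.extend_transport[where g = g, OF F.group_axioms trivial g gauge]; (assumption | rule that))
  show thesis
  proof (rule that[OF \<theta>])
    fix s assume s: "s \<in> S"
    define p where "p f = (\<lambda>t. e s (interval_point (f t)))" for f :: "real \<Rightarrow> real"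
    have p_collar: "\<theta> (p f) = \<one>\<^bsub>F\<^esub>" if f: "continuous_on {0..1} f" "\<And>t. t \<in> {0..1} \<Longrightarrow> 0 < \<bar>f t\<bar> \<and> \<bar>f t\<bar> \<le> 1" for f
    proof (rule collar)
      have "p f t \<in> edges.collar" if t: "t \<in> {0..1}" for t
      proof -
        have "interval_point (f t) \<noteq> (\<lambda>_. 0)" using f(2)[OF t] by (auto simp: interval_point_def fun_eq_iff)
        moreover have "interval_point (f t) \<in> topspace (disc 1)" using f(2)[OF t] interval_point_disc(1) by blast
        ultimately show ?thesis unfolding p_def using edges.cell_collar_iff[OF s] by blast
      qed
      then show "path_in (subtopology K edges.collar) (p f)"
        using edge_path_in_K[OF s f(1)] f(2) unfolding p_def by (auto simp: continuous_map_in_subtopology)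
    qed
    have in_cell: "e s (interval_point u) \<in> edges.cell s" if "\<bar>u\<bar> < 1" for u
      unfolding edges.cell_def using that interval_point_disc(2) by blast
    have p_cell: "\<theta> (p f) = inv\<^bsub>F\<^esub> \<gamma> (e s (interval_point (f 0))) \<otimes>\<^bsub>F\<^esub> \<gamma> (e s (interval_point (f 1)))"
      if f: "continuous_on {0..1} f" "\<And>t. t \<in> {0..1} \<Longrightarrow> \<bar>f t\<bar> < 1" for f
    proof -
      have "path_in (subtopology K (edges.cell s)) (p f)"
        using edge_path_in_K[OF s f(1)] f(2) in_cell unfolding p_def by (force simp: continuous_map_in_subtopology less_imp_le)
      from cell[OF s this] show ?thesis by (simp add: p_def)
    qed
    have \<gamma>_val: "\<gamma> (e s (interval_point u)) = (if u > 0 then [(s, True)] else [])" if "0 < \<bar>u\<bar>" "\<bar>u\<bar> < 1" for u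
    proof -
      have "interval_point u 0 \<noteq> 0" using that by (simp add: interval_point_def)
      then have "interval_point u \<in> open_disc 1 - {\<lambda>_. 0}" using that interval_point_disc(2) by auto
      then have "\<gamma> (e s (interval_point u)) = g s (radial 1 (interval_point u))" by (rule \<gamma>_g[OF s])
      then show ?thesis by (simp add: g_def radial_def radius_def interval_point_def zero_less_divide_iff that(1)[simplified])
    qed
    have p_path: "path_in K (p f)" if "continuous_on {0..1} f" "\<And>t. t \<in> {0..1} \<Longrightarrow> \<bar>f t\<bar> \<le> 1" for f
      using edge_path_in_K[OF s that] by (simp add: p_def)
    have half: "lower (p f) = p (\<lambda>t. f (t / 2))" "upper (p f) = p (\<lambda>t. f ((t + 1) / 2))" for f
      by (auto simp: p_def lower_def upper_def)
    have split: "\<theta> (p f) = \<theta> (p (\<lambda>t. f (t / 2))) \<otimes>\<^bsub>F\<^esub> \<theta> (p (\<lambda>t. f ((t + 1) / 2)))"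
      if "continuous_on {0..1} f" "\<And>t. t \<in> {0..1} \<Longrightarrow> \<bar>f t\<bar> \<le> 1" for f
      using transportD(3)[OF \<theta> p_path[OF that]] unfolding half .
    let ?x = "\<gamma> (e s (interval_point 0))" and ?s = "[(s, True)]"
    have closed: "?x \<in> carrier F" "?s \<in> carrier F" using \<gamma>[OF s in_cell[of 0]] s by (auto simp: free_group_def reduced_def)
    have cont: "continuous_on {0..1} (\<lambda>t :: real. (t - 1) / 2)" "continuous_on {0..1} (\<lambda>t :: real. t / 2)"
      by (intro continuous_intros; simp)+
    \<comment> \<open>The edge is cut at -1/2, 0 and 1/2. The outer quarters lie in the collar and
      contribute nothing, the inner ones lie in the open cell; the unknown gauge value at the centre
      cancels.\<close>
    have "letter_path e (s, True) = p (\<lambda>t. 2 * t - 1)"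
      by (simp add: p_def fun_eq_iff letter_path_interval_point del: letter_path.simps)
    then have "\<theta> (letter_path e (s, True)) = \<theta> (p (\<lambda>t. 2 * t - 1))" by simp
    also have "\<dots> = \<theta> (p (\<lambda>t. t - 1)) \<otimes>\<^bsub>F\<^esub> \<theta> (p (\<lambda>t. t))"
      by (subst split) (auto intro!: continuous_intros simp: add_divide_distrib)
    also have "\<theta> (p (\<lambda>t. t - 1)) = \<theta> (p (\<lambda>t. t / 2 - 1)) \<otimes>\<^bsub>F\<^esub> \<theta> (p (\<lambda>t. (t - 1) / 2))"
      by (subst split) (auto intro!: continuous_intros simp: field_simps)
    also have "\<theta> (p (\<lambda>t. t)) = \<theta> (p (\<lambda>t. t / 2)) \<otimes>\<^bsub>F\<^esub> \<theta> (p (\<lambda>t. (t + 1) / 2))"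
      by (subst split) (auto intro!: continuous_intros)
    also have "\<theta> (p (\<lambda>t. t / 2 - 1)) = \<one>\<^bsub>F\<^esub>"
      by (rule p_collar) (auto intro!: continuous_intros)
    also have "\<theta> (p (\<lambda>t. (t + 1) / 2)) = \<one>\<^bsub>F\<^esub>"
      by (rule p_collar) (auto intro!: continuous_intros)
    also have "\<theta> (p (\<lambda>t. (t - 1) / 2)) = ?x"
      using p_cell[OF cont(1)] \<gamma>_val[of "- 1 / 2"] closed by (simp add: one[symmetric])
    also have "\<theta> (p (\<lambda>t. t / 2)) = inv\<^bsub>F\<^esub> ?x \<otimes>\<^bsub>F\<^esub> ?s"
      using p_cell[OF cont(2)] \<gamma>_val[of "1 / 2"] by simp
    finally show "\<theta> (letter_path e (s, True)) = ?s"
      using closed by (simp add: F.inv_cancel_left' del: letter_path.simps)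
  qed
qed

lemma graph_transport_word:
  assumes \<theta>: "transport F K \<theta>" and letter: "\<And>s. s \<in> S \<Longrightarrow> \<theta> (letter_path e (s, True)) = [(s, True)]"
    and w: "w \<in> carrier F"
  shows "edge_value \<theta> (word_edge w) = w"
proof -
  note mult = edge_value_triangle[OF F.group_axioms \<theta>]
  note one = edge_value_constant[OF F.group_axioms \<theta> vertex]
  have T: "edge_value \<theta> (letter_edge (s, True)) = [(s, True)]" if "s \<in> S" for s
    using edge_value_segment[OF \<theta> letter_path_continuous] letter[OF that] that by (simp add: letter_edge_def)
  have Fl: "edge_value \<theta> (letter_edge (s, False)) = [(s, False)]" if s: "s \<in> S" for s
  proof -
    have c: "[(s, True)] \<in> carrier F" "[(s, False)] \<in> carrier F" using s by (auto simp: free_group_def reduced_def)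
    obtain \<tau> where \<tau>: "triangle K (letter_edge (s, True)) (letter_edge (s, False)) one_edge \<tau>"
      using edge(2)[of "(s, True)"] by (auto simp: bounds_def)
    have E: "edge_value \<theta> (letter_edge (s, False)) \<in> carrier F"
      unfolding edge_value_def by (rule transportD(1)[OF \<theta> edge_path_continuous[OF triangle_edges(2)[OF \<tau>]]])
    have "[(s, True)] \<otimes>\<^bsub>F\<^esub> edge_value \<theta> (letter_edge (s, False)) = \<one>\<^bsub>F\<^esub>" using mult[OF \<tau>] one T[OF s] by simp
    also have "\<dots> = [(s, True)] \<otimes>\<^bsub>F\<^esub> [(s, False)]" by (simp add: free_group_def)
    finally show ?thesis using F.Units_l_cancel[of "[(s, True)]"] c E by simp
  qed
  show ?thesis using w
  proof (induction w)
    case Nil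
    then show ?case using one by (simp add: free_group_def)
  next
    case (Cons x w)
    have S: "fst x \<in> S" and w: "w \<in> carrier F" and red: "reduced (x # w)"
      using Cons.prems by (auto simp: free_group_def reduced_Cons)
    obtain \<tau> where \<tau>: "triangle K (letter_edge x) (word_edge w) (word_edge (x # w)) \<tau>"
      using word_edge_Cons[of x w] by (auto simp: bounds_def)
    have "edge_value \<theta> (letter_edge x) = [x]" using T[OF S] Fl[OF S] by (cases x; cases "snd x") auto
    then have "edge_value \<theta> (word_edge (x # w)) = [x] \<otimes>\<^bsub>F\<^esub> w" using mult[OF \<tau>] Cons.IH[OF w] by simp
    also have "\<dots> = x # w" using red by (cases w) (auto simp: free_group_def reduced_Cons)
    finally show ?case .
  qed
qed

lemma graph_transport_relator:
  assumes \<theta>: "transport F K \<theta>" and letter: "\<And>s. s \<in> S \<Longrightarrow> \<theta> (letter_path e (s, True)) = [(s, True)]"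
  shows "\<theta> relator_loop = r"
proof -
  obtain \<tau> where "triangle K (segment relator_loop 0 1) one_edge (word_edge r) \<tau>"
    using relator_edge by (auto simp: bounds_def)
  from edge_value_triangle[OF F.group_axioms \<theta> this] show ?thesis
    using edge_value_constant[OF F.group_axioms \<theta> vertex] edge_value_segment[OF \<theta> relator_loop_path]
      graph_transport_word[OF \<theta> letter relator_closed] transportD(1)[OF \<theta> relator_loop_path] by simp
qed

end

section \<open>Extension over cells of dimension at least two\<close>

lemma (in cell_attachment) extend_transport_high:
  fixes G :: "('g, 'm) monoid_scheme"
  assumes G: "group G" and \<theta>: "transport G A \<theta>"
    and n: "n \<ge> 3 \<or> n = 2 \<and> (\<forall>i\<in>I. \<theta> (\<Phi> i \<circ> circle_point) = \<one>\<^bsub>G\<^esub>)"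
  obtains \<theta>' where "transport G X \<theta>'" "\<And>p. path_in A p \<Longrightarrow> \<theta>' p = \<theta> p"
proof -
  have "\<exists>g. (\<forall>y\<in>topspace (nsphere (n - 1)). g y \<in> carrier G) \<and>
     (\<forall>p. path_in (nsphere (n - 1)) p \<longrightarrow> \<theta> (\<Phi> i \<circ> p) = inv\<^bsub>G\<^esub> g (p 0) \<otimes>\<^bsub>G\<^esub> g (p 1))" (is "\<exists>g. ?P g") if i: "i \<in> I" for i
  proof -
    have m: "n - 1 \<ge> 2 \<or> n - 1 = 1 \<and> \<theta> (\<Phi> i \<circ> circle_point) = \<one>\<^bsub>G\<^esub>" using n i by auto
    have "\<exists>g. ?P g"
      by (rule sphere_gauge[OF G transport_pullback[OF \<theta> attaching_map[OF i]] m]) blast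
    then show ?thesis .
  qed
  then obtain g where g: "\<And>i y. i \<in> I \<Longrightarrow> y \<in> topspace (nsphere (n - 1)) \<Longrightarrow> g i y \<in> carrier G"
    "\<And>i p. i \<in> I \<Longrightarrow> path_in (nsphere (n - 1)) p \<Longrightarrow> \<theta> (\<Phi> i \<circ> p) = inv\<^bsub>G\<^esub> g i (p 0) \<otimes>\<^bsub>G\<^esub> g i (p 1)"
    by metis
  show thesis
    by (rule extend_transport[where g = g, OF G \<theta> g]; (assumption | rule that))
qed

lemma attaches_cells_from_stages:
  assumes "attaches_cells_from m A X" "m \<ge> 1" "t1_space A"
  obtains F C where "F 0 = A" "weak_union F X" "\<And>k. cell_attachment (m + k) (F k) (C k) id (F (Suc k))"
proof -
  obtain F where F: "F 0 = A" "\<forall>k. \<exists>C. attaches_cells (m + k) (F k) C id (F (Suc k))"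
    "topspace X = (\<Union>k. topspace (F k))"
    "\<forall>U. openin X U \<longleftrightarrow> U \<subseteq> topspace X \<and> (\<forall>k. openin (F k) (topspace (F k) \<inter> U))"
    using assms(1) unfolding attaches_cells_from_def by blast
  obtain C where "\<And>k. attaches_cells (m + k) (F k) (C k) id (F (Suc k))" using F(2) by metis
  then have cells: "cell_attachment (m + k) (F k) (C k) id (F (Suc k))" for k
    using assms(2) by unfold_locales auto
  have t1: "t1_space (F k)" for k
    by (induction k) (use F(1) assms(3) cell_attachment.t1_space_X[OF cells] in simp_all)
  have "weak_union F X"
    by (rule weak_union.intro[OF cell_attachment.closedin_A[OF cells] cell_attachment.A_subset[OF cells]
        cell_attachment.subtopology_A[OF cells] t1 F(3) F(4)[rule_format]])
  then show thesis using that[OF F(1) _ cells] by blast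
qed

lemma attaches_cells_from_transport:
  fixes G :: "('g, 'm) monoid_scheme"
  assumes X: "attaches_cells_from m A X" "m \<ge> 3" "t1_space A" and G: "group G" and \<theta>: "transport G A \<theta>"
  obtains \<theta>' where "transport G X \<theta>'" "\<And>p. path_in A p \<Longrightarrow> \<theta>' p = \<theta> p"
proof -
  have "m \<ge> 1" using X by simp
  then obtain F C where F: "F 0 = A" and w: "weak_union F X"
    and cells: "\<And>k. cell_attachment (m + k) (F k) (C k) id (F (Suc k))"
    using attaches_cells_from_stages[OF X(1) _ X(3)] by metis
  have "\<exists>\<Theta>. \<forall>k. (transport G (F k) (\<Theta> k) \<and> (k = 0 \<longrightarrow> \<Theta> k = \<theta>)) \<and> (\<forall>p. path_in (F k) p \<longrightarrow> \<Theta> (Suc k) p = \<Theta> k p)"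
  proof (rule dependent_nat_choice)
    show "\<exists>x. transport G (F 0) x \<and> (0 = 0 \<longrightarrow> x = \<theta>)" using F \<theta> by auto
    fix x k assume "transport G (F k) x \<and> (k = 0 \<longrightarrow> x = \<theta>)"
    then have x: "transport G (F k) x" ..
    have "m + k \<ge> 3 \<or> m + k = 2 \<and> (\<forall>i\<in>C k. x (id i \<circ> circle_point) = \<one>\<^bsub>G\<^esub>)" using X(2) by simp
    then show "\<exists>y. (transport G (F (Suc k)) y \<and> (Suc k = 0 \<longrightarrow> y = \<theta>)) \<and> (\<forall>p. path_in (F k) p \<longrightarrow> y p = x p)"
      by (rule cell_attachment.extend_transport_high[OF cells G x]) blast
  qed
  then obtain \<Theta> where "\<forall>k. (transport G (F k) (\<Theta> k) \<and> (k = 0 \<longrightarrow> \<Theta> k = \<theta>)) \<and> (\<forall>p. path_in (F k) p \<longrightarrow> \<Theta> (Suc k) p = \<Theta> k p)" ..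
  then have \<Theta>: "\<And>k. transport G (F k) (\<Theta> k)" "\<Theta> 0 = \<theta>" "\<And>k p. path_in (F k) p \<Longrightarrow> \<Theta> (Suc k) p = \<Theta> k p"
    by simp_all
  obtain \<theta>' where "transport G X \<theta>'" "\<And>k p. path_in (F k) p \<Longrightarrow> \<theta>' p = \<Theta> k p"
    by (rule weak_union.transport_union[OF w \<Theta>(1,3)]; (assumption | rule that))
  then show thesis using that[of \<theta>'] F \<Theta>(2) by metis
qed

lemma attaches_cells_from_inclusion:
  assumes "attaches_cells_from m A X" "m \<ge> 1" "t1_space A"
  shows "continuous_map A X id"
proof -
  obtain F C where F: "F 0 = A" and w: "weak_union F X"
    and cells: "\<And>k. cell_attachment (m + k) (F k) (C k) id (F (Suc k))"
    using attaches_cells_from_stages[OF assms] by metis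
  have "subtopology X (topspace A) = A" using weak_union.subtopology_X[OF w, of 0] F by simp
  then show ?thesis using continuous_map_from_subtopology[OF continuous_map_id[of X], of "topspace A"] by simp
qed

locale one_relator_space = one_relator_complex S r v e d K P
  for S :: "'s set" and r :: "'s word" and v :: 'x and e d K P +
  fixes X :: "'x topology"
  assumes high_cells: "attaches_cells_from 3 P X"
begin

abbreviation N where "N \<equiv> normal_closure F {r}"
abbreviation Q where "Q \<equiv> one_relator_group S r"

sublocale N: normal N F
proof -
  show "N \<lhd> F"
    unfolding normal_closure_def
  proof (rule F.normal_generateI)
    fix h g assume "h \<in> {g \<otimes>\<^bsub>F\<^esub> r' \<otimes>\<^bsub>F\<^esub> inv\<^bsub>F\<^esub> g | g r'. g \<in> carrier F \<and> r' \<in> {r}}" and g: "g \<in> carrier F"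
    then obtain u where u: "u \<in> carrier F" "h = u \<otimes>\<^bsub>F\<^esub> r \<otimes>\<^bsub>F\<^esub> inv\<^bsub>F\<^esub> u" by auto
    then have "g \<otimes>\<^bsub>F\<^esub> h \<otimes>\<^bsub>F\<^esub> inv\<^bsub>F\<^esub> g = (g \<otimes>\<^bsub>F\<^esub> u) \<otimes>\<^bsub>F\<^esub> r \<otimes>\<^bsub>F\<^esub> inv\<^bsub>F\<^esub> (g \<otimes>\<^bsub>F\<^esub> u)"
      using g relator_closed by (simp add: F.inv_mult_group F.m_assoc)
    then show "g \<otimes>\<^bsub>F\<^esub> h \<otimes>\<^bsub>F\<^esub> inv\<^bsub>F\<^esub> g \<in> {g \<otimes>\<^bsub>F\<^esub> r' \<otimes>\<^bsub>F\<^esub> inv\<^bsub>F\<^esub> g | g r'. g \<in> carrier F \<and> r' \<in> {r}}"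
      using g u(1) by blast
  qed (use relator_closed in auto)
qed

lemma group_Q: "group Q"
  unfolding one_relator_group_def by (rule N.factorgroup_is_group)

lemma coset_hom: "(\<lambda>w. N #>\<^bsub>F\<^esub> w) \<in> hom F Q"
  unfolding one_relator_group_def by (rule N.r_coset_hom_Mod)

lemma coset_one: "N #>\<^bsub>F\<^esub> w = \<one>\<^bsub>Q\<^esub> \<longleftrightarrow> w \<in> N" if "w \<in> carrier F"
  using F.coset_join1[OF _ that N.is_subgroup] F.coset_join2[OF that N.is_subgroup]
  by (auto simp: one_relator_group_def FactGroup_def)

lemma relator_in_N: "r \<in> N"
proof -
  have "r = \<one>\<^bsub>F\<^esub> \<otimes>\<^bsub>F\<^esub> r \<otimes>\<^bsub>F\<^esub> inv\<^bsub>F\<^esub> \<one>\<^bsub>F\<^esub>" using relator_closed by simp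
  then show ?thesis unfolding normal_closure_def by (intro generate.incl) blast
qed

lemma t1_space_P: "t1_space P"
proof (rule face.t1_space_X[OF edges.t1_space_X])
  show "t1_space (discrete_topology {v})" by (simp add: t1_space_closedin_singleton)
qed

lemma inclusion: "continuous_map P X id"
  by (rule attaches_cells_from_inclusion[OF high_cells _ t1_space_P]) simp

text \<open>The relator loop has the value \<open>r\<close>, so the transport of the graph extends
  over the 2-cell only after passing to the quotient \<open>Q\<close>. The original one is kept for
  the comparison on \<open>K\<close>.\<close>

lemma exists_transport:
  obtains \<theta> \<theta>X where "transport F K \<theta>" "\<theta> relator_loop = r"
    "transport Q X \<theta>X" "\<And>p. path_in K p \<Longrightarrow> \<theta>X p = N #>\<^bsub>F\<^esub> \<theta> p"
proof -
  obtain \<theta> where \<theta>: "transport F K \<theta>" "\<And>s. s \<in> S \<Longrightarrow> \<theta> (letter_path e (s, True)) = [(s, True)]"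
    by (rule graph_transport; (assumption | rule that))
  then have r: "\<theta> relator_loop = r" by (rule graph_transport_relator)
  have n: "2 \<ge> (3 :: nat) \<or> (2 :: nat) = 2 \<and> (\<forall>i\<in>{()}. N #>\<^bsub>F\<^esub> \<theta> (d \<circ> circle_point) = \<one>\<^bsub>Q\<^esub>)"
    using r coset_one[OF relator_closed] relator_in_N by simp
  obtain \<theta>P where P: "transport Q P \<theta>P" "\<And>p. path_in K p \<Longrightarrow> \<theta>P p = N #>\<^bsub>F\<^esub> \<theta> p"
    by (rule face.extend_transport_high[OF group_Q transport_hom[OF \<theta>(1) coset_hom] n]; (assumption | rule that))
  obtain \<theta>X where X: "transport Q X \<theta>X" "\<And>p. path_in P p \<Longrightarrow> \<theta>X p = \<theta>P p"
    by (rule attaches_cells_from_transport[OF high_cells _ t1_space_P group_Q P(1)]; (simp | assumption | rule that))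
  have "\<theta>X p = N #>\<^bsub>F\<^esub> \<theta> p" if "path_in K p" for p
  proof -
    have "path_in P p" using that by (subst (asm) K_subtopology) (simp add: continuous_map_in_subtopology)
    then show ?thesis using X(2) P(2)[OF that] by simp
  qed
  then show thesis using that \<theta>(1) r X(1) by blast
qed

lemma fundamental_class_eq:
  assumes z: "singular_relcycle 2 P {} z" "cell_chain K P \<delta> 1 z"
  shows "fundamental_class K P d X = homologous_rel_set 2 X {} z"
proof -
  have "hom_induced 2 P {} X {} id (homologous_rel_set 2 P {} z) = homologous_rel_set 2 X {} (chain_map 2 id z)"
    by (rule hom_induced_chain_map[where p = 2, unfolded of_nat_numeral, OF inclusion _ z(1)]) simp
  also have "chain_map 2 id z = z" using z(1) by (intro chain_map_ident[of 2 P]) (simp add: singular_cycle)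
  finally show ?thesis unfolding fundamental_class_def two_cell_class_eq[OF z] .
qed

end

section \<open>Real chains\<close>

lemma lookup_map_zero: "f 0 = 0 \<Longrightarrow> Poly_Mapping.lookup (Poly_Mapping.map f c) x = f (Poly_Mapping.lookup c x)"
  by (simp add: map.rep_eq when_def)

definition evaluate :: "('a \<Rightarrow> real) \<Rightarrow> ('a \<Rightarrow>\<^sub>0 real) \<Rightarrow> real" where
  "evaluate \<kappa> c = (\<Sum>f\<in>Poly_Mapping.keys c. Poly_Mapping.lookup c f * \<kappa> f)"

lemma evaluate_superset:
  assumes "finite A" "Poly_Mapping.keys c \<subseteq> A"
  shows "evaluate \<kappa> c = (\<Sum>f\<in>A. Poly_Mapping.lookup c f * \<kappa> f)"
  unfolding evaluate_def using assms by (intro sum.mono_neutral_left) (auto simp: in_keys_iff)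

lemma evaluate_0: "evaluate \<kappa> 0 = 0"
  by (simp add: evaluate_def)

lemma evaluate_add: "evaluate \<kappa> (c + d) = evaluate \<kappa> c + evaluate \<kappa> d"
proof -
  let ?A = "Poly_Mapping.keys c \<union> Poly_Mapping.keys d"
  have "evaluate \<kappa> (c + d) = (\<Sum>f\<in>?A. Poly_Mapping.lookup (c + d) f * \<kappa> f)"
    using keys_add[of c d] by (intro evaluate_superset) auto
  also have "\<dots> = evaluate \<kappa> c + evaluate \<kappa> d"
    by (simp add: lookup_add distrib_right sum.distrib evaluate_superset[of ?A])
  finally show ?thesis .
qed

lemma evaluate_diff: "evaluate \<kappa> (c - d) = evaluate \<kappa> c - evaluate \<kappa> d"
  using evaluate_add[of \<kappa> "c - d" d] by simp

lemma evaluate_sum: "evaluate \<kappa> (\<Sum>i\<in>I. c i) = (\<Sum>i\<in>I. evaluate \<kappa> (c i))"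
  by (induction I rule: infinite_finite_induct) (simp_all add: evaluate_0 evaluate_add)

lemma evaluate_single: "evaluate \<kappa> (Poly_Mapping.single f x) = x * \<kappa> f"
  by (simp add: evaluate_superset[of "{f}"])

lemma evaluate_scale: "evaluate \<kappa> (Poly_Mapping.map (times x) c) = x * evaluate \<kappa> c"
proof -
  have "Poly_Mapping.keys (Poly_Mapping.map (times x) c) \<subseteq> Poly_Mapping.keys c"
    by (auto simp: in_keys_iff lookup_map_zero)
  from evaluate_superset[OF finite_keys this] show ?thesis
    by (simp add: lookup_map_zero sum_distrib_left evaluate_def mult.assoc)
qed

lemma scale_0: "Poly_Mapping.map (times x) (0 :: 'a \<Rightarrow>\<^sub>0 real) = 0"
  by (rule poly_mapping_eqI) (simp add: lookup_map_zero)

lemma evaluate_indicator: "evaluate (\<lambda>f. if f = a then 1 else 0) c = Poly_Mapping.lookup c a"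
  by (simp add: evaluate_def if_distrib in_keys_iff cong: if_cong)

text \<open>Identities of real chains are verified after pairing with an arbitrary cochain, where
  supports need no attention.\<close>

lemma evaluate_eqI: "(\<And>\<kappa>. evaluate \<kappa> c = evaluate \<kappa> d) \<Longrightarrow> c = d"
  by (rule poly_mapping_eqI) (metis evaluate_indicator)

lemma evaluate_cong: "(\<And>f. f \<in> Poly_Mapping.keys c \<Longrightarrow> \<kappa> f = \<kappa>' f) \<Longrightarrow> evaluate \<kappa> c = evaluate \<kappa>' c"
  unfolding evaluate_def by (rule sum.cong) auto

text \<open>The boundary is adjoint to the coboundary of cochains.\<close>

lemma evaluate_boundary:
  assumes "p > 0"
  shows "evaluate \<kappa> (real_chain_boundary p c) = evaluate (\<lambda>f. \<Sum>k\<le>p. (-1) ^ k * \<kappa> (singular_face p k f)) c"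
  using assms
  by (simp add: real_chain_boundary_def evaluate_sum evaluate_single evaluate_def[of _ c] sum_distrib_left mult_ac)

lemma real_chain_boundary_diff:
  "p > 0 \<Longrightarrow> real_chain_boundary p (c - d) = real_chain_boundary p c - real_chain_boundary p d"
  by (rule evaluate_eqI) (simp add: evaluate_boundary evaluate_diff)

lemma real_chain_boundary_scale:
  "p > 0 \<Longrightarrow> real_chain_boundary p (Poly_Mapping.map (times x) c) = Poly_Mapping.map (times x) (real_chain_boundary p c)"
  by (rule evaluate_eqI) (simp add: evaluate_boundary evaluate_scale)

abbreviation real_chain :: "'x chain \<Rightarrow> 'x real_chain" where
  "real_chain \<equiv> Poly_Mapping.map real_of_int"

lemma keys_real_chain: "Poly_Mapping.keys (real_chain z) = Poly_Mapping.keys z"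
  by (auto simp: in_keys_iff lookup_map_zero)

lemma real_chain_diff: "real_chain (a - b) = real_chain a - real_chain b"
  by (rule poly_mapping_eqI) (simp add: lookup_map_zero lookup_minus)

lemma real_chain_add: "real_chain (a + b) = real_chain a + real_chain b"
  by (rule poly_mapping_eqI) (simp add: lookup_map_zero lookup_add)

lemma real_chain_0: "real_chain 0 = 0"
  by (rule poly_mapping_eqI) (simp add: lookup_map_zero)

lemma real_chain_frag_of: "real_chain (frag_of f) = Poly_Mapping.single f 1"
  by (rule poly_mapping_eqI) (simp add: lookup_map_zero lookup_single when_def)

lemma real_chain_cmul: "real_chain (frag_cmul k a) = Poly_Mapping.map (times (real_of_int k)) (real_chain a)"
  by (rule poly_mapping_eqI) (simp add: lookup_map_zero)

lemma l1_norm_real_chain: "l1_norm (real_chain z) = real_of_int (chain_size z)"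
  by (simp add: l1_norm_def chain_size_def keys_real_chain lookup_map_zero)

lemma l1_norm_scale: "l1_norm (Poly_Mapping.map (times x) c) = \<bar>x\<bar> * l1_norm c"
proof -
  have "Poly_Mapping.keys (Poly_Mapping.map (times x) c) \<subseteq> Poly_Mapping.keys c"
    by (auto simp: in_keys_iff lookup_map_zero)
  then have "l1_norm (Poly_Mapping.map (times x) c) = (\<Sum>f\<in>Poly_Mapping.keys c. \<bar>Poly_Mapping.lookup (Poly_Mapping.map (times x) c) f\<bar>)"
    unfolding l1_norm_def by (intro sum.mono_neutral_left) (auto simp: in_keys_iff)
  then show ?thesis by (simp add: lookup_map_zero abs_mult l1_norm_def sum_distrib_left)
qed

lemma l1_norm_nonneg: "0 \<le> l1_norm c"
  by (simp add: l1_norm_def sum_nonneg)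

lemma real_chain_boundary_real_chain:
  fixes z :: "'x chain"
  assumes "p > 0" shows "real_chain_boundary p (real_chain z) = real_chain (chain_boundary p z)"
proof (rule evaluate_eqI)
  fix \<kappa> :: "((nat \<Rightarrow> real) \<Rightarrow> 'x) \<Rightarrow> real"
  have difference: "evaluate \<kappa> (real_chain_boundary p (real_chain (a - b))) = evaluate \<kappa> (real_chain (chain_boundary p (a - b)))"
    if "evaluate \<kappa> (real_chain_boundary p (real_chain a)) = evaluate \<kappa> (real_chain (chain_boundary p a))"
      "evaluate \<kappa> (real_chain_boundary p (real_chain b)) = evaluate \<kappa> (real_chain (chain_boundary p b))" for a b :: "'x chain"
    using that by (simp add: real_chain_diff chain_boundary_diff real_chain_boundary_diff[OF assms] evaluate_diff)
  have sum: "real_chain (\<Sum>k\<in>J. b k) = (\<Sum>k\<in>J. real_chain (b k))" for J :: "nat set" and b :: "nat \<Rightarrow> 'x chain"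
    by (induction J rule: infinite_finite_induct) (simp_all add: real_chain_add real_chain_0)
  show "evaluate \<kappa> (real_chain_boundary p (real_chain z)) = evaluate \<kappa> (real_chain (chain_boundary p z))"
    using subset_UNIV[of "Poly_Mapping.keys z"]
  proof (induction z rule: frag_induction)
    case zero
    then show ?case using assms by (simp add: evaluate_boundary real_chain_0 evaluate_0)
  next
    case (one f)
    then show ?case using assms
      by (simp add: evaluate_boundary real_chain_frag_of evaluate_single chain_boundary_of sum real_chain_cmul evaluate_sum evaluate_scale)
  next
    case (diff a b)
    then show ?case by (intro difference)
  qed
qed

lemma real_singular_chain_real_chain: "singular_chain p X z \<Longrightarrow> real_singular_chain p X (real_chain z)"
  by (simp add: real_singular_chain_def singular_chain_def keys_real_chain)

lemma real_singular_chain_scale: "real_singular_chain p X c \<Longrightarrow> real_singular_chain p X (Poly_Mapping.map (times x) c)"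
  by (auto simp: real_singular_chain_def in_keys_iff lookup_map_zero subset_iff)

section \<open>Simplicial volume\<close>

context one_relator_space
begin

section \<open>The degree on the normal closure\<close>

text \<open>A homomorphism from \<open>N\<close> to the integers that is invariant under conjugation
  in \<open>F\<close>. On \<open>N / [F, N]\<close>, which is H_2 by Hopf's formula, it is the
  isomorphism that sends \<open>r\<close> to 1.\<close>

definition relator_degree :: "'s word \<Rightarrow> int" where
  "relator_degree w = (THE k. F.conjugate_product r k w)"

lemma relator_degree_eq: "F.conjugate_product r k w \<Longrightarrow> relator_degree w = k"
  unfolding relator_degree_def using conjugate_product_unique by blast

lemma conjugate_product_relator_degree: "w \<in> N \<Longrightarrow> F.conjugate_product r (relator_degree w) w"
  using F.normal_closure_imp_conjugate_product[OF _ relator_closed] relator_degree_eq by fastforce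

lemma relator_degree_mult: "x \<in> N \<Longrightarrow> y \<in> N \<Longrightarrow> relator_degree (x \<otimes>\<^bsub>F\<^esub> y) = relator_degree x + relator_degree y"
  by (intro relator_degree_eq F.conjugate_product_mult conjugate_product_relator_degree relator_closed)

lemma relator_degree_inv: "x \<in> N \<Longrightarrow> relator_degree (inv\<^bsub>F\<^esub> x) = - relator_degree x"
  by (intro relator_degree_eq F.conjugate_product_inv conjugate_product_relator_degree relator_closed)

lemma relator_degree_conjugate:
  "x \<in> N \<Longrightarrow> t \<in> carrier F \<Longrightarrow> relator_degree (t \<otimes>\<^bsub>F\<^esub> x \<otimes>\<^bsub>F\<^esub> inv\<^bsub>F\<^esub> t) = relator_degree x"
  by (intro relator_degree_eq F.conjugate_product_conjugate conjugate_product_relator_degree relator_closed)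

lemma relator_degree_relator: "relator_degree r = 1"
  by (rule relator_degree_eq[OF F.conjugate_product_self[OF relator_closed]])

lemma singular_simplex_X: "singular_simplex p P f \<Longrightarrow> singular_simplex p X f"
  using continuous_map_compose[OF _ inclusion] by (fastforce simp: singular_simplex_def)

lemma singular_simplex_P: "singular_simplex p K f \<Longrightarrow> singular_simplex p P f"
  using K_subtopology singular_simplex_subtopology by metis

section \<open>The cocycle dual to the fundamental class\<close>

context
  fixes \<theta> :: "(real \<Rightarrow> 'x) \<Rightarrow> 's word" and \<theta>X :: "(real \<Rightarrow> 'x) \<Rightarrow> 's word set"
  assumes \<theta>: "transport F K \<theta>" and \<theta>_relator: "\<theta> relator_loop = r"
    and \<theta>X: "transport Q X \<theta>X" and \<theta>X_K: "\<forall>p. path_in K p \<longrightarrow> \<theta>X p = N #>\<^bsub>F\<^esub> \<theta> p"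
begin

interpretation coset: group_hom F Q "\<lambda>w. N #>\<^bsub>F\<^esub> w"
  by (intro group_hom.intro group_hom_axioms.intro F.group_axioms group_Q coset_hom)

text \<open>The lifts of different edges need not be compatible in any way. Gluing only requires
  that two triangles with a common edge use the same lift of it.\<close>

definition lift_edge :: "((nat \<Rightarrow> real) \<Rightarrow> 'x) \<Rightarrow> 's word" where
  "lift_edge a = (SOME w. w \<in> carrier F \<and> (singular_simplex 1 X a \<longrightarrow> N #>\<^bsub>F\<^esub> w = edge_value \<theta>X a))"

lemma lift_edge: "lift_edge a \<in> carrier F" "singular_simplex 1 X a \<Longrightarrow> N #>\<^bsub>F\<^esub> lift_edge a = edge_value \<theta>X a"
proof -
  have "\<exists>w. w \<in> carrier F \<and> (singular_simplex 1 X a \<longrightarrow> N #>\<^bsub>F\<^esub> w = edge_value \<theta>X a)"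
  proof (cases "singular_simplex 1 X a")
    case True
    have "edge_value \<theta>X a \<in> carrier Q"
      unfolding edge_value_def by (rule transportD(1)[OF \<theta>X edge_path_continuous[OF True]])
    then show ?thesis by (auto simp: one_relator_group_def FactGroup_def RCOSETS_def)
  qed (use F.one_closed in blast)
  from someI_ex[OF this] show "lift_edge a \<in> carrier F"
    "singular_simplex 1 X a \<Longrightarrow> N #>\<^bsub>F\<^esub> lift_edge a = edge_value \<theta>X a"
    unfolding lift_edge_def by blast+
qed

definition holonomy where
  "holonomy a b c = lift_edge a \<otimes>\<^bsub>F\<^esub> lift_edge b \<otimes>\<^bsub>F\<^esub> inv\<^bsub>F\<^esub> lift_edge c"

lemma holonomy_in_N:
  assumes "triangle X a b c \<tau>" shows "holonomy a b c \<in> N"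
proof -
  have "N #>\<^bsub>F\<^esub> holonomy a b c = edge_value \<theta>X a \<otimes>\<^bsub>Q\<^esub> edge_value \<theta>X b \<otimes>\<^bsub>Q\<^esub> inv\<^bsub>Q\<^esub> edge_value \<theta>X c"
    unfolding holonomy_def using lift_edge(1) lift_edge(2)[OF triangle_edges(1)[OF assms]]
      lift_edge(2)[OF triangle_edges(2)[OF assms]] lift_edge(2)[OF triangle_edges(3)[OF assms]] by simp
  also have "\<dots> = edge_value \<theta>X c \<otimes>\<^bsub>Q\<^esub> inv\<^bsub>Q\<^esub> edge_value \<theta>X c"
    unfolding edge_value_triangle[OF group_Q \<theta>X assms, symmetric] ..
  also have "\<dots> = \<one>\<^bsub>Q\<^esub>"
    unfolding edge_value_def
    by (rule group.r_inv[OF group_Q transportD(1)[OF \<theta>X edge_path_continuous[OF triangle_edges(3)[OF assms]]]])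
  finally show ?thesis using coset_one[of "holonomy a b c"] lift_edge(1) by (simp add: holonomy_def)
qed

text \<open>A cocycle that represents the class dual to the fundamental class.\<close>

definition weight :: "((nat \<Rightarrow> real) \<Rightarrow> 'x) \<Rightarrow> int" where
  "weight \<sigma> = relator_degree (holonomy (singular_face 2 2 \<sigma>) (singular_face 2 0 \<sigma>) (singular_face 2 1 \<sigma>))"

lemma weight_triangle: "triangle X a b c \<tau> \<Longrightarrow> weight \<tau> = relator_degree (holonomy a b c)"
  by (simp add: weight_def triangle_def)

lemma triangle_faces: "singular_simplex 2 Y \<sigma> \<Longrightarrow>
    triangle Y (singular_face 2 2 \<sigma>) (singular_face 2 0 \<sigma>) (singular_face 2 1 \<sigma>) \<sigma>"
  by (simp add: triangle_def)

lemma weight_tetrahedron: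
  assumes "singular_simplex 3 X g"
  shows "weight (singular_face 3 0 g) + weight (singular_face 3 2 g) = weight (singular_face 3 1 g) + weight (singular_face 3 3 g)"
proof -
  let ?t = "\<lambda>i. singular_face 3 i g" and ?f = "singular_face 2"
  have tri: "triangle X (?f 2 (?t i)) (?f 0 (?t i)) (?f 1 (?t i)) (?t i)" if "i \<le> 3" for i
    using singular_simplex_singular_face[OF assms, of i] that by (intro triangle_faces) simp
  have ff: "?f i (?t j) = ?f (j - 1) (?t i)" if "i < j" "j \<le> 3" for i j
    using singular_face_singular_face[of i j 3 g] that by simp
  define x01 x12 x23 x02 x13 x03 where x: "x01 = ?f 2 (?t 2)" "x12 = ?f 2 (?t 0)" "x23 = ?f 0 (?t 0)"
    "x02 = ?f 2 (?t 1)" "x13 = ?f 1 (?t 0)" "x03 = ?f 1 (?t 1)"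
  have t: "triangle X x12 x23 x13 (?t 0)" "triangle X x02 x23 x03 (?t 1)" "triangle X x01 x13 x03 (?t 2)" "triangle X x01 x12 x02 (?t 3)"
    using tri[of 0] tri[of 1] tri[of 2] tri[of 3] ff[of 0 1] ff[of 0 2] ff[of 1 2] ff[of 2 3] ff[of 0 3] ff[of 1 3]
    unfolding x by simp_all
  \<comment> \<open>Both sides are the word \<open>01 12 23 03^-1\<close> in the lifts, read across
    one pair of faces or across the other. The conjugation by the lift of 01 is invisible to the
    degree.\<close>
  have "holonomy x01 x12 x02 \<otimes>\<^bsub>F\<^esub> holonomy x02 x23 x03 =
     (lift_edge x01 \<otimes>\<^bsub>F\<^esub> holonomy x12 x23 x13 \<otimes>\<^bsub>F\<^esub> inv\<^bsub>F\<^esub> lift_edge x01) \<otimes>\<^bsub>F\<^esub> holonomy x01 x13 x03"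
    using lift_edge(1) by (simp add: holonomy_def F.m_assoc F.inv_cancel_left F.inv_cancel_left')
  from arg_cong[OF this, of relator_degree] show ?thesis
    using holonomy_in_N[OF t(1)] holonomy_in_N[OF t(2)] holonomy_in_N[OF t(3)] holonomy_in_N[OF t(4)] lift_edge(1)
    by (simp add: weight_triangle[OF t(1)] weight_triangle[OF t(2), unfolded One_nat_def] weight_triangle[OF t(3)] weight_triangle[OF t(4)]
        relator_degree_mult relator_degree_conjugate N.inv_op_closed2)
qed

text \<open>On the graph \<open>K\<close> the transport lifts to the free group, and the cocycle is the coboundary of
  the degree by which the chosen lifts deviate from it.\<close>

definition defect :: "((nat \<Rightarrow> real) \<Rightarrow> 'x) \<Rightarrow> int" where
  "defect a = relator_degree (inv\<^bsub>F\<^esub> edge_value \<theta> a \<otimes>\<^bsub>F\<^esub> lift_edge a)"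

lemma weight_graph:
  assumes "triangle K a b c \<tau>" shows "weight \<tau> = defect a + defect b - defect c"
proof -
  have in_N: "edge_value \<theta> x \<in> carrier F \<and> inv\<^bsub>F\<^esub> edge_value \<theta> x \<otimes>\<^bsub>F\<^esub> lift_edge x \<in> N" if x: "singular_simplex 1 K x" for x
  proof -
    have E: "edge_value \<theta> x \<in> carrier F"
      unfolding edge_value_def by (rule transportD(1)[OF \<theta> edge_path_continuous[OF x]])
    have "N #>\<^bsub>F\<^esub> lift_edge x = N #>\<^bsub>F\<^esub> edge_value \<theta> x"
      using lift_edge(2)[OF singular_simplex_X[OF singular_simplex_P[OF x]]] \<theta>X_K[rule_format, OF edge_path_continuous[OF x]]
      by (simp add: edge_value_def)
    then have "N #>\<^bsub>F\<^esub> (inv\<^bsub>F\<^esub> edge_value \<theta> x \<otimes>\<^bsub>F\<^esub> lift_edge x) = \<one>\<^bsub>Q\<^esub>"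
      using E lift_edge(1) by simp
    moreover have "inv\<^bsub>F\<^esub> edge_value \<theta> x \<otimes>\<^bsub>F\<^esub> lift_edge x \<in> carrier F" using E lift_edge(1) by simp
    ultimately show ?thesis using coset_one E by blast
  qed
  let ?n = "\<lambda>x. inv\<^bsub>F\<^esub> edge_value \<theta> x \<otimes>\<^bsub>F\<^esub> lift_edge x"
  note abc = in_N[OF triangle_edges(1)[OF assms]] in_N[OF triangle_edges(2)[OF assms]] in_N[OF triangle_edges(3)[OF assms]]
  have X: "triangle X a b c \<tau>" using assms singular_simplex_X singular_simplex_P by (auto simp: triangle_def)
  have c: "edge_value \<theta> c = edge_value \<theta> a \<otimes>\<^bsub>F\<^esub> edge_value \<theta> b"
    by (rule edge_value_triangle[OF F.group_axioms \<theta> assms])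
  \<comment> \<open>Each lift is the transport times an element of \<open>N\<close>. The transports
    cancel by functoriality, and the degree ignores the conjugations that remain.\<close>
  have "holonomy a b c = edge_value \<theta> a \<otimes>\<^bsub>F\<^esub> (?n a \<otimes>\<^bsub>F\<^esub> (edge_value \<theta> b \<otimes>\<^bsub>F\<^esub> (?n b \<otimes>\<^bsub>F\<^esub> inv\<^bsub>F\<^esub> ?n c) \<otimes>\<^bsub>F\<^esub> inv\<^bsub>F\<^esub> edge_value \<theta> b))
     \<otimes>\<^bsub>F\<^esub> inv\<^bsub>F\<^esub> edge_value \<theta> a"
    using abc lift_edge(1) by (simp add: holonomy_def c F.m_assoc F.inv_mult_group F.inv_cancel_left F.inv_cancel_left')
  then have "relator_degree (holonomy a b c) = defect a + (defect b + - defect c)"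
    using abc by (simp only: relator_degree_conjugate relator_degree_mult relator_degree_inv N.inv_op_closed2
        N.m_closed N.m_inv_closed defect_def)
  then show ?thesis by (simp add: weight_triangle[OF X])
qed

abbreviation real_weight :: "((nat \<Rightarrow> real) \<Rightarrow> 'x) \<Rightarrow> real" where
  "real_weight \<sigma> \<equiv> real_of_int (weight \<sigma>)"

lemma evaluate_weight_boundary:
  assumes "real_singular_chain 3 X b" shows "evaluate real_weight (real_chain_boundary 3 b) = 0"
proof -
  have "(\<Sum>k\<le>3. (-1) ^ k * real_weight (singular_face 3 k g)) = 0" if "g \<in> Poly_Mapping.keys b" for g
  proof -
    have "singular_simplex 3 X g" using assms that by (auto simp: real_singular_chain_def)
    from arg_cong[OF weight_tetrahedron[OF this], of real_of_int] show ?thesis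
      by (simp add: numeral_3_eq_3 numeral_2_eq_2)
  qed
  then have "evaluate (\<lambda>g. \<Sum>k\<le>3. (-1) ^ k * real_weight (singular_face 3 k g)) b = 0"
    unfolding evaluate_def by (intro sum.neutral ballI) simp
  then show ?thesis by (simp only: evaluate_boundary zero_less_numeral)
qed

text \<open>The cycle is the cell plus a chain of the graph plus a boundary. On the graph the
  cocycle is the coboundary of \<open>defect\<close>, so its contribution is the negative defect of
  the relator loop. The lift of that loop exceeds its defect in degree by 1, since the transport of
  the loop is \<open>r\<close>.\<close>

lemma evaluate_weight_cell_cycle:
  assumes z: "singular_relcycle 2 P {} z" "cell_chain K P \<delta> 1 z"
  shows "evaluate real_weight (real_chain z) = 1"
proof -
  obtain y u where y: "singular_chain 2 K y" and u: "singular_chain 3 P u" and zyu: "z = \<delta> + y + chain_boundary 3 u"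
    using z(2) by (auto simp: cell_chain_def)
  let ?c = "segment relator_loop 0 1"
  have "chain_boundary 2 (chain_boundary 3 u) = 0" using chain_boundary_boundary[OF u] by simp
  then have dy: "chain_boundary 2 y = - frag_of ?c"
    using z(1) chain_boundary_triangle[OF triangle_cell_simplex]
    by (simp add: singular_cycle zyu chain_boundary_add add_eq_0_iff)
  have "singular_chain 3 X u" using u singular_simplex_X by (auto simp: singular_chain_def)
  then have "evaluate real_weight (real_chain (chain_boundary 3 u)) = 0"
    using evaluate_weight_boundary[OF real_singular_chain_real_chain] real_chain_boundary_real_chain[of 3 u] by (metis zero_less_numeral)
  moreover have "evaluate real_weight (real_chain y) = - defect ?c"
  proof -
    have "evaluate real_weight (real_chain y) =
      evaluate (\<lambda>\<sigma>. \<Sum>k\<le>2. (-1) ^ k * real_of_int (defect (singular_face 2 k \<sigma>))) (real_chain y)"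
    proof (rule evaluate_cong)
      fix \<sigma> assume "\<sigma> \<in> Poly_Mapping.keys (real_chain y)"
      then have "singular_simplex 2 K \<sigma>" using y by (auto simp: keys_real_chain singular_chain_def)
      from weight_graph[OF triangle_faces[OF this]]
      show "real_weight \<sigma> = (\<Sum>k\<le>2. (-1) ^ k * real_of_int (defect (singular_face 2 k \<sigma>)))"
        by (simp add: numeral_2_eq_2)
    qed
    also have "\<dots> = evaluate (\<lambda>a. real_of_int (defect a)) (real_chain (chain_boundary 2 y))"
      by (simp add: evaluate_boundary flip: real_chain_boundary_real_chain)
    also have "\<dots> = - defect ?c"
      using evaluate_diff[of "\<lambda>a. real_of_int (defect a)" 0 "real_chain (frag_of ?c)"] real_chain_diff[of 0 "frag_of ?c"]
      by (simp add: dy real_chain_0 evaluate_0 real_chain_frag_of evaluate_single)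
    finally show ?thesis .
  qed
  moreover have "evaluate real_weight (real_chain \<delta>) - defect ?c = 1"
  proof -
    have ss: "singular_simplex 1 K ?c" by (rule segment_continuous[OF relator_loop_path]) auto
    have tri: "triangle X ?c one_edge one_edge cell_simplex"
      using triangle_cell_simplex singular_simplex_X by (auto simp: triangle_def)
    have hol: "holonomy ?c one_edge one_edge = lift_edge ?c" using lift_edge(1) by (simp add: holonomy_def F.m_assoc)
    have "lift_edge ?c \<in> N" using holonomy_in_N[OF tri] hol by simp
    then have "defect ?c = - 1 + relator_degree (lift_edge ?c)"
      unfolding defect_def edge_value_segment[OF \<theta> relator_loop_path] \<theta>_relator
      by (simp add: relator_degree_mult relator_degree_inv relator_degree_relator relator_in_N N.m_inv_closed)
    then show ?thesis by (simp add: real_chain_frag_of evaluate_single weight_triangle[OF tri] hol)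
  qed
  ultimately show ?thesis by (simp add: zyu real_chain_add evaluate_add)
qed

text \<open>The simplices of the cycle become triangles whose letters are their faces; the value of
  such a word under the lifts is the holonomy.\<close>

lemma Inf_complexity_le_l1_norm:
  assumes c: "real_singular_cycle 2 X c"
  shows "(INF x\<in>exponents. complexity x) * \<bar>evaluate real_weight c\<bar> \<le> l1_norm c"
proof -
  let ?f = "singular_face 2"
  define W where "W \<sigma> = [(?f 2 \<sigma>, True), (?f 0 \<sigma>, True), (?f 1 \<sigma>, False)]" for \<sigma> :: "(nat \<Rightarrow> real) \<Rightarrow> 'x"
  have "(INF x\<in>exponents. complexity x) * \<bar>\<Sum>\<sigma>\<in>Poly_Mapping.keys c. Poly_Mapping.lookup c \<sigma> * real_weight \<sigma>\<bar>
      \<le> (\<Sum>\<sigma>\<in>Poly_Mapping.keys c. \<bar>Poly_Mapping.lookup c \<sigma>\<bar>)"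
  proof (rule F.real_polygon_bound[where W = W and k = weight, OF lift_edge(1) relator_closed Inf_complexity_nonneg Inf_complexity_le finite_keys])
    show "length (W \<sigma>) = 3" for \<sigma> by (simp add: W_def)
    fix \<sigma> assume "\<sigma> \<in> Poly_Mapping.keys c"
    then have "singular_simplex 2 X \<sigma>" using c by (auto simp: real_singular_cycle_def real_singular_chain_def)
    then have "F.conjugate_product r (weight \<sigma>) (holonomy (?f 2 \<sigma>) (?f 0 \<sigma>) (?f 1 \<sigma>))"
      unfolding weight_def by (intro conjugate_product_relator_degree holonomy_in_N[OF triangle_faces])
    then show "F.conjugate_product r (weight \<sigma>) (F.eval_word lift_edge (W \<sigma>))"
      using lift_edge(1) by (simp add: F.eval_word_def F.eval_letter_def W_def holonomy_def F.m_assoc)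
  next
    fix x :: "((nat \<Rightarrow> real) \<Rightarrow> 'x) \<times> bool"
    obtain a b where x: "x = (a, b)" by (cases x)
    define s :: real where "s = (if b then 1 else - 1)"
    \<comment> \<open>Pairing the boundary of the cycle with the indicator of the edge
      \<open>a\<close> gives the balance of the letter \<open>(a, True)\<close>; the sign
      \<open>s\<close> accounts for the inverse letter.\<close>
    let ?i = "\<lambda>f. if f = a then 1 else 0 :: real"
    have "real_of_int (int (count_list (W \<sigma>) x) - int (count_list (W \<sigma>) (inv_letter x))) =
        s * (\<Sum>k\<le>2. (-1) ^ k * ?i (?f k \<sigma>))" for \<sigma>
      by (simp add: W_def x s_def numeral_2_eq_2)
    then have "(\<Sum>\<sigma>\<in>Poly_Mapping.keys c. Poly_Mapping.lookup c \<sigma> *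
        real_of_int (int (count_list (W \<sigma>) x) - int (count_list (W \<sigma>) (inv_letter x)))) =
        s * evaluate (\<lambda>\<sigma>. \<Sum>k\<le>2. (-1) ^ k * ?i (?f k \<sigma>)) c"
      by (simp add: evaluate_def sum_distrib_left mult_ac)
    also have "evaluate (\<lambda>\<sigma>. \<Sum>k\<le>2. (-1) ^ k * ?i (?f k \<sigma>)) c = evaluate ?i (real_chain_boundary 2 c)"
      by (simp add: evaluate_boundary)
    also have "\<dots> = 0" using c by (simp add: real_singular_cycle_def evaluate_0)
    finally show "(\<Sum>\<sigma>\<in>Poly_Mapping.keys c. Poly_Mapping.lookup c \<sigma> *
        real_of_int (int (count_list (W \<sigma>) x) - int (count_list (W \<sigma>) (inv_letter x)))) = 0" by simp
  qed
  then show ?thesis by (simp add: evaluate_def l1_norm_def)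
qed

end

section \<open>The two inequalities\<close>

text \<open>The cycle \<open>Z - k z\<close> has multiplicity zero over the cell and therefore
  bounds; dividing its filling by \<open>k\<close> leads to real coefficients.\<close>

lemma scaled_cycle_in_class:
  assumes z: "singular_relcycle 2 P {} z" "cell_chain K P \<delta> 1 z"
    and Z: "singular_relcycle 2 P {} Z" "cell_chain K P \<delta> k Z" and k: "k \<noteq> 0"
  shows "Poly_Mapping.map (times (1 / real_of_int k)) (real_chain Z) \<in> real_homology_class 2 X (real_chain z)"
proof -
  let ?c = "Poly_Mapping.map (times (1 / real_of_int k)) (real_chain Z)"
  have chain: "singular_chain p X c" if "singular_chain p P c" for p c
    using that singular_simplex_X by (auto simp: singular_chain_def)
  have "singular_chain 2 X Z" "chain_boundary 2 Z = 0" using Z(1) chain by (auto simp: singular_cycle)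
  then have "real_singular_cycle 2 X ?c"
    unfolding real_singular_cycle_def
    by (auto intro!: real_singular_chain_scale real_singular_chain_real_chain
        simp: real_chain_boundary_scale real_chain_boundary_real_chain real_chain_0 scale_0)
  moreover have "real_singular_boundary 2 X (?c - real_chain z)"
  proof -
    have "cell_chain K P \<delta> (k - k * 1) (Z - frag_cmul k z)"
      by (intro cell_chain_diff cell_chain_cmul z Z)
    then have "singular_relboundary 2 P {} (Z - frag_cmul k z)"
      using z(1) Z(1) by (intro cell_chain_cycle_boundary singular_relcycle_diff singular_relcycle_cmul) auto
    then obtain b where b: "singular_chain 3 P b" "chain_boundary 3 b = Z - frag_cmul k z"
      by (auto simp: singular_boundary eval_nat_numeral)
    let ?b = "Poly_Mapping.map (times (1 / real_of_int k)) (real_chain b)"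
    have "real_chain_boundary 3 ?b = ?c - real_chain z"
    proof (rule evaluate_eqI)
      fix \<kappa>
      have "evaluate \<kappa> (real_chain_boundary 3 ?b) = 1 / real_of_int k * evaluate \<kappa> (real_chain (chain_boundary 3 b))"
        by (simp only: real_chain_boundary_scale real_chain_boundary_real_chain evaluate_scale zero_less_numeral)
      also have "\<dots> = evaluate \<kappa> (?c - real_chain z)"
        unfolding b(2) real_chain_diff real_chain_cmul evaluate_diff evaluate_scale using k by (simp add: field_simps)
      finally show "evaluate \<kappa> (real_chain_boundary 3 ?b) = evaluate \<kappa> (?c - real_chain z)" .
    qed
    then show ?thesis
      unfolding real_singular_boundary_def
      using real_singular_chain_scale[OF real_singular_chain_real_chain[OF chain[OF b(1)]]]
      by (intro exI[of _ ?b]) (simp add: eval_nat_numeral)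
  qed
  ultimately show ?thesis by (simp add: real_homology_class_def)
qed

theorem simplicial_volume_eq: "simplicial_volume K P d X = (INF x\<in>exponents. complexity x)"
proof -
  obtain z where z: "singular_relcycle 2 P {} z" "cell_chain K P \<delta> 1 z" using exists_cell_cycle by blast
  let ?\<alpha> = "change_of_coefficients 2 X (fundamental_class K P d X)" and ?I = "INF x\<in>exponents. complexity x"
  have \<alpha>: "?\<alpha> = (\<Union>z'\<in>homologous_rel_set 2 X {} z. real_homology_class 2 X (real_chain z'))"
    by (simp add: change_of_coefficients_def fundamental_class_eq[OF z])
  have "z \<in> homologous_rel_set 2 X {} z" by simp
  then have surface: "Poly_Mapping.map (times (1 / real_of_int k)) (real_chain Z) \<in> ?\<alpha>"
    if "singular_relcycle 2 P {} Z" "cell_chain K P \<delta> k Z" "k \<noteq> 0" for Z k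
    unfolding \<alpha> using scaled_cycle_in_class[OF z that] by blast
  \<comment> \<open>The cocycle takes the value 1 on every representative of the class, so
    \<open>Inf_complexity_le_l1_norm\<close> bounds each norm from below by the infimum.\<close>
  have lower: "?I \<le> l1_norm c" if c\<alpha>: "c \<in> ?\<alpha>" for c
  proof -
    obtain z' where z': "homologous_rel 2 X {} z z'" and c: "real_singular_cycle 2 X c" "real_singular_boundary 2 X (c - real_chain z')"
      using c\<alpha> unfolding \<alpha> real_homology_class_def by blast
    obtain b where b: "real_singular_chain 3 X b" "real_chain_boundary 3 b = c - real_chain z'"
      using c(2) by (auto simp: real_singular_boundary_def eval_nat_numeral)
    obtain u where u: "singular_chain 3 X u" "chain_boundary 3 u = z - z'"
      using z' by (auto simp: homologous_rel_def singular_boundary eval_nat_numeral)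
    obtain \<theta> \<theta>X where t: "transport F K \<theta>" "\<theta> relator_loop = r" "transport Q X \<theta>X"
      "\<forall>p. path_in K p \<longrightarrow> \<theta>X p = N #>\<^bsub>F\<^esub> \<theta> p"
      by (rule exists_transport) blast
    let ?ev = "evaluate (\<lambda>\<sigma>. real_of_int (weight \<theta>X \<sigma>))"
    note bd = evaluate_weight_boundary[OF t]
    have "?ev (c - real_chain z') = 0" using bd[OF b(1)] b(2) by simp
    moreover have "?ev (real_chain (z - z')) = 0"
      using bd[OF real_singular_chain_real_chain[OF u(1)]] u(2) real_chain_boundary_real_chain[of 3 u] by simp
    ultimately have "?ev c = 1" using evaluate_weight_cell_cycle[OF t z] by (simp add: evaluate_diff real_chain_diff)
    then show ?thesis using Inf_complexity_le_l1_norm[OF t c(1)] by simp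
  qed
  have "?\<alpha> \<noteq> {}" using surface[OF z one_neq_zero] by (intro notI) (simp only: empty_iff)
  then have "?I \<le> simplicial_volume K P d X"
    unfolding simplicial_volume_def l1_seminorm_def by (rule cINF_greatest) (rule lower)
  moreover have "simplicial_volume K P d X \<le> ?I"
  \<comment> \<open>The constant 2 is the one in \<open>4 m + 2\<close>.\<close>
  proof (rule le_Inf_complexity[of _ 2])
    fix m k w assume w: "F.commutator_product m w" "F.conjugate_product r k w" and k: "k \<noteq> 0"
    obtain Z where Z: "singular_relcycle 2 P {} Z" "chain_size Z \<le> 4 * int m + 2" "cell_chain K P \<delta> k Z"
      using closed_surface_cycle[OF relator_cell w] by blast
    have "simplicial_volume K P d X \<le> l1_norm (Poly_Mapping.map (times (1 / real_of_int k)) (real_chain Z))"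
      unfolding simplicial_volume_def l1_seminorm_def
      by (intro cINF_lower surface[OF Z(1,3) k] bdd_belowI2[where m = 0] l1_norm_nonneg)
    also have "\<dots> \<le> (4 * real m + 2) / \<bar>k\<bar>"
    proof -
      have "real_of_int (chain_size Z) \<le> 4 * real m + 2" using Z(2) by linarith
      then show ?thesis by (simp add: l1_norm_scale l1_norm_real_chain divide_right_mono)
    qed
    finally show "simplicial_volume K P d X * \<bar>k\<bar> \<le> 4 * real m + 2" using k by (simp add: pos_le_divide_eq)
  qed
  ultimately show ?thesis by simp
qed

end

theorem corollary3p13:
  fixes S :: "'s set" and r :: "'s word"
    and v :: 'x and e :: "'s \<Rightarrow> (nat \<Rightarrow> real) \<Rightarrow> 'x" and d :: "(nat \<Rightarrow> real) \<Rightarrow> 'x"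
    and K P X :: "'x topology"
  assumes "r \<in> derived (free_group S) (carrier (free_group S)) - {\<one>\<^bsub>free_group S\<^esub>}"
    and "presentation_complex S r v e d K P"
    and "attaches_cells_from 3 P X"
    and "classifying_space (one_relator_group S r) X v"
  shows "simplicial_volume K P d X =
    (INF (n, \<epsilon>) \<in> {(n :: nat, \<epsilon> :: int list).
         n > 0 \<and> length \<epsilon> = n \<and> set \<epsilon> \<subseteq> {-1, 1} \<and> (\<Sum>i<n. \<epsilon> ! i) \<noteq> 0}.
       4 * ((real (sum_commutator_length (free_group S)
                     (map (\<lambda>k. r [^]\<^bsub>free_group S\<^esub> k) \<epsilon>)) - 1)
            / \<bar>real_of_int (\<Sum>i<n. \<epsilon> ! i)\<bar>))"
proof -
  interpret one_relator_space S r v e d K P X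
    using assms(1-3) by unfold_locales
  show ?thesis using simplicial_volume_eq unfolding exponents_def complexity_def .
qed

end
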